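(* Let $\Omega\subset\mathbb{R}^2$ be an open bounded set with Lipschitz boundary and let $\Gamma_\gamma\subset\partial\Omega$ be a relatively open, connected boundary portion with nonzero one-dimensional measure. Assume that $\Gamma_\gamma$ is of class $C^2$. Let $\mathbf{g}_1\in L^2(\Omega;\mathbb{R}^2)$, $g_2\in L^2(\Omega)$, and $T_d\in H^2(\Omega)$ with $T_d=0$ on $\partial\Omega\setminus\Gamma_\gamma$. Let $\varepsilon_1,\varepsilon_2,\varepsilon_3,\delta>0$ be well-posedness constants for $\Omega$ (see context). If $$\mathrm{Re}\in(0,\varepsilon_1),\qquad \mathrm{Pr}\in\left(0,\frac{\varepsilon_2}{\mathrm{Re}}\right),\qquad \mathrm{Gr}\in(0,\varepsilon_3\,\mathrm{Re}),$$ and $\|\mathbf{g}_1\|_{V(\Omega)'}\le\delta$, $\|g_2\|_{H^{-1}(\Omega)}\le\delta$, $\|T_d\|_{H^1(\Omega)}\le\delta$, then the weak solution $(\mathbf{v},T)\in V(\Omega)\times H^1(\Omega)$ to the Boussinesq system satisfies $$\mathbf{v}\big|_{\Gamma_\gamma^\varepsilon}\in H^{3/2}(\Gamma_\gamma^\varepsilon;\mathbb{R}^2),\qquad T\big|_{\Gamma_\gamma^\varepsilon}\in H^{3/2}(\Gamma_\gamma^\varepsilon),$$ for every relatively open subset $\Gamma_\gamma^\varepsilon$ of $\partial\Omega$ strictly contained in $\Gamma_\gamma$, i.e. with $\overline{\Gamma_\gamma^\varepsilon}\subset\Gamma_\gamma$.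
   Context: $V(\Omega)=\{\boldsymbol\varphi\in H^1(\Omega;\mathbb{R}^2): \operatorname{div}\boldsymbol\varphi=0 \text{ a.e. in }\Omega,\ \boldsymbol\varphi=0\text{ on }\partial\Omega\text{ in the trace sense}\}$ with norm $\|\nabla\boldsymbol\varphi\|_{L^2(\Omega)}$; $H_0^1(\Omega)$ has norm $\|\nabla\varphi\|_{L^2(\Omega)}$. Their duals are $V(\Omega)'$ and $H^{-1}(\Omega)$; $L^2$ functions act on them by integration. $\mathbf{e}=(0,1)$; $\mathrm{Re},\mathrm{Pr},\mathrm{Gr}>0$ are real parameters. Restrictions to boundary portions are in the trace sense. The Boussinesq system is: $\mathbf{v}\cdot\nabla\mathbf{v}-\frac1{\mathrm{Re}}\Delta\mathbf{v}+\nabla p-\frac{\mathrm{Gr}}{\mathrm{Re}^2}T\mathbf{e}=\mathbf{g}_1$, $\nabla\cdot\mathbf{v}=0$ in $\Omega$, $\mathbf{v}=0$ on $\partial\Omega$; $\mathbf{v}\cdot\nabla T-\frac{1}{\mathrm{Re}\,\mathrm{Pr}}\Delta T=g_2$ in $\Omega$, $T=T_d$ on $\Gamma_\gamma$, $T=0$ on $\partial\Omega\setminus\Gamma_\gamma$. A weak solution is a pair $(\mathbf{v},T)\in V(\Omega)\times H^1(\Omega)$ with $T-T_d\in H_0^1(\Omega)$ such that $$\int_\Omega(\mathbf{v}\cdot\nabla\mathbf{v})\cdot\boldsymbol\varphi\,dx+\frac1{\mathrm{Re}}\int_\Omega\nabla\mathbf{v}:\nabla\boldsymbol\varphi\,dx-\frac{\mathrm{Gr}}{\mathrm{Re}^2}\int_\Omega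 T\mathbf{e}\cdot\boldsymbol\varphi\,dx=\langle\mathbf{g}_1,\boldsymbol\varphi\rangle\quad\forall\boldsymbol\varphi\in V(\Omega),$$ $$\int_\Omega(\mathbf{v}\cdot\nabla T)\varphi\,dx+\frac1{\mathrm{Re}\,\mathrm{Pr}}\int_\Omega\nabla T\cdot\nabla\varphi\,dx=\langle g_2,\varphi\rangle\quad\forall\varphi\in H_0^1(\Omega).$$ Here $(\mathbf{v}\cdot\nabla\mathbf{w})_j=\sum_i v_i\partial_i w_j$. Well-posedness constants for $\Omega$: numbers $\varepsilon_1,\varepsilon_2,\varepsilon_3,\delta>0$ such that for all $\mathrm{Re}\in(0,\varepsilon_1)$, $\mathrm{Pr}\in(0,\varepsilon_2/\mathrm{Re})$, $\mathrm{Gr}\in(0,\varepsilon_3\mathrm{Re})$ and all $\mathbf{g}_1\in V(\Omega)'$, $g_2\in H^{-1}(\Omega)$, $T_d\in H^1(\Omega)$ with $T_d|_{\partial\Omega\setminus\Gamma_\gamma}=0$ and norms at most $\delta$, the Boussinesq system has a unique weak solution. Such constants exist. *)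

theory Defs
  imports "HOL-Analysis.Analysis"
begin

text \<open>
  Elements of function spaces are represented by functions defined on the whole ambient space; only
  their values almost everywhere in the domain matter.
\<close>

section \<open>Sobolev spaces\<close>

text \<open>\<open>Ck k S f\<close> is meant for open \<open>S\<close>.\<close>

primrec Ck :: "nat \<Rightarrow> 'a::euclidean_space set \<Rightarrow> ('a \<Rightarrow> real) \<Rightarrow> bool" where
  "Ck 0 S f \<longleftrightarrow> continuous_on S f"
| "Ck (Suc k) S f \<longleftrightarrow>
     f differentiable_on S \<and> (\<forall>b\<in>Basis. Ck k S (\<lambda>x. frechet_derivative f (at x) b))"

definition test_function :: "'a::euclidean_space set \<Rightarrow> ('a \<Rightarrow> real) \<Rightarrow> bool" where
  "test_function \<Omega> \<phi> \<longleftrightarrow>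
     (\<forall>k. Ck k UNIV \<phi>) \<and> compact (closure {x. \<phi> x \<noteq> 0}) \<and> closure {x. \<phi> x \<noteq> 0} \<subseteq> \<Omega>"

definition square_integrable :: "'a measure \<Rightarrow> ('a \<Rightarrow> 'b::euclidean_space) \<Rightarrow> bool" where
  "square_integrable M f \<longleftrightarrow> f \<in> borel_measurable M \<and> integrable M (\<lambda>x. (norm (f x))\<^sup>2)"

definition L2_norm :: "'a measure \<Rightarrow> ('a \<Rightarrow> real) \<Rightarrow> real" where
  "L2_norm M f = sqrt (LINT x|M. (f x)\<^sup>2)"

definition has_weak_partial ::
    "'a::euclidean_space set \<Rightarrow> 'a \<Rightarrow> ('a \<Rightarrow> real) \<Rightarrow> ('a \<Rightarrow> real) \<Rightarrow> bool" where
  "has_weak_partial \<Omega> b u g \<longleftrightarrow>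
     square_integrable (lebesgue_on \<Omega>) g \<and>
     (\<forall>\<phi>. test_function \<Omega> \<phi> \<longrightarrow>
        (LINT x|lebesgue_on \<Omega>. u x * frechet_derivative \<phi> (at x) b)
        = - (LINT x|lebesgue_on \<Omega>. g x * \<phi> x))"

text \<open>Weak derivatives are unique up to null sets; a representative is chosen.\<close>

definition weak_partial :: "'a::euclidean_space set \<Rightarrow> 'a \<Rightarrow> ('a \<Rightarrow> real) \<Rightarrow> 'a \<Rightarrow> real" where
  "weak_partial \<Omega> b u = (SOME g. has_weak_partial \<Omega> b u g)"

definition H1 :: "'a::euclidean_space set \<Rightarrow> ('a \<Rightarrow> real) set" where
  "H1 \<Omega> = {u. square_integrable (lebesgue_on \<Omega>) u \<and> (\<forall>b\<in>Basis. \<exists>g. has_weak_partial \<Omega> b u g)}"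

definition H2 :: "'a::euclidean_space set \<Rightarrow> ('a \<Rightarrow> real) set" where
  "H2 \<Omega> = {u \<in> H1 \<Omega>. \<forall>b\<in>Basis. weak_partial \<Omega> b u \<in> H1 \<Omega>}"

definition grad_norm :: "'a::euclidean_space set \<Rightarrow> ('a \<Rightarrow> real) \<Rightarrow> real" where
  "grad_norm \<Omega> u = sqrt (\<Sum>b\<in>Basis. (L2_norm (lebesgue_on \<Omega>) (weak_partial \<Omega> b u))\<^sup>2)"

definition H1_norm :: "'a::euclidean_space set \<Rightarrow> ('a \<Rightarrow> real) \<Rightarrow> real" where
  "H1_norm \<Omega> u = sqrt ((L2_norm (lebesgue_on \<Omega>) u)\<^sup>2 + (grad_norm \<Omega> u)\<^sup>2)"

definition H10 :: "'a::euclidean_space set \<Rightarrow> ('a \<Rightarrow> real) set" where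
  "H10 \<Omega> = {u \<in> H1 \<Omega>. \<exists>U::nat \<Rightarrow> 'a \<Rightarrow> real.
     (\<forall>n. test_function \<Omega> (U n)) \<and> (\<lambda>n. H1_norm \<Omega> (\<lambda>x. U n x - u x)) \<longlonglongrightarrow> 0}"

text \<open>
  \<open>H\<^sup>3\<^sup>/\<^sup>2\<close> of an open subset of the line, with the Gagliardo (Sobolev--Slobodeckij) seminorm of
  order 1/2 of the first derivative. The integrand is 0 on the diagonal by the convention for
  division by 0.
\<close>

definition H32 :: "real set \<Rightarrow> (real \<Rightarrow> real) set" where
  "H32 I = {u \<in> H1 I.
     (\<integral>\<^sup>+ s. (\<integral>\<^sup>+ t. ennreal ((weak_partial I 1 u s - weak_partial I 1 u t)\<^sup>2 / (s - t)\<^sup>2)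
        \<partial>lebesgue_on I) \<partial>lebesgue_on I) < \<infinity>}"

section \<open>Boundary regularity and surface measure\<close>

text \<open>
  Near \<open>x0\<close>, in the orthonormal coordinates \<open>(s, t) \<mapsto> x0 + Q (s, t)\<close>, the set \<open>\<Omega>\<close> is the part of
  the open rectangle of half-widths \<open>r\<close> and \<open>h\<close> above the graph of \<open>f\<close>. For open \<open>\<Omega>\<close> and continuous
  \<open>f\<close> it follows that the frontier of \<open>\<Omega>\<close> in that rectangle is the graph of \<open>f\<close>.
\<close>

definition boundary_chart ::
    "(real^2) set \<Rightarrow> real^2 \<Rightarrow> (real^2 \<Rightarrow> real^2) \<Rightarrow> real \<Rightarrow> real \<Rightarrow> (real \<Rightarrow> real) \<Rightarrow> bool" where
  "boundary_chart \<Omega> x0 Q r h f \<longleftrightarrow>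
     orthogonal_transformation Q \<and> 0 < r \<and> 0 < h \<and> f 0 = 0 \<and>
     (\<forall>s. \<bar>s\<bar> < r \<longrightarrow> \<bar>f s\<bar> < h) \<and>
     (\<forall>s t. \<bar>s\<bar> < r \<longrightarrow> \<bar>t\<bar> < h \<longrightarrow> (x0 + Q (vector [s, t]) \<in> \<Omega> \<longleftrightarrow> f s < t))"

definition lipschitz_boundary :: "(real^2) set \<Rightarrow> bool" where
  "lipschitz_boundary \<Omega> \<longleftrightarrow>
     (\<forall>x0\<in>frontier \<Omega>. \<exists>Q r h f L. boundary_chart \<Omega> x0 Q r h f \<and> L-lipschitz_on {-r<..<r} f)"

text \<open>\<open>f\<close> is required to be twice continuously differentiable up to the end points \<open>-r\<close> and \<open>r\<close>.\<close>

definition C2_chart ::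
    "(real^2) set \<Rightarrow> real^2 \<Rightarrow> (real^2 \<Rightarrow> real^2) \<Rightarrow> real \<Rightarrow> real \<Rightarrow> (real \<Rightarrow> real) \<Rightarrow> bool" where
  "C2_chart \<Omega> x0 Q r h f \<longleftrightarrow> boundary_chart \<Omega> x0 Q r h f \<and> (\<exists>R>r. Ck 2 {-R<..<R} f)"

definition C2_portion :: "(real^2) set \<Rightarrow> (real^2) set \<Rightarrow> bool" where
  "C2_portion \<Omega> \<Gamma> \<longleftrightarrow> (\<forall>x0\<in>\<Gamma>. \<exists>Q r h f. C2_chart \<Omega> x0 Q r h f)"

text \<open>
  One-dimensional Hausdorff measure. Boundedness of the covering sets is required because
  \<open>diameter\<close> is 0 on unbounded sets.
\<close>

definition hausdorff1_outer :: "'a::metric_space set \<Rightarrow> ennreal" where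
  "hausdorff1_outer A =
     (SUP d\<in>{0<..}. INF U\<in>{U::nat \<Rightarrow> 'a set. A \<subseteq> (\<Union>n. U n) \<and>
         (\<forall>n. bounded (U n) \<and> diameter (U n) \<le> d)}. \<Sum>n. ennreal (diameter (U n)))"

definition hausdorff1 :: "'a::metric_space measure" where
  "hausdorff1 = measure_of UNIV (sets borel) hausdorff1_outer"

definition boundary_measure :: "(real^2) set \<Rightarrow> (real^2) measure" where
  "boundary_measure \<Omega> = restrict_space hausdorff1 (frontier \<Omega>)"

section \<open>Traces\<close>

text \<open>
  The trace operator is the continuous extension, from \<open>H\<^sup>1(\<Omega>)\<close> to \<open>L\<^sup>2(\<partial>\<Omega>)\<close>, of the restriction of
  smooth functions to the boundary. For bounded Lipschitz \<open>\<Omega>\<close> every \<open>u \<in> H1 \<Omega>\<close> has a trace, unique up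
  to null sets of the boundary.
\<close>

definition has_trace :: "(real^2) set \<Rightarrow> (real^2 \<Rightarrow> real) \<Rightarrow> (real^2 \<Rightarrow> real) \<Rightarrow> bool" where
  "has_trace \<Omega> u g \<longleftrightarrow> u \<in> H1 \<Omega> \<and> square_integrable (boundary_measure \<Omega>) g \<and>
     (\<exists>U::nat \<Rightarrow> real^2 \<Rightarrow> real. (\<forall>n k. Ck k UNIV (U n)) \<and>
        (\<lambda>n. H1_norm \<Omega> (\<lambda>x. U n x - u x)) \<longlonglongrightarrow> 0 \<and>
        (\<lambda>n. L2_norm (boundary_measure \<Omega>) (\<lambda>x. U n x - g x)) \<longlonglongrightarrow> 0)"

definition trace_on_boundary :: "(real^2) set \<Rightarrow> (real^2 \<Rightarrow> real) \<Rightarrow> real^2 \<Rightarrow> real" where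
  "trace_on_boundary \<Omega> u = (SOME g. has_trace \<Omega> u g)"

definition zero_trace_on :: "(real^2) set \<Rightarrow> (real^2) set \<Rightarrow> (real^2 \<Rightarrow> real) \<Rightarrow> bool" where
  "zero_trace_on \<Omega> S u \<longleftrightarrow> (AE x in boundary_measure \<Omega>. x \<in> S \<longrightarrow> trace_on_boundary \<Omega> u x = 0)"

text \<open>
  \<open>H\<^sup>3\<^sup>/\<^sup>2\<close> of a relatively open part \<open>\<Gamma>0\<close> of the boundary, by pull-back along all \<open>C\<^sup>2\<close> graph
  parametrisations (Grisvard). Meaningful when \<open>\<Gamma>0\<close> lies in a \<open>C\<^sup>2\<close> portion of the boundary.
\<close>

definition H32_boundary :: "(real^2) set \<Rightarrow> (real^2) set \<Rightarrow> (real^2 \<Rightarrow> real) set" where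
  "H32_boundary \<Omega> \<Gamma>0 = {u. square_integrable (restrict_space (boundary_measure \<Omega>) \<Gamma>0) u \<and>
     (\<forall>x0 Q r h f. C2_chart \<Omega> x0 Q r h f \<longrightarrow>
        (\<lambda>s. u (x0 + Q (vector [s, f s])))
          \<in> H32 {s. \<bar>s\<bar> < r \<and> x0 + Q (vector [s, f s]) \<in> \<Gamma>0})}"

section \<open>The Boussinesq system\<close>

definition solenoidal_space :: "(real^2) set \<Rightarrow> (real^2 \<Rightarrow> real^2) set" where
  "solenoidal_space \<Omega> = {\<phi>.
     (\<forall>j. (\<lambda>x. \<phi> x $ j) \<in> H1 \<Omega>) \<and>
     (AE x in lebesgue_on \<Omega>. (\<Sum>j\<in>UNIV. weak_partial \<Omega> (axis j 1) (\<lambda>y. \<phi> y $ j) x) = 0) \<and>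
     (\<forall>j. zero_trace_on \<Omega> (frontier \<Omega>) (\<lambda>x. \<phi> x $ j))}"

definition vec_grad_norm :: "(real^2) set \<Rightarrow> (real^2 \<Rightarrow> real^2) \<Rightarrow> real" where
  "vec_grad_norm \<Omega> v = sqrt (\<Sum>j\<in>UNIV. (grad_norm \<Omega> (\<lambda>x. v x $ j))\<^sup>2)"

text \<open>
  Bounded linear functionals on a space \<open>X\<close> of functions with norm \<open>N\<close>. Functionals that are bounded
  for \<open>N\<close> automatically take equal values on functions at \<open>N\<close>-distance 0.
\<close>

definition dual_space ::
    "('a \<Rightarrow> 'b::real_vector) set \<Rightarrow> (('a \<Rightarrow> 'b) \<Rightarrow> real) \<Rightarrow> (('a \<Rightarrow> 'b) \<Rightarrow> real) set" where
  "dual_space X N = {F.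
     (\<forall>\<phi>\<in>X. \<forall>\<psi>\<in>X. F (\<lambda>x. \<phi> x + \<psi> x) = F \<phi> + F \<psi>) \<and>
     (\<forall>\<phi>\<in>X. \<forall>c. F (\<lambda>x. c *\<^sub>R \<phi> x) = c * F \<phi>) \<and>
     (\<exists>C. \<forall>\<phi>\<in>X. \<bar>F \<phi>\<bar> \<le> C * N \<phi>)}"

definition dual_norm ::
    "('a \<Rightarrow> 'b) set \<Rightarrow> (('a \<Rightarrow> 'b) \<Rightarrow> real) \<Rightarrow> (('a \<Rightarrow> 'b) \<Rightarrow> real) \<Rightarrow> real" where
  "dual_norm X N F = (SUP \<phi>\<in>{\<phi>\<in>X. N \<phi> \<le> 1}. \<bar>F \<phi>\<bar>)"

definition L2_functional ::
    "(real^2) set \<Rightarrow> (real^2 \<Rightarrow> 'b::euclidean_space) \<Rightarrow> (real^2 \<Rightarrow> 'b) \<Rightarrow> real" where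
  "L2_functional \<Omega> g \<phi> = (LINT x|lebesgue_on \<Omega>. g x \<bullet> \<phi> x)"

definition weak_solution ::
    "(real^2) set \<Rightarrow> real \<Rightarrow> real \<Rightarrow> real \<Rightarrow> ((real^2 \<Rightarrow> real^2) \<Rightarrow> real) \<Rightarrow> ((real^2 \<Rightarrow> real) \<Rightarrow> real) \<Rightarrow>
     (real^2 \<Rightarrow> real) \<Rightarrow> (real^2 \<Rightarrow> real^2) \<Rightarrow> (real^2 \<Rightarrow> real) \<Rightarrow> bool" where
  "weak_solution \<Omega> Rey Pr Gr F1 F2 Td v T \<longleftrightarrow>
     v \<in> solenoidal_space \<Omega> \<and> T \<in> H1 \<Omega> \<and> (\<lambda>x. T x - Td x) \<in> H10 \<Omega> \<and>
     (\<forall>\<phi>\<in>solenoidal_space \<Omega>.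
        (LINT x|lebesgue_on \<Omega>. (\<Sum>j\<in>UNIV. \<Sum>i\<in>UNIV.
           v x $ i * weak_partial \<Omega> (axis i 1) (\<lambda>y. v y $ j) x * \<phi> x $ j))
        + 1 / Rey * (LINT x|lebesgue_on \<Omega>. (\<Sum>j\<in>UNIV. \<Sum>i\<in>UNIV.
           weak_partial \<Omega> (axis i 1) (\<lambda>y. v y $ j) x
             * weak_partial \<Omega> (axis i 1) (\<lambda>y. \<phi> y $ j) x))
        - Gr / Rey\<^sup>2 * (LINT x|lebesgue_on \<Omega>. (T x *\<^sub>R vector [0, 1]) \<bullet> \<phi> x)
        = F1 \<phi>) \<and>
     (\<forall>\<phi>\<in>H10 \<Omega>.
        (LINT x|lebesgue_on \<Omega>. (\<Sum>i\<in>UNIV. v x $ i * weak_partial \<Omega> (axis i 1) T x) * \<phi> x)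
        + 1 / (Rey * Pr) * (LINT x|lebesgue_on \<Omega>. (\<Sum>i\<in>UNIV.
           weak_partial \<Omega> (axis i 1) T x * weak_partial \<Omega> (axis i 1) \<phi> x))
        = F2 \<phi>)"

definition well_posedness_constants ::
    "(real^2) set \<Rightarrow> (real^2) set \<Rightarrow> real \<Rightarrow> real \<Rightarrow> real \<Rightarrow> real \<Rightarrow> bool" where
  "well_posedness_constants \<Omega> \<Gamma> \<epsilon>1 \<epsilon>2 \<epsilon>3 \<delta> \<longleftrightarrow>
     0 < \<epsilon>1 \<and> 0 < \<epsilon>2 \<and> 0 < \<epsilon>3 \<and> 0 < \<delta> \<and>
     (\<forall>Rey Pr Gr F1 F2 Td.
        Rey \<in> {0<..<\<epsilon>1} \<longrightarrow> Pr \<in> {0<..<\<epsilon>2 / Rey} \<longrightarrow> Gr \<in> {0<..<\<epsilon>3 * Rey} \<longrightarrow>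
        F1 \<in> dual_space (solenoidal_space \<Omega>) (vec_grad_norm \<Omega>) \<longrightarrow>
        F2 \<in> dual_space (H10 \<Omega>) (grad_norm \<Omega>) \<longrightarrow>
        Td \<in> H1 \<Omega> \<longrightarrow> zero_trace_on \<Omega> (frontier \<Omega> - \<Gamma>) Td \<longrightarrow>
        dual_norm (solenoidal_space \<Omega>) (vec_grad_norm \<Omega>) F1 \<le> \<delta> \<longrightarrow>
        dual_norm (H10 \<Omega>) (grad_norm \<Omega>) F2 \<le> \<delta> \<longrightarrow>
        H1_norm \<Omega> Td \<le> \<delta> \<longrightarrow>
        (\<exists>v T. weak_solution \<Omega> Rey Pr Gr F1 F2 Td v T) \<and>
        (\<forall>v T v' T'. weak_solution \<Omega> Rey Pr Gr F1 F2 Td v T \<longrightarrow>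
           weak_solution \<Omega> Rey Pr Gr F1 F2 Td v' T' \<longrightarrow>
           (AE x in lebesgue_on \<Omega>. v x = v' x \<and> T x = T' x)))"

end

theory Submission
  imports Defs
begin

text \<open>
  The regularity comes from the boundary data alone. The trace of \<open>v\<close> is zero, and since \<open>T - Td\<close> is a
  limit of test functions, the trace of \<open>T\<close> is the \<open>L\<^sup>2\<close> limit of the restrictions to the boundary of
  smooth functions \<open>V n\<close> that approximate \<open>Td\<close> in \<open>H\<^sup>2\<close>. Along the graph of a \<open>C\<^sup>2\<close> function the
  tangential derivatives of the \<open>V n\<close> converge to the product of the Lipschitz tangent field with the
  trace of the gradient of \<open>Td\<close>, which is therefore the weak derivative of the trace of \<open>T\<close>. It remains
  to see that the trace of an \<open>H\<^sup>1\<close> function has a finite Gagliardo seminorm of order 1/2: two boundary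
  points at distance \<open>d\<close> are joined through the domain by two segments of length comparable to \<open>d\<close>, and
  Hardy's inequality bounds the double integral of the squared difference quotients by the Dirichlet integral.

  The hypothesis that \<open>\<Gamma>\<close> has nonzero measure excludes the junk value of \<open>measure_of\<close>: since
  \<open>hausdorff1\<close> is not the null measure, it agrees with \<open>hausdorff1_outer\<close> on Borel sets.
\<close>

text \<open>Convolution commutes with weak derivatives only where the kernel sees nothing but points
  of \<Omega>. This obstacle shapes the density proof, which has to reach the boundary and to work
  in \<open>H\<^sup>2\<close>: near a boundary point the kernel is displaced along the axis of a
  Lipschitz graph, far enough that its support lies above the graph. A trace is known only as an
  \<open>L\<^sup>2\<close> limit, so boundary estimates are proved for smooth functions, with bounds
  that stay finite along the approximating sequence, and are then carried to the limit. The joining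
  segments have directions steeper than the graph, which is why they sweep into \<Omega> with
  bounded distortion. Boundary points far apart require no geometry, since the denominator of the
  quotient is bounded below there; local patches with a Lebesgue number are therefore enough.
  Hausdorff and Lebesgue measure are compared by one-sided inequalities in both directions, through
  coverings by short intervals, in place of an area formula. A Lipschitz tangent field matters
  because a bounded Lipschitz factor preserves a finite seminorm of order 1/2.\<close>

definition smooth :: "('a::euclidean_space \<Rightarrow> real) \<Rightarrow> bool" where
  "smooth f \<longleftrightarrow> (\<forall>k. Ck k UNIV f)"

text \<open>The direction may be any vector, so that \<open>\<lambda>h. pd h f x\<close> is the
  whole derivative of a smooth \<open>f\<close> at \<open>x\<close>, and partial derivatives are its
  values on \<open>Basis\<close>.\<close>

definition pd :: "'a::euclidean_space \<Rightarrow> ('a \<Rightarrow> real) \<Rightarrow> 'a \<Rightarrow> real" where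
  "pd b f x = frechet_derivative f (at x) b"

lemma pd_eqI: "(f has_derivative f') (at x) \<Longrightarrow> pd b f x = f' b"
  unfolding pd_def by (metis frechet_derivative_at)

lemma Ck_Suc_pd:
  "Ck (Suc k) S f \<longleftrightarrow> f differentiable_on S \<and> (\<forall>b\<in>Basis. Ck k S (pd b f))"
  by (simp add: pd_def[abs_def])

lemma Ck_continuous_on: "Ck k S f \<Longrightarrow> continuous_on S f"
  by (cases k) (auto intro: differentiable_imp_continuous_on)

lemma Ck_mono: "Ck (Suc k) S f \<Longrightarrow> Ck k S f"
proof (induction k arbitrary: f)
  case 0
  then show ?case by (auto intro: differentiable_imp_continuous_on)
next
  case (Suc k)
  have "f differentiable_on S" "\<forall>b\<in>Basis. Ck (Suc k) S (pd b f)"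
    using Suc.prems Ck_Suc_pd by blast+
  then show ?case using Suc.IH unfolding Ck_Suc_pd by blast
qed

lemma Ck_has_derivative:
  "Ck (Suc k) UNIV f \<Longrightarrow> (f has_derivative frechet_derivative f (at x)) (at x)"
  by (simp add: differentiable_on_def frechet_derivative_works[symmetric])

text \<open>\<open>Ck\<close> speaks of the chosen \<open>frechet_derivative\<close>; uniqueness of
  derivatives allows any explicit family \<open>f'\<close> in its place.\<close>

lemma Ck_SucI:
  assumes "\<And>x. (f has_derivative f' x) (at x)" "\<And>b. b \<in> Basis \<Longrightarrow> Ck k UNIV (\<lambda>x. f' x b)"
  shows "Ck (Suc k) UNIV f"
proof -
  have "pd b f = (\<lambda>x. f' x b)" for b
    using pd_eqI[OF assms(1)] by auto
  then show ?thesis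
    using assms unfolding Ck_Suc_pd by (auto simp: differentiable_on_def differentiable_def)
qed

lemma Ck_const: "Ck k UNIV (\<lambda>x. c)"
proof (induction k arbitrary: c)
  case (Suc k)
  show ?case by (rule Ck_SucI[where f'="\<lambda>x b. 0"]) (use Suc in auto)
qed simp

lemma Ck_add:
  assumes "Ck k UNIV f" "Ck k UNIV g" shows "Ck k UNIV (\<lambda>x. f x + g x)"
  using assms
proof (induction k arbitrary: f g)
  case 0 then show ?case by (auto intro: continuous_intros)
next
  case (Suc k)
  show ?case
    by (rule Ck_SucI, rule has_derivative_add, rule Ck_has_derivative[OF Suc.prems(1)],
        rule Ck_has_derivative[OF Suc.prems(2)]) (use Suc in auto)
qed

lemma Ck_mult:
  assumes "Ck k UNIV f" "Ck k UNIV g" shows "Ck k UNIV (\<lambda>x. f x * g x)"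
  using assms
proof (induction k arbitrary: f g)
  case 0 then show ?case by (auto intro: continuous_intros)
next
  case (Suc k)
  show ?case
    by (rule Ck_SucI, rule has_derivative_mult, rule Ck_has_derivative[OF Suc.prems(1)],
        rule Ck_has_derivative[OF Suc.prems(2)])
      (use Suc Ck_mono[OF Suc.prems(1)] Ck_mono[OF Suc.prems(2)] in \<open>auto intro!: Ck_add\<close>)
qed

text \<open>As the outer function is real, the chain rule yields the product of
  \<open>pd 1 h\<close> along \<open>f\<close> with a derivative of \<open>f\<close>; the induction
  then closes with \<open>Ck_mult\<close>.\<close>

lemma Ck_compose:
  fixes h :: "real \<Rightarrow> real"
  assumes "Ck k UNIV h" "Ck k UNIV f" shows "Ck k UNIV (\<lambda>x. h (f x))"
  using assms
proof (induction k arbitrary: h f)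
  case 0 then show ?case using continuous_on_compose2[of UNIV h UNIV f] by auto
next
  case (Suc k)
  have h: "(h has_derivative (\<lambda>t. t * pd 1 h y)) (at y)" for y
  proof -
    note d = Ck_has_derivative[OF Suc.prems(1), of y]
    have "frechet_derivative h (at y) = (\<lambda>t. t * pd 1 h y)"
    proof
      fix t show "frechet_derivative h (at y) t = t * pd 1 h y"
        using linear_scale[OF has_derivative_linear[OF d], of t 1] by (simp add: pd_def)
    qed
    with d show ?thesis by simp
  qed
  have c: "Ck k UNIV (\<lambda>x. pd 1 h (f x))"
  proof (rule Suc.IH[of "pd 1 h" f])
    show "Ck k UNIV (pd 1 h)" using Suc.prems(1) unfolding Ck_Suc_pd by simp
    show "Ck k UNIV f" using Ck_mono[OF Suc.prems(2)] .
  qed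
  show ?case
    by (rule Ck_SucI[OF has_derivative_compose[OF Ck_has_derivative[OF Suc.prems(2)] h]])
      (use c Suc.prems in \<open>auto intro!: Ck_mult\<close>)
qed

lemma Ck_bounded_linear:
  assumes "bounded_linear f" shows "Ck k UNIV f"
proof (cases k)
  case (Suc m)
  then show ?thesis
    using Ck_SucI[of f "\<lambda>x. f", OF bounded_linear_imp_has_derivative[OF assms] Ck_const] by simp
qed (use assms in \<open>simp add: linear_continuous_on\<close>)

lemma Ck_affine:
  assumes "Ck k UNIV f" shows "Ck k UNIV (\<lambda>x. f (a + c *\<^sub>R x))"
  using assms
proof (induction k arbitrary: f)
  case 0
  then show ?case
    using continuous_on_compose2[of UNIV f UNIV "\<lambda>x. a + c *\<^sub>R x"]
    by (simp add: continuous_on_add continuous_on_scaleR)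
next
  case (Suc k)
  have d: "((\<lambda>x. f (a + c *\<^sub>R x)) has_derivative
     (\<lambda>h. frechet_derivative f (at (a + c *\<^sub>R x)) (c *\<^sub>R h))) (at x)" for x
    by (rule has_derivative_compose[OF _ Ck_has_derivative[OF Suc.prems]])
      (auto intro!: derivative_eq_intros)
  have "frechet_derivative f (at y) (c *\<^sub>R h) = c * frechet_derivative f (at y) h" for y h
    using linear_scale[OF has_derivative_linear[OF Ck_has_derivative[OF Suc.prems]]] by simp
  then show ?case
    by (intro Ck_SucI[OF d]) (use Suc in \<open>auto intro!: Ck_mult Ck_const\<close>)
qed

text \<open>A fixed-point form of smoothness: a function whose derivative is already known to be
  smooth needs no further induction on the order.\<close>

lemma smooth_iff: "smooth f \<longleftrightarrow> f differentiable_on UNIV \<and> (\<forall>b\<in>Basis. smooth (pd b f))"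
proof
  assume "smooth f"
  then have "\<And>k. Ck (Suc k) UNIV f" by (auto simp: smooth_def)
  then show "f differentiable_on UNIV \<and> (\<forall>b\<in>Basis. smooth (pd b f))"
    unfolding smooth_def Ck_Suc_pd by auto
next
  assume *: "f differentiable_on UNIV \<and> (\<forall>b\<in>Basis. smooth (pd b f))"
  then have "Ck (Suc k) UNIV f" for k
    unfolding smooth_def Ck_Suc_pd by blast
  then show "smooth f" unfolding smooth_def using Ck_mono by blast
qed

lemma smooth_pd: "smooth f \<Longrightarrow> b \<in> Basis \<Longrightarrow> smooth (pd b f)"
  using smooth_iff by blast

lemma smooth_has_derivative: "smooth f \<Longrightarrow> (f has_derivative (\<lambda>h. pd h f x)) (at x)"
  using Ck_has_derivative unfolding smooth_def pd_def by blast

lemma smooth_continuous: "smooth f \<Longrightarrow> continuous_on S f"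
  using Ck_continuous_on smooth_def continuous_on_subset by blast

lemma smooth_const [simp]: "smooth (\<lambda>x. c)"
  by (simp add: smooth_def Ck_const)

lemma smooth_add: "smooth f \<Longrightarrow> smooth g \<Longrightarrow> smooth (\<lambda>x. f x + g x)"
  by (simp add: smooth_def Ck_add)

lemma smooth_mult: "smooth f \<Longrightarrow> smooth g \<Longrightarrow> smooth (\<lambda>x. f x * g x)"
  by (simp add: smooth_def Ck_mult)

lemma smooth_cmult: "smooth f \<Longrightarrow> smooth (\<lambda>x. c * f x)"
  by (simp add: smooth_mult)

lemma smooth_diff: "smooth f \<Longrightarrow> smooth g \<Longrightarrow> smooth (\<lambda>x. f x - g x)"
  using smooth_add[of f "\<lambda>x. (-1) * g x"] smooth_cmult[of g "-1"] by simp

lemma smooth_compose: "smooth h \<Longrightarrow> smooth f \<Longrightarrow> smooth (\<lambda>x. h (f x :: real))"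
  by (simp add: smooth_def Ck_compose)

lemma smooth_affine: "smooth f \<Longrightarrow> smooth (\<lambda>x. f (a + c *\<^sub>R x))"
  by (simp add: smooth_def Ck_affine)

lemma smooth_inner: "smooth (\<lambda>x. x \<bullet> x :: real)"
proof -
  have "smooth (\<lambda>x::'a. x \<bullet> b)" for b
    by (auto simp: smooth_def intro!: Ck_bounded_linear bounded_linear_intros)
  moreover have "smooth (\<lambda>x. \<Sum>i\<in>A. f i x)" if "finite A" "\<And>i. i \<in> A \<Longrightarrow> smooth (f i)"
    for A and f :: "'a \<Rightarrow> 'a \<Rightarrow> real"
    using that by (induction A) (auto intro!: smooth_add)
  ultimately have "smooth (\<lambda>x::'a. \<Sum>b\<in>Basis. x \<bullet> b * (x \<bullet> b))"
    by (simp add: smooth_mult)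
  then show ?thesis
    unfolding euclidean_inner[of x x for x] .
qed

lemma pd_add: "smooth f \<Longrightarrow> smooth g \<Longrightarrow> pd b (\<lambda>x. f x + g x) x = pd b f x + pd b g x"
  by (rule pd_eqI[THEN trans]) (auto intro!: has_derivative_add smooth_has_derivative)

lemma pd_diff: "smooth f \<Longrightarrow> smooth g \<Longrightarrow> pd b (\<lambda>x. f x - g x) x = pd b f x - pd b g x"
  by (rule pd_eqI[THEN trans]) (auto intro!: has_derivative_diff smooth_has_derivative)

lemma pd_mult:
  "smooth f \<Longrightarrow> smooth g \<Longrightarrow> pd b (\<lambda>x. f x * g x) x = f x * pd b g x + pd b f x * g x"
  by (rule pd_eqI[THEN trans]) (auto intro!: has_derivative_mult smooth_has_derivative)

lemma pd_const: "pd b (\<lambda>x. c) x = 0"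
  by (rule pd_eqI) simp

lemma pd_affine: "smooth f \<Longrightarrow> pd b (\<lambda>x. f (a + c *\<^sub>R x)) x = c * pd b f (a + c *\<^sub>R x)"
proof -
  assume f: "smooth f"
  have "((\<lambda>x. f (a + c *\<^sub>R x)) has_derivative (\<lambda>h. pd (c *\<^sub>R h) f (a + c *\<^sub>R x))) (at x)"
    by (rule has_derivative_compose[OF _ smooth_has_derivative[OF f]])
      (auto intro!: derivative_eq_intros)
  then have "pd b (\<lambda>x. f (a + c *\<^sub>R x)) x = pd (c *\<^sub>R b) f (a + c *\<^sub>R x)"
    by (rule pd_eqI)
  also have "\<dots> = c * pd b f (a + c *\<^sub>R x)"
    using linear_scale[OF has_derivative_linear[OF smooth_has_derivative[OF f, of "a + c *\<^sub>R x"]], of c b] by simp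
  finally show ?thesis .
qed

lemma pd_cong_open:
  assumes "open S" "x \<in> S" "smooth f" "\<And>y. y \<in> S \<Longrightarrow> f y = g y"
  shows "pd b g x = pd b f x"
  by (rule pd_eqI)
    (rule has_derivative_transform_within_open[OF smooth_has_derivative[OF assms(3)] assms(1,2,4)])

lemma pd_zero_open: "open S \<Longrightarrow> x \<in> S \<Longrightarrow> (\<And>y. y \<in> S \<Longrightarrow> f y = 0) \<Longrightarrow> pd b f x = 0"
  using pd_cong_open[of S x "\<lambda>x. 0" f b] by (simp add: pd_const)

section \<open>Bump functions\<close>

text \<open>The induction on the order passes from \<open>D n\<close> to \<open>D (Suc n)\<close>,
  so the whole tower of derivatives has to be given at once.\<close>

lemma smooth_of_derivs:
  fixes D :: "nat \<Rightarrow> real \<Rightarrow> real"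
  assumes "\<And>n x. (D n has_real_derivative D (Suc n) x) (at x)"
  shows "smooth (D n)"
proof -
  have "Ck k UNIV (D n)" for k n
  proof (induction k arbitrary: n)
    case 0
    show ?case using assms by (auto intro!: DERIV_continuous_on)
  next
    case (Suc k)
    show ?case
      by (rule Ck_SucI[OF assms[of n, unfolded has_field_derivative_def]]) (use Suc in auto)
  qed
  then show ?thesis by (simp add: smooth_def)
qed

text \<open>The classical smooth function that is flat at 0; all cutoffs and mollifying kernels
  below are built from it.\<close>

definition flat_exp :: "real \<Rightarrow> real" where
  "flat_exp x = (if x > 0 then exp (- (1 / x)) else 0)"

text \<open>The derivatives of \<open>flat_exp\<close> are of the form \<open>P (1/x) exp (-1/x)\<close> with polynomials \<open>P\<close>.\<close>

primrec flat_exp_poly :: "nat \<Rightarrow> real poly" where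
  "flat_exp_poly 0 = 1"
| "flat_exp_poly (Suc n) = [:0, 0, 1:] * (flat_exp_poly n - pderiv (flat_exp_poly n))"

text \<open>With \<open>y = 1 / x\<close> this is the decay of a polynomial against the exponential
  at infinity.\<close>

lemma poly_exp_inverse_tendsto:
  "((\<lambda>x. poly p (1 / x) * exp (- (1 / x))) \<longlongrightarrow> 0) (at_right (0::real))"
proof -
  have "((\<lambda>y. y ^ k / exp y) \<longlongrightarrow> (0::real)) at_top" for k
    by (rule tendsto_power_div_exp_0)
  then have "((\<lambda>y. poly p y * exp (- y)) \<longlongrightarrow> (0::real)) at_top"
  proof -
    assume k: "\<And>k. ((\<lambda>y. y ^ k / exp y) \<longlongrightarrow> (0::real)) at_top"
    have "((\<lambda>y. \<Sum>i\<le>degree p. coeff p i * (y ^ i / exp y)) \<longlongrightarrow> (\<Sum>i\<le>degree p. coeff p i * 0)) at_top"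
      by (intro tendsto_intros k)
    then show ?thesis
      by (simp add: poly_altdef exp_minus sum_distrib_right divide_inverse mult.assoc)
  qed
  from filterlim_compose[OF this filterlim_inverse_at_top_right]
  show ?thesis by (simp add: divide_inverse)
qed

lemma smooth_flat_exp: "smooth flat_exp"
proof -
  define D where "D n x = (if x > 0 then poly (flat_exp_poly n) (1 / x) * exp (- (1 / x)) else 0)"
    for n and x :: real
  have "(D n has_real_derivative D (Suc n) x) (at x)" for n x
  proof (cases x "0 :: real" rule: linorder_cases)
    case greater
    have "((\<lambda>x. poly (flat_exp_poly n) (1 / x) * exp (- (1 / x))) has_real_derivative
      D (Suc n) x) (at x)"
      using greater by (auto intro!: derivative_eq_intros simp: D_def field_simps power2_eq_square)
    then show ?thesis
      by (rule has_field_derivative_transform_within_open[of _ _ _ "{0<..}"])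
        (use greater in \<open>auto simp: D_def\<close>)
  next
    case less
    have "((\<lambda>x. 0) has_real_derivative D (Suc n) x) (at x)"
      using less by (simp add: D_def)
    then show ?thesis
      by (rule has_field_derivative_transform_within_open[of _ _ _ "{..<0}"])
        (use less in \<open>auto simp: D_def\<close>)
  next
    case equal
    \<comment> \<open>Dividing by \<open>h\<close> multiplies the polynomial in \<open>1 / h\<close>
      by its variable, so the right difference quotient at 0 has the form treated in
      \<open>poly_exp_inverse_tendsto\<close>. On the left it is identically 0.\<close>
    have "((\<lambda>h. D n h / h) \<longlongrightarrow> 0) (at_right 0)"
    proof -
      have "eventually (\<lambda>h. poly ([:0, 1:] * flat_exp_poly n) (1 / h) * exp (- (1 / h)) = D n h / h)
          (at_right 0)"
        by (auto simp: eventually_at_right_less D_def eventually_at intro!: exI[of _ 1])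
      from Lim_transform_eventually[OF poly_exp_inverse_tendsto this] show ?thesis .
    qed
    moreover have "((\<lambda>h. D n h / h) \<longlongrightarrow> 0) (at_left 0)"
    proof -
      have "eventually (\<lambda>h. 0 = D n h / h) (at_left (0::real))"
        by (auto simp: D_def eventually_at intro!: exI[of _ 1])
      from Lim_transform_eventually[OF tendsto_const this] show ?thesis .
    qed
    ultimately have "((\<lambda>h. D n h / h) \<longlongrightarrow> 0) (at 0)"
      by (simp add: filterlim_at_split)
    then show ?thesis using equal by (simp add: DERIV_def D_def)
  qed
  from smooth_of_derivs[of D, OF this] have "smooth (D 0)" .
  moreover have "D 0 = flat_exp"
    by (auto simp: D_def flat_exp_def)
  ultimately show ?thesis by simp
qed

lemma flat_exp_nonneg [simp]: "0 \<le> flat_exp x"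
  by (simp add: flat_exp_def)

lemma flat_exp_pos_iff [simp]: "0 < flat_exp x \<longleftrightarrow> 0 < x" "flat_exp x = 0 \<longleftrightarrow> x \<le> 0"
  by (auto simp: flat_exp_def)

text \<open>The normalised primitive of a bump that is positive exactly on the open unit
  interval.\<close>

lemma smooth_step_exists:
  "\<exists>\<psi>::real \<Rightarrow> real. smooth \<psi> \<and> (\<forall>t\<le>0. \<psi> t = 0) \<and> (\<forall>t\<ge>1. \<psi> t = 1)"
proof -
  define b where "b t = flat_exp t * flat_exp (1 - t)" for t
  have sb: "smooth b"
    unfolding b_def
    using smooth_mult[OF smooth_flat_exp smooth_affine[OF smooth_flat_exp, of 1 "-1"]] by simp
  then have cb: "continuous_on S b" for S by (rule smooth_continuous)
  define c where "c = integral {0..1} b"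
  have "c > 0"
  proof -
    have "c \<noteq> 0"
    proof
      assume "c = 0"
      then have "(b has_integral 0) (cbox 0 1)"
        using integrable_integral[OF integrable_continuous_real[OF cb[of "{0..1}"]]] by (simp add: c_def)
      from has_integral_0_cbox_imp_0[OF _ _ this, of "1/2"]
      show False using cb by (auto simp: b_def content_real)
    qed
    moreover have "c \<ge> 0" unfolding c_def
      by (intro integral_nonneg integrable_continuous_real cb) (auto simp: b_def)
    ultimately show ?thesis by simp
  qed
  define \<psi> where "\<psi> t = (if t \<le> 0 then 0 else integral {0..t} b / c)" for t
  have z: "b t = 0" if "t \<le> 0 \<or> 1 \<le> t" for t
    using that by (auto simp: b_def flat_exp_def)
  \<comment> \<open>Moving the lower limit to -1 changes nothing, as \<open>b\<close> vanishes
    there, but puts \<open>t = 0\<close> inside the interval of integration. The fundamental theorem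
    then gives a two-sided derivative at 0.\<close>
  have eq: "\<psi> t = integral {-1..t} b / c" if "t > -1" for t
  proof (cases "t \<le> 0")
    case True
    have "integral {-1..t} b = integral {-1..t} (\<lambda>x. 0)"
      by (rule Henstock_Kurzweil_Integration.integral_cong) (use True z in auto)
    then show ?thesis using True by (simp add: \<psi>_def)
  next
    case False
    have "integral {-1..0} b = integral {-1..(0::real)} (\<lambda>x. 0)"
      by (rule Henstock_Kurzweil_Integration.integral_cong) (use z in auto)
    moreover have "integral {-1..0} b + integral {0..t} b = integral {-1..t} b"
      by (rule Henstock_Kurzweil_Integration.integral_combine)
        (use False in \<open>auto intro!: integrable_continuous_real cb\<close>)
    ultimately show ?thesis using False by (simp add: \<psi>_def)
  qed
  have d: "(\<psi> has_real_derivative b t / c) (at t)" for t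
  proof (cases "t < 0")
    case True
    have "((\<lambda>x. 0) has_real_derivative b t / c) (at t)" using z True by simp
    then show ?thesis
      by (rule has_field_derivative_transform_within_open[of _ _ _ "{..<0}"])
        (use True in \<open>auto simp: \<psi>_def\<close>)
  next
    case False
    have "((\<lambda>u. integral {-1..u} b) has_real_derivative b t) (at t within {-1..t + 1})"
      by (rule integral_has_real_derivative) (use False cb in auto)
    moreover have "at t within {-1..t + 1} = at t"
      by (rule at_within_interior) (use False in auto)
    ultimately have "((\<lambda>u. integral {-1..u} b) has_real_derivative b t) (at t)"
      by simp
    then have "((\<lambda>u. integral {-1..u} b / c) has_real_derivative b t / c) (at t)"
      by (rule DERIV_cdivide)
    then show ?thesis
      by (rule has_field_derivative_transform_within_open[of _ _ _ "{-1<..}"])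
        (use False eq in auto)
  qed
  have "smooth \<psi>"
    unfolding smooth_iff[of \<psi>]
  proof safe
    show "\<psi> differentiable_on UNIV"
      using d by (auto simp: differentiable_on_def real_differentiable_def)
    fix e :: real assume "e \<in> Basis"
    have "pd e \<psi> = (\<lambda>t. (e / c) * b t)"
      using pd_eqI[OF d[unfolded has_field_derivative_def]] by (auto simp: field_simps)
    then show "smooth (pd e \<psi>)"
      by (simp only: smooth_cmult[OF sb])
  qed
  moreover have "\<psi> t = 1" if "t \<ge> 1" for t
  proof -
    have "integral {1..t} b = integral {1..t} (\<lambda>x. 0)"
      by (rule Henstock_Kurzweil_Integration.integral_cong) (use z in auto)
    moreover have "integral {0..1} b + integral {1..t} b = integral {0..t} b"
      by (rule Henstock_Kurzweil_Integration.integral_combine)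
        (use that in \<open>auto intro!: integrable_continuous_real cb\<close>)
    ultimately show ?thesis using that \<open>c > 0\<close> by (simp add: \<psi>_def c_def)
  qed
  moreover have "\<psi> t = 0" if "t \<le> 0" for t
    using that by (simp add: \<psi>_def)
  ultimately show ?thesis by blast
qed

lemma smooth_cutoff_exists:
  fixes p :: "'a::euclidean_space"
  assumes "0 < r"
  shows "\<exists>\<beta>. smooth \<beta> \<and> (\<forall>x\<in>ball p r. \<beta> x = 1) \<and> (\<forall>x. x \<notin> cball p (2 * r) \<longrightarrow> \<beta> x = 0)"
proof -
  obtain \<psi> :: "real \<Rightarrow> real"
    where \<psi>: "smooth \<psi>" "\<forall>t\<le>0. \<psi> t = 0" "\<forall>t\<ge>1. \<psi> t = 1"
    using smooth_step_exists by blast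
  \<comment> \<open>Affine in the squared distance from \<open>p\<close>, with value 1 at distance
    \<open>r\<close> and 0 at distance \<open>2 * r\<close>. The squared distance is written in this
    way to match \<open>smooth_affine\<close>.\<close>
  define q where "q x = (4 / 3) + (- 1 / (3 * r\<^sup>2)) *\<^sub>R (((-p) + 1 *\<^sub>R x) \<bullet> ((-p) + 1 *\<^sub>R x))" for x
  have qd: "q x = 4 / 3 - (dist p x)\<^sup>2 / (3 * r\<^sup>2)" for x
    by (simp add: q_def dist_norm power2_norm_eq_inner[symmetric] norm_minus_commute)
  have s: "smooth (\<lambda>x. \<psi> (q x))"
    unfolding q_def real_scaleR_def
    by (intro smooth_compose[OF \<psi>(1)] smooth_add smooth_const smooth_cmult
        smooth_affine[where f="\<lambda>x. x \<bullet> x", OF smooth_inner])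
  have "q x \<ge> 1" if "dist p x < r" for x
  proof -
    have "(dist p x)\<^sup>2 \<le> r\<^sup>2" using that by (intro power_mono) auto
    then show ?thesis using assms by (simp add: qd field_simps)
  qed
  moreover have "q x \<le> 0" if "\<not> dist p x \<le> 2 * r" for x
  proof -
    have "(2 * r)\<^sup>2 \<le> (dist p x)\<^sup>2" using that assms by (intro power_mono) auto
    then show ?thesis using assms by (simp add: qd field_simps)
  qed
  ultimately show ?thesis
    using s \<psi>(2,3) by (intro exI[of _ "\<lambda>x. \<psi> (q x)"]) auto
qed

lemma ennreal_tendsto_0I:
  fixes f :: "'a \<Rightarrow> ennreal"
  assumes "\<And>e. 0 < e \<Longrightarrow> eventually (\<lambda>n. f n \<le> ennreal e) F"
  shows "(f \<longlongrightarrow> 0) F"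
proof (rule order_tendstoI)
  fix a :: ennreal assume "0 < a"
  then obtain c where c: "0 < c" "c < a" using dense by blast
  then obtain e where e: "0 < e" "ennreal e < a"
    by (cases c) auto
  show "eventually (\<lambda>n. f n < a) F"
    using assms[OF e(1)] by eventually_elim (use e in auto)
qed auto

lemma ennreal_tendsto_0D:
  fixes f :: "'a \<Rightarrow> ennreal"
  assumes "(f \<longlongrightarrow> 0) F" "0 < e"
  shows "eventually (\<lambda>n. f n < ennreal e) F"
  using order_tendstoD(2)[OF assms(1), of "ennreal e"] assms(2) by simp

section \<open>Compactly supported smooth functions\<close>

text \<open>The case \<open>c = 1\<close> is a translation and \<open>c = - 1\<close> a point
  reflection; convolution needs both.\<close>

lemma nn_integral_lborel_affine:
  fixes f :: "'a::euclidean_space \<Rightarrow> ennreal"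
  assumes [measurable]: "f \<in> borel_measurable borel" and c: "\<bar>c\<bar> = 1"
  shows "(\<integral>\<^sup>+x. f (t + c *\<^sub>R x) \<partial>lborel) = (\<integral>\<^sup>+x. f x \<partial>lborel)"
proof -
  have "c \<noteq> 0" using c by auto
  have "(\<integral>\<^sup>+x. f x \<partial>lborel) =
    (\<integral>\<^sup>+x. f x \<partial>density (distr lborel borel (\<lambda>x. t + c *\<^sub>R x)) (\<lambda>_. \<bar>c\<bar>^DIM('a)))"
    using lborel_affine[OF \<open>c \<noteq> 0\<close>, of t] by simp
  also have "\<dots> = (\<integral>\<^sup>+x. f (t + c *\<^sub>R x) \<partial>lborel)"
    using c by (simp add: nn_integral_density nn_integral_distr)
  finally show ?thesis ..
qed

lemma nn_integral_lborel_shift: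
  fixes f :: "'a::euclidean_space \<Rightarrow> ennreal"
  assumes [measurable]: "f \<in> borel_measurable borel"
  shows "(\<integral>\<^sup>+x. f (x - t) \<partial>lborel) = (\<integral>\<^sup>+x. f x \<partial>lborel)"
  using nn_integral_lborel_affine[of f 1 "-t"] by simp

lemma lborel_affine1:
  fixes t :: "'a::euclidean_space"
  assumes "\<bar>c\<bar> = 1" shows "distr lborel borel (\<lambda>x. t + c *\<^sub>R x) = (lborel :: 'a measure)"
  using lborel_affine[of c t] assms by (auto simp: density_1)

lemma integral_lborel_affine:
  fixes f :: "'a::euclidean_space \<Rightarrow> real"
  assumes [measurable]: "f \<in> borel_measurable borel" and c: "\<bar>c\<bar> = 1"
  shows "(LINT x|lborel. f (t + c *\<^sub>R x)) = (LINT x|lborel. f x)"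
proof -
  have "(LINT x|distr lborel borel (\<lambda>x. t + c *\<^sub>R x). f x) = (LINT x|lborel. f (t + c *\<^sub>R x))"
    by (rule integral_distr) auto
  then show ?thesis unfolding lborel_affine1[OF c] ..
qed

lemma smooth_measurable [measurable_dest]: "smooth f \<Longrightarrow> f \<in> borel_measurable borel"
  by (rule borel_measurable_continuous_onI) (rule smooth_continuous)

lemma compact_support_bounded:
  assumes "continuous_on UNIV f" "compact K" "\<And>x. x \<notin> K \<Longrightarrow> f x = (0::real)"
  obtains B where "0 \<le> B" "\<And>x. \<bar>f x\<bar> \<le> B"
proof -
  have "bounded (f ` K)"
    using assms by (intro compact_imp_bounded compact_continuous_image) (auto intro: continuous_on_subset)
  then obtain B where "\<forall>y\<in>f ` K. \<bar>y\<bar> \<le> B" by (auto simp: bounded_iff)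
  then have "\<bar>f x\<bar> \<le> max B 0" for x using assms(3)[of x] by (cases "x \<in> K") (auto simp: max_def)
  then show ?thesis using that[of "max B 0"] by auto
qed

lemma compact_support_integrable:
  fixes f :: "'a::euclidean_space \<Rightarrow> real"
  assumes "continuous_on UNIV f" "compact K" "\<And>x. x \<notin> K \<Longrightarrow> f x = 0"
  shows "integrable lborel f"
proof -
  have "integrable lborel (\<lambda>x. indicator K x *\<^sub>R f x)"
    by (rule borel_integrable_compact) (use assms in \<open>auto intro: continuous_on_subset\<close>)
  moreover have "(\<lambda>x. indicator K x *\<^sub>R f x) = f"
  proof
    fix x show "indicator K x *\<^sub>R f x = f x" using assms(3)[of x] by (cases "x \<in> K") auto
  qed
  ultimately show ?thesis by simp
qed

lemma pd_zero_off_compact: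
  assumes "compact K" "\<And>x. x \<notin> K \<Longrightarrow> f x = 0" "x \<notin> K"
  shows "pd b f x = 0"
  using pd_zero_open[of "-K" x f b] assms by (auto dest: compact_imp_closed)

lemma pd_norm_le:
  assumes "smooth f" shows "\<bar>pd h f x\<bar> \<le> norm h * (\<Sum>b\<in>Basis. \<bar>pd b f x\<bar>)"
proof -
  interpret linear "\<lambda>h. pd h f x"
    using has_derivative_linear[OF smooth_has_derivative[OF assms]] .
  have "pd h f x = pd (\<Sum>b\<in>Basis. (h \<bullet> b) *\<^sub>R b) f x" by (simp only: euclidean_representation)
  also have "\<dots> = (\<Sum>b\<in>Basis. (h \<bullet> b) * pd b f x)" by (simp add: sum scale)
  also have "\<bar>\<dots>\<bar> \<le> (\<Sum>b\<in>Basis. norm h * \<bar>pd b f x\<bar>)"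
    by (rule order_trans[OF sum_abs], rule sum_mono)
      (auto simp: abs_mult intro!: mult_right_mono Basis_le_norm)
  finally show ?thesis by (simp add: sum_distrib_left)
qed

lemma pd_sum_bounded:
  assumes "smooth f" "compact K" "\<And>x. x \<notin> K \<Longrightarrow> f x = 0"
  obtains B where "0 \<le> B" "\<And>x. (\<Sum>b\<in>Basis. \<bar>pd b f x\<bar>) \<le> B"
proof -
  have "\<bar>\<Sum>b\<in>Basis. \<bar>pd b f x\<bar>\<bar> = (\<Sum>b\<in>Basis. \<bar>pd b f x\<bar>)" for x by (simp add: sum_nonneg)
  moreover have "continuous_on UNIV (\<lambda>x. \<Sum>b\<in>Basis. \<bar>pd b f x\<bar>)"
    using assms(1) by (intro continuous_intros smooth_continuous smooth_pd) auto
  moreover have "(\<Sum>b\<in>Basis. \<bar>pd b f x\<bar>) = 0" if "x \<notin> K" for x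
    using pd_zero_off_compact[OF assms(2,3) that] by simp
  ultimately show ?thesis
    using compact_support_bounded[of "\<lambda>x. \<Sum>b\<in>Basis. \<bar>pd b f x\<bar>" K] that assms(2) by metis
qed

lemma compact_support_lipschitz:
  assumes "smooth f" "compact K" "\<And>x. x \<notin> K \<Longrightarrow> f x = 0"
  obtains L where "0 \<le> L" "\<And>x y. \<bar>f x - f y\<bar> \<le> L * norm (x - y)"
proof -
  obtain B where B: "0 \<le> B" "\<And>x. (\<Sum>b\<in>Basis. \<bar>pd b f x\<bar>) \<le> B"
    using pd_sum_bounded[OF assms] by blast
  have "norm (f x - f y) \<le> B * norm (x - y)" for x y
  proof (rule differentiable_bound[OF convex_UNIV])
    show "(f has_derivative (\<lambda>h. pd h f x)) (at x within UNIV)" for x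
      using smooth_has_derivative[OF assms(1)] by simp
    show "onorm (\<lambda>h. pd h f x) \<le> B" for x
    proof (rule onorm_le)
      fix h show "norm (pd h f x) \<le> B * norm h"
        using pd_norm_le[OF assms(1), of h x] mult_left_mono[OF B(2)[of x], of "norm h"]
        by (simp add: mult.commute)
    qed
  qed auto
  then show ?thesis using that[of B] B(1) by auto
qed

text \<open>The partial derivatives are again smooth with compact support, hence Lipschitz, and the
  mean value inequality gives a quadratic remainder. One constant serves all points, which is what
  differentiation under an integral requires.\<close>

lemma compact_support_taylor:
  assumes "smooth f" "compact K" "\<And>x. x \<notin> K \<Longrightarrow> f x = 0"
  obtains C where "0 \<le> C" "\<And>x h. \<bar>f (x + h) - f x - pd h f x\<bar> \<le> C * (norm h)\<^sup>2"
proof -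
  have "\<exists>L. 0 \<le> L \<and> (\<forall>x y. \<bar>pd b f x - pd b f y\<bar> \<le> L * norm (x - y))" if b: "b \<in> Basis" for b
  proof -
    obtain L where "0 \<le> L" "\<And>x y. \<bar>pd b f x - pd b f y\<bar> \<le> L * norm (x - y)"
      using compact_support_lipschitz[of "pd b f" K] smooth_pd[OF assms(1) b] assms(2)
        pd_zero_off_compact[of K f _ b, OF assms(2,3)] by blast
    then show ?thesis by blast
  qed
  then obtain L where L': "\<forall>b\<in>Basis. 0 \<le> L b \<and> (\<forall>x y. \<bar>pd b f x - pd b f y\<bar> \<le> L b * norm (x - y))"
    using bchoice[of Basis "\<lambda>b L. 0 \<le> L \<and> (\<forall>x y. \<bar>pd b f x - pd b f y\<bar> \<le> L * norm (x - y))"] by blast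
  then have L: "\<And>b. b \<in> Basis \<Longrightarrow> L b \<ge> 0"
    "\<And>b x y. b \<in> Basis \<Longrightarrow> \<bar>pd b f x - pd b f y\<bar> \<le> L b * norm (x - y)" by blast+
  define C where "C = sum L Basis"
  have C: "0 \<le> C" unfolding C_def using L(1) by (simp add: sum_nonneg)
  have lin: "linear (\<lambda>h. pd h f x)" for x
    using has_derivative_linear[OF smooth_has_derivative[OF assms(1)]] .
  have dif: "\<bar>pd h f y - pd h f x\<bar> \<le> norm h * (C * norm (y - x))" for h x y
  proof -
    have rep: "pd h f x = (\<Sum>b\<in>Basis. (h \<bullet> b) * pd b f x)" for x
      using linear_sum[OF lin[of x], of "\<lambda>b. (h \<bullet> b) *\<^sub>R b" Basis] linear_scale[OF lin[of x]]
      by (simp add: euclidean_representation)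
    have "pd h f y - pd h f x = (\<Sum>b\<in>Basis. (h \<bullet> b) * (pd b f y - pd b f x))"
      by (simp add: rep[of x] rep[of y] sum_subtractf algebra_simps)
    also have "\<bar>\<dots>\<bar> \<le> (\<Sum>b\<in>Basis. norm h * (L b * norm (y - x)))"
      by (rule order_trans[OF sum_abs], rule sum_mono)
        (auto simp: abs_mult intro!: mult_mono Basis_le_norm L)
    finally show ?thesis by (simp add: C_def sum_distrib_left sum_distrib_right)
  qed
  have "norm (f (x + h) - f x - pd (x + h - x) f x) \<le> norm (x + h - x) * (C * norm h)" for x h
  proof (rule differentiable_bound_linearization[where S="cball x (norm h)"])
    show "x + t *\<^sub>R (x + h - x) \<in> cball x (norm h)" if "t \<in> {0..1}" for t
      using that by (auto simp: dist_norm mult_left_le_one_le)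
    show "(f has_derivative (\<lambda>h. pd h f y)) (at y within cball x (norm h))" for y
      using smooth_has_derivative[OF assms(1)] has_derivative_at_withinI by blast
    show "onorm ((\<lambda>h. pd h f y) - (\<lambda>h. pd h f x)) \<le> C * norm h" if "y \<in> cball x (norm h)" for y
    proof (rule onorm_le)
      fix k :: 'a
      have "norm k * (C * norm (y - x)) \<le> C * norm h * norm k"
        using that C by (auto simp: dist_norm norm_minus_commute mult.commute mult_left_mono mult_right_mono)
      then show "norm (((\<lambda>h. pd h f y) - (\<lambda>h. pd h f x)) k) \<le> C * norm h * norm k"
        using dif[of k y x] by simp
    qed
  qed auto
  then show ?thesis using that[of C] C by (auto simp: power2_eq_square mult.assoc mult.left_commute)
qed

text \<open>Translation invariance does the work: \<open>f\<close> and its shift by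
  \<open>e *\<^sub>R b\<close> have the same integral, so \<open>e\<close> times the integral of
  \<open>pd b f\<close> is a Taylor remainder, of order \<open>e\<^sup>2\<close>. Now let
  \<open>e\<close> tend to 0.\<close>

lemma integral_pd_compact_support:
  fixes f :: "'a::euclidean_space \<Rightarrow> real"
  assumes f: "smooth f" "compact K" "\<And>x. x \<notin> K \<Longrightarrow> f x = 0" and b: "b \<in> Basis"
  shows "(LINT x|lborel. pd b f x) = 0"
proof -
  obtain C where C: "0 \<le> C" "\<And>x h. \<bar>f (x + h) - f x - pd h f x\<bar> \<le> C * (norm h)\<^sup>2"
    using compact_support_taylor[OF f] by blast
  \<comment> \<open>The closed unit neighbourhood of \<open>K\<close>. For
    \<open>0 < e \<le> 1\<close> it contains the supports of \<open>f\<close> and of its shift, so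
    the remainder vanishes outside a compact set independent of \<open>e\<close>.\<close>
  define K' where "K' = {x + y | x y. x \<in> K \<and> y \<in> cball 0 1}"
  have K': "compact K'" unfolding K'_def by (rule compact_sums[OF f(2) compact_cball])
  have int: "integrable lborel f" "integrable lborel (pd b f)"
    using compact_support_integrable[OF smooth_continuous[OF f(1)] f(2,3)]
      compact_support_integrable[OF smooth_continuous[OF smooth_pd[OF f(1) b]] f(2) pd_zero_off_compact[OF f(2,3)]]
    by auto
  have mint: "(LINT x|lborel. f (x + h)) = (LINT x|lborel. f x)" "integrable lborel (\<lambda>x. f (x + h))" for h
  proof -
    show "(LINT x|lborel. f (x + h)) = (LINT x|lborel. f x)"
      using integral_lborel_affine[of f 1 h] f(1) by (simp add: smooth_measurable add.commute)
    show "integrable lborel (\<lambda>x. f (x + h))"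
    proof (rule compact_support_integrable[of _ "(\<lambda>x. x - h) ` K"])
      show "continuous_on UNIV (\<lambda>x. f (x + h))"
        by (rule continuous_on_compose2[OF smooth_continuous[OF f(1), of UNIV]]) (auto intro: continuous_intros)
      show "compact ((\<lambda>x. x - h) ` K)"
        by (rule compact_continuous_image) (auto intro: continuous_intros f)
      show "f (x + h) = 0" if "x \<notin> (\<lambda>x. x - h) ` K" for x
        using that f(3)[of "x + h"] by (force simp: image_iff)
    qed
  qed
  have ineq: "\<bar>LINT x|lborel. pd b f x\<bar> \<le> e * (C * measure lborel K')" if e: "0 < e" "e \<le> 1" for e
  proof -
    have sc: "pd (e *\<^sub>R b) f x = e * pd b f x" for x
      using linear_scale[OF has_derivative_linear[OF smooth_has_derivative[OF f(1), of x]]] by simp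
    let ?g = "\<lambda>x. f (x + e *\<^sub>R b) - f x - e * pd b f x"
    have le: "\<bar>?g x\<bar> \<le> indicator K' x * (C * e\<^sup>2)" for x
    proof (cases "x \<in> K'")
      case True then show ?thesis using C(2)[of x "e *\<^sub>R b"] b e by (simp add: sc)
    next
      case False
      have "x \<notin> K" using False unfolding K'_def by (auto intro!: exI[of _ x])
      moreover have "x + e *\<^sub>R b \<notin> K"
      proof
        assume "x + e *\<^sub>R b \<in> K"
        then have "x + e *\<^sub>R b + (- e *\<^sub>R b) \<in> K'" unfolding K'_def using e b by fastforce
        then show False using False by simp
      qed
      ultimately have "?g x = 0"
        using f(3)[of x] f(3)[of "x + e *\<^sub>R b"] pd_zero_off_compact[where f=f, OF f(2,3), of x b] by simp
      then show ?thesis using C by simp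
    qed
    have ig: "integrable lborel ?g" using int mint by auto
    have iK: "integrable lborel (\<lambda>x. indicator K' x * (C * e\<^sup>2))"
      using K' emeasure_compact_finite[OF K']
      by (intro integrable_mult_left) (auto simp: integrable_indicator_iff compact_imp_closed less_top)
    have "e * (LINT x|lborel. pd b f x) = - (LINT x|lborel. ?g x)"
      using int mint by simp
    then have "e * \<bar>LINT x|lborel. pd b f x\<bar> = \<bar>LINT x|lborel. ?g x\<bar>"
      using e by (metis abs_minus_cancel abs_mult abs_of_nonneg less_imp_le)
    also have "\<dots> \<le> (LINT x|lborel. indicator K' x * (C * e\<^sup>2))"
      by (rule order_trans[OF integral_abs_bound integral_mono[OF integrable_abs[OF ig] iK le]])
    also have "\<dots> = measure lborel K' * (C * e\<^sup>2)"
      using K' by (simp add: compact_imp_closed)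
    finally have "e * \<bar>LINT x|lborel. pd b f x\<bar> \<le> e * (e * (C * measure lborel K'))"
      by (simp add: power2_eq_square ac_simps)
    then show ?thesis using e by simp
  qed
  have "\<bar>LINT x|lborel. pd b f x\<bar> \<le> 0"
  proof (rule tendsto_lowerbound)
    have "((\<lambda>e. e * (C * measure lborel K')) \<longlongrightarrow> 0 * (C * measure lborel K')) (at_right 0)"
      by (intro tendsto_intros)
    then show "((\<lambda>e. e * (C * measure lborel K')) \<longlongrightarrow> 0) (at_right 0)" by simp
    show "eventually (\<lambda>e. \<bar>LINT x|lborel. pd b f x\<bar> \<le> e * (C * measure lborel K')) (at_right 0)"
      by (rule eventually_mono[OF eventually_at_right_real[of 0 1]]) (use ineq in auto)
  qed simp
  then show ?thesis by simp
qed

section \<open>Mollification\<close>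

text \<open>Take an open \<open>O'\<close> around \<open>A\<close> of little more measure. What is
  shifted out of \<open>A\<close> either lands in \<open>O' - A\<close>, which is small, or leaves
  \<open>O'\<close>, which tends to 0 by dominated convergence because \<open>O'\<close> is open.
  This is one half of the symmetric difference; the other half is the same statement for
  \<open>- z n\<close>.\<close>

lemma translation_continuous_indicator:
  fixes A :: "'a::euclidean_space set"
  assumes [measurable]: "A \<in> sets borel" and fin: "emeasure lborel A < \<infinity>" and z: "z \<longlonglongrightarrow> 0"
  shows "(\<lambda>n. \<integral>\<^sup>+x. indicator A (x - z n) * indicator (- A) x \<partial>lborel) \<longlonglongrightarrow> 0"
proof (rule ennreal_tendsto_0I)
  fix e :: real assume "e > 0"
  obtain O' where O': "open O'" "A \<subseteq> O'" "emeasure lborel (O' - A) < ennreal (e / 2)"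
    using outer_regular_lborel[of A "e / 2"] \<open>e > 0\<close> by auto
  have [measurable]: "O' \<in> sets borel" using O' by auto
  have "(\<lambda>n. \<integral>\<^sup>+y. indicator A y * indicator (- O') (y + z n) \<partial>lborel) \<longlonglongrightarrow> (\<integral>\<^sup>+y. 0 \<partial>(lborel::'a measure))"
  proof (rule nn_integral_dominated_convergence[where w="indicator A"])
    show "(\<integral>\<^sup>+ x. indicator A x \<partial>lborel) < \<infinity>" using fin by simp
    have "(\<lambda>n. indicator A y * indicator (- O') (y + z n)) \<longlonglongrightarrow> (0::ennreal)" for y
    proof (cases "y \<in> A")
      case True
      have "(\<lambda>n. y + z n) \<longlonglongrightarrow> y + 0" by (intro tendsto_intros z)
      then have "eventually (\<lambda>n. y + z n \<in> O') sequentially"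
        using O' True by (intro topological_tendstoD) auto
      then have "eventually (\<lambda>n. indicator A y * indicator (- O') (y + z n) = (0::ennreal)) sequentially"
        by eventually_elim auto
      then show ?thesis by (rule tendsto_eventually)
    qed auto
    then show "AE y in lborel. (\<lambda>n. indicator A y * indicator (- O') (y + z n)) \<longlonglongrightarrow> (0::ennreal)" by auto
  qed (auto simp: indicator_def)
  then have "(\<lambda>n. \<integral>\<^sup>+y. indicator A y * indicator (- O') (y + z n) \<partial>lborel) \<longlonglongrightarrow> 0" by simp
  then have "eventually (\<lambda>n. (\<integral>\<^sup>+y. indicator A y * indicator (- O') (y + z n) \<partial>lborel) < ennreal (e / 2)) sequentially"
    by (rule order_tendstoD) (use \<open>e > 0\<close> in simp)
  then show "eventually (\<lambda>n. (\<integral>\<^sup>+x. indicator A (x - z n) * indicator (- A) x \<partial>lborel) \<le> ennreal e) sequentially"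
  proof eventually_elim
    case (elim n)
    have "(\<integral>\<^sup>+x. indicator A (x - z n) * indicator (- A) x \<partial>lborel)
       \<le> (\<integral>\<^sup>+x. indicator (O' - A) x + indicator A (x - z n) * indicator (- O') (x - z n + z n) \<partial>lborel)"
      by (rule nn_integral_mono) (auto simp: indicator_def)
    also have "\<dots> = emeasure lborel (O' - A)
        + (\<integral>\<^sup>+x. indicator A (x - z n) * indicator (- O') (x - z n + z n) \<partial>lborel)"
      by (subst nn_integral_add) auto
    also have "(\<integral>\<^sup>+x. indicator A (x - z n) * indicator (- O') (x - z n + z n) \<partial>lborel)
      = (\<integral>\<^sup>+y. indicator A y * indicator (- O') (y + z n) \<partial>lborel)"
      by (rule nn_integral_lborel_shift[where f="\<lambda>y. indicator A y * indicator (- O') (y + z n)"]) auto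
    also have "emeasure lborel (O' - A) + \<dots> \<le> ennreal (e / 2) + ennreal (e / 2)"
      using O'(3) elim by (intro add_mono) auto
    also have "\<dots> = ennreal e" using \<open>e > 0\<close> by (simp flip: ennreal_plus)
    finally show ?case .
  qed
qed


text \<open>Indicators carry the content; sums and dominated limits are handled by the induction
  principle for integrable functions, the last by an argument with three errors of
  \<open>e / 3\<close>.\<close>

lemma translation_continuous_L1_seq:
  fixes w :: "'a::euclidean_space \<Rightarrow> real"
  assumes "integrable lborel w" "z \<longlonglongrightarrow> 0"
  shows "(\<lambda>n. \<integral>\<^sup>+x. ennreal \<bar>w (x - z n) - w x\<bar> \<partial>lborel) \<longlonglongrightarrow> 0"
  using assms
proof (induction arbitrary: z rule: integrable_induct)
  case (base A c)
  have [measurable]: "A \<in> sets borel" using base by simp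
  let ?I = "\<lambda>z. \<integral>\<^sup>+x. indicator A (x - z) * indicator (- A) x \<partial>lborel"
  have eq: "(\<integral>\<^sup>+x. ennreal \<bar>indicator A (x - z n) *\<^sub>R c - indicator A x *\<^sub>R c\<bar> \<partial>lborel)
     = ennreal \<bar>c\<bar> * (?I (z n) + ?I (- z n))" for n
  proof -
    \<comment> \<open>A translation by \<open>z n\<close> exchanges the two halves of the symmetric
      difference of \<open>A\<close> and its shift.\<close>
    have "?I (- z n) = (\<integral>\<^sup>+x. indicator A x * indicator (- A) (x - z n) \<partial>lborel)"
      using nn_integral_lborel_shift[of "\<lambda>x. indicator A (x + z n) * indicator (- A) x" "z n"] by simp
    then have "ennreal \<bar>c\<bar> * (?I (z n) + ?I (- z n)) = (\<integral>\<^sup>+x. ennreal \<bar>c\<bar> *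
       (indicator A (x - z n) * indicator (- A) x + indicator A x * indicator (- A) (x - z n)) \<partial>lborel)"
      by (subst nn_integral_cmult) (auto simp: nn_integral_add)
    also have "\<dots> = (\<integral>\<^sup>+x. ennreal \<bar>indicator A (x - z n) *\<^sub>R c - indicator A x *\<^sub>R c\<bar> \<partial>lborel)"
      by (rule nn_integral_cong) (auto simp: indicator_def)
    finally show ?thesis ..
  qed
  have "(\<lambda>n. - z n) \<longlonglongrightarrow> 0" using tendsto_minus[OF base(3)] by simp
  then have "(\<lambda>n. ?I (z n) + ?I (- z n)) \<longlonglongrightarrow> 0 + 0"
    using translation_continuous_indicator[of A z] translation_continuous_indicator[of A "\<lambda>n. - z n"] base
    by (intro tendsto_add) auto
  then have "(\<lambda>n. ennreal \<bar>c\<bar> * (?I (z n) + ?I (- z n))) \<longlonglongrightarrow> ennreal \<bar>c\<bar> * 0"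
    by (intro ennreal_tendsto_cmult) auto
  then show ?case unfolding eq by simp
next
  case (add f g)
  have [measurable]: "f \<in> borel_measurable borel" "g \<in> borel_measurable borel"
    using add(1,2) by auto
  show ?case
  proof (rule tendsto_sandwich[OF _ _ tendsto_const])
    show "eventually (\<lambda>n. (\<integral>\<^sup>+x. ennreal \<bar>f (x - z n) + g (x - z n) - (f x + g x)\<bar> \<partial>lborel)
      \<le> (\<integral>\<^sup>+x. ennreal \<bar>f (x - z n) - f x\<bar> \<partial>lborel) + (\<integral>\<^sup>+x. ennreal \<bar>g (x - z n) - g x\<bar> \<partial>lborel)) sequentially"
      by (intro always_eventually allI, subst nn_integral_add[symmetric])
        (auto intro!: nn_integral_mono simp flip: ennreal_plus)
    show "(\<lambda>n. (\<integral>\<^sup>+x. ennreal \<bar>f (x - z n) - f x\<bar> \<partial>lborel)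
       + (\<integral>\<^sup>+x. ennreal \<bar>g (x - z n) - g x\<bar> \<partial>lborel)) \<longlonglongrightarrow> 0"
      using tendsto_add[OF add.IH(1)[OF add.prems] add.IH(2)[OF add.prems]] by simp
  qed auto
next
  case (lim f s)
  have [measurable]: "f \<in> borel_measurable borel" "s i \<in> borel_measurable borel" for i
    using lim(1,4) by auto
  have "(\<lambda>i. \<integral>\<^sup>+x. ennreal \<bar>s i x - f x\<bar> \<partial>lborel) \<longlonglongrightarrow> (\<integral>\<^sup>+x. 0 \<partial>(lborel :: 'a measure))"
  proof (rule nn_integral_dominated_convergence[where w="\<lambda>x. ennreal (3 * \<bar>f x\<bar>)"])
    show "(\<integral>\<^sup>+x. ennreal (3 * \<bar>f x\<bar>) \<partial>lborel) < \<infinity>"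
      using lim(4) integrable_iff_bounded[of lborel "\<lambda>x. 3 * \<bar>f x\<bar>"] by (auto simp: abs_mult)
    show "AE x in lborel. ennreal \<bar>s i x - f x\<bar> \<le> ennreal (3 * \<bar>f x\<bar>)" for i
    proof (rule AE_I2)
      fix x have "\<bar>s i x\<bar> \<le> 2 * \<bar>f x\<bar>" using lim(3)[of x i] by simp
      then show "ennreal \<bar>s i x - f x\<bar> \<le> ennreal (3 * \<bar>f x\<bar>)" by (intro ennreal_leI) auto
    qed
    show "AE x in lborel. (\<lambda>i. ennreal \<bar>s i x - f x\<bar>) \<longlonglongrightarrow> 0"
    proof (rule AE_I2)
      fix x have "(\<lambda>i. s i x - f x) \<longlonglongrightarrow> 0" using lim(2)[of x] by (simp add: LIM_zero)
      then have "(\<lambda>i. \<bar>s i x - f x\<bar>) \<longlonglongrightarrow> 0" by (rule tendsto_rabs_zero)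
      then show "(\<lambda>i. ennreal \<bar>s i x - f x\<bar>) \<longlonglongrightarrow> 0" by (simp add: ennreal_tendsto_0_iff)
    qed
  qed auto
  then have c: "(\<lambda>i. \<integral>\<^sup>+x. ennreal \<bar>s i x - f x\<bar> \<partial>lborel) \<longlonglongrightarrow> 0" by simp
  show ?case
  proof (rule ennreal_tendsto_0I)
    fix e :: real assume "e > 0"
    obtain i where i: "(\<integral>\<^sup>+x. ennreal \<bar>s i x - f x\<bar> \<partial>lborel) < ennreal (e / 3)"
      using ennreal_tendsto_0D[OF c, of "e / 3"] \<open>e > 0\<close> by (auto dest: eventually_happens)
    have "eventually (\<lambda>n. (\<integral>\<^sup>+x. ennreal \<bar>s i (x - z n) - s i x\<bar> \<partial>lborel) < ennreal (e / 3)) sequentially"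
      using ennreal_tendsto_0D[OF lim.IH[OF lim.prems, of i], of "e / 3"] \<open>e > 0\<close> by auto
    then show "eventually (\<lambda>n. (\<integral>\<^sup>+x. ennreal \<bar>f (x - z n) - f x\<bar> \<partial>lborel) \<le> ennreal e) sequentially"
    proof eventually_elim
      case (elim n)
      have "(\<integral>\<^sup>+x. ennreal \<bar>f (x - z n) - f x\<bar> \<partial>lborel) \<le>
        (\<integral>\<^sup>+x. ennreal \<bar>s i (x - z n) - f (x - z n)\<bar> + ennreal \<bar>s i (x - z n) - s i x\<bar>
           + ennreal \<bar>s i x - f x\<bar> \<partial>lborel)"
        by (rule nn_integral_mono) (auto simp flip: ennreal_plus intro!: ennreal_leI)
      also have "\<dots> = (\<integral>\<^sup>+x. ennreal \<bar>s i (x - z n) - f (x - z n)\<bar> \<partial>lborel)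
         + (\<integral>\<^sup>+x. ennreal \<bar>s i (x - z n) - s i x\<bar> \<partial>lborel) + (\<integral>\<^sup>+x. ennreal \<bar>s i x - f x\<bar> \<partial>lborel)"
        by (simp add: nn_integral_add)
      also have "(\<integral>\<^sup>+x. ennreal \<bar>s i (x - z n) - f (x - z n)\<bar> \<partial>lborel) = (\<integral>\<^sup>+x. ennreal \<bar>s i x - f x\<bar> \<partial>lborel)"
        by (rule nn_integral_lborel_shift[where f="\<lambda>x. ennreal \<bar>s i x - f x\<bar>"]) simp
      also have "(\<integral>\<^sup>+x. ennreal \<bar>s i x - f x\<bar> \<partial>lborel) + (\<integral>\<^sup>+x. ennreal \<bar>s i (x - z n) - s i x\<bar> \<partial>lborel)
         + (\<integral>\<^sup>+x. ennreal \<bar>s i x - f x\<bar> \<partial>lborel) \<le> ennreal (e / 3) + ennreal (e / 3) + ennreal (e / 3)"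
        using i elim by (intro add_mono) auto
      also have "\<dots> = ennreal e" using \<open>e > 0\<close> by (simp flip: ennreal_plus)
      finally show ?case .
    qed
  qed
qed

text \<open>The map \<open>t \<mapsto> t \<bar>t\<bar>\<close> turns square integrable functions into integrable ones.\<close>

lemma square_diff_le_abs_diff_signed_squares:
  "(a - b)\<^sup>2 \<le> 2 * \<bar>a * \<bar>a\<bar> - b * \<bar>b\<bar>\<bar>" for a b :: real
proof -
  have same: "(a - b)\<^sup>2 \<le> 2 * \<bar>a * a - b * b\<bar>" if "0 \<le> a" "0 \<le> b" for a b :: real
  proof -
    have "(a - b)\<^sup>2 = \<bar>a - b\<bar> * \<bar>a - b\<bar>" by (simp add: power2_eq_square)
    also have "\<dots> \<le> \<bar>a - b\<bar> * \<bar>a + b\<bar>" using that by (intro mult_left_mono) auto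
    also have "\<dots> = \<bar>a * a - b * b\<bar>" by (simp add: abs_mult[symmetric] algebra_simps)
    finally show ?thesis by (rule order_trans) simp
  qed
  have opp: "(a + b)\<^sup>2 \<le> 2 * (a * a + b * b)" for a b :: real
    using zero_le_power2[of "a - b"] by (simp add: power2_eq_square algebra_simps)
  consider "0 \<le> a" "0 \<le> b" | "a \<le> 0" "b \<le> 0" | "0 \<le> a" "b \<le> 0" | "a \<le> 0" "0 \<le> b" by linarith
  then show ?thesis
  proof cases
    case 1 then show ?thesis using same[of a b] by simp
  next
    case 2 then show ?thesis using same[of "-a" "-b"] by (simp add: power2_commute abs_minus_commute)
  next
    case 3 then show ?thesis using opp[of a "-b"] by simp
  next
    case 4
    then have "\<bar>a * \<bar>a\<bar> - b * \<bar>b\<bar>\<bar> = a * a + b * b" by (simp add: abs_if) (smt (verit) mult_nonneg_nonneg mult_nonpos_nonpos)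
    then show ?thesis using opp[of "-a" b] by (simp add: power2_commute)
  qed
qed

text \<open>By the preceding inequality the squared \<open>L\<^sup>2\<close> modulus of continuity
  of \<open>v\<close> is at most twice the \<open>L\<^sup>1\<close> modulus of the integrable
  function \<open>v * \<bar>v\<bar>\<close>.\<close>

lemma translation_continuous_L2:
  fixes v :: "'a::euclidean_space \<Rightarrow> real"
  assumes [measurable]: "v \<in> borel_measurable borel" and v: "integrable lborel (\<lambda>x. (v x)\<^sup>2)"
  shows "((\<lambda>z. \<integral>\<^sup>+x. ennreal ((v (x - z) - v x)\<^sup>2) \<partial>lborel) \<longlongrightarrow> 0) (at 0)"
proof -
  have int: "integrable lborel (\<lambda>x. v x * \<bar>v x\<bar>)"
    by (rule Bochner_Integration.integrable_bound[OF v]) (auto simp: abs_mult power2_eq_square)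
  have "(\<lambda>n. \<integral>\<^sup>+x. ennreal ((v (x - z n) - v x)\<^sup>2) \<partial>lborel) \<longlonglongrightarrow> 0" if "z \<longlonglongrightarrow> 0" for z
  proof (rule tendsto_sandwich[OF _ _ tendsto_const])
    show "eventually (\<lambda>n. (\<integral>\<^sup>+x. ennreal ((v (x - z n) - v x)\<^sup>2) \<partial>lborel)
      \<le> 2 * (\<integral>\<^sup>+x. ennreal \<bar>v (x - z n) * \<bar>v (x - z n)\<bar> - v x * \<bar>v x\<bar>\<bar> \<partial>lborel)) sequentially"
      by (intro always_eventually allI, subst nn_integral_cmult[symmetric])
        (auto intro!: nn_integral_mono square_diff_le_abs_diff_signed_squares ennreal_leI
          simp flip: ennreal_numeral ennreal_mult)
    have "(\<lambda>n. 2 * (\<integral>\<^sup>+x. ennreal \<bar>v (x - z n) * \<bar>v (x - z n)\<bar> - v x * \<bar>v x\<bar>\<bar> \<partial>lborel)) \<longlonglongrightarrow> 2 * 0"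
      by (intro ennreal_tendsto_cmult translation_continuous_L1_seq[OF int that]) auto
    then show "(\<lambda>n. 2 * (\<integral>\<^sup>+x. ennreal \<bar>v (x - z n) * \<bar>v (x - z n)\<bar> - v x * \<bar>v x\<bar>\<bar> \<partial>lborel)) \<longlonglongrightarrow> 0"
      by simp
  qed auto
  then show ?thesis
    unfolding tendsto_at_iff_sequentially by (auto simp: o_def)
qed

section \<open>Convolution with a smooth kernel\<close>

definition convol :: "('a::euclidean_space \<Rightarrow> real) \<Rightarrow> ('a \<Rightarrow> real) \<Rightarrow> 'a \<Rightarrow> real" where
  "convol k v x = (LINT y|lborel. k (x - y) * v y)"

lemma integrable_mult_square:
  fixes f g :: "'a \<Rightarrow> real"
  assumes [measurable]: "f \<in> borel_measurable M" "g \<in> borel_measurable M"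
    and "integrable M (\<lambda>x. (f x)\<^sup>2)" "integrable M (\<lambda>x. (g x)\<^sup>2)"
  shows "integrable M (\<lambda>x. f x * g x)"
proof (rule Bochner_Integration.integrable_bound)
  show "integrable M (\<lambda>x. (f x)\<^sup>2 + (g x)\<^sup>2)" using assms by auto
  show "AE x in M. norm (f x * g x) \<le> norm ((f x)\<^sup>2 + (g x)\<^sup>2)"
  proof (rule AE_I2)
    fix x
    have "0 \<le> (\<bar>f x\<bar> - \<bar>g x\<bar>)\<^sup>2" by simp
    then have "2 * (\<bar>f x\<bar> * \<bar>g x\<bar>) \<le> (f x)\<^sup>2 + (g x)\<^sup>2" by (simp add: power2_diff)
    then show "norm (f x * g x) \<le> norm ((f x)\<^sup>2 + (g x)\<^sup>2)"
      by (simp add: abs_mult) (smt (verit) abs_ge_zero mult_nonneg_nonneg)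
  qed
qed auto

lemma compact_support_square_integrable:
  fixes f :: "'a::euclidean_space \<Rightarrow> real"
  assumes "continuous_on UNIV f" "compact K" "\<And>x. x \<notin> K \<Longrightarrow> f x = 0"
  shows "integrable lborel (\<lambda>x. (f x)\<^sup>2)"
  by (rule compact_support_integrable[OF _ assms(2)]) (use assms in \<open>auto intro: continuous_intros\<close>)

text \<open>The kernel is a probability density, so the error is an average of differences between
  \<open>v\<close> and its translates. Cauchy-Schwarz with the factor \<open>sqrt (k z)\<close>
  moves the square inside this average, and Fubini leaves the \<open>L\<^sup>2\<close> moduli
  bounded by \<open>e\<close>.\<close>

lemma mollification_error:
  fixes v :: "'a::euclidean_space \<Rightarrow> real"
  assumes [measurable]: "v \<in> borel_measurable borel" and v: "integrable lborel (\<lambda>x. (v x)\<^sup>2)"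
    and k: "smooth k" "\<And>x. 0 \<le> k x" "\<And>x. x \<notin> cball 0 r \<Longrightarrow> k x = 0" "(LINT x|lborel. k x) = 1"
    and e: "\<And>z. norm z \<le> r \<Longrightarrow> (\<integral>\<^sup>+x. ennreal ((v (x - z) - v x)\<^sup>2) \<partial>lborel) \<le> e"
  shows "(\<integral>\<^sup>+x. ennreal ((convol k v x - v x)\<^sup>2) \<partial>lborel) \<le> e"
proof -
  have [measurable]: "k \<in> borel_measurable borel" using k(1) by (rule smooth_measurable)
  have ik: "integrable lborel k"
    by (rule compact_support_integrable[OF smooth_continuous[OF k(1)] compact_cball k(3)])
  have nk: "(\<integral>\<^sup>+z. ennreal (k z) \<partial>lborel) = 1"
    using nn_integral_eq_integral[OF ik] k by simp
  have pw: "ennreal ((convol k v x - v x)\<^sup>2) \<le> (\<integral>\<^sup>+z. ennreal (k z) * ennreal ((v (x - z) - v x)\<^sup>2) \<partial>lborel)" for x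
  proof -
    have conv: "convol k v x = (LINT z|lborel. k z * v (x - z))"
      unfolding convol_def
      using integral_lborel_affine[of "\<lambda>z. k z * v (x - z)" "-1" x] by simp
    have sq: "integrable lborel (\<lambda>z. (v (x - z))\<^sup>2)"
    proof -
      have "integrable (distr lborel borel (\<lambda>z. x + (-1) *\<^sub>R z)) (\<lambda>y. (v y)\<^sup>2)"
        using v by (subst lborel_affine1) auto
      then show ?thesis by (subst (asm) integrable_distr_eq) auto
    qed
    have "integrable lborel (\<lambda>x. (k x)\<^sup>2)"
      by (rule compact_support_square_integrable[OF smooth_continuous[OF k(1)] compact_cball k(3)])
    then have i1: "integrable lborel (\<lambda>z. k z * v (x - z))"
      by (intro integrable_mult_square sq) auto
    have "convol k v x - v x = (LINT z|lborel. k z * (v (x - z) - v x))"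
      using i1 ik k(4) by (simp add: conv right_diff_distrib)
    also have "\<bar>\<dots>\<bar> \<le> (LINT z|lborel. \<bar>k z * (v (x - z) - v x)\<bar>)" by (rule integral_abs_bound)
    finally have "ennreal \<bar>convol k v x - v x\<bar> \<le> (\<integral>\<^sup>+z. ennreal \<bar>k z * (v (x - z) - v x)\<bar> \<partial>lborel)"
      using i1 ik by (subst nn_integral_eq_integral) (auto simp: right_diff_distrib intro!: ennreal_leI)
    then have "ennreal \<bar>convol k v x - v x\<bar> ^ 2 \<le> (\<integral>\<^sup>+z. ennreal \<bar>k z * (v (x - z) - v x)\<bar> \<partial>lborel) ^ 2"
      by (rule power_mono) simp
    also have "(\<integral>\<^sup>+z. ennreal \<bar>k z * (v (x - z) - v x)\<bar> \<partial>lborel)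
       = (\<integral>\<^sup>+z. ennreal (sqrt (k z)) * ennreal (sqrt (k z) * \<bar>v (x - z) - v x\<bar>) \<partial>lborel)"
      using k(2) by (intro nn_integral_cong) (auto simp flip: ennreal_mult simp: abs_mult mult.assoc[symmetric])
    also have "\<dots> ^ 2 \<le> (\<integral>\<^sup>+z. ennreal (sqrt (k z)) ^ 2 \<partial>lborel) * (\<integral>\<^sup>+z. ennreal (sqrt (k z) * \<bar>v (x - z) - v x\<bar>) ^ 2 \<partial>lborel)"
      by (rule Cauchy_Schwarz_nn_integral) auto
    also have "(\<integral>\<^sup>+z. ennreal (sqrt (k z)) ^ 2 \<partial>lborel) = 1"
      using k(2) nk by (simp add: ennreal_power)
    also have "(\<integral>\<^sup>+z. ennreal (sqrt (k z) * \<bar>v (x - z) - v x\<bar>) ^ 2 \<partial>lborel)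
       = (\<integral>\<^sup>+z. ennreal (k z) * ennreal ((v (x - z) - v x)\<^sup>2) \<partial>lborel)"
      using k(2) by (intro nn_integral_cong) (auto simp: ennreal_power power_mult_distrib simp flip: ennreal_mult)
    finally show ?thesis by (simp add: ennreal_power)
  qed
  have "(\<integral>\<^sup>+x. ennreal ((convol k v x - v x)\<^sup>2) \<partial>lborel)
    \<le> (\<integral>\<^sup>+x. (\<integral>\<^sup>+z. ennreal (k z) * ennreal ((v (x - z) - v x)\<^sup>2) \<partial>lborel) \<partial>lborel)"
    by (rule nn_integral_mono) (rule pw)
  also have "\<dots> = (\<integral>\<^sup>+z. (\<integral>\<^sup>+x. ennreal (k z) * ennreal ((v (x - z) - v x)\<^sup>2) \<partial>lborel) \<partial>lborel)"
    by (rule lborel_pair.Fubini') measurable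
  also have "\<dots> = (\<integral>\<^sup>+z. ennreal (k z) * (\<integral>\<^sup>+x. ennreal ((v (x - z) - v x)\<^sup>2) \<partial>lborel) \<partial>lborel)"
    by (intro nn_integral_cong nn_integral_cmult) measurable
  also have "\<dots> \<le> (\<integral>\<^sup>+z. ennreal (k z) * e \<partial>lborel)"
  proof (rule nn_integral_mono)
    fix z :: 'a
    show "ennreal (k z) * (\<integral>\<^sup>+x. ennreal ((v (x - z) - v x)\<^sup>2) \<partial>lborel) \<le> ennreal (k z) * e"
      using e[of z] k(3)[of z] by (cases "norm z \<le> r") (auto intro: mult_left_mono)
  qed
  also have "\<dots> = e" using nk by (simp add: nn_integral_multc)
  finally show ?thesis .
qed

lemma mollification_tendsto:
  fixes v :: "'a::euclidean_space \<Rightarrow> real"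
  assumes [measurable]: "v \<in> borel_measurable borel" and v: "integrable lborel (\<lambda>x. (v x)\<^sup>2)"
    and k: "\<And>n. smooth (k n)" "\<And>n x. 0 \<le> k n x" "\<And>n x. x \<notin> cball 0 (r n) \<Longrightarrow> k n x = 0"
      "\<And>n. (LINT x|lborel. k n x) = 1" "r \<longlonglongrightarrow> 0"
  shows "(\<lambda>n. \<integral>\<^sup>+x. ennreal ((convol (k n) v x - v x)\<^sup>2) \<partial>lborel) \<longlonglongrightarrow> 0"
proof (rule ennreal_tendsto_0I)
  fix e :: real assume e: "e > 0"
  obtain d where d: "d > 0"
    "\<And>z. z \<noteq> 0 \<Longrightarrow> dist z 0 < d \<Longrightarrow> (\<integral>\<^sup>+x. ennreal ((v (x - z) - v x)\<^sup>2) \<partial>lborel) < ennreal e"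
    using ennreal_tendsto_0D[OF translation_continuous_L2[OF assms(1) v] e] by (auto simp: eventually_at)
  have d': "(\<integral>\<^sup>+x. ennreal ((v (x - z) - v x)\<^sup>2) \<partial>lborel) \<le> ennreal e" if "norm z < d" for z
    using d(2)[of z] that by (cases "z = 0") auto
  have "eventually (\<lambda>n. r n < d) sequentially" using k(5) d(1) by (rule order_tendstoD)
  then show "eventually (\<lambda>n. (\<integral>\<^sup>+x. ennreal ((convol (k n) v x - v x)\<^sup>2) \<partial>lborel) \<le> ennreal e) sequentially"
  proof eventually_elim
    case (elim n)
    show ?case by (rule mollification_error[OF assms(1) v k(1) k(2) k(3) k(4)]) (use elim d' in auto)
  qed
qed

lemma mollifier_exists:
  assumes "0 < (r::real)"
  obtains k :: "'a::euclidean_space \<Rightarrow> real" where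
    "smooth k" "\<And>x. 0 \<le> k x" "\<And>x. x \<notin> cball 0 r \<Longrightarrow> k x = 0" "(LINT x|lborel. k x) = 1"
proof -
  define h :: "'a \<Rightarrow> real" where "h x = flat_exp (r\<^sup>2 - x \<bullet> x)" for x
  have sm: "smooth h" unfolding h_def
    by (intro smooth_compose[OF smooth_flat_exp] smooth_diff smooth_const smooth_inner)
  have nn: "0 \<le> h x" for x by (simp add: h_def)
  have zero: "h x = 0 \<longleftrightarrow> r \<le> norm x" for x
    using assms by (simp add: h_def dot_square_norm abs_le_square_iff[symmetric])
  have int: "integrable lborel h"
    by (rule compact_support_integrable[OF smooth_continuous[OF sm] compact_cball[of 0 r]]) (auto simp: zero)
  have "(LINT x|lborel. h x) \<noteq> 0"
  proof
    assume "(LINT x|lborel. h x) = 0"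
    then have "AE x in lborel. h x = 0"
      using integral_nonneg_eq_0_iff_AE[OF int] nn by auto
    then have "AE x in lborel. x \<notin> ball (0::'a) r" by eventually_elim (simp add: zero)
    then have "emeasure lborel (ball (0::'a) r) = 0"
      using AE_iff_measurable[of "ball (0::'a) r" lborel "\<lambda>x. x \<notin> ball 0 r"] by (auto simp: ball_def)
    moreover have "open (ball (0::'a) r)" "ball (0::'a) r \<noteq> {}" using assms by auto
    ultimately show False using open_not_negligible[of "ball (0::'a) r"]
      by (auto simp: negligible_iff_null_sets null_sets_def)
  qed
  moreover have "(LINT x|lborel. h x) \<ge> 0" using nn by (simp add: integral_nonneg_AE)
  ultimately have pos: "(LINT x|lborel. h x) > 0" by simp
  show ?thesis
    by (rule that[of "\<lambda>x. inverse (LINT x|lborel. h x) * h x"])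
      (use pos nn in \<open>auto simp: zero intro: smooth_cmult[OF sm]\<close>)
qed

text \<open>Differentiation under the integral sign: the Taylor remainder of the kernel is uniform,
  so the error is at most a constant times \<open>(norm h)\<^sup>2\<close> times the
  \<open>L\<^sup>1\<close> norm of \<open>v\<close>.\<close>

lemma convol_has_derivative:
  fixes k v :: "'a::euclidean_space \<Rightarrow> real"
  assumes k: "smooth k" "compact K" "\<And>x. x \<notin> K \<Longrightarrow> k x = 0" and v: "integrable lborel v"
  shows "(convol k v has_derivative (\<lambda>h. convol (pd h k) v x)) (at x)"
proof -
  have [measurable]: "k \<in> borel_measurable borel" using k(1) by (rule smooth_measurable)
  have [measurable]: "v \<in> borel_measurable borel" using v by auto
  obtain C where C: "0 \<le> C" "\<And>x h. \<bar>k (x + h) - k x - pd h k x\<bar> \<le> C * (norm h)\<^sup>2"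
    using compact_support_taylor[OF k] by blast
  obtain B where B: "0 \<le> B" "\<And>x. (\<Sum>b\<in>Basis. \<bar>pd b k x\<bar>) \<le> B"
    using pd_sum_bounded[OF k] by blast
  obtain B' where B': "0 \<le> B'" "\<And>x. \<bar>k x\<bar> \<le> B'"
    using compact_support_bounded[OF smooth_continuous[OF k(1)] k(2,3)] by blast
  have lin: "linear (\<lambda>h. pd h k y)" for y
    using has_derivative_linear[OF smooth_has_derivative[OF k(1)]] .
  have rep: "pd h k = (\<lambda>y. \<Sum>b\<in>Basis. (h \<bullet> b) * pd b k y)" for h
    using linear_sum[OF lin, of "\<lambda>b. (h \<bullet> b) *\<^sub>R b" Basis] linear_scale[OF lin]
    by (auto simp: euclidean_representation)
  have [measurable]: "pd h k \<in> borel_measurable borel" for h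
    unfolding rep[of h] using smooth_measurable[OF smooth_pd[OF k(1)]] by auto
  have bd: "\<bar>pd h k y\<bar> \<le> norm h * B" for h y
    using pd_norm_le[OF k(1), of h y] mult_left_mono[OF B(2)[of y], of "norm h"] by simp
  have i1: "integrable lborel (\<lambda>y. pd h k (x - y) * v y)" for h x
    by (rule Bochner_Integration.integrable_bound[where f="\<lambda>y. norm h * B * v y"])
      (use v bd B in \<open>auto simp: abs_mult intro!: mult_right_mono\<close>)
  have i2: "integrable lborel (\<lambda>y. k (x - y) * v y)" for x
    by (rule Bochner_Integration.integrable_bound[where f="\<lambda>y. B' * v y"])
      (use v B' in \<open>auto simp: abs_mult intro!: mult_right_mono\<close>)
  have bl: "bounded_linear (\<lambda>h. convol (pd h k) v x)"
  proof (rule linear_conv_bounded_linear[THEN iffD1, OF linearI])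
    show "convol (pd (h + h') k) v x = convol (pd h k) v x + convol (pd h' k) v x" for h h'
      using i1 by (simp add: convol_def linear_add[OF lin] distrib_right)
    show "convol (pd (c *\<^sub>R h) k) v x = c *\<^sub>R convol (pd h k) v x" for c h
      using i1 by (simp add: convol_def linear_scale[OF lin] mult.assoc)
  qed
  define I where "I = (LINT y|lborel. \<bar>v y\<bar>)"
  show ?thesis
  proof (rule has_derivativeI_sandwich[where e=1 and H="\<lambda>y. C * I * norm (y - x)", OF _ bl])
    fix z assume z: "z \<noteq> x"
    let ?h = "z - x"
    have "convol k v z - convol k v x - convol (pd ?h k) v x
      = (LINT y|lborel. (k (z - y) - k (x - y) - pd ?h k (x - y)) * v y)"
      using i1 i2 by (simp add: convol_def left_diff_distrib)
    also have "\<bar>\<dots>\<bar> \<le> (LINT y|lborel. \<bar>(k (z - y) - k (x - y) - pd ?h k (x - y)) * v y\<bar>)"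
      by (rule integral_abs_bound)
    also have "\<dots> \<le> (LINT y|lborel. C * (norm ?h)\<^sup>2 * \<bar>v y\<bar>)"
    proof (rule integral_mono)
      show "integrable lborel (\<lambda>y. \<bar>(k (z - y) - k (x - y) - pd ?h k (x - y)) * v y\<bar>)"
        using i1 i2 by (auto simp: left_diff_distrib intro!: integrable_abs Bochner_Integration.integrable_diff)
      show "\<bar>(k (z - y) - k (x - y) - pd ?h k (x - y)) * v y\<bar> \<le> C * (norm ?h)\<^sup>2 * \<bar>v y\<bar>" for y
        unfolding abs_mult by (rule mult_right_mono) (use C(2)[of "x - y" ?h] in auto)
    qed (use v in auto)
    also have "\<dots> = C * (norm ?h)\<^sup>2 * I" by (simp add: I_def)
    finally show "norm ((convol k v z - convol k v x) - convol (pd ?h k) v x) / norm ?h \<le> C * I * norm ?h"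
      using z by (simp add: field_simps power2_eq_square)
  next
    have "((\<lambda>y. C * I * norm (y - x)) \<longlongrightarrow> C * I * norm (x - x)) (at x within UNIV)" by (intro tendsto_intros)
    then show "((\<lambda>y. C * I * norm (y - x)) \<longlongrightarrow> 0) (at x within UNIV)" by simp
  qed auto
qed

lemma pd_convol:
  assumes "smooth k" "compact K" "\<And>x. x \<notin> K \<Longrightarrow> k x = 0" "integrable lborel v"
  shows "pd b (convol k v) = convol (pd b k) v"
  using pd_eqI[OF convol_has_derivative[OF assms]] by auto

text \<open>All derivatives fall on the kernel, which stays smooth with the same support. The
  induction starts at order one, where continuity of a derivative follows from its own
  differentiability.\<close>

lemma smooth_convol:
  assumes k: "smooth k" "compact K" "\<And>x. x \<notin> K \<Longrightarrow> k x = 0" and v: "integrable lborel v"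
  shows "smooth (convol k v)"
proof -
  have "Ck (Suc m) UNIV (convol k v)" for m
    using k
  proof (induction m arbitrary: k)
    case 0
    have "continuous_on UNIV (convol (pd b k) v)" if b: "b \<in> Basis" for b
      using convol_has_derivative[OF smooth_pd[OF 0(1) b] 0(2) pd_zero_off_compact[OF 0(2,3)] v]
      by (intro has_derivative_continuous_on) auto
    then show ?case
      by (intro Ck_SucI[OF convol_has_derivative[OF 0 v]]) auto
  next
    case (Suc m)
    show ?case
      by (rule Ck_SucI[OF convol_has_derivative[OF Suc.prems v]])
        (use Suc.IH smooth_pd[OF Suc.prems(1)] Suc.prems(2) pd_zero_off_compact[OF Suc.prems(2,3)] in auto)
  qed
  then show ?thesis unfolding smooth_def using Ck_mono by blast
qed

section \<open>Square integrable functions and weak derivatives\<close>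

text \<open>After finitely many terms, whose integrals may be infinite, the squares converge to 0 in
  \<open>L\<^sup>1\<close>, and an almost everywhere convergent subsequence exists.\<close>

lemma L2_AE_subseq:
  fixes f :: "nat \<Rightarrow> 'a \<Rightarrow> real"
  assumes [measurable]: "\<And>n. f n \<in> borel_measurable M"
    and lim: "(\<lambda>n. \<integral>\<^sup>+x. ennreal ((f n x)\<^sup>2) \<partial>M) \<longlonglongrightarrow> 0"
  obtains r :: "nat \<Rightarrow> nat" where "strict_mono r" "AE x in M. (\<lambda>n. f (r n) x) \<longlonglongrightarrow> 0"
proof -
  obtain N where N: "\<And>n. n \<ge> N \<Longrightarrow> (\<integral>\<^sup>+x. ennreal ((f n x)\<^sup>2) \<partial>M) < ennreal 1"
    using ennreal_tendsto_0D[OF lim, of 1] by (auto simp: eventually_sequentially)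
  have int: "integrable M (\<lambda>x. (f (n + N) x)\<^sup>2)" for n
    unfolding integrable_iff_bounded using N[of "n + N"] by (auto intro: less_trans)
  have eq: "(\<integral>\<^sup>+x. ennreal ((f (n + N) x)\<^sup>2) \<partial>M) = ennreal (LINT x|M. (f (n + N) x)\<^sup>2)" for n
    by (rule nn_integral_eq_integral[OF int]) auto
  have "(\<lambda>n. ennreal (LINT x|M. (f (n + N) x)\<^sup>2)) \<longlonglongrightarrow> 0"
    using LIMSEQ_ignore_initial_segment[OF lim, of N] by (simp only: eq)
  then have "(\<lambda>n. LINT x|M. norm ((f (n + N) x)\<^sup>2)) \<longlonglongrightarrow> 0"
    by (simp add: ennreal_tendsto_0_iff)
  from tendsto_L1_AE_subseq[OF int this] obtain r
    where r: "strict_mono r" "AE x in M. (\<lambda>n. (f (r n + N) x)\<^sup>2) \<longlonglongrightarrow> 0" by blast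
  have "AE x in M. (\<lambda>n. f (r n + N) x) \<longlonglongrightarrow> 0"
    using r(2)
  proof eventually_elim
    case (elim x)
    from tendsto_real_sqrt[OF this] show ?case by (simp add: tendsto_rabs_zero_iff)
  qed
  moreover have "strict_mono (\<lambda>n. r n + N)" using r(1) by (simp add: strict_mono_def)
  ultimately show ?thesis using that by blast
qed

lemma nn_integral_square_add_le:
  fixes f g :: "'a \<Rightarrow> real"
  assumes [measurable]: "f \<in> borel_measurable M" "g \<in> borel_measurable M"
  shows "(\<integral>\<^sup>+x. ennreal ((f x + g x)\<^sup>2) \<partial>M)
    \<le> 2 * (\<integral>\<^sup>+x. ennreal ((f x)\<^sup>2) \<partial>M) + 2 * (\<integral>\<^sup>+x. ennreal ((g x)\<^sup>2) \<partial>M)"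
proof -
  have pw: "(a + b)\<^sup>2 \<le> 2 * a\<^sup>2 + 2 * b\<^sup>2" for a b :: real
    using zero_le_power2[of "a - b"] by (simp add: power2_sum power2_diff)
  have "(\<integral>\<^sup>+x. ennreal ((f x + g x)\<^sup>2) \<partial>M) \<le> (\<integral>\<^sup>+x. 2 * ennreal ((f x)\<^sup>2) + 2 * ennreal ((g x)\<^sup>2) \<partial>M)"
  proof (rule nn_integral_mono)
    fix x
    have "2 * ennreal ((f x)\<^sup>2) + 2 * ennreal ((g x)\<^sup>2) = ennreal (2 * (f x)\<^sup>2 + 2 * (g x)\<^sup>2)"
      by (simp add: ennreal_mult)
    then show "ennreal ((f x + g x)\<^sup>2) \<le> 2 * ennreal ((f x)\<^sup>2) + 2 * ennreal ((g x)\<^sup>2)"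
      using pw by (simp add: ennreal_leI del: ennreal_plus)
  qed
  also have "\<dots> = 2 * (\<integral>\<^sup>+x. ennreal ((f x)\<^sup>2) \<partial>M) + 2 * (\<integral>\<^sup>+x. ennreal ((g x)\<^sup>2) \<partial>M)"
    by (simp add: nn_integral_add nn_integral_cmult)
  finally show ?thesis .
qed

lemma L2_tendsto_add:
  fixes f g :: "nat \<Rightarrow> 'a \<Rightarrow> real"
  assumes "\<And>n. f n \<in> borel_measurable M" "\<And>n. g n \<in> borel_measurable M"
    and f: "(\<lambda>n. \<integral>\<^sup>+x. ennreal ((f n x)\<^sup>2) \<partial>M) \<longlonglongrightarrow> 0"
    and g: "(\<lambda>n. \<integral>\<^sup>+x. ennreal ((g n x)\<^sup>2) \<partial>M) \<longlonglongrightarrow> 0"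
  shows "(\<lambda>n. \<integral>\<^sup>+x. ennreal ((f n x + g n x)\<^sup>2) \<partial>M) \<longlonglongrightarrow> 0"
proof (rule tendsto_sandwich[OF _ _ tendsto_const])
  have "(\<lambda>n. 2 * (\<integral>\<^sup>+x. ennreal ((f n x)\<^sup>2) \<partial>M) + 2 * (\<integral>\<^sup>+x. ennreal ((g n x)\<^sup>2) \<partial>M)) \<longlonglongrightarrow> 2 * 0 + 2 * 0"
    by (intro tendsto_add ennreal_tendsto_cmult f g) auto
  then show "(\<lambda>n. 2 * (\<integral>\<^sup>+x. ennreal ((f n x)\<^sup>2) \<partial>M) + 2 * (\<integral>\<^sup>+x. ennreal ((g n x)\<^sup>2) \<partial>M)) \<longlonglongrightarrow> 0"
    by simp
qed (auto intro!: always_eventually nn_integral_square_add_le assms)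

lemma square_integrable_iff:
  fixes f :: "'a \<Rightarrow> real"
  shows "square_integrable M f \<longleftrightarrow>
    f \<in> borel_measurable M \<and> (\<integral>\<^sup>+x. ennreal ((f x)\<^sup>2) \<partial>M) < \<infinity>"
  unfolding square_integrable_def integrable_iff_bounded by auto

lemma square_integrable_D:
  fixes f :: "'a \<Rightarrow> real"
  assumes "square_integrable M f"
  shows "f \<in> borel_measurable M" "integrable M (\<lambda>x. (f x)\<^sup>2)"
  using assms by (auto simp: square_integrable_def)

lemma square_integrable_add:
  fixes f g :: "'a \<Rightarrow> real"
  assumes "square_integrable M f" "square_integrable M g"
  shows "square_integrable M (\<lambda>x. f x + g x)"
  using assms nn_integral_square_add_le[of f M g] unfolding square_integrable_iff
  by (auto simp: ennreal_mult_less_top intro: le_less_trans)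

lemma square_integrable_mult_bounded:
  fixes f \<beta> :: "'a \<Rightarrow> real"
  assumes f: "square_integrable M f" and [measurable]: "\<beta> \<in> borel_measurable M"
    and B: "\<And>x. x \<in> space M \<Longrightarrow> \<bar>\<beta> x\<bar> \<le> B"
  shows "square_integrable M (\<lambda>x. \<beta> x * f x)"
proof -
  note square_integrable_D[OF f, measurable]
  have "integrable M (\<lambda>x. (\<beta> x * f x)\<^sup>2)"
  proof (rule Bochner_Integration.integrable_bound)
    show "integrable M (\<lambda>x. B\<^sup>2 * (f x)\<^sup>2)" using square_integrable_D(2)[OF f] by simp
    show "AE x in M. norm ((\<beta> x * f x)\<^sup>2) \<le> norm (B\<^sup>2 * (f x)\<^sup>2)"
      using B by (auto simp: power_mult_distrib abs_le_square_iff[symmetric] intro!: mult_right_mono AE_I2)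
        (meson abs_ge_self order_trans)
  qed measurable
  then show ?thesis using square_integrable_D(1)[OF f] by (simp add: square_integrable_def)
qed

lemma square_integrable_cmult:
  fixes f :: "'a \<Rightarrow> real"
  shows "square_integrable M f \<Longrightarrow> square_integrable M (\<lambda>x. c * f x)"
  using square_integrable_mult_bounded[of M f "\<lambda>x. c" "\<bar>c\<bar>"] by simp

lemma square_integrable_diff:
  fixes f g :: "'a \<Rightarrow> real"
  assumes "square_integrable M f" "square_integrable M g"
  shows "square_integrable M (\<lambda>x. f x - g x)"
  using square_integrable_add[OF assms(1) square_integrable_cmult[OF assms(2), of "-1"]] by simp

lemma square_integrable_cong:
  fixes f g :: "'a \<Rightarrow> real"
  assumes "\<And>x. x \<in> space M \<Longrightarrow> f x = g x"
  shows "square_integrable M f \<longleftrightarrow> square_integrable M g"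
proof -
  have "(\<integral>\<^sup>+x. ennreal ((f x)\<^sup>2) \<partial>M) = (\<integral>\<^sup>+x. ennreal ((g x)\<^sup>2) \<partial>M)"
    by (rule nn_integral_cong) (simp add: assms)
  then show ?thesis
    unfolding square_integrable_iff using measurable_cong[of M f g borel] assms by auto
qed

lemma integrable_mult_square_integrable:
  fixes f g :: "'a \<Rightarrow> real"
  shows "square_integrable M f \<Longrightarrow> square_integrable M g \<Longrightarrow> integrable M (\<lambda>x. f x * g x)"
  by (intro integrable_mult_square) (auto simp: square_integrable_def)

text \<open>The function spaces live on the completed measure \<open>lebesgue_on\<close>, while
  translations and Fubini are applied to Borel functions on \<open>lborel\<close>. Borel
  representatives link the two.\<close>

lemma borel_representative:
  fixes f :: "'a::euclidean_space \<Rightarrow> real"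
  assumes "\<Omega> \<in> sets borel" "f \<in> borel_measurable (lebesgue_on \<Omega>)"
  obtains g where "g \<in> borel_measurable borel" "\<And>x. x \<notin> \<Omega> \<Longrightarrow> g x = 0" "AE x in lebesgue_on \<Omega>. f x = g x"
proof -
  have \<Omega>: "\<Omega> \<in> sets lebesgue" using assms(1) by (simp add: sets_completionI_sets)
  have "(\<lambda>x. indicator \<Omega> x *\<^sub>R f x) \<in> borel_measurable lebesgue"
    using assms(2) \<Omega> by (subst (asm) borel_measurable_restrict_space_iff) auto
  then obtain g where g: "g \<in> borel_measurable lborel" "AE x in lborel. indicator \<Omega> x *\<^sub>R f x = g x"
    using completion_ex_borel_measurable_real[of "\<lambda>x. indicator \<Omega> x *\<^sub>R f x" lborel] by auto
  from AE_completion[OF g(2)] have "AE x in lebesgue_on \<Omega>. f x = indicator \<Omega> x * g x"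
    using \<Omega> by (subst AE_restrict_space_iff) auto
  then show ?thesis
    using that[of "\<lambda>x. indicator \<Omega> x * g x"] g(1) assms(1) by auto
qed

lemma lebesgue_on_borel:
  fixes g :: "'a::euclidean_space \<Rightarrow> real"
  assumes "\<Omega> \<in> sets borel" "g \<in> borel_measurable borel" "\<And>x. x \<notin> \<Omega> \<Longrightarrow> g x = 0"
  shows "(LINT x|lebesgue_on \<Omega>. g x) = (LINT x|lborel. g x)"
    and "integrable (lebesgue_on \<Omega>) g \<longleftrightarrow> integrable lborel g"
proof -
  have eq: "(\<lambda>x. indicator \<Omega> x *\<^sub>R g x) = g"
  proof
    show "indicator \<Omega> x *\<^sub>R g x = g x" for x using assms(3)[of x] by (cases "x \<in> \<Omega>") auto
  qed
  have \<Omega>: "\<Omega> \<inter> space lebesgue \<in> sets lebesgue" using assms(1) by (simp add: sets_completionI_sets)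
  have g: "g \<in> borel_measurable lborel" using assms(2) by simp
  show "(LINT x|lebesgue_on \<Omega>. g x) = (LINT x|lborel. g x)"
    unfolding integral_restrict_space[OF \<Omega>] eq integral_completion[OF g] ..
  show "integrable (lebesgue_on \<Omega>) g \<longleftrightarrow> integrable lborel g"
    unfolding integrable_restrict_space[OF \<Omega>] eq integrable_completion[OF g] ..
qed

lemma nn_integral_lebesgue_on_borel:
  fixes g :: "'a::euclidean_space \<Rightarrow> ennreal"
  assumes "\<Omega> \<in> sets borel" "g \<in> borel_measurable borel"
  shows "(\<integral>\<^sup>+x. g x \<partial>lebesgue_on \<Omega>) = (\<integral>\<^sup>+x. g x * indicator \<Omega> x \<partial>lborel)"
  using assms by (simp add: nn_integral_restrict_space nn_integral_completion sets_completionI_sets)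

lemma borel_lebesgue_on: "g \<in> borel_measurable borel \<Longrightarrow> g \<in> borel_measurable (lebesgue_on \<Omega>)"
  by (rule measurable_restrict_space1, rule measurable_completion) auto

text \<open>Multiplying by the indicator of \<open>K\<close> makes the representative vanish at
  every point off \<open>K\<close>, so that supports can later be used pointwise.\<close>

lemma square_integrable_representative:
  fixes f :: "'a::euclidean_space \<Rightarrow> real"
  assumes "K \<in> sets borel" "\<Omega> \<in> sets borel" "K \<subseteq> \<Omega>" "square_integrable (lebesgue_on \<Omega>) f"
    "\<And>x. x \<notin> K \<Longrightarrow> f x = 0"
  shows "\<exists>g. g \<in> borel_measurable borel \<and> (\<forall>x. x \<notin> K \<longrightarrow> g x = 0) \<and>
    (AE x in lebesgue_on \<Omega>. f x = g x) \<and> integrable lborel (\<lambda>x. (g x)\<^sup>2)"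
proof -
  obtain g where g: "g \<in> borel_measurable borel" "\<And>x. x \<notin> \<Omega> \<Longrightarrow> g x = 0" "AE x in lebesgue_on \<Omega>. f x = g x"
    using borel_representative[OF assms(2) square_integrable_D(1)[OF assms(4)]] by blast
  define h where "h x = indicator K x * g x" for x
  have h[measurable]: "h \<in> borel_measurable borel" unfolding h_def using g(1) assms(1) by auto
  have z: "h x = 0" if "x \<notin> K" for x using that by (simp add: h_def)
  have ae: "AE x in lebesgue_on \<Omega>. f x = h x"
    using g(3)
  proof eventually_elim
    case (elim x) then show ?case using assms(5)[of x] by (cases "x \<in> K") (auto simp: h_def)
  qed
  have "integrable (lebesgue_on \<Omega>) (\<lambda>x. (h x)\<^sup>2)"
    by (rule integrable_cong_AE_imp[OF square_integrable_D(2)[OF assms(4)]])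
      (use ae h in \<open>auto intro: borel_lebesgue_on\<close>)
  then have "integrable lborel (\<lambda>x. (h x)\<^sup>2)"
    using lebesgue_on_borel(2)[OF assms(2), of "\<lambda>x. (h x)\<^sup>2"] z assms(3) by auto
  with h z ae show ?thesis by blast
qed

section \<open>Test functions and rules for weak derivatives\<close>

lemma test_function_iff:
  "test_function \<Omega> \<phi> \<longleftrightarrow> smooth \<phi> \<and> (\<exists>K. compact K \<and> K \<subseteq> \<Omega> \<and> (\<forall>x. x \<notin> K \<longrightarrow> \<phi> x = 0))"
proof
  assume "test_function \<Omega> \<phi>"
  moreover have "x \<notin> closure {x. \<phi> x \<noteq> 0} \<Longrightarrow> \<phi> x = 0" for x
    using closure_subset[of "{x. \<phi> x \<noteq> 0}"] by auto
  ultimately show "smooth \<phi> \<and> (\<exists>K. compact K \<and> K \<subseteq> \<Omega> \<and> (\<forall>x. x \<notin> K \<longrightarrow> \<phi> x = 0))"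
    unfolding test_function_def smooth_def by blast
next
  assume "smooth \<phi> \<and> (\<exists>K. compact K \<and> K \<subseteq> \<Omega> \<and> (\<forall>x. x \<notin> K \<longrightarrow> \<phi> x = 0))"
  then obtain K where K: "smooth \<phi>" "compact K" "K \<subseteq> \<Omega>" "\<And>x. x \<notin> K \<Longrightarrow> \<phi> x = 0" by blast
  have "closure {x. \<phi> x \<noteq> 0} \<subseteq> K"
    by (rule closure_minimal) (use K compact_imp_closed in auto)
  then show "test_function \<Omega> \<phi>"
    using K compact_Int_closed[OF K(2) closed_closure, of "{x. \<phi> x \<noteq> 0}"]
    unfolding test_function_def smooth_def by (auto simp: Int_absorb1)
qed

lemma test_function_square_integrable:
  assumes "test_function \<Omega> \<phi>" "\<Omega> \<in> sets borel"
  shows "square_integrable (lebesgue_on \<Omega>) \<phi>" "b \<in> Basis \<Longrightarrow> square_integrable (lebesgue_on \<Omega>) (pd b \<phi>)"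
proof -
  obtain K where K: "smooth \<phi>" "compact K" "K \<subseteq> \<Omega>" "\<And>x. x \<notin> K \<Longrightarrow> \<phi> x = 0"
    using assms test_function_iff by metis
  have *: "square_integrable (lebesgue_on \<Omega>) f" if "smooth f" "\<And>x. x \<notin> K \<Longrightarrow> f x = 0" for f
    using compact_support_square_integrable[OF smooth_continuous[OF that(1)] K(2) that(2)]
      lebesgue_on_borel(2)[OF assms(2), of "\<lambda>x. (f x)\<^sup>2"] smooth_measurable[OF that(1)] that(2) K(3)
    by (auto simp: square_integrable_def intro: borel_lebesgue_on)
  show "square_integrable (lebesgue_on \<Omega>) \<phi>" using * K by blast
  show "square_integrable (lebesgue_on \<Omega>) (pd b \<phi>)" if "b \<in> Basis"
    by (rule *) (use smooth_pd[OF K(1) that] pd_zero_off_compact[where f=\<phi>, OF K(2,4)] in auto)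
qed

lemma has_weak_partial_pd:
  "has_weak_partial \<Omega> b u g \<longleftrightarrow> square_integrable (lebesgue_on \<Omega>) g \<and>
     (\<forall>\<phi>. test_function \<Omega> \<phi> \<longrightarrow>
        (LINT x|lebesgue_on \<Omega>. u x * pd b \<phi> x) = - (LINT x|lebesgue_on \<Omega>. g x * \<phi> x))"
  by (simp add: has_weak_partial_def pd_def)

lemma has_weak_partial_cong:
  assumes "has_weak_partial \<Omega> b u g" "\<And>x. x \<in> \<Omega> \<Longrightarrow> u x = u' x" "\<And>x. x \<in> \<Omega> \<Longrightarrow> g x = g' x"
  shows "has_weak_partial \<Omega> b u' g'"
proof -
  have "(LINT x|lebesgue_on \<Omega>. u x * f x) = (LINT x|lebesgue_on \<Omega>. u' x * f x)"
    "(LINT x|lebesgue_on \<Omega>. g x * f x) = (LINT x|lebesgue_on \<Omega>. g' x * f x)" for f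
    using assms(2,3) by (auto intro!: Bochner_Integration.integral_cong)
  moreover have "square_integrable (lebesgue_on \<Omega>) g \<longleftrightarrow> square_integrable (lebesgue_on \<Omega>) g'"
    by (rule square_integrable_cong) (use assms(3) in auto)
  ultimately show ?thesis using assms(1) unfolding has_weak_partial_pd by simp
qed

lemma has_weak_partial_add:
  assumes "\<Omega> \<in> sets borel" "b \<in> Basis"
    and "square_integrable (lebesgue_on \<Omega>) u" "square_integrable (lebesgue_on \<Omega>) u'"
    and "has_weak_partial \<Omega> b u g" "has_weak_partial \<Omega> b u' g'"
  shows "has_weak_partial \<Omega> b (\<lambda>x. u x + u' x) (\<lambda>x. g x + g' x)"
  unfolding has_weak_partial_pd
proof (intro conjI allI impI)
  show "square_integrable (lebesgue_on \<Omega>) (\<lambda>x. g x + g' x)"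
    using assms(5,6) by (auto simp: has_weak_partial_pd intro: square_integrable_add)
  fix \<phi> assume \<phi>: "test_function \<Omega> \<phi>"
  note s = test_function_square_integrable[OF \<phi> assms(1)]
  show "(LINT x|lebesgue_on \<Omega>. (u x + u' x) * pd b \<phi> x) = - (LINT x|lebesgue_on \<Omega>. (g x + g' x) * \<phi> x)"
    using assms \<phi> integrable_mult_square_integrable[OF assms(3) s(2)[OF assms(2)]]
      integrable_mult_square_integrable[OF assms(4) s(2)[OF assms(2)]]
      integrable_mult_square_integrable[OF _ s(1), of g] integrable_mult_square_integrable[OF _ s(1), of g']
    by (simp add: distrib_right has_weak_partial_pd)
qed

lemma bounded_smooth_bound:
  fixes \<Omega> :: "'a::euclidean_space set"
  assumes "smooth \<beta>" "bounded \<Omega>"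
  obtains B where "0 \<le> B" "\<And>x. x \<in> \<Omega> \<Longrightarrow> \<bar>\<beta> x\<bar> \<le> B"
proof -
  have "bounded (\<beta> ` closure \<Omega>)"
    using assms by (intro compact_imp_bounded compact_continuous_image smooth_continuous) auto
  then obtain B where "\<forall>y\<in>\<beta> ` closure \<Omega>. \<bar>y\<bar> \<le> B" by (auto simp: bounded_iff)
  then have "\<bar>\<beta> x\<bar> \<le> max B 0" if "x \<in> \<Omega>" for x
    using that closure_subset[of \<Omega>] by (intro max.coboundedI1) auto
  then show ?thesis using that[of "max B 0"] by auto
qed

lemma square_integrable_smooth_mult:
  fixes \<Omega> :: "'a::euclidean_space set"
  assumes "smooth \<beta>" "bounded \<Omega>" "square_integrable (lebesgue_on \<Omega>) u"
  shows "square_integrable (lebesgue_on \<Omega>) (\<lambda>x. \<beta> x * u x)"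
proof -
  obtain B where "\<And>x. x \<in> \<Omega> \<Longrightarrow> \<bar>\<beta> x\<bar> \<le> B" using bounded_smooth_bound[OF assms(1,2)] by blast
  then show ?thesis
    using square_integrable_mult_bounded[OF assms(3), of \<beta> B] smooth_measurable[OF assms(1)]
    by (auto intro: borel_lebesgue_on)
qed

lemma smooth_square_integrable:
  fixes \<Omega> :: "'a::euclidean_space set"
  assumes "smooth \<beta>" "bounded \<Omega>" "\<Omega> \<in> sets borel"
  shows "square_integrable (lebesgue_on \<Omega>) \<beta>"
proof -
  have "emeasure lborel \<Omega> < \<infinity>" using emeasure_bounded_finite[OF assms(2)] by simp
  then have "square_integrable (lebesgue_on \<Omega>) (\<lambda>x. 1 :: real)"
    using assms(3) by (simp add: square_integrable_iff emeasure_restrict_space sets_completionI_sets)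
  from square_integrable_smooth_mult[OF assms(1,2) this] show ?thesis by simp
qed

lemma test_function_mult:
  assumes "test_function \<Omega> \<phi>" "smooth \<beta>" shows "test_function \<Omega> (\<lambda>x. \<beta> x * \<phi> x)"
proof -
  obtain K where "compact K" "K \<subseteq> \<Omega>" "\<forall>x. x \<notin> K \<longrightarrow> \<phi> x = 0"
    using assms(1) unfolding test_function_iff by blast
  then have "\<exists>K. compact K \<and> K \<subseteq> \<Omega> \<and> (\<forall>x. x \<notin> K \<longrightarrow> \<beta> x * \<phi> x = 0)"
    by (intro exI[of _ K]) simp
  then show ?thesis
    using assms smooth_mult[of \<beta> \<phi>] unfolding test_function_iff by blast
qed

text \<open>Leibniz rule: \<open>\<beta>\<close> times a test function is a test function, and
  expanding its derivative isolates the term with \<open>pd b \<phi>\<close>.\<close>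

lemma has_weak_partial_mult:
  fixes \<Omega> :: "'a::euclidean_space set"
  assumes "\<Omega> \<in> sets borel" "bounded \<Omega>" "b \<in> Basis" "smooth \<beta>"
    and u: "square_integrable (lebesgue_on \<Omega>) u" "has_weak_partial \<Omega> b u g"
  shows "has_weak_partial \<Omega> b (\<lambda>x. \<beta> x * u x) (\<lambda>x. pd b \<beta> x * u x + \<beta> x * g x)"
  unfolding has_weak_partial_pd
proof (intro conjI allI impI)
  have g: "square_integrable (lebesgue_on \<Omega>) g" using u(2) by (simp add: has_weak_partial_pd)
  note sm = square_integrable_smooth_mult[OF smooth_pd[OF assms(4,3)] assms(2) u(1)]
    square_integrable_smooth_mult[OF assms(4,2) g]
  show "square_integrable (lebesgue_on \<Omega>) (\<lambda>x. pd b \<beta> x * u x + \<beta> x * g x)"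
    by (intro square_integrable_add sm)
  fix \<phi> assume \<phi>: "test_function \<Omega> \<phi>"
  then have s\<phi>: "smooth \<phi>" by (simp add: test_function_iff)
  note s = test_function_square_integrable[OF \<phi> assms(1)]
  note t = test_function_square_integrable[OF test_function_mult[OF \<phi> assms(4)] assms(1)]
  have pm: "pd b (\<lambda>x. \<beta> x * \<phi> x) x = \<beta> x * pd b \<phi> x + pd b \<beta> x * \<phi> x" for x
    by (rule pd_mult[OF assms(4) s\<phi>])
  have "(LINT x|lebesgue_on \<Omega>. \<beta> x * u x * pd b \<phi> x)
      = (LINT x|lebesgue_on \<Omega>. u x * pd b (\<lambda>x. \<beta> x * \<phi> x) x - (pd b \<beta> x * u x) * \<phi> x)"
    by (rule Bochner_Integration.integral_cong) (auto simp: pm algebra_simps)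
  also have "\<dots> = (LINT x|lebesgue_on \<Omega>. u x * pd b (\<lambda>x. \<beta> x * \<phi> x) x) - (LINT x|lebesgue_on \<Omega>. (pd b \<beta> x * u x) * \<phi> x)"
    by (rule Bochner_Integration.integral_diff)
      (intro integrable_mult_square_integrable u(1) t(2) assms(3) sm(1) s(1))+
  also have "(LINT x|lebesgue_on \<Omega>. u x * pd b (\<lambda>x. \<beta> x * \<phi> x) x) = - (LINT x|lebesgue_on \<Omega>. g x * (\<beta> x * \<phi> x))"
    using u(2) test_function_mult[OF \<phi> assms(4)] by (simp add: has_weak_partial_pd)
  also have "(LINT x|lebesgue_on \<Omega>. g x * (\<beta> x * \<phi> x)) = (LINT x|lebesgue_on \<Omega>. \<beta> x * g x * \<phi> x)"
    by (simp add: ac_simps)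
  also have "- (LINT x|lebesgue_on \<Omega>. \<beta> x * g x * \<phi> x) - (LINT x|lebesgue_on \<Omega>. pd b \<beta> x * u x * \<phi> x)
     = - (LINT x|lebesgue_on \<Omega>. (pd b \<beta> x * u x + \<beta> x * g x) * \<phi> x)"
    unfolding distrib_right
    by (subst Bochner_Integration.integral_add) (auto intro!: integrable_mult_square_integrable sm s)
  finally show "(LINT x|lebesgue_on \<Omega>. \<beta> x * u x * pd b \<phi> x)
    = - (LINT x|lebesgue_on \<Omega>. (pd b \<beta> x * u x + \<beta> x * g x) * \<phi> x)" .
qed

text \<open>Read \<open>U\<close> as \<open>U\<close> times 1. The product rule reduces the claim to
  the constant 1, whose weak derivative is 0 because derivatives of compactly supported functions
  have integral 0.\<close>

lemma has_weak_partial_smooth: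
  fixes \<Omega> :: "'a::euclidean_space set"
  assumes "\<Omega> \<in> sets borel" "bounded \<Omega>" "b \<in> Basis" "smooth U"
  shows "has_weak_partial \<Omega> b U (pd b U)"
proof -
  have one: "has_weak_partial \<Omega> b (\<lambda>x. 1) (\<lambda>x. 0)"
    unfolding has_weak_partial_pd
  proof (intro conjI allI impI)
    show "square_integrable (lebesgue_on \<Omega>) (\<lambda>x. 0 :: real)" by (simp add: square_integrable_def)
    fix \<phi> assume "test_function \<Omega> \<phi>"
    then obtain K where K: "smooth \<phi>" "compact K" "K \<subseteq> \<Omega>" "\<And>x. x \<notin> K \<Longrightarrow> \<phi> x = 0"
      using test_function_iff by metis
    have "(LINT x|lebesgue_on \<Omega>. pd b \<phi> x) = (LINT x|lborel. pd b \<phi> x)"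
      by (rule lebesgue_on_borel(1)[OF assms(1) smooth_measurable[OF smooth_pd[OF K(1) assms(3)]]])
        (use pd_zero_off_compact[where f=\<phi>, OF K(2,4)] K(3) in blast)
    then show "(LINT x|lebesgue_on \<Omega>. 1 * pd b \<phi> x) = - (LINT x|lebesgue_on \<Omega>. 0 * \<phi> x)"
      using integral_pd_compact_support[OF K(1,2,4) assms(3)] by simp
  qed
  have "square_integrable (lebesgue_on \<Omega>) (\<lambda>x. 1 :: real)"
    by (rule smooth_square_integrable[OF smooth_const assms(2,1)])
  from has_weak_partial_mult[OF assms this one] show ?thesis by simp
qed

text \<open>The fundamental lemma of the calculus of variations. At a point of the open set \<Omega>
  the reflected kernel is a test function as soon as its radius is small, so the mollifications of
  \<open>d\<close> vanish there; along a subsequence they also converge to \<open>d\<close> almost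
  everywhere.\<close>

lemma has_weak_partial_0_unique:
  fixes \<Omega> :: "'a::euclidean_space set"
  assumes "open \<Omega>" and d: "square_integrable (lebesgue_on \<Omega>) d"
    and z: "\<And>\<phi>. test_function \<Omega> \<phi> \<Longrightarrow> (LINT x|lebesgue_on \<Omega>. d x * \<phi> x) = 0"
  shows "AE x in lebesgue_on \<Omega>. d x = 0"
proof -
  have \<Omega>: "\<Omega> \<in> sets borel" using assms(1) by auto
  have sI: "square_integrable (lebesgue_on \<Omega>) (\<lambda>x. indicator \<Omega> x * d x)"
    using d by (subst square_integrable_cong[of _ _ d]) auto
  obtain D where D: "D \<in> borel_measurable borel" "\<And>x. x \<notin> \<Omega> \<Longrightarrow> D x = 0"
    "AE x in lebesgue_on \<Omega>. indicator \<Omega> x * d x = D x" "integrable lborel (\<lambda>x. (D x)\<^sup>2)"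
    using square_integrable_representative[OF \<Omega> \<Omega> subset_refl sI] by auto
  have dD: "AE x in lebesgue_on \<Omega>. d x = D x"
    using AE_space D(3) by eventually_elim auto
  define r where "r n = inverse (real (Suc n))" for n
  have r0: "r \<longlonglongrightarrow> 0" unfolding r_def by (rule LIMSEQ_inverse_real_of_nat)
  have "\<exists>k::'a \<Rightarrow> real. smooth k \<and> (\<forall>x. 0 \<le> k x) \<and> (\<forall>x. x \<notin> cball 0 (r n) \<longrightarrow> k x = 0) \<and> (LINT x|lborel. k x) = 1" for n
  proof -
    have "0 < r n" by (simp add: r_def)
    from mollifier_exists[OF this, where 'a='a] show ?thesis by metis
  qed
  then obtain k :: "nat \<Rightarrow> 'a \<Rightarrow> real" where k: "\<And>n. smooth (k n)" "\<And>n x. 0 \<le> k n x"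
    "\<And>n x. x \<notin> cball 0 (r n) \<Longrightarrow> k n x = 0" "\<And>n. (LINT x|lborel. k n x) = 1"
    by metis
  have [measurable]: "D \<in> borel_measurable borel" "\<And>n. k n \<in> borel_measurable borel"
    using D(1) k(1) smooth_measurable by auto
  have lim: "(\<lambda>n. \<integral>\<^sup>+x. ennreal ((convol (k n) D x - D x)\<^sup>2) \<partial>lborel) \<longlonglongrightarrow> 0"
    by (rule mollification_tendsto[OF D(1,4) k r0])
  have "(\<lambda>x. convol (k n) D x - D x) \<in> borel_measurable lborel" for n
    unfolding convol_def by measurable
  from L2_AE_subseq[OF this lim] obtain s :: "nat \<Rightarrow> nat"
    where s: "strict_mono s" "AE x in lborel. (\<lambda>n. convol (k (s n)) D x - D x) \<longlonglongrightarrow> 0" by blast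
  have c0: "convol (k n) D x = 0" if sub: "cball x (r n) \<subseteq> \<Omega>" for n x
  proof -
    have zero: "k n (x + (-1) *\<^sub>R y) = 0" if "y \<notin> cball x (r n)" for y
      using that k(3)[of "x - y" n] by (simp add: dist_norm norm_minus_commute)
    have "smooth (\<lambda>y. k n (x + (-1) *\<^sub>R y))" by (rule smooth_affine[OF k(1)])
    then have "test_function \<Omega> (\<lambda>y. k n (x + (-1) *\<^sub>R y))"
      unfolding test_function_iff using zero sub compact_cball by blast
    then have "0 = (LINT y|lebesgue_on \<Omega>. d y * k n (x - y))" using z by force
    also have "\<dots> = (LINT y|lebesgue_on \<Omega>. k n (x - y) * D y)"
    proof (rule integral_cong_AE)
      have m: "(\<lambda>y. k n (x - y)) \<in> borel_measurable (lebesgue_on \<Omega>)"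
        "D \<in> borel_measurable (lebesgue_on \<Omega>)"
        by (auto intro: borel_lebesgue_on)
      show "(\<lambda>y. d y * k n (x - y)) \<in> borel_measurable (lebesgue_on \<Omega>)"
        by (intro borel_measurable_times square_integrable_D(1)[OF d] m)
      show "(\<lambda>y. k n (x - y) * D y) \<in> borel_measurable (lebesgue_on \<Omega>)"
        by (intro borel_measurable_times m)
      show "AE y in lebesgue_on \<Omega>. d y * k n (x - y) = k n (x - y) * D y"
        using dD by eventually_elim simp
    qed
    also have "\<dots> = convol (k n) D x"
      unfolding convol_def by (rule lebesgue_on_borel(1)[OF \<Omega>]) (use D(2) in auto)
    finally show ?thesis by simp
  qed
  have "AE x in lborel. x \<in> \<Omega> \<longrightarrow> D x = 0"
    using s(2)
  proof eventually_elim
    case (elim x)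
    show ?case
    proof
      assume "x \<in> \<Omega>"
      then obtain e where e: "e > 0" "cball x e \<subseteq> \<Omega>" using assms(1) open_contains_cball by blast
      have "eventually (\<lambda>n. r (s n) < e) sequentially"
        using LIMSEQ_subseq_LIMSEQ[OF r0 s(1)] e(1) by (intro order_tendstoD(2)[of _ 0]) (auto simp: o_def)
      then have "eventually (\<lambda>n. convol (k (s n)) D x - D x = - D x) sequentially"
      proof eventually_elim
        case (elim n)
        then have "cball x (r (s n)) \<subseteq> \<Omega>" using e(2) by (meson less_imp_le order_trans subset_cball)
        then show ?case by (simp add: c0)
      qed
      then have "(\<lambda>n. convol (k (s n)) D x - D x) \<longlonglongrightarrow> - D x" by (rule tendsto_eventually)
      from LIMSEQ_unique[OF this elim] show "D x = 0" by simp
    qed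
  qed
  from AE_completion[OF this] have "AE x in lebesgue_on \<Omega>. D x = 0"
    using \<Omega> by (subst AE_restrict_space_iff) (auto simp: sets_completionI_sets)
  with dD show ?thesis by eventually_elim simp
qed

lemma has_weak_partial_unique:
  fixes \<Omega> :: "'a::euclidean_space set"
  assumes "open \<Omega>" "has_weak_partial \<Omega> b u g" "has_weak_partial \<Omega> b u g'"
  shows "AE x in lebesgue_on \<Omega>. g x = g' x"
proof -
  have s: "square_integrable (lebesgue_on \<Omega>) g" "square_integrable (lebesgue_on \<Omega>) g'"
    using assms(2,3) by (auto simp: has_weak_partial_pd)
  have "AE x in lebesgue_on \<Omega>. g x - g' x = 0"
  proof (rule has_weak_partial_0_unique[OF assms(1) square_integrable_diff[OF s]])
    fix \<phi> assume \<phi>: "test_function \<Omega> \<phi>"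
    have "square_integrable (lebesgue_on \<Omega>) \<phi>"
      using test_function_square_integrable(1)[OF \<phi>] assms(1) by auto
    then show "(LINT x|lebesgue_on \<Omega>. (g x - g' x) * \<phi> x) = 0"
      using assms(2,3) \<phi> s by (simp add: left_diff_distrib integrable_mult_square_integrable has_weak_partial_pd)
  qed
  then show ?thesis by simp
qed

section \<open>The chosen weak derivatives and the \<open>H\<^sup>1\<close> norm\<close>

lemma has_weak_partial_weak_partial: "has_weak_partial \<Omega> b u g \<Longrightarrow> has_weak_partial \<Omega> b u (weak_partial \<Omega> b u)"
  unfolding weak_partial_def by (rule someI[of "has_weak_partial \<Omega> b u"])

lemma H1_weak_partial:
  assumes "u \<in> H1 \<Omega>" "b \<in> Basis" shows "has_weak_partial \<Omega> b u (weak_partial \<Omega> b u)"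
  using assms has_weak_partial_weak_partial by (fastforce simp: H1_def)

lemma smooth_H1:
  fixes \<Omega> :: "'a::euclidean_space set"
  shows "open \<Omega> \<Longrightarrow> bounded \<Omega> \<Longrightarrow> smooth U \<Longrightarrow> U \<in> H1 \<Omega>"
  using has_weak_partial_smooth[of \<Omega>] smooth_square_integrable[of U \<Omega>] by (fastforce simp: H1_def)

lemma H1_I:
  assumes "square_integrable (lebesgue_on \<Omega>) u" "\<And>b. b \<in> Basis \<Longrightarrow> has_weak_partial \<Omega> b u (g b)"
  shows "u \<in> H1 \<Omega>"
  using assms unfolding H1_def by blast

lemma H1_square_integrable: "u \<in> H1 \<Omega> \<Longrightarrow> square_integrable (lebesgue_on \<Omega>) u"
  by (simp add: H1_def)

lemma H1_add:
  fixes \<Omega> :: "'a::euclidean_space set"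
  assumes "open \<Omega>" "u \<in> H1 \<Omega>" "w \<in> H1 \<Omega>" shows "(\<lambda>x. u x + w x) \<in> H1 \<Omega>"
proof (rule H1_I)
  have B: "\<Omega> \<in> sets borel" using assms by auto
  show "square_integrable (lebesgue_on \<Omega>) (\<lambda>x. u x + w x)"
    by (intro square_integrable_add H1_square_integrable assms)
  show "has_weak_partial \<Omega> b (\<lambda>x. u x + w x) (\<lambda>x. weak_partial \<Omega> b u x + weak_partial \<Omega> b w x)"
    if "b \<in> Basis" for b
    by (intro has_weak_partial_add B that H1_square_integrable H1_weak_partial assms)
qed

lemma H1_cmult:
  fixes \<Omega> :: "'a::euclidean_space set"
  assumes "open \<Omega>" "bounded \<Omega>" "u \<in> H1 \<Omega>" shows "(\<lambda>x. c * u x) \<in> H1 \<Omega>"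
proof (rule H1_I)
  have B: "\<Omega> \<in> sets borel" using assms by auto
  show "square_integrable (lebesgue_on \<Omega>) (\<lambda>x. c * u x)"
    by (intro square_integrable_cmult H1_square_integrable assms)
  show "has_weak_partial \<Omega> b (\<lambda>x. c * u x) (\<lambda>x. pd b (\<lambda>x. c) x * u x + c * weak_partial \<Omega> b u x)"
    if "b \<in> Basis" for b
    by (intro has_weak_partial_mult B that H1_square_integrable H1_weak_partial assms smooth_const)
qed

lemma weak_partial_diff_AE:
  fixes \<Omega> :: "'a::euclidean_space set"
  assumes \<Omega>: "open \<Omega>" "bounded \<Omega>" and b: "b \<in> Basis"
    and u: "square_integrable (lebesgue_on \<Omega>) u" "has_weak_partial \<Omega> b u g"
    and w: "square_integrable (lebesgue_on \<Omega>) w" "has_weak_partial \<Omega> b w h"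
  shows "AE x in lebesgue_on \<Omega>. weak_partial \<Omega> b (\<lambda>x. u x - w x) x = g x - h x"
proof -
  have B: "\<Omega> \<in> sets borel" using \<Omega> by auto
  have "has_weak_partial \<Omega> b (\<lambda>x. (-1) * w x) (\<lambda>x. pd b (\<lambda>x. -1) x * w x + (-1) * h x)"
    by (rule has_weak_partial_mult[OF B \<Omega>(2) b smooth_const w])
  from has_weak_partial_add[OF B b u(1) square_integrable_cmult[OF w(1)] u(2) this]
  have "has_weak_partial \<Omega> b (\<lambda>x. u x - w x) (\<lambda>x. g x - h x)" by (simp add: pd_const)
  from has_weak_partial_unique[OF \<Omega>(1) has_weak_partial_weak_partial[OF this] this] show ?thesis .
qed

lemma L2_norm_nonneg: "0 \<le> L2_norm M f" by (simp add: L2_norm_def integral_nonneg_AE)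

lemma L2_norm_square:
  assumes "square_integrable M f"
  shows "ennreal ((L2_norm M f)\<^sup>2) = (\<integral>\<^sup>+x. ennreal ((f x)\<^sup>2) \<partial>M)"
  using nn_integral_eq_integral[OF square_integrable_D(2)[OF assms]] by (simp add: L2_norm_def)

lemma L2_norm_tendsto_iff:
  assumes "\<And>n. square_integrable M (f n)"
  shows "(\<lambda>n. L2_norm M (f n)) \<longlonglongrightarrow> 0 \<longleftrightarrow> (\<lambda>n. \<integral>\<^sup>+x. ennreal ((f n x)\<^sup>2) \<partial>M) \<longlonglongrightarrow> 0"
proof -
  have "(\<lambda>n. L2_norm M (f n)) \<longlonglongrightarrow> 0 \<longleftrightarrow> (\<lambda>n. (L2_norm M (f n))\<^sup>2) \<longlonglongrightarrow> 0"
  proof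
    assume "(\<lambda>n. (L2_norm M (f n))\<^sup>2) \<longlonglongrightarrow> 0"
    from tendsto_real_sqrt[OF this] show "(\<lambda>n. L2_norm M (f n)) \<longlonglongrightarrow> 0"
      by (simp add: L2_norm_nonneg)
  qed (use tendsto_power[of "\<lambda>n. L2_norm M (f n)" 0 _ 2] in simp)
  also have "\<dots> \<longleftrightarrow> (\<lambda>n. ennreal ((L2_norm M (f n))\<^sup>2)) \<longlonglongrightarrow> 0"
    by (simp add: ennreal_tendsto_0_iff)
  finally show ?thesis by (simp only: L2_norm_square[OF assms])
qed

lemma tendsto_sqrt_sum_squares_iff:
  fixes f :: "'i \<Rightarrow> nat \<Rightarrow> real"
  assumes "finite I"
  shows "(\<lambda>n. sqrt (\<Sum>i\<in>I. (f i n)\<^sup>2)) \<longlonglongrightarrow> 0 \<longleftrightarrow> (\<forall>i\<in>I. (\<lambda>n. f i n) \<longlonglongrightarrow> 0)"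
proof
  assume lim: "(\<lambda>n. sqrt (\<Sum>i\<in>I. (f i n)\<^sup>2)) \<longlonglongrightarrow> 0"
  show "\<forall>i\<in>I. (\<lambda>n. f i n) \<longlonglongrightarrow> 0"
  proof
    fix i assume i: "i \<in> I"
    have "\<bar>f i n\<bar> \<le> sqrt (\<Sum>i\<in>I. (f i n)\<^sup>2)" for n
      using member_le_sum[OF i, of "\<lambda>i. (f i n)\<^sup>2"] assms by (intro real_le_rsqrt) auto
    then show "(\<lambda>n. f i n) \<longlonglongrightarrow> 0"
      by (intro Lim_null_comparison[OF _ lim]) auto
  qed
next
  assume "\<forall>i\<in>I. (\<lambda>n. f i n) \<longlonglongrightarrow> 0"
  then have "(\<lambda>n. sqrt (\<Sum>i\<in>I. (f i n)\<^sup>2)) \<longlonglongrightarrow> sqrt (\<Sum>i\<in>I. 0\<^sup>2)" by (intro tendsto_intros) auto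
  then show "(\<lambda>n. sqrt (\<Sum>i\<in>I. (f i n)\<^sup>2)) \<longlonglongrightarrow> 0" by simp
qed

text \<open>\<open>H1_norm\<close> refers to representatives selected by
  \<open>weak_partial\<close>. Uniqueness up to null sets replaces them by whatever weak derivatives
  are at hand.\<close>

lemma H1_norm_tendsto_iff:
  fixes \<Omega> :: "'a::euclidean_space set"
  assumes \<Omega>: "open \<Omega>" "bounded \<Omega>" and U: "\<And>n. U n \<in> H1 \<Omega>" and u: "u \<in> H1 \<Omega>"
    and g: "\<And>b n. b \<in> Basis \<Longrightarrow> has_weak_partial \<Omega> b (U n) (G b n)"
      "\<And>b. b \<in> Basis \<Longrightarrow> has_weak_partial \<Omega> b u (g b)"
  shows "(\<lambda>n. H1_norm \<Omega> (\<lambda>x. U n x - u x)) \<longlonglongrightarrow> 0 \<longleftrightarrow>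
    (\<lambda>n. \<integral>\<^sup>+x. ennreal ((U n x - u x)\<^sup>2) \<partial>lebesgue_on \<Omega>) \<longlonglongrightarrow> 0 \<and>
    (\<forall>b\<in>Basis. (\<lambda>n. \<integral>\<^sup>+x. ennreal ((G b n x - g b x)\<^sup>2) \<partial>lebesgue_on \<Omega>) \<longlonglongrightarrow> 0)"
proof -
  let ?M = "lebesgue_on \<Omega>"
  have su: "square_integrable ?M u" "square_integrable ?M (U n)" for n using u U by (auto simp: H1_def)
  have dH: "(\<lambda>x. U n x - u x) \<in> H1 \<Omega>" for n
    using H1_add[OF \<Omega>(1) U H1_cmult[OF \<Omega> u, of "-1"]] by simp
  \<comment> \<open>The norm is read as the root of a two-term sum of squares indexed by booleans;
    the same lemma then serves for this sum and for the gradient.\<close>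
  have "(\<lambda>n. H1_norm \<Omega> (\<lambda>x. U n x - u x)) \<longlonglongrightarrow> 0 \<longleftrightarrow>
    (\<lambda>n. sqrt (\<Sum>i\<in>{True, False}. (if i then L2_norm ?M (\<lambda>x. U n x - u x) else grad_norm \<Omega> (\<lambda>x. U n x - u x))\<^sup>2)) \<longlonglongrightarrow> 0"
    unfolding H1_norm_def by simp
  also have "\<dots> \<longleftrightarrow> (\<lambda>n. L2_norm ?M (\<lambda>x. U n x - u x)) \<longlonglongrightarrow> 0 \<and> (\<lambda>n. grad_norm \<Omega> (\<lambda>x. U n x - u x)) \<longlonglongrightarrow> 0"
    by (subst tendsto_sqrt_sum_squares_iff) auto
  also have "(\<lambda>n. grad_norm \<Omega> (\<lambda>x. U n x - u x)) \<longlonglongrightarrow> 0 \<longleftrightarrow>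
    (\<forall>b\<in>Basis. (\<lambda>n. L2_norm ?M (weak_partial \<Omega> b (\<lambda>x. U n x - u x))) \<longlonglongrightarrow> 0)"
    unfolding grad_norm_def by (subst tendsto_sqrt_sum_squares_iff) auto
  also have "\<dots> \<longleftrightarrow> (\<forall>b\<in>Basis. (\<lambda>n. \<integral>\<^sup>+x. ennreal ((G b n x - g b x)\<^sup>2) \<partial>?M) \<longlonglongrightarrow> 0)"
  proof (rule ball_cong[OF refl])
    fix b :: 'a assume b: "b \<in> Basis"
    have sq: "square_integrable ?M (weak_partial \<Omega> b (\<lambda>x. U n x - u x))" for n
      using H1_weak_partial[OF dH b] by (simp add: has_weak_partial_pd)
    have "(\<integral>\<^sup>+x. ennreal ((weak_partial \<Omega> b (\<lambda>x. U n x - u x) x)\<^sup>2) \<partial>?M) = (\<integral>\<^sup>+x. ennreal ((G b n x - g b x)\<^sup>2) \<partial>?M)" for n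
      by (rule nn_integral_cong_AE)
        (use weak_partial_diff_AE[OF \<Omega> b su(2) g(1)[OF b] su(1) g(2)[OF b], of n] in eventually_elim, simp)
    then show "(\<lambda>n. L2_norm ?M (weak_partial \<Omega> b (\<lambda>x. U n x - u x))) \<longlonglongrightarrow> 0 \<longleftrightarrow>
       (\<lambda>n. \<integral>\<^sup>+x. ennreal ((G b n x - g b x)\<^sup>2) \<partial>?M) \<longlonglongrightarrow> 0"
      by (simp add: L2_norm_tendsto_iff[OF sq])
  qed
  also have "(\<lambda>n. L2_norm ?M (\<lambda>x. U n x - u x)) \<longlonglongrightarrow> 0 \<longleftrightarrow> (\<lambda>n. \<integral>\<^sup>+x. ennreal ((U n x - u x)\<^sup>2) \<partial>?M) \<longlonglongrightarrow> 0"
    by (rule L2_norm_tendsto_iff) (intro square_integrable_diff su)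
  finally show ?thesis .
qed

section \<open>Density of smooth functions\<close>

lemma indicator_mult_eq:
  fixes W :: "'a \<Rightarrow> real"
  assumes "\<And>x. x \<notin> K \<Longrightarrow> W x = 0" shows "(\<lambda>x. indicator K x * W x) = W"
proof
  fix x show "indicator K x * W x = W x" using assms[of x] by (cases "x \<in> K") auto
qed

text \<open>The Sobolev space of order \<open>m\<close> with support in \<open>K\<close>.
  Derivatives are quantified existentially, not taken from \<open>weak_partial\<close>, so that they
  too can be required to vanish at every point off \<open>K\<close>.\<close>

primrec Hsob :: "'a::euclidean_space set \<Rightarrow> 'a set \<Rightarrow> nat \<Rightarrow> ('a \<Rightarrow> real) \<Rightarrow> bool" where
  "Hsob \<Omega> K 0 u \<longleftrightarrow> square_integrable (lebesgue_on \<Omega>) u \<and> (\<forall>x. x \<notin> K \<longrightarrow> u x = 0)"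
| "Hsob \<Omega> K (Suc m) u \<longleftrightarrow> square_integrable (lebesgue_on \<Omega>) u \<and> (\<forall>x. x \<notin> K \<longrightarrow> u x = 0) \<and>
     (\<forall>b\<in>Basis. \<exists>g. has_weak_partial \<Omega> b u g \<and> Hsob \<Omega> K m g)"

text \<open>Convergence of order \<open>m\<close> of smooth functions: their classical derivatives
  are compared with weak derivatives of the limit. Orders 1 and 2 are treated uniformly in this
  way.\<close>

primrec Hconv :: "'a::euclidean_space set \<Rightarrow> nat \<Rightarrow> (nat \<Rightarrow> 'a \<Rightarrow> real) \<Rightarrow> ('a \<Rightarrow> real) \<Rightarrow> bool" where
  "Hconv \<Omega> 0 U u \<longleftrightarrow> (\<lambda>n. \<integral>\<^sup>+x. ennreal ((U n x - u x)\<^sup>2) \<partial>lebesgue_on \<Omega>) \<longlonglongrightarrow> 0"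
| "Hconv \<Omega> (Suc m) U u \<longleftrightarrow> (\<lambda>n. \<integral>\<^sup>+x. ennreal ((U n x - u x)\<^sup>2) \<partial>lebesgue_on \<Omega>) \<longlonglongrightarrow> 0 \<and>
     (\<forall>b\<in>Basis. \<exists>g. has_weak_partial \<Omega> b u g \<and> Hconv \<Omega> m (\<lambda>n. pd b (U n)) g)"

lemma Hsob_imp: "Hsob \<Omega> K m u \<Longrightarrow> square_integrable (lebesgue_on \<Omega>) u \<and> (\<forall>x. x \<notin> K \<longrightarrow> u x = 0)"
  by (cases m) auto

lemma Hconv_imp: "Hconv \<Omega> m U u \<Longrightarrow> (\<lambda>n. \<integral>\<^sup>+x. ennreal ((U n x - u x)\<^sup>2) \<partial>lebesgue_on \<Omega>) \<longlonglongrightarrow> 0"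
  by (cases m) auto

lemma Hsob_lower: "Hsob \<Omega> K (Suc m) u \<Longrightarrow> Hsob \<Omega> K m u"
proof (induction m arbitrary: u)
  case (Suc m)
  have "\<exists>g. has_weak_partial \<Omega> b u g \<and> Hsob \<Omega> K m g" if "b \<in> Basis" for b
    using Suc.prems Suc.IH that unfolding Hsob.simps(2)[of _ _ "Suc m"] by blast
  then show ?case using Suc.prems by simp
qed simp

lemma Hsob_mono:
  assumes "Hsob \<Omega> K m u" "K \<subseteq> K'" shows "Hsob \<Omega> K' m u"
  using assms
proof (induction m arbitrary: u)
  case (Suc m)
  have "\<exists>g. has_weak_partial \<Omega> b u g \<and> Hsob \<Omega> K' m g" if "b \<in> Basis" for b
    using Suc.prems Suc.IH that by fastforce
  then show ?case using Suc.prems by auto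
qed auto

lemma Hsob_add:
  assumes "\<Omega> \<in> sets borel" "Hsob \<Omega> K m u" "Hsob \<Omega> K m w"
  shows "Hsob \<Omega> K m (\<lambda>x. u x + w x)"
  using assms(2,3)
proof (induction m arbitrary: u w)
  case 0
  then show ?case by (auto intro: square_integrable_add)
next
  case (Suc m)
  have "\<exists>g. has_weak_partial \<Omega> b (\<lambda>x. u x + w x) g \<and> Hsob \<Omega> K m g" if b: "b \<in> Basis" for b
  proof -
    obtain g h where "has_weak_partial \<Omega> b u g" "Hsob \<Omega> K m g" "has_weak_partial \<Omega> b w h" "Hsob \<Omega> K m h"
      using Suc.prems b unfolding Hsob.simps by blast
    then show ?thesis
      using has_weak_partial_add[OF assms(1) b, of u w g h] Suc.IH[of g h] Suc.prems by auto
  qed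
  then show ?case using Suc.prems by (auto intro: square_integrable_add)
qed

text \<open>Since \<open>S\<close> is open, the derivatives of \<open>\<beta>\<close> vanish on it
  together with \<open>\<beta>\<close>; hence the support shrinks to \<open>K - S\<close> for the
  derivatives of the product as well.\<close>

lemma Hsob_mult:
  assumes \<Omega>: "\<Omega> \<in> sets borel" "bounded \<Omega>"
    and u: "Hsob \<Omega> K m u" and \<beta>: "smooth \<beta>" and S: "open S" "\<And>x. x \<in> S \<Longrightarrow> \<beta> x = 0"
  shows "Hsob \<Omega> (K - S) m (\<lambda>x. \<beta> x * u x)"
  using u \<beta> S(2)
proof (induction m arbitrary: u \<beta>)
  case 0
  then show ?case by (auto intro: square_integrable_smooth_mult \<Omega>)
next
  case (Suc m)
  have u: "square_integrable (lebesgue_on \<Omega>) u" using Suc.prems by simp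
  have "\<exists>g. has_weak_partial \<Omega> b (\<lambda>x. \<beta> x * u x) g \<and> Hsob \<Omega> (K - S) m g" if b: "b \<in> Basis" for b
  proof -
    obtain g where g: "has_weak_partial \<Omega> b u g" "Hsob \<Omega> K m g"
      using Suc.prems b unfolding Hsob.simps by blast
    have "Hsob \<Omega> (K - S) m (\<lambda>x. pd b \<beta> x * u x)"
      by (rule Suc.IH[OF Hsob_lower[OF Suc.prems(1)] smooth_pd[OF Suc.prems(2) b]])
        (use pd_zero_open[OF S(1)] Suc.prems(3) in blast)
    moreover have "Hsob \<Omega> (K - S) m (\<lambda>x. \<beta> x * g x)"
      by (rule Suc.IH[OF g(2) Suc.prems(2,3)])
    ultimately have "Hsob \<Omega> (K - S) m (\<lambda>x. pd b \<beta> x * u x + \<beta> x * g x)"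
      by (rule Hsob_add[OF \<Omega>(1)])
    with has_weak_partial_mult[OF \<Omega> b Suc.prems(2) u g(1)] show ?thesis by blast
  qed
  then show ?case
    using Suc.prems square_integrable_smooth_mult[OF Suc.prems(2) \<Omega>(2) u] by auto
qed

lemma Hsob_restrict:
  assumes "Hsob \<Omega> K m u" shows "Hsob \<Omega> (K \<inter> \<Omega>) m (\<lambda>x. indicator \<Omega> x * u x)"
  using assms
proof (induction m arbitrary: u)
  case 0
  then show ?case using square_integrable_cong[of "lebesgue_on \<Omega>" u "\<lambda>x. indicator \<Omega> x * u x"]
    by (auto simp: indicator_def)
next
  case (Suc m)
  have "\<exists>g. has_weak_partial \<Omega> b (\<lambda>x. indicator \<Omega> x * u x) g \<and> Hsob \<Omega> (K \<inter> \<Omega>) m g" if b: "b \<in> Basis" for b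
  proof -
    obtain g where g: "has_weak_partial \<Omega> b u g" "Hsob \<Omega> K m g"
      using Suc.prems b unfolding Hsob.simps by blast
    have "has_weak_partial \<Omega> b (\<lambda>x. indicator \<Omega> x * u x) (\<lambda>x. indicator \<Omega> x * g x)"
      by (rule has_weak_partial_cong[OF g(1)]) auto
    with Suc.IH[OF g(2)] show ?thesis by blast
  qed
  then show ?case
    using Suc.prems square_integrable_cong[of "lebesgue_on \<Omega>" u "\<lambda>x. indicator \<Omega> x * u x"]
    by (auto simp: indicator_def)
qed

lemma Hconv_cong:
  assumes "open \<Omega>" "Hconv \<Omega> m U u" "\<And>n. smooth (U n)"
    and "\<And>n x. x \<in> \<Omega> \<Longrightarrow> U n x = V n x" "\<And>x. x \<in> \<Omega> \<Longrightarrow> u x = w x"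
  shows "Hconv \<Omega> m V w"
  using assms(2-5)
proof (induction m arbitrary: U V u w)
  case 0
  have "(\<integral>\<^sup>+x. ennreal ((U n x - u x)\<^sup>2) \<partial>lebesgue_on \<Omega>) = (\<integral>\<^sup>+x. ennreal ((V n x - w x)\<^sup>2) \<partial>lebesgue_on \<Omega>)" for n
    by (rule nn_integral_cong) (use 0 in auto)
  then show ?case using 0 by simp
next
  case (Suc m)
  have "(\<integral>\<^sup>+x. ennreal ((U n x - u x)\<^sup>2) \<partial>lebesgue_on \<Omega>) = (\<integral>\<^sup>+x. ennreal ((V n x - w x)\<^sup>2) \<partial>lebesgue_on \<Omega>)" for n
    by (rule nn_integral_cong) (use Suc.prems in auto)
  moreover have "\<exists>g. has_weak_partial \<Omega> b w g \<and> Hconv \<Omega> m (\<lambda>n. pd b (V n)) g" if b: "b \<in> Basis" for b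
  proof -
    obtain g where g: "has_weak_partial \<Omega> b u g" "Hconv \<Omega> m (\<lambda>n. pd b (U n)) g"
      using Suc.prems b unfolding Hconv.simps by blast
    have "Hconv \<Omega> m (\<lambda>n. pd b (V n)) g"
      by (rule Suc.IH[OF g(2)])
        (use smooth_pd[OF Suc.prems(2) b] pd_cong_open[OF assms(1) _ Suc.prems(2), of _ _ "V _"] Suc.prems(3) in auto)
    moreover have "has_weak_partial \<Omega> b w g"
      by (rule has_weak_partial_cong[OF g(1)]) (use Suc.prems in auto)
    ultimately show ?thesis by blast
  qed
  ultimately show ?case using Suc.prems(1) by simp
qed

lemma Hconv_add:
  fixes \<Omega> :: "'a::euclidean_space set"
  assumes \<Omega>: "\<Omega> \<in> sets borel" "bounded \<Omega>"
    and "Hconv \<Omega> m U u" "Hconv \<Omega> m V w" "\<And>n. smooth (U n)" "\<And>n. smooth (V n)"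
    and "square_integrable (lebesgue_on \<Omega>) u" "square_integrable (lebesgue_on \<Omega>) w"
  shows "Hconv \<Omega> m (\<lambda>n x. U n x + V n x) (\<lambda>x. u x + w x)"
  using assms(3-8)
proof (induction m arbitrary: U V u w)
  have L2: "(\<lambda>n. \<integral>\<^sup>+x. ennreal ((U n x + V n x - (u x + w x))\<^sup>2) \<partial>lebesgue_on \<Omega>) \<longlonglongrightarrow> 0"
    if "(\<lambda>n. \<integral>\<^sup>+x. ennreal ((U n x - u x)\<^sup>2) \<partial>lebesgue_on \<Omega>) \<longlonglongrightarrow> 0"
      "(\<lambda>n. \<integral>\<^sup>+x. ennreal ((V n x - w x)\<^sup>2) \<partial>lebesgue_on \<Omega>) \<longlonglongrightarrow> 0"
      "\<And>n. smooth (U n)" "\<And>n. smooth (V n)"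
      "square_integrable (lebesgue_on \<Omega>) u" "square_integrable (lebesgue_on \<Omega>) w"
    for U V :: "nat \<Rightarrow> 'a \<Rightarrow> real" and u w
  proof -
    have "(\<lambda>x. U n x - u x) \<in> borel_measurable (lebesgue_on \<Omega>)" "(\<lambda>x. V n x - w x) \<in> borel_measurable (lebesgue_on \<Omega>)" for n
      using that(3-6)
      by (intro borel_measurable_diff square_integrable_D(1) borel_lebesgue_on[OF smooth_measurable]; simp)+
    from L2_tendsto_add[OF this that(1,2)] show ?thesis by (simp add: algebra_simps)
  qed
  {
    case 0
    then show ?case using L2[of U u V w] by simp
  next
    case (Suc m)
    have "\<exists>g. has_weak_partial \<Omega> b (\<lambda>x. u x + w x) g \<and> Hconv \<Omega> m (\<lambda>n. pd b (\<lambda>x. U n x + V n x)) g" if b: "b \<in> Basis" for b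
    proof -
      obtain g h where g: "has_weak_partial \<Omega> b u g" "Hconv \<Omega> m (\<lambda>n. pd b (U n)) g"
        and h: "has_weak_partial \<Omega> b w h" "Hconv \<Omega> m (\<lambda>n. pd b (V n)) h"
        using Suc.prems b unfolding Hconv.simps by blast
      have "Hconv \<Omega> m (\<lambda>n x. pd b (U n) x + pd b (V n) x) (\<lambda>x. g x + h x)"
        by (rule Suc.IH[OF g(2) h(2)])
          (use g(1) h(1) smooth_pd[OF _ b] Suc.prems in \<open>auto simp: has_weak_partial_pd\<close>)
      moreover have "(\<lambda>x. pd b (U n) x + pd b (V n) x) = pd b (\<lambda>x. U n x + V n x)" for n
        using pd_add[OF Suc.prems(3,4)] by auto
      ultimately show ?thesis
        using has_weak_partial_add[OF \<Omega>(1) b Suc.prems(5,6) g(1) h(1)] by auto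
    qed
    moreover have "(\<lambda>n. \<integral>\<^sup>+x. ennreal ((U n x + V n x - (u x + w x))\<^sup>2) \<partial>lebesgue_on \<Omega>) \<longlonglongrightarrow> 0"
      by (rule L2) (use Suc.prems in auto)
    ultimately show ?case by simp
  }
qed

text \<open>The assumption \<open>cases\<close> offers two reasons why convolution and weak
  derivative commute at \<open>x\<close>. Either the kernel meets only a compact part of \<Omega>,
  so that its reflection is a test function, or it misses \<open>K\<close> for all points near
  \<open>x\<close>, and both sides are 0.\<close>

lemma Hsob_mollification:
  fixes \<Omega> :: "'a::euclidean_space set"
  assumes \<Omega>: "\<Omega> \<in> sets borel" "bounded \<Omega>" "open \<Omega>" and K: "K \<in> sets borel" "K \<subseteq> \<Omega>"
    and k: "\<And>n. smooth (k n)" "\<And>n x. 0 \<le> k n x" "\<And>n x. x \<notin> cball 0 (r n) \<Longrightarrow> k n x = 0"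
      "\<And>n. (LINT x|lborel. k n x) = 1" "r \<longlonglongrightarrow> 0"
    and cases: "\<And>n x. x \<in> \<Omega> \<Longrightarrow> (\<exists>C. compact C \<and> C \<subseteq> \<Omega> \<and> (\<forall>y. y \<notin> C \<longrightarrow> k n (x - y) = 0)) \<or>
      (\<exists>S. open S \<and> x \<in> S \<and> (\<forall>x'\<in>S. \<forall>y\<in>K. k n (x' - y) = 0))"
    and u: "Hsob \<Omega> K m u" and W: "W \<in> borel_measurable borel" "\<And>x. x \<notin> K \<Longrightarrow> W x = 0"
      "AE x in lebesgue_on \<Omega>. u x = W x" "integrable lborel (\<lambda>x. (W x)\<^sup>2)"
  shows "Hconv \<Omega> m (\<lambda>n. convol (k n) W) u"
  using u W
proof (induction m arbitrary: u W)
  have L2: "(\<lambda>n. \<integral>\<^sup>+x. ennreal ((convol (k n) W x - u x)\<^sup>2) \<partial>lebesgue_on \<Omega>) \<longlonglongrightarrow> 0"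
    if W: "W \<in> borel_measurable borel" "AE x in lebesgue_on \<Omega>. u x = W x" "integrable lborel (\<lambda>x. (W x)\<^sup>2)"
    for u W
  proof (rule tendsto_sandwich[OF _ _ tendsto_const mollification_tendsto[OF W(1,3) k]])
    have "(\<integral>\<^sup>+x. ennreal ((convol (k n) W x - u x)\<^sup>2) \<partial>lebesgue_on \<Omega>)
      \<le> (\<integral>\<^sup>+x. ennreal ((convol (k n) W x - W x)\<^sup>2) \<partial>lborel)" for n
    proof -
      have [measurable]: "k n \<in> borel_measurable borel" "W \<in> borel_measurable borel"
        using smooth_measurable[OF k(1)] W by auto
      have "(\<integral>\<^sup>+x. ennreal ((convol (k n) W x - u x)\<^sup>2) \<partial>lebesgue_on \<Omega>)
        = (\<integral>\<^sup>+x. ennreal ((convol (k n) W x - W x)\<^sup>2) \<partial>lebesgue_on \<Omega>)"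
        by (rule nn_integral_cong_AE) (use W(2) in eventually_elim, simp)
      also have "\<dots> = (\<integral>\<^sup>+x. ennreal ((convol (k n) W x - W x)\<^sup>2) * indicator \<Omega> x \<partial>lborel)"
        unfolding convol_def by (rule nn_integral_lebesgue_on_borel[OF \<Omega>(1)]) measurable
      also have "\<dots> \<le> (\<integral>\<^sup>+x. ennreal ((convol (k n) W x - W x)\<^sup>2) \<partial>lborel)"
        by (rule nn_integral_mono) (auto simp: indicator_def)
      finally show ?thesis .
    qed
    then show "eventually (\<lambda>n. (\<integral>\<^sup>+x. ennreal ((convol (k n) W x - u x)\<^sup>2) \<partial>lebesgue_on \<Omega>)
      \<le> (\<integral>\<^sup>+x. ennreal ((convol (k n) W x - W x)\<^sup>2) \<partial>lborel)) sequentially" by simp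
  qed auto
  have int: "integrable lborel W" if W: "W \<in> borel_measurable borel" "\<And>x. x \<notin> K \<Longrightarrow> W x = 0"
    "integrable lborel (\<lambda>x. (W x)\<^sup>2)" for W :: "'a \<Rightarrow> real"
  proof -
    have fin: "emeasure lborel K < \<infinity>"
      using emeasure_bounded_finite[of K] bounded_subset[OF \<Omega>(2) K(2)] by simp
    have "integrable lborel (\<lambda>x. indicator K x * W x)"
      by (rule integrable_mult_square)
        (use W K fin in \<open>auto simp: power2_eq_square indicator_inter_arith[symmetric] integrable_indicator_iff\<close>)
    moreover have "(\<lambda>x. indicator K x * W x) = W" using W(2) by (rule indicator_mult_eq)
    ultimately show ?thesis by simp
  qed
  {
    case 0
    show ?case unfolding Hconv.simps by (rule L2[OF 0(2,4,5)])
  next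
    case (Suc m)
    have "\<exists>g. has_weak_partial \<Omega> b u g \<and> Hconv \<Omega> m (\<lambda>n. pd b (convol (k n) W)) g" if b: "b \<in> Basis" for b
    proof -
      obtain g where g: "has_weak_partial \<Omega> b u g" "Hsob \<Omega> K m g"
        using Suc.prems b unfolding Hsob.simps by blast
      have gs: "square_integrable (lebesgue_on \<Omega>) g" "\<And>x. x \<notin> K \<Longrightarrow> g x = 0"
        using Hsob_imp[OF g(2)] by auto
      obtain G where G: "G \<in> borel_measurable borel" "\<And>x. x \<notin> K \<Longrightarrow> G x = 0"
        "AE x in lebesgue_on \<Omega>. g x = G x" "integrable lborel (\<lambda>x. (G x)\<^sup>2)"
        using square_integrable_representative[OF K(1) \<Omega>(1) K(2) gs] by blast
      note Wint = int[OF Suc.prems(2,3,5)] and Gint = int[OF G(1,2,4)]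
      have um: "u \<in> borel_measurable (lebesgue_on \<Omega>)" and gm: "g \<in> borel_measurable (lebesgue_on \<Omega>)"
        using square_integrable_D(1)[OF conjunct1[OF Hsob_imp[OF Suc.prems(1)]]] square_integrable_D(1)[OF gs(1)]
        by blast+
      have eqc: "convol (k n) G x = pd b (convol (k n) W) x" if x: "x \<in> \<Omega>" for n x
      proof -
        have pc: "pd b (convol (k n) W) x = convol (pd b (k n)) W x"
          using pd_convol[where k="k n" and K="cball 0 (r n)", OF k(1) compact_cball k(3) Wint] by simp
        show ?thesis
          using cases[OF x, of n]
        proof
          assume "\<exists>C. compact C \<and> C \<subseteq> \<Omega> \<and> (\<forall>y. y \<notin> C \<longrightarrow> k n (x - y) = 0)"
          then have tf: "test_function \<Omega> (\<lambda>y. k n (x + (-1) *\<^sub>R y))"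
            unfolding test_function_iff using smooth_affine[OF k(1), of n x "-1"] by auto
          have [measurable]: "(\<lambda>y. k n (x - y)) \<in> borel_measurable borel" "(\<lambda>y. pd b (k n) (x - y)) \<in> borel_measurable borel"
            using smooth_measurable[OF k(1), of n] smooth_measurable[OF smooth_pd[OF k(1) b], of n] by auto
          note mm = borel_lebesgue_on[of "\<lambda>y. k n (x - y)" \<Omega>] borel_lebesgue_on[of "\<lambda>y. pd b (k n) (x - y)" \<Omega>]
             borel_lebesgue_on[OF Suc.prems(2), of \<Omega>] borel_lebesgue_on[OF G(1), of \<Omega>] um gm
          have "(LINT y|lebesgue_on \<Omega>. u y * pd b (\<lambda>y. k n (x + (-1) *\<^sub>R y)) y)
             = - (LINT y|lebesgue_on \<Omega>. g y * k n (x + (-1) *\<^sub>R y))"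
            using g(1) tf unfolding has_weak_partial_pd by blast
          \<comment> \<open>Differentiating the reflected kernel in \<open>y\<close> produces a
            minus sign, which cancels the one in the definition of the weak derivative.\<close>
          then have "(LINT y|lebesgue_on \<Omega>. u y * - pd b (k n) (x - y)) = - (LINT y|lebesgue_on \<Omega>. g y * k n (x - y))"
            unfolding pd_affine[OF k(1)] by simp
          then have "(LINT y|lebesgue_on \<Omega>. u y * pd b (k n) (x - y)) = (LINT y|lebesgue_on \<Omega>. g y * k n (x - y))"
            by simp
          moreover have "(LINT y|lebesgue_on \<Omega>. u y * pd b (k n) (x - y)) = (LINT y|lebesgue_on \<Omega>. pd b (k n) (x - y) * W y)"
          proof (rule integral_cong_AE)
            show "AE y in lebesgue_on \<Omega>. u y * pd b (k n) (x - y) = pd b (k n) (x - y) * W y"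
              using Suc.prems(4) by eventually_elim simp
          qed (intro borel_measurable_times mm; measurable)+
          moreover have "(LINT y|lebesgue_on \<Omega>. g y * k n (x - y)) = (LINT y|lebesgue_on \<Omega>. k n (x - y) * G y)"
          proof (rule integral_cong_AE)
            show "AE y in lebesgue_on \<Omega>. g y * k n (x - y) = k n (x - y) * G y"
              using G(3) by eventually_elim simp
          qed (intro borel_measurable_times mm; measurable)+
          moreover have "(LINT y|lebesgue_on \<Omega>. pd b (k n) (x - y) * W y) = convol (pd b (k n)) W x"
            unfolding convol_def using Suc.prems(2,3) K(2) by (intro lebesgue_on_borel(1)[OF \<Omega>(1)]) auto
          moreover have "(LINT y|lebesgue_on \<Omega>. k n (x - y) * G y) = convol (k n) G x"
            unfolding convol_def using G(1,2) K(2) by (intro lebesgue_on_borel(1)[OF \<Omega>(1)]) auto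
          ultimately show ?thesis using pc by simp
        next
          \<comment> \<open>A whole neighbourhood of \<open>x\<close> is required because the
            derivative of the kernel has to vanish too, not only its value.\<close>
          assume "\<exists>S. open S \<and> x \<in> S \<and> (\<forall>x'\<in>S. \<forall>y\<in>K. k n (x' - y) = 0)"
          then obtain S where S: "open S" "x \<in> S" "\<And>x' y. x' \<in> S \<Longrightarrow> y \<in> K \<Longrightarrow> k n (x' - y) = 0" by blast
          have "k n (x - y) * G y = 0" for y
            using S(2) S(3)[of x y] G(2)[of y] by (cases "y \<in> K") auto
          moreover have "pd b (k n) (x - y) * W y = 0" for y
          proof (cases "y \<in> K")
            case True
            have "pd b (k n) (x - y) = 0"
            proof (rule pd_zero_open)
              show "open ((+) (- y) ` S)" by (rule open_translation[OF S(1)])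
              show "x - y \<in> (+) (- y) ` S" using S(2) by (auto simp: image_iff)
              show "k n z = 0" if "z \<in> (+) (- y) ` S" for z
                using that S(3)[OF _ True] by (auto simp: image_iff)
            qed
            then show ?thesis by simp
          qed (use Suc.prems(3) in auto)
          ultimately show ?thesis unfolding pc convol_def by (simp only:)
        qed
      qed
      have sm: "smooth (convol (k n) G)" for n
        by (rule smooth_convol[where K="cball 0 (r n)", OF k(1) compact_cball k(3) Gint])
      have "Hconv \<Omega> m (\<lambda>n. convol (k n) G) g"
        by (rule Suc.IH[OF g(2) G(1) _ G(3,4)]) (rule G(2))
      from Hconv_cong[OF \<Omega>(3) this sm eqc refl]
      have "Hconv \<Omega> m (\<lambda>n. pd b (convol (k n) W)) g" .
      with g(1) show ?thesis by blast
    qed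
    moreover have "(\<lambda>n. \<integral>\<^sup>+x. ennreal ((convol (k n) W x - u x)\<^sup>2) \<partial>lebesgue_on \<Omega>) \<longlonglongrightarrow> 0"
      by (rule L2[OF Suc.prems(2,4,5)])
    ultimately show ?case by simp
  }
qed

text \<open>
  The kernels \<open>k n\<close> are not centred: near \<open>p\<close>, convolution with \<open>k n\<close> at a point of \<open>\<Omega>\<close> only uses values
  inside \<open>\<Omega>\<close>, so it commutes with weak derivatives in \<open>\<Omega>\<close>.
\<close>

definition mollifiable_at :: "'a::euclidean_space set \<Rightarrow> 'a \<Rightarrow> bool" where
  "mollifiable_at \<Omega> p \<longleftrightarrow> (\<exists>\<rho>>0. \<exists>k r. (\<forall>n. smooth (k n)) \<and> (\<forall>n x. 0 \<le> k n x) \<and>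
     (\<forall>n x. x \<notin> cball 0 (r n) \<longrightarrow> k n x = 0) \<and> (\<forall>n. (LINT x|lborel. k n x) = 1) \<and> r \<longlonglongrightarrow> 0 \<and>
     (\<forall>n. r n \<le> \<rho>) \<and>
     (\<forall>n x. x \<in> \<Omega> \<longrightarrow> dist p x < 4 * \<rho> \<longrightarrow>
        (\<exists>C. compact C \<and> C \<subseteq> \<Omega> \<and> (\<forall>y. y \<notin> C \<longrightarrow> k n (x - y) = 0))))"

text \<open>The function lives within distance \<open>2 * \<rho>\<close> of \<open>p\<close> and the
  kernels have radius at most \<open>\<rho>\<close>, so points farther than
  \<open>3 * \<rho>\<close> are not reached. Points closer than \<open>4 * \<rho>\<close> are
  covered by the defining property of \<open>mollifiable_at\<close>; the overlap makes both
  alternatives available with an open set.\<close>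

lemma mollifiable_at_approx:
  fixes \<Omega> :: "'a::euclidean_space set"
  assumes \<Omega>: "bounded \<Omega>" "open \<Omega>" and "mollifiable_at \<Omega> p"
  obtains \<rho> where "0 < \<rho>" "\<And>m u. Hsob \<Omega> (\<Omega> \<inter> cball p (2 * \<rho>)) m u \<Longrightarrow> \<exists>U. (\<forall>n. smooth (U n)) \<and> Hconv \<Omega> m U u"
proof -
  obtain \<rho> and k :: "nat \<Rightarrow> 'a \<Rightarrow> real" and r where \<rho>: "\<rho> > 0" and k: "\<And>n. smooth (k n)" "\<And>n x. 0 \<le> k n x"
      "\<And>n x. x \<notin> cball 0 (r n) \<Longrightarrow> k n x = 0" "\<And>n. (LINT x|lborel. k n x) = 1" "r \<longlonglongrightarrow> 0"
      and r: "\<And>n. r n \<le> \<rho>" and C: "\<And>n x. x \<in> \<Omega> \<Longrightarrow> dist p x < 4 * \<rho> \<Longrightarrow>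
        \<exists>C. compact C \<and> C \<subseteq> \<Omega> \<and> (\<forall>y. y \<notin> C \<longrightarrow> k n (x - y) = 0)"
    using assms(3) unfolding mollifiable_at_def by blast
  show ?thesis
  proof (rule that[OF \<rho>])
    fix m u assume u: "Hsob \<Omega> (\<Omega> \<inter> cball p (2 * \<rho>)) m u"
    let ?K = "\<Omega> \<inter> cball p (2 * \<rho>)"
    have B: "\<Omega> \<in> sets borel" "?K \<in> sets borel" "?K \<subseteq> \<Omega>" using \<Omega> by auto
    have us: "square_integrable (lebesgue_on \<Omega>) u" "\<And>x. x \<notin> ?K \<Longrightarrow> u x = 0"
      using Hsob_imp[OF u] by auto
    obtain W where W: "W \<in> borel_measurable borel" "\<And>x. x \<notin> ?K \<Longrightarrow> W x = 0"
      "AE x in lebesgue_on \<Omega>. u x = W x" "integrable lborel (\<lambda>x. (W x)\<^sup>2)"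
      using square_integrable_representative[OF B(2,1,3) us] by blast
    have "Hconv \<Omega> m (\<lambda>n. convol (k n) W) u"
    proof (rule Hsob_mollification[OF B(1) \<Omega> B(2,3) k _ u W])
      fix n x assume x: "x \<in> \<Omega>"
      show "(\<exists>C. compact C \<and> C \<subseteq> \<Omega> \<and> (\<forall>y. y \<notin> C \<longrightarrow> k n (x - y) = 0)) \<or>
        (\<exists>S. open S \<and> x \<in> S \<and> (\<forall>x'\<in>S. \<forall>y\<in>?K. k n (x' - y) = 0))"
      proof (cases "dist p x < 4 * \<rho>")
        case True then show ?thesis using C[OF x] by blast
      next
        case False
        have "k n (x' - y) = 0" if "x' \<in> - cball p (3 * \<rho>)" "y \<in> ?K" for x' y
        proof (rule k(3))
          have "dist p x' \<le> dist p y + dist y x'" by (rule dist_triangle)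
          then have "dist y x' > \<rho>" using that by auto
          then show "x' - y \<notin> cball 0 (r n)" using r[of n] by (simp add: dist_norm norm_minus_commute)
        qed
        moreover have "open (- cball p (3 * \<rho>))" "x \<in> - cball p (3 * \<rho>)" using False \<rho> by auto
        ultimately show ?thesis by blast
      qed
    qed
    moreover have "smooth (convol (k n) W)" for n
    proof (rule smooth_convol[OF k(1) compact_cball k(3)])
      have fin: "emeasure lborel ?K < \<infinity>"
        using emeasure_bounded_finite[of ?K] bounded_subset[OF \<Omega>(1) B(3)] by simp
      have "integrable lborel (\<lambda>x. (indicator ?K x :: real)\<^sup>2)"
        using B(2) fin by (simp add: power2_eq_square indicator_inter_arith[symmetric] integrable_indicator_iff)
      then have "integrable lborel (\<lambda>x. indicator ?K x * W x)"
        by (intro integrable_mult_square W(4)) (use W(1) B(2) in simp_all)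
      moreover have "(\<lambda>x. indicator ?K x * W x) = W" using W(2) by (rule indicator_mult_eq)
      ultimately show "integrable lborel W" by simp
    qed
    ultimately show "\<exists>U. (\<forall>n. smooth (U n)) \<and> Hconv \<Omega> m U u" by (intro exI[of _ "\<lambda>n. convol (k n) W"]) simp
  qed
qed

text \<open>Induction over a finite cover by balls: a cutoff that is 1 on one ball splits off a part
  supported in the double ball, where mollification works, and the remainder is supported in the
  other balls. Thus the cutoffs are used one at a time.\<close>

theorem smooth_dense:
  fixes \<Omega> :: "'a::euclidean_space set"
  assumes \<Omega>: "bounded \<Omega>" "open \<Omega>" and moll: "\<And>p. p \<in> closure \<Omega> \<Longrightarrow> mollifiable_at \<Omega> p"
    and u: "Hsob \<Omega> UNIV m u"
  shows "\<exists>U. (\<forall>n. smooth (U n)) \<and> Hconv \<Omega> m U u"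
proof -
  have B: "\<Omega> \<in> sets borel" using \<Omega> by auto
  have "\<exists>\<rho>>0. \<forall>m u. Hsob \<Omega> (\<Omega> \<inter> cball p (2 * \<rho>)) m u \<longrightarrow> (\<exists>U. (\<forall>n. smooth (U n)) \<and> Hconv \<Omega> m U u)"
    if "p \<in> closure \<Omega>" for p
    using mollifiable_at_approx[OF \<Omega> moll[OF that]] by metis
  then obtain \<rho> where \<rho>: "\<And>p. p \<in> closure \<Omega> \<Longrightarrow> \<rho> p > 0"
    "\<And>p m u. p \<in> closure \<Omega> \<Longrightarrow> Hsob \<Omega> (\<Omega> \<inter> cball p (2 * \<rho> p)) m u \<Longrightarrow> \<exists>U. (\<forall>n. smooth (U n)) \<and> Hconv \<Omega> m U u"
    by metis
  have "compact (closure \<Omega>)" using \<Omega> by simp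
  then obtain F where F: "F \<subseteq> closure \<Omega>" "finite F" "closure \<Omega> \<subseteq> (\<Union>p\<in>F. ball p (\<rho> p))"
  proof (rule compactE_image[where C="closure \<Omega>" and f="\<lambda>p. ball p (\<rho> p)"])
    show "closure \<Omega> \<subseteq> (\<Union>p\<in>closure \<Omega>. ball p (\<rho> p))" using \<rho>(1) by force
  qed auto
  have ind: "\<exists>U. (\<forall>n. smooth (U n)) \<and> Hconv \<Omega> m U u" if "Hsob \<Omega> (\<Omega> \<inter> (\<Union>p\<in>F. ball p (\<rho> p))) m u" for u
    using F(2,1) that
  proof (induction F arbitrary: u rule: finite_induct)
    case empty
    have "Hsob \<Omega> {} m w \<Longrightarrow> Hconv \<Omega> m (\<lambda>n x. 0) w" for w :: "'a \<Rightarrow> real"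
    proof (induction m arbitrary: w)
      case (Suc m)
      have "\<exists>g. has_weak_partial \<Omega> b w g \<and> Hconv \<Omega> m (\<lambda>n. pd b (\<lambda>x. 0)) g" if b: "b \<in> Basis" for b
      proof -
        obtain g where g: "has_weak_partial \<Omega> b w g" "Hsob \<Omega> {} m g"
          using Suc.prems b unfolding Hsob.simps by blast
        moreover have "pd b (\<lambda>x. 0) = (\<lambda>x::'a. 0)" by (auto simp: pd_const)
        ultimately show ?thesis using Suc.IH by auto
      qed
      moreover have "(\<lambda>n. \<integral>\<^sup>+x. ennreal ((0 - w x)\<^sup>2) \<partial>lebesgue_on \<Omega>) \<longlonglongrightarrow> 0"
        using Suc.prems by simp
      ultimately show ?case unfolding Hconv.simps by blast
    qed simp
    then show ?case using empty by (intro exI[of _ "\<lambda>n x. 0"]) auto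
  next
    case (insert p F)
    let ?A = "\<Omega> \<inter> (\<Union>p\<in>insert p F. ball p (\<rho> p))"
    have p: "p \<in> closure \<Omega>" using insert by auto
    obtain \<beta> where \<beta>: "smooth \<beta>" "\<And>x. x \<in> ball p (\<rho> p) \<Longrightarrow> \<beta> x = 1" "\<And>x. x \<notin> cball p (2 * \<rho> p) \<Longrightarrow> \<beta> x = 0"
      using smooth_cutoff_exists[OF \<rho>(1)[OF p]] by metis
    have "Hsob \<Omega> (?A - (- cball p (2 * \<rho> p))) m (\<lambda>x. \<beta> x * u x)"
      by (rule Hsob_mult[OF B \<Omega>(1) insert.prems(2) \<beta>(1)]) (use \<beta>(3) in auto)
    then have h1: "Hsob \<Omega> (\<Omega> \<inter> cball p (2 * \<rho> p)) m (\<lambda>x. \<beta> x * u x)"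
      by (rule Hsob_mono) auto
    have "Hsob \<Omega> (?A - ball p (\<rho> p)) m (\<lambda>x. (1 - \<beta> x) * u x)"
      by (rule Hsob_mult[OF B \<Omega>(1) insert.prems(2) smooth_diff[OF smooth_const \<beta>(1)]]) (use \<beta>(2) in auto)
    then have h2: "Hsob \<Omega> (\<Omega> \<inter> (\<Union>p\<in>F. ball p (\<rho> p))) m (\<lambda>x. (1 - \<beta> x) * u x)"
      by (rule Hsob_mono) auto
    obtain U where U: "\<And>n. smooth (U n)" "Hconv \<Omega> m U (\<lambda>x. \<beta> x * u x)"
      using \<rho>(2)[OF p h1] by blast
    obtain V where V: "\<And>n. smooth (V n)" "Hconv \<Omega> m V (\<lambda>x. (1 - \<beta> x) * u x)"
      using insert.IH[OF _ h2] insert.prems by blast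
    have "Hconv \<Omega> m (\<lambda>n x. U n x + V n x) (\<lambda>x. \<beta> x * u x + (1 - \<beta> x) * u x)"
      by (rule Hconv_add[OF B \<Omega>(1) U(2) V(2) U(1) V(1)]) (use Hsob_imp[OF h1] Hsob_imp[OF h2] in auto)
    moreover have "(\<lambda>x. \<beta> x * u x + (1 - \<beta> x) * u x) = u" by (auto simp: algebra_simps)
    ultimately show ?case using U(1) V(1) smooth_add by (intro exI[of _ "\<lambda>n x. U n x + V n x"]) auto
  qed
  \<comment> \<open>Values of \<open>u\<close> outside \<Omega> are arbitrary; multiplying by the
    indicator of \<Omega> puts the support inside the cover without changing anything on
    \<Omega>.\<close>
  have "Hsob \<Omega> (\<Omega> \<inter> (\<Union>p\<in>F. ball p (\<rho> p))) m (\<lambda>x. indicator \<Omega> x * u x)"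
    by (rule Hsob_mono[OF Hsob_restrict[OF u]]) (use F(3) closure_subset in blast)
  from ind[OF this] obtain U where U: "\<And>n. smooth (U n)" "Hconv \<Omega> m U (\<lambda>x. indicator \<Omega> x * u x)" by blast
  have "Hconv \<Omega> m U u" by (rule Hconv_cong[OF \<Omega>(2) U(2,1)]) auto
  with U(1) show ?thesis by blast
qed

section \<open>One-dimensional Hausdorff measure\<close>

lemma
  fixes \<Gamma> B :: "'a::metric_space set"
  assumes "emeasure hausdorff1 \<Gamma> \<noteq> 0"
  shows sets_hausdorff1: "sets (hausdorff1 :: 'a measure) = sets borel"
    and emeasure_hausdorff1: "B \<in> sets borel \<Longrightarrow> emeasure hausdorff1 B = hausdorff1_outer B"
proof -
  have sig: "sigma_sets UNIV (sets (borel :: 'a measure)) = sets borel"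
    using sets.sigma_sets_eq[of "borel :: 'a measure"] by simp
  then have *: "emeasure (hausdorff1 :: 'a measure) =
    (\<lambda>B. if B \<in> sets borel \<and> measure_space UNIV (sets (borel :: 'a measure)) hausdorff1_outer then hausdorff1_outer B else 0)"
    unfolding hausdorff1_def by (subst emeasure_measure_of_conv) auto
  then have "measure_space UNIV (sets (borel :: 'a measure)) hausdorff1_outer"
    using assms by (auto split: if_split_asm)
  with * show "B \<in> sets borel \<Longrightarrow> emeasure hausdorff1 B = hausdorff1_outer B" by simp
  show "sets (hausdorff1 :: 'a measure) = sets borel"
    unfolding hausdorff1_def by (simp add: sig)
qed

lemma subset_interval_of_diameter:
  fixes S :: "real set"
  assumes "\<And>s t. s \<in> S \<Longrightarrow> t \<in> S \<Longrightarrow> \<bar>s - t\<bar> \<le> D"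
  shows "\<exists>a. S \<subseteq> {a..a + D}"
proof (cases "S = {}")
  case False
  then obtain s0 where s0: "s0 \<in> S" by blast
  have bdd: "bdd_below S"
    by (rule bdd_belowI[of _ "s0 - D"]) (use assms[OF s0] in fastforce)
  have "s \<le> Inf S + D" if "s \<in> S" for s
  proof -
    have "s - D \<le> Inf S" by (rule cInf_greatest[OF False]) (use assms[OF that] in fastforce)
    then show ?thesis by simp
  qed
  then show ?thesis using cInf_lower[OF _ bdd] by (intro exI[of _ "Inf S"]) auto
qed auto

text \<open>A parametrisation that does not contract distances meets a covering set of diameter
  \<open>D\<close> only in parameters from an interval of length \<open>D\<close>. Any cover of
  \<open>B\<close> thus yields a cover of \<open>A\<close> by intervals of the same total
  length.\<close>

lemma emeasure_le_hausdorff1_outer: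
  fixes \<gamma> :: "real \<Rightarrow> 'a::metric_space"
  assumes A: "A \<in> sets borel" and \<gamma>: "\<And>s t. s \<in> A \<Longrightarrow> t \<in> A \<Longrightarrow> \<bar>s - t\<bar> \<le> dist (\<gamma> s) (\<gamma> t)"
    and B: "\<gamma> ` A \<subseteq> B"
  shows "emeasure lborel A \<le> hausdorff1_outer B"
proof -
  \<comment> \<open>For a lower bound one mesh size in the supremum is enough; 1 is
    arbitrary.\<close>
  have "emeasure lborel A \<le> (INF U\<in>{U::nat \<Rightarrow> 'a set. B \<subseteq> (\<Union>n. U n) \<and>
         (\<forall>n. bounded (U n) \<and> diameter (U n) \<le> 1)}. \<Sum>n. ennreal (diameter (U n)))"
  proof (rule INF_greatest)
    fix U :: "nat \<Rightarrow> 'a set"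
    assume "U \<in> {U. B \<subseteq> (\<Union>n. U n) \<and> (\<forall>n. bounded (U n) \<and> diameter (U n) \<le> 1)}"
    then have U: "B \<subseteq> (\<Union>n. U n)" "\<And>n. bounded (U n)" by auto
    have "\<exists>a. {s\<in>A. \<gamma> s \<in> U n} \<subseteq> {a..a + diameter (U n)}" for n
    proof (rule subset_interval_of_diameter)
      fix s t assume "s \<in> {s\<in>A. \<gamma> s \<in> U n}" "t \<in> {s\<in>A. \<gamma> s \<in> U n}"
      then show "\<bar>s - t\<bar> \<le> diameter (U n)"
        using \<gamma>[of s t] diameter_bounded_bound[OF U(2), of "\<gamma> s" n "\<gamma> t"] by simp
    qed
    then obtain a where a: "\<And>n. {s\<in>A. \<gamma> s \<in> U n} \<subseteq> {a n..a n + diameter (U n)}" by metis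
    have "A \<subseteq> (\<Union>n. {a n..a n + diameter (U n)})"
    proof
      fix s assume "s \<in> A"
      then obtain n where "\<gamma> s \<in> U n" using B U(1) by blast
      then show "s \<in> (\<Union>n. {a n..a n + diameter (U n)})" using a[of n] \<open>s \<in> A\<close> by blast
    qed
    then have "emeasure lborel A \<le> emeasure lborel (\<Union>n. {a n..a n + diameter (U n)})"
      by (rule emeasure_mono) auto
    also have "\<dots> \<le> (\<Sum>n. emeasure lborel {a n..a n + diameter (U n)})"
      by (rule emeasure_subadditive_countably) auto
    also have "\<dots> = (\<Sum>n. ennreal (diameter (U n)))"
      using diameter_ge_0[OF U(2)] by simp
    finally show "emeasure lborel A \<le> (\<Sum>n. ennreal (diameter (U n)))" .
  qed
  also have "\<dots> \<le> hausdorff1_outer B"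
    unfolding hausdorff1_outer_def by (rule SUP_upper) auto
  finally show ?thesis .
qed

text \<open>The intervals do not overlap and stay inside an open set of almost the measure of
  \<open>A\<close>, so their lengths add up to no more than that measure, however fine the
  mesh.\<close>

lemma fine_interval_cover:
  fixes A :: "real set"
  assumes A: "A \<in> sets borel" "A \<subseteq> {a..b}" and "0 < e" "0 < d"
  shows "\<exists>l u :: nat \<Rightarrow> real. (\<forall>n. l n \<le> u n) \<and> (\<forall>n. u n - l n \<le> d) \<and> A \<subseteq> (\<Union>n. {l n..u n}) \<and>
    (\<Sum>n. ennreal (u n - l n)) \<le> emeasure lborel A + ennreal e"
proof -
  obtain V where V: "open V" "A \<subseteq> V" "emeasure lborel (V - A) < ennreal e"
    using outer_regular_lborel[OF A(1) \<open>0 < e\<close>] by auto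
  \<comment> \<open>The gauge forces an interval tagged in \<open>A\<close> to lie in
    \<open>V\<close> and to be shorter than \<open>d\<close>. Off \<open>V\<close> any ball will do,
    since all tags lie in \<open>A\<close>.\<close>
  define g where "g x = (if x \<in> V then V \<inter> ball x (d / 2) else ball x 1)" for x
  have "gauge g" unfolding gauge_def g_def using V(1) \<open>0 < d\<close> by auto
  \<comment> \<open>The covering lemma needs a box with nonempty interior, and \<open>{a..b}\<close>
    may be degenerate or empty.\<close>
  have "A \<subseteq> cbox a (max b (a + 1))" using A(2) by (auto simp: subset_iff le_max_iff_disj)
  moreover have "box a (max b (a + 1)) \<noteq> {}" by auto
  ultimately obtain \<D> where \<D>: "countable \<D>" "\<And>K. K \<in> \<D> \<Longrightarrow> interior K \<noteq> {} \<and> (\<exists>c d. K = cbox c d)"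
    "pairwise (\<lambda>A B. interior A \<inter> interior B = {}) \<D>" "\<And>K. K \<in> \<D> \<Longrightarrow> \<exists>x \<in> A \<inter> K. K \<subseteq> g x" "A \<subseteq> \<Union>\<D>"
    using \<open>gauge g\<close> by (rule covering_lemma) blast
  obtain l' u' where K: "\<And>K. K \<in> \<D> \<Longrightarrow> K = {l' K..u' K}"
  proof -
    have "\<forall>K\<in>\<D>. \<exists>l u. K = {l..u}" using \<D>(2) by (metis cbox_interval)
    then show ?thesis using that by metis
  qed
  have lu: "l' K \<le> u' K" if "K \<in> \<D>" for K using \<D>(2)[OF that] K[OF that] by (metis atLeastatMost_empty_iff interior_empty)
  have fine: "u' K - l' K \<le> d" if KD: "K \<in> \<D>" for K
  proof -
    obtain x where "x \<in> A" "K \<subseteq> g x" using \<D>(4)[OF KD] by blast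
    moreover from this have "x \<in> V" using V(2) by blast
    ultimately have "K \<subseteq> ball x (d / 2)" by (simp add: g_def)
    then have "{l' K..u' K} \<subseteq> ball x (d / 2)" unfolding K[OF KD, symmetric] .
    then have "l' K \<in> ball x (d / 2)" "u' K \<in> ball x (d / 2)" using lu[OF KD] by auto
    then show ?thesis unfolding mem_ball dist_real_def abs_less_iff by linarith
  qed
  have sub: "K \<subseteq> V" if KD: "K \<in> \<D>" for K
  proof -
    obtain x where "x \<in> A" "K \<subseteq> g x" using \<D>(4)[OF KD] by blast
    moreover from this have "x \<in> V" using V(2) by blast
    ultimately show ?thesis by (simp add: g_def)
  qed
  define N where "N = to_nat_on \<D> ` \<D>"
  define l where "l n = (if n \<in> N then l' (from_nat_into \<D> n) else 0)" for n
  define u where "u n = (if n \<in> N then u' (from_nat_into \<D> n) else 0)" for n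
  have N: "from_nat_into \<D> n \<in> \<D>" if "n \<in> N" for n using that \<D>(1) by (auto simp: N_def)
  have inj: "n = m" if "n \<in> N" "m \<in> N" "from_nat_into \<D> n = from_nat_into \<D> m" for n m
    using that \<D>(1) by (auto simp: N_def)
  show ?thesis
  proof -
    have lu1: "l n \<le> u n" for n using lu N by (auto simp: l_def u_def)
    have lu2: "u n - l n \<le> d" for n using fine N \<open>0 < d\<close> by (auto simp: l_def u_def)
    have cover: "A \<subseteq> (\<Union>n. {l n..u n})"
    proof
      fix x assume "x \<in> A"
      then obtain K where "K \<in> \<D>" "x \<in> K" using \<D>(5) by blast
      then have "{l (to_nat_on \<D> K)..u (to_nat_on \<D> K)} = K"
        using K[of K, symmetric] \<D>(1) by (simp add: l_def u_def N_def)
      then have "x \<in> {l (to_nat_on \<D> K)..u (to_nat_on \<D> K)}" using \<open>x \<in> K\<close> by simp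
      then show "x \<in> (\<Union>n. {l n..u n})" by blast
    qed
    have disj: "disjoint_family (\<lambda>n. {l n<..<u n})"
      unfolding disjoint_family_on_def
    proof (intro ballI impI)
      fix m n :: nat assume "m \<noteq> n"
      show "{l m<..<u m} \<inter> {l n<..<u n} = {}"
      proof (cases "m \<in> N \<and> n \<in> N")
        case True
        then have "from_nat_into \<D> m \<noteq> from_nat_into \<D> n" using inj \<open>m \<noteq> n\<close> by blast
        then have "interior (from_nat_into \<D> m) \<inter> interior (from_nat_into \<D> n) = {}"
          using \<D>(3) N True by (auto simp: pairwise_def)
        moreover have "interior (from_nat_into \<D> i) = {l i<..<u i}" if "i \<in> N" for i
          using that K[OF N[OF that]] by (metis interior_atLeastAtMost_real l_def u_def)
        ultimately show ?thesis using True by simp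
      qed (auto simp: l_def u_def)
    qed
    have "(\<Sum>n. ennreal (u n - l n)) = (\<Sum>n. emeasure lborel {l n<..<u n})"
      using lu N by (intro suminf_cong) (auto simp: l_def u_def)
    also have "\<dots> = emeasure lborel (\<Union>n. {l n<..<u n})"
      by (rule suminf_emeasure) (use disj in auto)
    also have "\<dots> \<le> emeasure lborel V"
    proof (rule emeasure_mono)
      have "{l n<..<u n} \<subseteq> V" for n
      proof (cases "n \<in> N")
        case True
        then have "{l n..u n} \<subseteq> V" using sub[OF N, of n] K[OF N, of n] by (simp add: l_def u_def)
        then show ?thesis using greaterThanLessThan_subseteq_atLeastAtMost_iff by fastforce
      qed (simp add: l_def u_def)
      then show "(\<Union>n. {l n<..<u n}) \<subseteq> V" by blast
    qed (use V in auto)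
    also have "\<dots> = emeasure lborel (A \<union> (V - A))" using V(2) by (simp add: Un_absorb1)
    also have "\<dots> \<le> emeasure lborel A + emeasure lborel (V - A)"
      by (rule emeasure_subadditive) (use V A in auto)
    also have "\<dots> \<le> emeasure lborel A + ennreal e" using V(3) by (intro add_left_mono) auto
    finally have "(\<Sum>n. ennreal (u n - l n)) \<le> emeasure lborel A + ennreal e" .
    then show ?thesis using lu1 lu2 cover by blast
  qed
qed

text \<open>Images of short parameter intervals have diameter at most \<open>C\<close> times the
  length, so a cover of mesh \<open>d / C\<close> with excess \<open>e / C\<close> becomes a cover
  of mesh \<open>d\<close> with excess \<open>e\<close>.\<close>

lemma hausdorff1_outer_image_le:
  fixes \<gamma> :: "real \<Rightarrow> 'a::metric_space"
  assumes A: "A \<in> sets borel" "A \<subseteq> {a..b}" and C: "0 < C"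
    and \<gamma>: "\<And>s t. s \<in> A \<Longrightarrow> t \<in> A \<Longrightarrow> dist (\<gamma> s) (\<gamma> t) \<le> C * \<bar>s - t\<bar>" and B: "B \<subseteq> \<gamma> ` A"
  shows "hausdorff1_outer B \<le> ennreal C * emeasure lborel A"
  unfolding hausdorff1_outer_def
proof (rule SUP_least)
  fix d :: real assume "d \<in> {0<..}"
  then have d: "0 < d" by simp
  let ?I = "INF U\<in>{U::nat \<Rightarrow> 'a set. B \<subseteq> (\<Union>n. U n) \<and> (\<forall>n. bounded (U n) \<and> diameter (U n) \<le> d)}.
    \<Sum>n. ennreal (diameter (U n))"
  have fin: "emeasure lborel A < \<infinity>"
    by (rule le_less_trans[OF emeasure_mono[OF A(2)]]) (auto simp: emeasure_lborel_Icc_eq)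
  show "?I \<le> ennreal C * emeasure lborel A"
  proof (rule ennreal_le_epsilon)
    fix e :: real assume e: "0 < e"
    have pos: "0 < e / C" "0 < d / C" using e d C by auto
    obtain l u where lu: "\<And>n. l n \<le> u n" "\<And>n. u n - l n \<le> d / C" "A \<subseteq> (\<Union>n. {l n..u n})"
      "(\<Sum>n. ennreal (u n - l n)) \<le> emeasure lborel A + ennreal (e / C)"
      using fine_interval_cover[OF A pos] by blast
    define U where "U n = \<gamma> ` (A \<inter> {l n..u n})" for n
    have dist: "dist x y \<le> C * (u n - l n)" if "x \<in> U n" "y \<in> U n" for x y n
    proof -
      obtain s t where st: "s \<in> A" "t \<in> A" "s \<in> {l n..u n}" "t \<in> {l n..u n}" "x = \<gamma> s" "y = \<gamma> t"
        using \<open>x \<in> U n\<close> \<open>y \<in> U n\<close> unfolding U_def by blast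
      have "dist x y \<le> C * \<bar>s - t\<bar>" using \<gamma> st by simp
      also have "\<dots> \<le> C * (u n - l n)" using st C by (intro mult_left_mono) auto
      finally show ?thesis .
    qed
    have bdd: "bounded (U n)" for n
    proof (cases "U n = {}")
      case False
      then obtain x where "x \<in> U n" by blast
      then show ?thesis unfolding bounded_def using dist by blast
    qed simp
    have diam: "diameter (U n) \<le> C * (u n - l n)" for n
      using dist lu(1)[of n] C
      by (cases "U n = {}") (auto simp: diameter_def intro!: cSUP_least)
    have "?I \<le> (\<Sum>n. ennreal (diameter (U n)))"
    proof (rule INF_lower, safe)
      fix x assume "x \<in> B"
      then obtain s where "s \<in> A" "x = \<gamma> s" using B by blast
      then show "x \<in> (\<Union>n. U n)" using lu(3) by (fastforce simp: U_def)
    next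
      fix n
      show "diameter (U n) \<le> d"
        using diam[of n] mult_left_mono[OF lu(2)[of n], of C] C by simp
    qed (rule bdd)
    also have "\<dots> \<le> (\<Sum>n. ennreal C * ennreal (u n - l n))"
      using diam C lu(1) by (intro suminf_le) (auto simp flip: ennreal_mult intro!: ennreal_leI)
    also have "\<dots> = ennreal C * (\<Sum>n. ennreal (u n - l n))" by simp
    also have "\<dots> \<le> ennreal C * (emeasure lborel A + ennreal (e / C))"
      by (rule mult_left_mono[OF lu(4)]) simp
    also have "\<dots> = ennreal C * emeasure lborel A + ennreal e"
      using C e by (simp add: distrib_left flip: ennreal_mult)
    finally show "?I \<le> ennreal C * emeasure lborel A + ennreal e" .
  qed
qed

text \<open>Parameters sent into an interval of length \<open>l\<close> lie in an interval of length
  \<open>l / c\<close>. No differentiability of \<open>\<phi>\<close> is involved; the bounded range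
  serves the interval cover.\<close>

lemma emeasure_expanding_preimage:
  fixes \<phi> :: "real \<Rightarrow> real"
  assumes J: "\<phi> ` J \<subseteq> {a..b}" and c: "0 < c"
    and \<phi>: "\<And>s t. s \<in> J \<Longrightarrow> t \<in> J \<Longrightarrow> c * \<bar>s - t\<bar> \<le> \<bar>\<phi> s - \<phi> t\<bar>"
    and A: "A \<in> sets borel" and S: "S \<in> sets borel" "S \<subseteq> J" "\<phi> ` S \<subseteq> A"
  shows "emeasure lborel S \<le> ennreal (1 / c) * emeasure lborel A"
proof (rule ennreal_le_epsilon)
  fix e :: real assume e: "0 < e"
  have Ab: "A \<inter> {a..b} \<in> sets borel" and pos: "0 < e * c" "0 < (1::real)" using A e c by auto
  obtain l u where lu: "\<And>n. l n \<le> u n" "\<And>n. u n - l n \<le> 1" "A \<inter> {a..b} \<subseteq> (\<Union>n. {l n..u n})"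
    "(\<Sum>n. ennreal (u n - l n)) \<le> emeasure lborel (A \<inter> {a..b}) + ennreal (e * c)"
    using fine_interval_cover[OF Ab Int_lower2 pos] by blast
  have "\<exists>x. {s\<in>S. \<phi> s \<in> {l n..u n}} \<subseteq> {x..x + (u n - l n) / c}" for n
  proof (rule subset_interval_of_diameter)
    fix s t assume st: "s \<in> {s\<in>S. \<phi> s \<in> {l n..u n}}" "t \<in> {s\<in>S. \<phi> s \<in> {l n..u n}}"
    then have "c * \<bar>s - t\<bar> \<le> \<bar>\<phi> s - \<phi> t\<bar>" using S(2) by (intro \<phi>) auto
    also have "\<dots> \<le> u n - l n" using st by auto
    finally show "\<bar>s - t\<bar> \<le> (u n - l n) / c" using c by (simp add: field_simps)
  qed
  then obtain x where x: "\<And>n. {s\<in>S. \<phi> s \<in> {l n..u n}} \<subseteq> {x n..x n + (u n - l n) / c}" by metis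
  have "S \<subseteq> (\<Union>n. {x n..x n + (u n - l n) / c})"
  proof
    fix s assume s: "s \<in> S"
    then have "\<phi> s \<in> A \<inter> {a..b}" using S J by blast
    then obtain n where "\<phi> s \<in> {l n..u n}" using lu(3) by blast
    then show "s \<in> (\<Union>n. {x n..x n + (u n - l n) / c})" using x[of n] s by blast
  qed
  then have "emeasure lborel S \<le> emeasure lborel (\<Union>n. {x n..x n + (u n - l n) / c})"
    by (rule emeasure_mono) auto
  also have "\<dots> \<le> (\<Sum>n. emeasure lborel {x n..x n + (u n - l n) / c})"
    by (rule emeasure_subadditive_countably) auto
  also have "\<dots> = (\<Sum>n. ennreal (1 / c) * ennreal (u n - l n))"
    using lu(1) c by (intro suminf_cong) (simp flip: ennreal_mult)
  also have "\<dots> = ennreal (1 / c) * (\<Sum>n. ennreal (u n - l n))" by simp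
  also have "\<dots> \<le> ennreal (1 / c) * (emeasure lborel (A \<inter> {a..b}) + ennreal (e * c))"
    by (rule mult_left_mono[OF lu(4)]) simp
  also have "\<dots> = ennreal (1 / c) * emeasure lborel (A \<inter> {a..b}) + ennreal e"
    using c e by (simp add: distrib_left flip: ennreal_mult)
  also have "\<dots> \<le> ennreal (1 / c) * emeasure lborel A + ennreal e"
    using A by (intro add_right_mono mult_left_mono emeasure_mono) auto
  finally show "emeasure lborel S \<le> ennreal (1 / c) * emeasure lborel A + ennreal e" .
qed

text \<open>A one-sided change of variables. The bound on preimages says that the distribution of
  \<open>\<phi>\<close> is below the scaled measure, and integrals are monotone in the
  measure.\<close>

lemma nn_integral_change_le:
  assumes J: "J \<in> sets M" and \<phi>: "\<phi> \<in> measurable (restrict_space M J) N"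
    and le: "\<And>B. B \<in> sets N \<Longrightarrow> emeasure M (\<phi> -` B \<inter> J) \<le> c * emeasure N B"
    and F: "F \<in> borel_measurable N"
  shows "(\<integral>\<^sup>+x. F (\<phi> x) * indicator J x \<partial>M) \<le> c * (\<integral>\<^sup>+y. F y \<partial>N)"
proof -
  let ?D = "distr (restrict_space M J) N \<phi>"
  have J': "J \<inter> space M = J" using sets.sets_into_space[OF J] by auto
  have "(\<integral>\<^sup>+x. F (\<phi> x) * indicator J x \<partial>M) = (\<integral>\<^sup>+x. F (\<phi> x) \<partial>restrict_space M J)"
    using J J' by (subst nn_integral_restrict_space) auto
  also have "\<dots> = (\<integral>\<^sup>+y. F y \<partial>?D)" using \<phi> F by (intro nn_integral_distr[symmetric]) auto
  also have "\<dots> \<le> (\<integral>\<^sup>+y. F y \<partial>scale_measure c N)"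
  proof (rule nn_integral_mono_measure)
    show "?D \<le> scale_measure c N"
    proof -
      have st: "sets ?D = sets (scale_measure c N)" by simp
      have "emeasure ?D \<le> emeasure (scale_measure c N)"
    proof (rule le_funI)
      fix B
      show "emeasure ?D B \<le> emeasure (scale_measure c N) B"
      proof (cases "B \<in> sets N")
        case True
        have "emeasure ?D B = emeasure (restrict_space M J) (\<phi> -` B \<inter> J)"
          using True J' by (simp add: emeasure_distr[OF \<phi>] space_restrict_space)
        also have "\<dots> = emeasure M (\<phi> -` B \<inter> J)"
          by (rule emeasure_restrict_space) (use J J' in auto)
        also have "\<dots> \<le> c * emeasure N B" by (rule le[OF True])
        finally show ?thesis by simp
      qed (simp add: emeasure_notin_sets)
    qed
    then show ?thesis
      unfolding le_measure_iff if_P[OF sets_eq_imp_space_eq[OF st]] if_P[OF st] .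
    qed
  qed simp
  also have "\<dots> = c * (\<integral>\<^sup>+y. F y \<partial>N)"
    using F by (rule nn_integral_scale_measure)
  finally show ?thesis .
qed

section \<open>Coordinates in the plane\<close>

lemma distr_vector2:
  "distr (lborel :: (real \<times> real) measure) borel (\<lambda>(s, t). vector [s, t]) = (lborel :: (real^2) measure)"
proof (rule lborel_eqI[symmetric])
  have cont: "continuous_on UNIV (\<lambda>(s, t). vector [s, t] :: real^2)"
  proof -
    have "(\<lambda>(s, t). vector [s, t] :: real^2) = (\<lambda>p. fst p *\<^sub>R axis 1 1 + snd p *\<^sub>R axis 2 1)"
      by (auto simp: vec_eq_iff forall_2 axis_def)
    then show ?thesis by (auto intro!: continuous_intros)
  qed
  then have meas: "(\<lambda>(s, t). vector [s, t] :: real^2) \<in> borel_measurable borel"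
    by (rule borel_measurable_continuous_onI)
  fix l u :: "real^2" assume le: "\<And>b. b \<in> Basis \<Longrightarrow> l \<bullet> b \<le> u \<bullet> b"
  have le': "l $ i \<le> u $ i" for i using le[of "axis i 1"] by (simp add: inner_axis axis_in_Basis_iff)
  have "(\<lambda>(s, t). vector [s, t]) -` box l u = box (l $ 1, l $ 2) (u $ 1, u $ 2)"
    by (auto simp: mem_box_cart forall_2 mem_box Basis_prod_def)
  then have "emeasure (distr lborel borel (\<lambda>(s, t). vector [s, t])) (box l u)
     = emeasure lborel (box (l $ 1, l $ 2) (u $ 1, u $ 2))"
    using meas by (simp add: emeasure_distr)
  also have "\<dots> = ennreal (\<Prod>b\<in>Basis. ((u $ 1, u $ 2) - (l $ 1, l $ 2)) \<bullet> b)"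
    using le' by (subst emeasure_lborel_box) (auto simp: Basis_prod_def)
  also have "(\<Prod>b\<in>Basis. ((u $ 1, u $ 2) - (l $ 1, l $ 2)) \<bullet> b) = (\<Prod>i\<in>UNIV. (u - l) $ i)"
    by (simp add: Basis_prod_def UNIV_2)
  also have "\<dots> = (\<Prod>b\<in>Basis. (u - l) \<bullet> b)"
    by (simp add: Basis_vec_def UNION_singleton_eq_range prod.reindex inj_on_def axis_eq_axis inner_axis)
  finally show "emeasure (distr lborel borel (\<lambda>(s, t). vector [s, t])) (box l u) = (\<Prod>b\<in>Basis. (u - l) \<bullet> b)" .
qed simp

lemma distr_orthogonal:
  fixes Q :: "real^2 \<Rightarrow> real^2"
  assumes Q: "orthogonal_transformation Q"
  shows "distr lborel borel Q = lborel"
proof (rule lborel_eqI[symmetric])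
  have meas: "Q \<in> borel_measurable borel"
    using Q by (intro borel_measurable_continuous_onI linear_continuous_on)
      (simp add: orthogonal_transformation_linear linear_conv_bounded_linear[symmetric])
  obtain R where R: "orthogonal_transformation R" "\<And>x. R (Q x) = x" "\<And>x. Q (R x) = x"
    using orthogonal_transformation_inv[OF Q] orthogonal_transformation_bij[OF Q]
    by (metis bij_inv_eq_iff)
  fix l u :: "real^2" assume le: "\<And>b. b \<in> Basis \<Longrightarrow> l \<bullet> b \<le> u \<bullet> b"
  have eq: "Q -` box l u = R ` box l u"
    using R by (auto simp: image_iff) metis
  have "emeasure (distr lborel borel Q) (box l u) = emeasure lborel (Q -` box l u)"
    using meas by (simp add: emeasure_distr)
  also have "\<dots> = emeasure lebesgue (R ` box l u)"
    using meas measurable_sets[OF meas, of "box l u"] by (simp add: eq)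
  also have "\<dots> = ennreal (measure lebesgue (R ` box l u))"
    using measurable_orthogonal_image[OF R(1), of "box l u"] by (simp add: emeasure_eq_measure2)
  also have "\<dots> = ennreal (measure lebesgue (box l u))"
    using measure_orthogonal_image[OF R(1), of "box l u"] by simp
  also have "\<dots> = (\<Prod>b\<in>Basis. (u - l) \<bullet> b)"
    using le by (simp add: measure_lborel_box)
  finally show "emeasure (distr lborel borel Q) (box l u) = (\<Prod>b\<in>Basis. (u - l) \<bullet> b)" .
qed simp

text \<open>The translation by \<open>x0\<close>, the orthogonal map and the passage from pairs to
  vectors all preserve Lebesgue measure; Tonelli separates the coordinates.\<close>

lemma nn_integral_chart:
  fixes Q :: "real^2 \<Rightarrow> real^2"
  assumes Q: "orthogonal_transformation Q" and F: "F \<in> borel_measurable borel"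
  shows "(\<integral>\<^sup>+x. F x \<partial>lborel) = (\<integral>\<^sup>+s. \<integral>\<^sup>+t. F (x0 + Q (vector [s, t])) \<partial>lborel \<partial>lborel)"
proof -
  note [measurable] = F
  have [measurable]: "Q \<in> borel_measurable borel"
    using Q by (intro borel_measurable_continuous_onI linear_continuous_on)
      (simp add: orthogonal_transformation_linear linear_conv_bounded_linear[symmetric])
  have "(\<lambda>(s, t). vector [s, t] :: real^2) = (\<lambda>p. fst p *\<^sub>R axis 1 1 + snd p *\<^sub>R axis 2 1)"
    by (auto simp: vec_eq_iff forall_2 axis_def)
  then have [measurable]: "(\<lambda>(s, t). vector [s, t] :: real^2) \<in> borel_measurable borel"
    by (auto intro!: borel_measurable_continuous_onI continuous_intros)
  have "(\<integral>\<^sup>+x. F x \<partial>lborel) = (\<integral>\<^sup>+x. F (x0 + x) \<partial>lborel)"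
    using nn_integral_lborel_affine[of F 1 x0] by simp
  also have "\<dots> = (\<integral>\<^sup>+x. F (x0 + x) \<partial>distr lborel borel Q)" by (simp only: distr_orthogonal[OF Q])
  also have "\<dots> = (\<integral>\<^sup>+x. F (x0 + Q x) \<partial>lborel)" by (subst nn_integral_distr) auto
  also have "\<dots> = (\<integral>\<^sup>+x. F (x0 + Q x) \<partial>distr lborel borel (\<lambda>(s, t). vector [s, t]))" by (simp only: distr_vector2)
  also have "\<dots> = (\<integral>\<^sup>+p. F (x0 + Q ((\<lambda>(s, t). vector [s, t]) p)) \<partial>lborel)" by (subst nn_integral_distr) auto
  also have "\<dots> = (\<integral>\<^sup>+p. F (x0 + Q ((\<lambda>(s, t). vector [s, t]) p)) \<partial>(lborel \<Otimes>\<^sub>M lborel))" by (simp only: lborel_prod)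
  also have "\<dots> = (\<integral>\<^sup>+s. \<integral>\<^sup>+t. F (x0 + Q (vector [s, t])) \<partial>lborel \<partial>lborel)"
    by (subst lborel.nn_integral_fst[symmetric]) (simp_all add: lborel_prod)
  finally show ?thesis .
qed

section \<open>Boundary charts\<close>

definition chart_pt :: "real^2 \<Rightarrow> (real^2 \<Rightarrow> real^2) \<Rightarrow> real \<Rightarrow> real \<Rightarrow> real^2" where
  "chart_pt x0 Q s t = x0 + Q (vector [s, t])"

lemma norm_vector2: "norm (vector [a, b] :: real^2) = sqrt (a\<^sup>2 + b\<^sup>2)"
  by (simp add: norm_vec_def L2_set_def UNIV_2)

lemma vector2_add: "vector [a, b] + vector [c, d] = (vector [a + c, b + d] :: real^2)"
  and vector2_diff: "vector [a, b] - vector [c, d] = (vector [a - c, b - d] :: real^2)"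
  and vector2_scale: "k *\<^sub>R vector [a, b] = (vector [k * a, k * b] :: real^2)"
  by (simp_all add: vec_eq_iff forall_2)

context
  fixes Q :: "real^2 \<Rightarrow> real^2"
  assumes Q: "orthogonal_transformation Q"
begin

lemma chart_linear: "linear Q" using Q by (rule orthogonal_transformation_linear)

lemma dist_chart_pt: "dist (chart_pt x0 Q s t) (chart_pt x0 Q s' t') = sqrt ((s - s')\<^sup>2 + (t - t')\<^sup>2)"
proof -
  have "dist (chart_pt x0 Q s t) (chart_pt x0 Q s' t') = norm (Q (vector [s, t] - vector [s', t']))"
    by (simp add: chart_pt_def dist_norm linear_diff[OF chart_linear])
  also have "\<dots> = sqrt ((s - s')\<^sup>2 + (t - t')\<^sup>2)"
    using Q by (simp add: orthogonal_transformation_norm vector2_diff norm_vector2)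
  finally show ?thesis .
qed

lemma dist_chart_pt_bounds:
  "\<bar>s - s'\<bar> \<le> dist (chart_pt x0 Q s t) (chart_pt x0 Q s' t')"
  "\<bar>t - t'\<bar> \<le> dist (chart_pt x0 Q s t) (chart_pt x0 Q s' t')"
  "dist (chart_pt x0 Q s t) (chart_pt x0 Q s' t') \<le> \<bar>s - s'\<bar> + \<bar>t - t'\<bar>"
  by (simp_all add: dist_chart_pt real_le_rsqrt sqrt_sum_squares_le_sum_abs)

lemma chart_pt_surj: "\<exists>s t. x = chart_pt x0 Q s t"
proof -
  obtain y where y: "Q y = x - x0"
    using orthogonal_transformation_surj[OF Q] by (metis surjD)
  have "y = vector [y $ 1, y $ 2]" by (simp add: vec_eq_iff forall_2)
  then show ?thesis using y by (metis add.commute chart_pt_def diff_add_cancel)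
qed

lemma chart_pt_add: "chart_pt x0 Q s t + Q (vector [a, b]) = chart_pt x0 Q (s + a) (t + b)"
  by (simp add: chart_pt_def vector2_add[symmetric] linear_add[OF chart_linear])

lemma chart_scale: "k *\<^sub>R Q (vector [a, b]) = Q (vector [k * a, k * b])"
  by (simp add: vector2_scale[symmetric] linear_scale[OF chart_linear])

lemma chart_pt_origin: "chart_pt x0 Q 0 0 = x0"
proof -
  have "vector [0, 0] = (0 :: real^2)" by (simp add: vec_eq_iff forall_2)
  then show ?thesis by (simp add: chart_pt_def linear_0[OF chart_linear])
qed

lemma norm_chart_vector: "norm (Q (vector [a, b])) = sqrt (a\<^sup>2 + b\<^sup>2)"
  using Q by (simp add: orthogonal_transformation_norm norm_vector2)

text \<open>Recovers the abscissa of a chart point, and so inverts the graph parametrisation by a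
  linear projection.\<close>

lemma chart_pt_inner: "(chart_pt x0 Q s t - x0) \<bullet> Q (vector [1, 0]) = s"
proof -
  have "Q (vector [s, t]) \<bullet> Q (vector [1, 0]) = (vector [s, t] :: real^2) \<bullet> vector [1, 0]"
    using Q by (simp add: orthogonal_transformation_def)
  then show ?thesis by (simp add: chart_pt_def inner_vec_def UNIV_2)
qed

lemma chart_pt_measurable [measurable]: "(\<lambda>p. chart_pt x0 Q (fst p) (snd p)) \<in> borel_measurable borel"
proof (rule borel_measurable_continuous_onI)
  have eq: "(\<lambda>p. chart_pt x0 Q (fst p) (snd p)) = (\<lambda>p. x0 + (fst p *\<^sub>R Q (vector [1, 0]) + snd p *\<^sub>R Q (vector [0, 1])))"
    by (simp add: chart_pt_def chart_scale linear_add[OF chart_linear, symmetric] vector2_add)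
  show "continuous_on UNIV (\<lambda>p. chart_pt x0 Q (fst p) (snd p))"
    unfolding eq by (intro continuous_intros)
qed

lemma chart_pt_measurable2:
  assumes "f \<in> borel_measurable M" "g \<in> borel_measurable M"
  shows "(\<lambda>x. chart_pt x0 Q (f x) (g x)) \<in> borel_measurable M"
  using measurable_compose[OF borel_measurable_Pair[OF assms] chart_pt_measurable] by simp

end

lemma boundary_chart_above:
  assumes "boundary_chart \<Omega> x0 Q r h f" "\<bar>s\<bar> < r" "\<bar>t\<bar> < h"
  shows "chart_pt x0 Q s t \<in> \<Omega> \<longleftrightarrow> f s < t"
  using assms by (simp add: boundary_chart_def chart_pt_def)

lemma boundary_chart_orthogonal: "boundary_chart \<Omega> x0 Q r h f \<Longrightarrow> orthogonal_transformation Q"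
  by (simp add: boundary_chart_def)

lemma boundary_chart_graph_in_frontier:
  assumes ch: "boundary_chart \<Omega> x0 Q r h f" and "open \<Omega>" and s: "\<bar>s\<bar> < r"
  shows "chart_pt x0 Q s (f s) \<in> frontier \<Omega>"
proof -
  note Q = boundary_chart_orthogonal[OF ch]
  have fs: "\<bar>f s\<bar> < h" using ch s by (simp add: boundary_chart_def)
  have "chart_pt x0 Q s (f s) \<notin> \<Omega>" using boundary_chart_above[OF ch s fs] by simp
  moreover have "chart_pt x0 Q s (f s) \<in> closure \<Omega>"
    unfolding closure_approachable
  proof (intro allI impI)
    fix e :: real assume "0 < e"
    define d where "d = min (e / 2) ((h - f s) / 2)"
    have d: "0 < d" "d < e" "f s + d < h" using \<open>0 < e\<close> fs by (auto simp: d_def min_def field_simps)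
    have "chart_pt x0 Q s (f s + d) \<in> \<Omega>"
      using boundary_chart_above[OF ch s, of "f s + d"] d fs by auto
    moreover have "dist (chart_pt x0 Q s (f s + d)) (chart_pt x0 Q s (f s)) < e"
      using dist_chart_pt_bounds(3)[OF Q, of x0 s "f s + d" s "f s"] d by simp
    ultimately show "\<exists>y\<in>\<Omega>. dist y (chart_pt x0 Q s (f s)) < e" by blast
  qed
  ultimately show ?thesis using \<open>open \<Omega>\<close> by (simp add: frontier_def interior_open)
qed

text \<open>The chart places no point on or below the graph in \<Omega>. By continuity of
  \<open>f\<close> a point strictly below the graph has a neighbourhood below it, hence is not in
  the closure of \<Omega>.\<close>

lemma boundary_chart_frontier_is_graph:
  assumes ch: "boundary_chart \<Omega> x0 Q r h f" and "open \<Omega>" and cont: "continuous_on {-r<..<r} f"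
    and s: "\<bar>s\<bar> < r" and t: "\<bar>t\<bar> < h" and fr: "chart_pt x0 Q s t \<in> frontier \<Omega>"
  shows "t = f s"
proof (rule ccontr)
  note Q = boundary_chart_orthogonal[OF ch]
  assume "t \<noteq> f s"
  have "chart_pt x0 Q s t \<notin> \<Omega>" using fr \<open>open \<Omega>\<close> by (simp add: frontier_def interior_open)
  then have "t < f s" using boundary_chart_above[OF ch s t] \<open>t \<noteq> f s\<close> by simp
  have "isCont f s" using cont s by (simp add: continuous_on_eq_continuous_at abs_less_iff)
  then obtain d where d: "d > 0" "\<And>s'. \<bar>s' - s\<bar> < d \<Longrightarrow> \<bar>f s' - f s\<bar> < (f s - t) / 2"
    using \<open>t < f s\<close> unfolding continuous_at_eps_delta by (metis dist_real_def half_gt_zero diff_gt_0_iff_gt)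
  \<comment> \<open>Small enough that a perturbation by \<open>e\<close> stays in the rectangle,
    changes \<open>f\<close> by less than half the gap \<open>f s - t\<close>, and changes the
    height by less than the other half.\<close>
  define e where "e = min (min d ((f s - t) / 2)) (min (r - \<bar>s\<bar>) (h - \<bar>t\<bar>))"
  have e: "0 < e" "e \<le> d" "e \<le> (f s - t) / 2" "e \<le> r - \<bar>s\<bar>" "e \<le> h - \<bar>t\<bar>"
    using d \<open>t < f s\<close> s t unfolding e_def by (simp, linarith+)
  have "chart_pt x0 Q s t \<in> closure \<Omega>" using fr by (simp add: frontier_def)
  then obtain y where y: "y \<in> \<Omega>" "dist y (chart_pt x0 Q s t) < e"
    using e(1) unfolding closure_approachable by blast
  obtain s' t' where st: "y = chart_pt x0 Q s' t'" using chart_pt_surj[OF Q] by blast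
  have b: "\<bar>s' - s\<bar> < e" "\<bar>t' - t\<bar> < e"
    using y(2) dist_chart_pt_bounds(1,2)[OF Q, of s' s x0 t' t] st
      dist_chart_pt_bounds(2)[OF Q, of t' t x0 s' s] by auto
  then have "\<bar>s'\<bar> < r" "\<bar>t'\<bar> < h" using e by auto
  then have "f s' < t'" using boundary_chart_above[OF ch] y(1) st by blast
  moreover have "\<bar>f s' - f s\<bar> < (f s - t) / 2" by (rule d(2)) (use b e in linarith)
  ultimately show False using b(2) e(3) unfolding abs_less_iff by argo
qed

section \<open>Mollification from inside\<close>

lemma mollifiable_at_interior:
  fixes \<Omega> :: "'a::euclidean_space set"
  assumes "open \<Omega>" "p \<in> \<Omega>" shows "mollifiable_at \<Omega> p"
proof -
  obtain e where e: "e > 0" "ball p e \<subseteq> \<Omega>" using assms open_contains_ball by blast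
  \<comment> \<open>Points closer than \<open>4 * \<rho>\<close> to \<open>p\<close>, moved by a
    kernel radius of at most \<open>\<rho>\<close>, remain in the ball of radius
    \<open>e\<close>.\<close>
  define \<rho> where "\<rho> = e / 5"
  define r where "r n = \<rho> * inverse (real (Suc n))" for n
  have \<rho>: "0 < \<rho>" using e by (simp add: \<rho>_def)
  have r: "0 < r n" "r n \<le> \<rho>" for n using \<rho> by (auto simp: r_def field_simps)
  have "\<exists>k::'a \<Rightarrow> real. smooth k \<and> (\<forall>x. 0 \<le> k x) \<and> (\<forall>x. x \<notin> cball 0 (r n) \<longrightarrow> k x = 0) \<and> (LINT x|lborel. k x) = 1" for n
    using mollifier_exists[OF r(1), where 'a='a] by metis
  then obtain k :: "nat \<Rightarrow> 'a \<Rightarrow> real" where k: "\<And>n. smooth (k n)" "\<And>n x. 0 \<le> k n x"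
    "\<And>n x. x \<notin> cball 0 (r n) \<Longrightarrow> k n x = 0" "\<And>n. (LINT x|lborel. k n x) = 1"
    by metis
  have lim: "r \<longlonglongrightarrow> 0"
    unfolding r_def using tendsto_mult_left[OF LIMSEQ_inverse_real_of_nat, of \<rho>] by simp
  have C: "\<exists>C. compact C \<and> C \<subseteq> \<Omega> \<and> (\<forall>y. y \<notin> C \<longrightarrow> k n (x - y) = 0)" if "dist p x < 4 * \<rho>" for n x
  proof (intro exI[of _ "cball x (r n)"] conjI allI impI)
    show "cball x (r n) \<subseteq> \<Omega>"
    proof
      fix y assume "y \<in> cball x (r n)"
      then have "dist p y < e" using dist_triangle[of p y x] that r(2)[of n] by (simp add: \<rho>_def)
      then show "y \<in> \<Omega>" using e(2) by auto
    qed
    show "k n (x - y) = 0" if "y \<notin> cball x (r n)" for y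
      using that k(3)[of "x - y" n] by (simp add: dist_norm norm_minus_commute)
  qed simp
  show ?thesis
    unfolding mollifiable_at_def
    by (intro exI[of _ \<rho>] conjI exI[of _ k] exI[of _ r] allI impI \<rho> k lim r(2) C) auto
qed

text \<open>The mollifier is displaced upwards in the chart by
  \<open>\<delta> = (L + 2) * \<epsilon>\<close>. A ball of radius \<open>\<epsilon>\<close> around
  the displaced point stays above the graph, which can rise by at most \<open>L * \<epsilon>\<close>
  over the horizontal distance \<open>\<epsilon>\<close>.\<close>

lemma mollifiable_at_boundary:
  fixes \<Omega> :: "(real^2) set"
  assumes ch: "boundary_chart \<Omega> p Q r h f" and L: "L-lipschitz_on {-r<..<r} f"
  shows "mollifiable_at \<Omega> p"
proof -
  note Q = boundary_chart_orthogonal[OF ch]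
  have L0: "0 \<le> L" using L by (rule lipschitz_on_nonneg)
  have rh: "0 < r" "0 < h" using ch by (auto simp: boundary_chart_def)
  \<comment> \<open>Leaves room in the chart rectangle for a distance \<open>4 * \<rho>\<close> from
    \<open>p\<close> plus a kernel radius of at most \<open>\<rho>\<close>.\<close>
  define \<rho> where "\<rho> = min r h / 6"
  have \<rho>: "0 < \<rho>" "5 * \<rho> < r" "5 * \<rho> < h" using rh by (auto simp: \<rho>_def min_def)
  \<comment> \<open>\<open>R n\<close> is the displacement plus the radius of the mollifier, so a
    centred ball of radius \<open>R n\<close> contains the support of the displaced kernel. The
    scaling makes it at most \<open>\<rho>\<close>.\<close>
  define \<epsilon> where "\<epsilon> n = \<rho> / (L + 3) * inverse (real (Suc n))" for n
  define R where "R n = (L + 3) * \<epsilon> n" for n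
  have \<epsilon>: "0 < \<epsilon> n" for n using \<rho> L0 by (simp add: \<epsilon>_def)
  have R_eq: "R n = \<rho> * inverse (real (Suc n))" for n using L0 by (simp add: R_def \<epsilon>_def)
  have R: "R n \<le> \<rho>" for n unfolding R_eq using \<rho> by (auto simp: field_simps)
  have lim: "R \<longlonglongrightarrow> 0"
    unfolding R_eq using tendsto_mult_left[OF LIMSEQ_inverse_real_of_nat, of \<rho>] by simp
  have "\<exists>k::real^2 \<Rightarrow> real. smooth k \<and> (\<forall>x. 0 \<le> k x) \<and> (\<forall>x. x \<notin> cball 0 (\<epsilon> n) \<longrightarrow> k x = 0) \<and> (LINT x|lborel. k x) = 1" for n
    using mollifier_exists[OF \<epsilon>, where 'a="real^2"] by metis
  then obtain m :: "nat \<Rightarrow> real^2 \<Rightarrow> real" where m: "\<And>n. smooth (m n)" "\<And>n x. 0 \<le> m n x"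
    "\<And>n x. x \<notin> cball 0 (\<epsilon> n) \<Longrightarrow> m n x = 0" "\<And>n. (LINT x|lborel. m n x) = 1"
    by metis
  define e where "e = Q (vector [0, 1])"
  have e1: "norm e = 1" by (simp add: e_def norm_chart_vector[OF Q])
  define \<delta> where "\<delta> n = (L + 2) * \<epsilon> n" for n
  have \<delta>0: "0 < \<delta> n" for n using \<epsilon>[of n] L0 by (simp add: \<delta>_def)
  have \<delta>R: "\<delta> n + \<epsilon> n = R n" for n by (simp add: R_def \<delta>_def algebra_simps)
  \<comment> \<open>The support of \<open>k n\<close> is centred at
    \<open>- \<delta> n *\<^sub>R e\<close>; as a function of \<open>y\<close>,
    \<open>k n (x - y)\<close> therefore lives around
    \<open>x + \<delta> n *\<^sub>R e\<close>.\<close>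
  define k where "k n z = m n (\<delta> n *\<^sub>R e + 1 *\<^sub>R z)" for n z
  have k1: "smooth (k n)" for n unfolding k_def by (rule smooth_affine[OF m(1)])
  have k2: "0 \<le> k n x" for n x by (simp add: k_def m(2))
  have k3: "k n x = 0" if "x \<notin> cball 0 (R n)" for n x
  proof -
    have "norm x \<le> norm (\<delta> n *\<^sub>R e + x) + norm (\<delta> n *\<^sub>R e)"
      using norm_triangle_ineq4[of "\<delta> n *\<^sub>R e + x" "\<delta> n *\<^sub>R e"] by simp
    then have "norm (\<delta> n *\<^sub>R e + x) > \<epsilon> n" using that \<delta>R[of n] \<delta>0[of n] e1 by simp
    then show ?thesis using m(3) by (simp add: k_def)
  qed
  have k4: "(LINT x|lborel. k n x) = 1" for n
    unfolding k_def using m(4)[of n] smooth_measurable[OF m(1)]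
    by (subst integral_lborel_affine) auto
  have C: "\<exists>C. compact C \<and> C \<subseteq> \<Omega> \<and> (\<forall>y. y \<notin> C \<longrightarrow> k n (x - y) = 0)"
    if x: "x \<in> \<Omega>" "dist p x < 4 * \<rho>" for n x
  proof (intro exI[of _ "cball (x + \<delta> n *\<^sub>R e) (\<epsilon> n)"] conjI allI impI)
    obtain s t where st: "x = chart_pt p Q s t" using chart_pt_surj[OF Q] by blast
    have "dist (chart_pt p Q s t) (chart_pt p Q 0 0) < 4 * \<rho>"
      using x(2) st by (simp add: chart_pt_origin[OF Q] dist_commute)
    then have st4: "\<bar>s\<bar> < 4 * \<rho>" "\<bar>t\<bar> < 4 * \<rho>"
      using dist_chart_pt_bounds(1)[OF Q, of s 0 p t 0] dist_chart_pt_bounds(2)[OF Q, of t 0 p s 0] by auto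
    have "f s < t" using boundary_chart_above[OF ch, of s t] x(1) st st4 \<rho> by auto
    have xe: "x + \<delta> n *\<^sub>R e = chart_pt p Q s (t + \<delta> n)"
      using chart_pt_add[OF Q, of p s t 0 "\<delta> n"] by (simp add: e_def chart_scale[OF Q] st)
    show "cball (x + \<delta> n *\<^sub>R e) (\<epsilon> n) \<subseteq> \<Omega>"
    proof
      fix y assume "y \<in> cball (x + \<delta> n *\<^sub>R e) (\<epsilon> n)"
      moreover obtain a b where ab: "y = chart_pt p Q a b" using chart_pt_surj[OF Q] by blast
      ultimately have d: "\<bar>s - a\<bar> \<le> \<epsilon> n" "\<bar>t + \<delta> n - b\<bar> \<le> \<epsilon> n"
        using dist_chart_pt_bounds(1)[OF Q, of s a p "t + \<delta> n" b]
          dist_chart_pt_bounds(2)[OF Q, of "t + \<delta> n" b p s a] by (auto simp: xe)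
      have "\<bar>a\<bar> < r" "\<bar>b\<bar> < h"
        using d st4 \<rho> R[of n] \<delta>R[of n] \<epsilon>[of n] \<delta>0[of n] by (auto simp: abs_le_iff abs_less_iff)
      moreover have "\<bar>f a - f s\<bar> \<le> L * \<bar>a - s\<bar>"
        using lipschitz_onD[OF L, of a s] \<open>\<bar>a\<bar> < r\<close> st4 \<rho> by (auto simp: dist_real_def abs_less_iff)
      moreover have "L * \<bar>a - s\<bar> \<le> L * \<epsilon> n" using d L0 by (intro mult_left_mono) auto
      moreover have "\<delta> n = L * \<epsilon> n + 2 * \<epsilon> n" by (simp add: \<delta>_def algebra_simps)
      ultimately have "f a < b" using d(2) \<open>f s < t\<close> \<epsilon>[of n] by (auto simp: abs_le_iff)
      then show "y \<in> \<Omega>" using boundary_chart_above[OF ch \<open>\<bar>a\<bar> < r\<close> \<open>\<bar>b\<bar> < h\<close>] ab by simp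
    qed
    show "k n (x - y) = 0" if "y \<notin> cball (x + \<delta> n *\<^sub>R e) (\<epsilon> n)" for y
    proof -
      have eq: "\<delta> n *\<^sub>R e + 1 *\<^sub>R (x - y) = x + \<delta> n *\<^sub>R e - y" by simp
      have "x + \<delta> n *\<^sub>R e - y \<notin> cball 0 (\<epsilon> n)" using that unfolding mem_cball dist_norm by (simp only: diff_0 norm_minus_cancel not_False_eq_True)
      from m(3)[OF this] show ?thesis by (simp only: k_def eq)
    qed
  qed simp
  show ?thesis
    unfolding mollifiable_at_def
    by (intro exI[of _ \<rho>] conjI exI[of _ k] exI[of _ R] allI impI \<rho>(1) k1 k2 k3 k4 lim R C) auto
qed

lemma lipschitz_mollifiable:
  assumes "open \<Omega>" "lipschitz_boundary \<Omega>" "p \<in> closure \<Omega>"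
  shows "mollifiable_at \<Omega> p"
proof (cases "p \<in> \<Omega>")
  case True then show ?thesis using mollifiable_at_interior assms(1) by blast
next
  case False
  then have "p \<in> frontier \<Omega>" using assms by (simp add: frontier_def interior_open)
  then show ?thesis using assms(2) mollifiable_at_boundary unfolding lipschitz_boundary_def by blast
qed

section \<open>Interior cones at the boundary\<close>

text \<open>The direction \<open>E\<close> is not normalised: \<open>l\<close> measures the
  parameter along \<open>E\<close>, and the segment has length \<open>l * norm E\<close>.\<close>

definition seg_int :: "(real^2 \<Rightarrow> real) \<Rightarrow> real^2 \<Rightarrow> real^2 \<Rightarrow> real \<Rightarrow> ennreal" where
  "seg_int U E x l = (\<integral>\<^sup>+\<tau>. ennreal \<bar>pd E U (x + \<tau> *\<^sub>R E)\<bar> * indicator {0..l} \<tau> \<partial>lborel)"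

text \<open>
  Two boundary points of \<open>B\<close> are joined through \<open>\<Omega>\<close> by two segments in directions from \<open>\<E>\<close> of
  length comparable to their distance, and the boundary is swept into \<open>\<Omega>\<close> along these directions
  with bounded distortion of measure.
\<close>

definition cone_patch :: "(real^2) set \<Rightarrow> (real^2) set \<Rightarrow> real \<Rightarrow> (real^2) set \<Rightarrow> real \<Rightarrow> bool" where
  "cone_patch \<Omega> B D \<E> C \<longleftrightarrow> open B \<and> 0 < D \<and> 0 \<le> C \<and> finite \<E> \<and> \<E> \<noteq> {} \<and>
     (\<forall>U x y. smooth U \<longrightarrow> x \<in> frontier \<Omega> \<inter> B \<longrightarrow> y \<in> frontier \<Omega> \<inter> B \<longrightarrow> dist x y \<le> D \<and>
        ennreal \<bar>U x - U y\<bar> \<le> (\<Sum>E\<in>\<E>. seg_int U E x (dist x y) + seg_int U E y (dist x y))) \<and>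
     (\<forall>E\<in>\<E>. \<forall>F\<in>borel_measurable borel.
        (\<integral>\<^sup>+x. (\<integral>\<^sup>+\<tau>. F (x + \<tau> *\<^sub>R E) * indicator {0..D} \<tau> \<partial>lborel) * indicator B x \<partial>boundary_measure \<Omega>)
        \<le> ennreal C * (\<integral>\<^sup>+x. F x * indicator \<Omega> x \<partial>lborel))"

lemma smooth_segment_bound:
  fixes U :: "real^2 \<Rightarrow> real"
  assumes U: "smooth U" and a: "0 \<le> a" "a \<le> l"
  shows "ennreal \<bar>U (x + a *\<^sub>R E) - U x\<bar> \<le> seg_int U E x l"
proof -
  let ?g = "\<lambda>\<tau>. pd E U (x + \<tau> *\<^sub>R E)"
  have lin: "linear (\<lambda>h. pd h U y)" for y
    using has_derivative_linear[OF smooth_has_derivative[OF U]] .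
  have rep: "pd E U y = (\<Sum>b\<in>Basis. (E \<bullet> b) * pd b U y)" for y
    using linear_sum[OF lin, of "\<lambda>b. (E \<bullet> b) *\<^sub>R b" Basis] linear_scale[OF lin]
    by (simp add: euclidean_representation)
  have "continuous_on UNIV (pd E U)"
    unfolding rep[abs_def] by (intro continuous_intros smooth_continuous smooth_pd[OF U])
  then have cont: "continuous_on S ?g" for S
    by (rule continuous_on_compose2) (auto intro!: continuous_intros)
  have d: "((\<lambda>\<tau>. U (x + \<tau> *\<^sub>R E)) has_vector_derivative ?g \<tau>) (at \<tau> within {0..a})" for \<tau>
  proof -
    have "((\<lambda>\<tau>. U (x + \<tau> *\<^sub>R E)) has_derivative (\<lambda>h. pd (h *\<^sub>R E) U (x + \<tau> *\<^sub>R E))) (at \<tau> within {0..a})"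
      by (rule has_derivative_compose[OF _ smooth_has_derivative[OF U]]) (auto intro!: derivative_eq_intros)
    then show ?thesis
      by (simp add: has_vector_derivative_def linear_scale[OF lin])
  qed
  have hi: "(?g has_integral (U (x + a *\<^sub>R E) - U (x + 0 *\<^sub>R E))) {0..a}"
    by (rule fundamental_theorem_of_calculus[OF a(1) d])
  have ai: "((\<lambda>\<tau>. \<bar>?g \<tau>\<bar>) has_integral integral {0..a} (\<lambda>\<tau>. \<bar>?g \<tau>\<bar>)) {0..a}"
    by (intro integrable_integral integrable_continuous_real continuous_intros cont)
  have "\<bar>U (x + a *\<^sub>R E) - U x\<bar> = \<bar>integral {0..a} ?g\<bar>" using integral_unique[OF hi] by simp
  also have "\<dots> \<le> integral {0..a} (\<lambda>\<tau>. \<bar>?g \<tau>\<bar>)"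
    using integral_norm_bound_integral[of ?g "{0..a}" "\<lambda>\<tau>. \<bar>?g \<tau>\<bar>"]
      integrable_continuous_real[OF cont] integrable_continuous_real[OF continuous_on_rabs[OF cont]]
    by simp
  finally have "ennreal \<bar>U (x + a *\<^sub>R E) - U x\<bar> \<le> ennreal (integral {0..a} (\<lambda>\<tau>. \<bar>?g \<tau>\<bar>))"
    by (rule ennreal_leI)
  also have "\<dots> = (\<integral>\<^sup>+\<tau>. ennreal (indicator {0..a} \<tau> * \<bar>?g \<tau>\<bar>) \<partial>lborel)"
    using nn_integral_has_integral_lebesgue[OF _ ai] by simp
  also have "\<dots> \<le> seg_int U E x l"
    unfolding seg_int_def using a by (intro nn_integral_mono) (auto simp: indicator_def)
  finally show ?thesis .
qed

lemma boundary_measure_emeasure: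
  assumes H: "emeasure hausdorff1 (\<Gamma> :: (real^2) set) \<noteq> 0" and B: "B \<in> sets borel" "B \<subseteq> frontier \<Omega>"
  shows "emeasure (boundary_measure \<Omega>) B = hausdorff1_outer B"
    and "B \<in> sets (boundary_measure \<Omega>)"
proof -
  have "frontier \<Omega> \<inter> space hausdorff1 \<in> sets (hausdorff1 :: (real^2) measure)"
    using sets_eq_imp_space_eq[OF sets_hausdorff1[OF H]] by (simp add: sets_hausdorff1[OF H])
  then show "emeasure (boundary_measure \<Omega>) B = hausdorff1_outer B"
    unfolding boundary_measure_def using B by (subst emeasure_restrict_space) (auto simp: emeasure_hausdorff1[OF H])
  show "B \<in> sets (boundary_measure \<Omega>)"
    unfolding boundary_measure_def sets_restrict_space sets_hausdorff1[OF H] using B by (auto simp: image_iff)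
qed

lemma boundary_measure_space:
  assumes H: "emeasure hausdorff1 (\<Gamma> :: (real^2) set) \<noteq> 0"
  shows "space (boundary_measure \<Omega>) = frontier \<Omega>"
    and "g \<in> borel_measurable borel \<Longrightarrow> g \<in> borel_measurable (boundary_measure \<Omega>)"
    and "sets (boundary_measure \<Omega>) = sets (restrict_space borel (frontier \<Omega>))"
proof -
  have s: "space (hausdorff1 :: (real^2) measure) = UNIV"
    using sets_eq_imp_space_eq[OF sets_hausdorff1[OF H]] by simp
  then show "space (boundary_measure \<Omega>) = frontier \<Omega>"
    by (simp add: boundary_measure_def space_restrict_space)
  show "sets (boundary_measure \<Omega>) = sets (restrict_space borel (frontier \<Omega>))"
    by (simp add: boundary_measure_def sets_restrict_space sets_hausdorff1[OF H])
  show "g \<in> borel_measurable borel \<Longrightarrow> g \<in> borel_measurable (boundary_measure \<Omega>)"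
    unfolding boundary_measure_def
    by (rule measurable_restrict_space1) (simp add: measurable_cong_sets[OF sets_hausdorff1[OF H] refl])
qed

text \<open>In chart coordinates a boundary point \<open>(s, f s)\<close> moves to
  \<open>(s + k * \<tau>, f s + (L + 1) * \<tau>)\<close>. For a fixed new abscissa
  \<open>\<sigma> = s + k * \<tau>\<close> the height grows at rate at least 1 in
  \<open>\<tau>\<close>, because the slope \<open>L + 1\<close> beats the Lipschitz constant. So the
  inner change of variables costs a factor 1, and only the passage from boundary measure to
  \<open>s\<close> costs \<open>1 + L\<close>.\<close>

lemma lipschitz_cone_sweep:
  fixes \<Omega> :: "(real^2) set"
  assumes H: "emeasure hausdorff1 (\<Gamma> :: (real^2) set) \<noteq> 0"
    and ch: "boundary_chart \<Omega> p Q r h f" and L: "L-lipschitz_on {-r<..<r} f" and "open \<Omega>"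
    and \<eta>: "0 < \<eta>" "2 * \<eta> < r" "(2 * L + 1) * \<eta> < h" and k: "\<bar>k\<bar> = 1" and F[measurable]: "F \<in> borel_measurable borel"
  shows "(\<integral>\<^sup>+x. (\<integral>\<^sup>+\<tau>. F (x + \<tau> *\<^sub>R Q (vector [k, L + 1])) * indicator {0..\<eta>} \<tau> \<partial>lborel) * indicator (ball p \<eta>) x
       \<partial>boundary_measure \<Omega>) \<le> ennreal (1 + L) * (\<integral>\<^sup>+x. F x * indicator \<Omega> x \<partial>lborel)"
proof -
  note Q = boundary_chart_orthogonal[OF ch]
  have L0: "0 \<le> L" using L by (rule lipschitz_on_nonneg)
  have f0: "f 0 = 0" using ch by (simp add: boundary_chart_def)
  have [measurable]: "\<Omega> \<in> sets borel" using \<open>open \<Omega>\<close> by auto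
  have lip: "\<bar>f s - f t\<bar> \<le> L * \<bar>s - t\<bar>" if "\<bar>s\<bar> < r" "\<bar>t\<bar> < r" for s t
    using lipschitz_onD[OF L, of s t] that by (auto simp: dist_real_def abs_less_iff)
  have cont: "continuous_on {-r<..<r} f" using L by (rule lipschitz_on_continuous_on)
  \<comment> \<open>\<open>f\<close> is controlled only on the base of the chart; the extension by 0
    is Borel on the whole line.\<close>
  define f' where "f' s = (if s \<in> {-r<..<r} then f s else 0)" for s
  have [measurable]: "f' \<in> borel_measurable borel"
    unfolding f'_def by (intro borel_measurable_continuous_on_if cont) auto
  have f'_eq: "f' s = f s" if "\<bar>s\<bar> < r" for s using that by (auto simp: f'_def)
  define E where "E = Q (vector [k, L + 1])"
  define P where "P = chart_pt p Q"
  have Pm: "(\<lambda>x. P (a x) (b x)) \<in> borel_measurable M" if "a \<in> borel_measurable M" "b \<in> borel_measurable M"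
    for a b and M :: "'x measure"
    unfolding P_def by (rule chart_pt_measurable2[OF Q that])
  have PE: "P s t + \<tau> *\<^sub>R E = P (s + k * \<tau>) (t + (L + 1) * \<tau>)" for s t \<tau>
    by (simp add: P_def E_def chart_scale[OF Q] chart_pt_add[OF Q] mult.commute)
  define \<Phi> where "\<Phi> x = (\<integral>\<^sup>+\<tau>. F (x + \<tau> *\<^sub>R E) * indicator {0..\<eta>} \<tau> \<partial>lborel)" for x
  have \<Phi>m[measurable]: "\<Phi> \<in> borel_measurable borel" unfolding \<Phi>_def by measurable
  define \<pi> where "\<pi> x = (x - p) \<bullet> Q (vector [1, 0])" for x
  have [measurable]: "\<pi> \<in> borel_measurable borel" unfolding \<pi>_def by measurable
  have \<pi>P: "\<pi> (P s t) = s" for s t by (simp add: \<pi>_def P_def chart_pt_inner[OF Q])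
  define J where "J = frontier \<Omega> \<inter> ball p \<eta>"
  have Jb: "J \<in> sets borel" "J \<subseteq> frontier \<Omega>" by (auto simp: J_def)
  have "\<eta> < h" 
    by (rule le_less_trans[OF _ \<eta>(3)]) (use \<eta>(1) L0 in \<open>simp add: distrib_right\<close>)
  have graph: "\<exists>s. \<bar>s\<bar> < \<eta> \<and> x = P s (f s)" if "x \<in> J" for x
  proof -
    obtain s t where st: "x = P s t" using chart_pt_surj[OF Q] P_def by blast
    have "dist (P s t) (P 0 0) < \<eta>"
      using that st by (simp add: J_def P_def chart_pt_origin[OF Q] dist_commute)
    then have b: "\<bar>s\<bar> < \<eta>" "\<bar>t\<bar> < \<eta>"
      using dist_chart_pt_bounds(1)[OF Q, of s 0 p t 0] dist_chart_pt_bounds(2)[OF Q, of t 0 p s 0]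
      by (auto simp: P_def)
    have "t = f s"
      by (rule boundary_chart_frontier_is_graph[OF ch \<open>open \<Omega>\<close> cont])
        (use b \<eta> \<open>\<eta> < h\<close> that st in \<open>auto simp: J_def P_def\<close>)
    then show ?thesis using st b by auto
  qed
  have "(\<integral>\<^sup>+x. \<Phi> x * indicator (ball p \<eta>) x \<partial>boundary_measure \<Omega>)
     = (\<integral>\<^sup>+x. (\<lambda>s. \<Phi> (P s (f' s)) * indicator {-\<eta><..<\<eta>} s) (\<pi> x) * indicator J x \<partial>boundary_measure \<Omega>)"
  proof (rule nn_integral_cong)
    fix x assume "x \<in> space (boundary_measure \<Omega>)"
    then have x: "x \<in> frontier \<Omega>" by (simp add: boundary_measure_space[OF H])
    show "\<Phi> x * indicator (ball p \<eta>) x = (\<lambda>s. \<Phi> (P s (f' s)) * indicator {-\<eta><..<\<eta>} s) (\<pi> x) * indicator J x"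
    proof (cases "x \<in> J")
      case True
      then obtain s where s: "\<bar>s\<bar> < \<eta>" "x = P s (f s)" using graph by blast
      then have "f' s = f s" using \<eta> by (intro f'_eq) auto
      then show ?thesis using True s by (auto simp: \<pi>P J_def indicator_def)
    qed (use x in \<open>auto simp: J_def\<close>)
  qed
  \<comment> \<open>The part of the boundary above a Borel set of parameters is a
    \<open>(1 + L)\<close>-Lipschitz image of it, which bounds its Hausdorff measure.\<close>
  also have "\<dots> \<le> ennreal (1 + L) * (\<integral>\<^sup>+s. \<Phi> (P s (f' s)) * indicator {-\<eta><..<\<eta>} s \<partial>lborel)"
  proof (rule nn_integral_change_le)
    show "J \<in> sets (boundary_measure \<Omega>)" by (rule boundary_measure_emeasure(2)[OF H Jb])
    show "\<pi> \<in> measurable (restrict_space (boundary_measure \<Omega>) J) lborel"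
      by (simp add: boundary_measure_space(2)[OF H] measurable_restrict_space1)
    show "(\<lambda>s. \<Phi> (P s (f' s)) * indicator {-\<eta><..<\<eta>} s) \<in> borel_measurable lborel"
      using measurable_compose[OF Pm[of "\<lambda>s. s" lborel f'] \<Phi>m] by simp
    fix B :: "real set" assume "B \<in> sets lborel"
    then have B: "B \<in> sets borel" by simp
    have "\<pi> -` B \<inter> J \<in> sets borel" using Jb(1) measurable_sets[of \<pi> borel borel B] B by auto
    then have "emeasure (boundary_measure \<Omega>) (\<pi> -` B \<inter> J) = hausdorff1_outer (\<pi> -` B \<inter> J)"
      by (rule boundary_measure_emeasure(1)[OF H]) (use Jb in auto)
    also have "\<dots> \<le> ennreal (1 + L) * emeasure lborel (B \<inter> {-\<eta><..<\<eta>})"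
    proof (rule hausdorff1_outer_image_le[where a="-\<eta>" and b=\<eta> and \<gamma>="\<lambda>s. P s (f s)"])
      show "dist (P s (f s)) (P t (f t)) \<le> (1 + L) * \<bar>s - t\<bar>"
        if "s \<in> B \<inter> {-\<eta><..<\<eta>}" "t \<in> B \<inter> {-\<eta><..<\<eta>}" for s t
      proof -
        have "dist (P s (f s)) (P t (f t)) \<le> \<bar>s - t\<bar> + \<bar>f s - f t\<bar>"
          unfolding P_def by (rule dist_chart_pt_bounds(3)[OF Q])
        also have "\<bar>f s - f t\<bar> \<le> L * \<bar>s - t\<bar>" using that \<eta> by (intro lip) auto
        finally show ?thesis by (simp add: algebra_simps)
      qed
      show "\<pi> -` B \<inter> J \<subseteq> (\<lambda>s. P s (f s)) ` (B \<inter> {-\<eta><..<\<eta>})"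
      proof
        fix x assume x: "x \<in> \<pi> -` B \<inter> J"
        then obtain s where s: "\<bar>s\<bar> < \<eta>" "x = P s (f s)" using graph by blast
        then have "s \<in> B \<inter> {-\<eta><..<\<eta>}" using x \<pi>P by auto
        then show "x \<in> (\<lambda>s. P s (f s)) ` (B \<inter> {-\<eta><..<\<eta>})" using s(2) by blast
      qed
    qed (use B L0 in auto)
    also have "\<dots> \<le> ennreal (1 + L) * emeasure lborel B"
      using B by (intro mult_left_mono emeasure_mono) auto
    finally show "emeasure (boundary_measure \<Omega>) (\<pi> -` B \<inter> J) \<le> ennreal (1 + L) * emeasure lborel B" .
  qed
  also have "(\<integral>\<^sup>+s. \<Phi> (P s (f' s)) * indicator {-\<eta><..<\<eta>} s \<partial>lborel)
     = (\<integral>\<^sup>+s. \<integral>\<^sup>+\<tau>. F (P (s + k * \<tau>) (f' s + (L + 1) * \<tau>)) * indicator {0..\<eta>} \<tau> * indicator {-\<eta><..<\<eta>} s \<partial>lborel \<partial>lborel)"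
  proof (rule nn_integral_cong)
    fix s
    have "(\<lambda>\<tau>. P (s + k * \<tau>) (f' s + (L + 1) * \<tau>)) \<in> borel_measurable lborel" by (intro Pm) auto
    from measurable_compose[OF this F]
    show "\<Phi> (P s (f' s)) * indicator {-\<eta><..<\<eta>} s
      = (\<integral>\<^sup>+\<tau>. F (P (s + k * \<tau>) (f' s + (L + 1) * \<tau>)) * indicator {0..\<eta>} \<tau> * indicator {-\<eta><..<\<eta>} s \<partial>lborel)"
      unfolding \<Phi>_def PE by (subst nn_integral_multc) auto
  qed
  also have "\<dots> = (\<integral>\<^sup>+\<tau>. \<integral>\<^sup>+s. F (P (s + k * \<tau>) (f' s + (L + 1) * \<tau>)) * indicator {0..\<eta>} \<tau> * indicator {-\<eta><..<\<eta>} s \<partial>lborel \<partial>lborel)"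
  proof (rule lborel_pair.Fubini')
    have "(\<lambda>z. P (snd z + k * fst z) (f' (snd z) + (L + 1) * fst z)) \<in> borel_measurable (lborel \<Otimes>\<^sub>M lborel)"
      by (rule Pm) measurable
    from measurable_compose[OF this F]
    show "(\<lambda>(\<tau>, s). F (P (s + k * \<tau>) (f' s + (L + 1) * \<tau>)) * indicator {0..\<eta>} \<tau> * indicator {-\<eta><..<\<eta>} s)
      \<in> borel_measurable (lborel \<Otimes>\<^sub>M lborel)"
      by (simp add: case_prod_beta')
  qed
  \<comment> \<open>Translation by \<open>k * \<tau>\<close> at fixed \<open>\<tau>\<close>, from
    the old abscissa \<open>s\<close> to the new one \<open>\<sigma>\<close>; afterwards the order
    of integration is restored with \<open>\<sigma>\<close> outside.\<close>
  also have "\<dots> = (\<integral>\<^sup>+\<tau>. \<integral>\<^sup>+\<sigma>. F (P \<sigma> (f' (\<sigma> - k * \<tau>) + (L + 1) * \<tau>)) * indicator {0..\<eta>} \<tau> * indicator {-\<eta><..<\<eta>} (\<sigma> - k * \<tau>) \<partial>lborel \<partial>lborel)"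
  proof (rule nn_integral_cong)
    fix \<tau> :: real
    let ?G = "\<lambda>s. F (P (s + k * \<tau>) (f' s + (L + 1) * \<tau>)) * indicator {0..\<eta>} \<tau> * indicator {-\<eta><..<\<eta>} s"
    have "(\<lambda>s. P (s + k * \<tau>) (f' s + (L + 1) * \<tau>)) \<in> borel_measurable borel" by (intro Pm) auto
    from measurable_compose[OF this F] have "?G \<in> borel_measurable borel" by simp
    from nn_integral_lborel_shift[OF this, of "k * \<tau>"]
    show "(\<integral>\<^sup>+s. ?G s \<partial>lborel) = (\<integral>\<^sup>+\<sigma>. F (P \<sigma> (f' (\<sigma> - k * \<tau>) + (L + 1) * \<tau>)) * indicator {0..\<eta>} \<tau> * indicator {-\<eta><..<\<eta>} (\<sigma> - k * \<tau>) \<partial>lborel)"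
      by simp
  qed
  also have "\<dots> = (\<integral>\<^sup>+\<sigma>. \<integral>\<^sup>+\<tau>. F (P \<sigma> (f' (\<sigma> - k * \<tau>) + (L + 1) * \<tau>)) * indicator {0..\<eta>} \<tau> * indicator {-\<eta><..<\<eta>} (\<sigma> - k * \<tau>) \<partial>lborel \<partial>lborel)"
  proof (rule lborel_pair.Fubini')
    have "(\<lambda>z. P (fst z) (f' (fst z - k * snd z) + (L + 1) * snd z)) \<in> borel_measurable (lborel \<Otimes>\<^sub>M lborel)"
      by (rule Pm) measurable
    from measurable_compose[OF this F]
    show "(\<lambda>(\<sigma>, \<tau>). F (P \<sigma> (f' (\<sigma> - k * \<tau>) + (L + 1) * \<tau>)) * indicator {0..\<eta>} \<tau> * indicator {-\<eta><..<\<eta>} (\<sigma> - k * \<tau>))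
      \<in> borel_measurable (lborel \<Otimes>\<^sub>M lborel)"
      by (simp add: case_prod_beta')
  qed
  also have "\<dots> \<le> (\<integral>\<^sup>+\<sigma>. \<integral>\<^sup>+y. F (P \<sigma> y) * indicator \<Omega> (P \<sigma> y) \<partial>lborel \<partial>lborel)"
  proof (rule nn_integral_mono)
    fix \<sigma> :: real
    define I where "I = {\<tau>. 0 \<le> \<tau> \<and> \<tau> \<le> \<eta> \<and> \<bar>\<sigma> - k * \<tau>\<bar> < \<eta>}"
    define \<phi> where "\<phi> \<tau> = f' (\<sigma> - k * \<tau>) + (L + 1) * \<tau>" for \<tau>
    have [measurable]: "\<phi> \<in> borel_measurable borel" unfolding \<phi>_def by measurable
    have Ib: "I \<in> sets borel" unfolding I_def by measurable
    have kk: "\<bar>k * a\<bar> = \<bar>a\<bar>" for a using k by (simp add: abs_mult)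
    have inI: "\<bar>\<sigma> - k * \<tau>\<bar> < r" "\<phi> \<tau> = f (\<sigma> - k * \<tau>) + (L + 1) * \<tau>" if "\<tau> \<in> I" for \<tau>
      using that \<eta> f'_eq by (auto simp: I_def \<phi>_def)
    \<comment> \<open>The smallness of \<open>\<eta>\<close> enters here:
      \<open>2 * \<eta> < r\<close> keeps \<open>\<sigma>\<close> in the base, and the height is at
      most \<open>L * \<eta> + (L + 1) * \<eta>\<close>, below \<open>h\<close>.\<close>
    have bd: "\<bar>\<phi> \<tau>\<bar> < h" "f \<sigma> < \<phi> \<tau>" "\<bar>\<sigma>\<bar> < r" if "\<tau> \<in> I" "\<tau> \<noteq> 0" for \<tau>
    proof -
      have \<tau>: "0 < \<tau>" "\<tau> \<le> \<eta>" "\<bar>\<sigma> - k * \<tau>\<bar> < \<eta>" using that by (auto simp: I_def)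
      have "\<bar>\<sigma>\<bar> \<le> \<bar>\<sigma> - k * \<tau>\<bar> + \<bar>k * \<tau>\<bar>" by simp
      then show \<sigma>: "\<bar>\<sigma>\<bar> < r" using \<tau> kk \<eta> by auto
      have "\<bar>f (\<sigma> - k * \<tau>) - f 0\<bar> \<le> L * \<bar>\<sigma> - k * \<tau> - 0\<bar>" using inI that \<eta> by (intro lip) auto
      also have "\<dots> \<le> L * \<eta>" using \<tau> L0 by (intro mult_left_mono) auto
      finally have 1: "\<bar>f (\<sigma> - k * \<tau>)\<bar> \<le> L * \<eta>" using f0 by simp
      have 2: "0 \<le> (L + 1) * \<tau>" "(L + 1) * \<tau> \<le> (L + 1) * \<eta>" using \<tau> L0 by (auto intro: mult_left_mono)
      have 3: "L * \<eta> + (L + 1) * \<eta> < h" using \<eta> by (simp add: algebra_simps)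
      show "\<bar>\<phi> \<tau>\<bar> < h" using 1 2 3 inI(2)[OF that(1)] by linarith
      have "\<bar>f \<sigma> - f (\<sigma> - k * \<tau>)\<bar> \<le> L * \<bar>\<sigma> - (\<sigma> - k * \<tau>)\<bar>" using inI that \<sigma> by (intro lip) auto
      also have "\<dots> = L * \<tau>" using kk[of \<tau>] \<tau> by simp
      finally show "f \<sigma> < \<phi> \<tau>" using inI(2)[OF that(1)] \<tau> by (simp add: algebra_simps)
    qed
    have in\<Omega>: "P \<sigma> (\<phi> \<tau>) \<in> \<Omega>" if "\<tau> \<in> I" "\<tau> \<noteq> 0" for \<tau>
      using boundary_chart_above[OF ch bd(3) bd(1)] bd(2) that unfolding P_def by blast
    have Fm: "(\<lambda>y. F (P \<sigma> y) * indicator \<Omega> (P \<sigma> y)) \<in> borel_measurable borel"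
    proof -
      have "(\<lambda>y. P \<sigma> y) \<in> borel_measurable borel" by (rule Pm) auto
      from measurable_compose[OF this, of "\<lambda>x. F x * indicator \<Omega> x" borel] show ?thesis by simp
    qed
    \<comment> \<open>At \<open>\<tau> = 0\<close> the point lies on the graph and not in \<Omega>;
      a single parameter does not matter.\<close>
    have "AE \<tau> in lborel. \<tau> \<noteq> (0::real)" by (rule AE_lborel_singleton)
    then have "(\<integral>\<^sup>+\<tau>. F (P \<sigma> (f' (\<sigma> - k * \<tau>) + (L + 1) * \<tau>)) * indicator {0..\<eta>} \<tau> * indicator {-\<eta><..<\<eta>} (\<sigma> - k * \<tau>) \<partial>lborel)
      = (\<integral>\<^sup>+\<tau>. (\<lambda>y. F (P \<sigma> y) * indicator \<Omega> (P \<sigma> y)) (\<phi> \<tau>) * indicator I \<tau> \<partial>lborel)"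
    proof (intro nn_integral_cong_AE, eventually_elim)
      case (elim \<tau>)
      have "indicator {0..\<eta>} \<tau> * indicator {-\<eta><..<\<eta>} (\<sigma> - k * \<tau>) = (indicator I \<tau> :: ennreal)"
        by (auto simp: indicator_def I_def abs_less_iff)
      then show ?case using in\<Omega>[of \<tau>] elim by (cases "\<tau> \<in> I") (auto simp: \<phi>_def[symmetric] mult.assoc)
    qed
    also have "\<dots> \<le> ennreal 1 * (\<integral>\<^sup>+y. F (P \<sigma> y) * indicator \<Omega> (P \<sigma> y) \<partial>lborel)"
    proof (rule nn_integral_change_le)
      show "I \<in> sets lborel" using Ib by simp
      show "\<phi> \<in> measurable (restrict_space lborel I) lborel" by (simp add: measurable_restrict_space1)
      show "(\<lambda>y. F (P \<sigma> y) * indicator \<Omega> (P \<sigma> y)) \<in> borel_measurable lborel" using Fm by simp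
      fix B :: "real set" assume "B \<in> sets lborel"
      then have B: "B \<in> sets borel" by simp
      have Sb: "\<phi> -` B \<inter> I \<in> sets borel" using Ib measurable_sets[of \<phi> borel borel B] B by auto
      have "emeasure lborel (\<phi> -` B \<inter> I) \<le> ennreal (1 / 1) * emeasure lborel B"
      proof (rule emeasure_expanding_preimage[OF _ _ _ B Sb])
        have "\<phi> ` I \<subseteq> {- (L * \<eta>)..L * \<eta> + (L + 1) * \<eta>}"
        proof safe
          fix \<tau> assume "\<tau> \<in> I"
          have \<tau>: "0 \<le> \<tau>" "\<tau> \<le> \<eta>" "\<bar>\<sigma> - k * \<tau>\<bar> < \<eta>" using \<open>\<tau> \<in> I\<close> by (auto simp: I_def)
          have "\<bar>f (\<sigma> - k * \<tau>) - f 0\<bar> \<le> L * \<bar>\<sigma> - k * \<tau> - 0\<bar>" using inI \<open>\<tau> \<in> I\<close> \<eta> by (intro lip) auto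
          also have "\<dots> \<le> L * \<eta>" using \<tau> L0 by (intro mult_left_mono) auto
          finally have 1: "\<bar>f (\<sigma> - k * \<tau>)\<bar> \<le> L * \<eta>" using f0 by simp
          have 2: "0 \<le> (L + 1) * \<tau>" "(L + 1) * \<tau> \<le> (L + 1) * \<eta>" using \<tau> L0 by (auto intro: mult_left_mono)
          show "\<phi> \<tau> \<in> {- (L * \<eta>)..L * \<eta> + (L + 1) * \<eta>}"
            using 1 2 inI(2)[OF \<open>\<tau> \<in> I\<close>] by auto
        qed
        then show "\<phi> ` I \<subseteq> {- (L * \<eta>)..L * \<eta> + (L + 1) * \<eta>}" .
        \<comment> \<open>Increments of \<open>(L + 1) * \<tau>\<close> exceed those of
          \<open>f\<close> by at least the increment of the parameter.\<close>
        show "1 * \<bar>\<tau> - \<tau>'\<bar> \<le> \<bar>\<phi> \<tau> - \<phi> \<tau>'\<bar>" if "\<tau> \<in> I" "\<tau>' \<in> I" for \<tau> \<tau>'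
        proof -
          have "\<bar>f (\<sigma> - k * \<tau>) - f (\<sigma> - k * \<tau>')\<bar> \<le> L * \<bar>(\<sigma> - k * \<tau>) - (\<sigma> - k * \<tau>')\<bar>"
            using inI that by (intro lip) auto
          also have "\<bar>(\<sigma> - k * \<tau>) - (\<sigma> - k * \<tau>')\<bar> = \<bar>\<tau> - \<tau>'\<bar>"
            using kk[of "\<tau>' - \<tau>"] by (simp add: algebra_simps abs_minus_commute)
          finally have 1: "\<bar>f (\<sigma> - k * \<tau>) - f (\<sigma> - k * \<tau>')\<bar> \<le> L * \<bar>\<tau> - \<tau>'\<bar>" .
          have "\<phi> \<tau> - \<phi> \<tau>' = (L + 1) * (\<tau> - \<tau>') + (f (\<sigma> - k * \<tau>) - f (\<sigma> - k * \<tau>'))"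
            using inI(2) that by (simp add: algebra_simps)
          then have "\<bar>\<phi> \<tau> - \<phi> \<tau>'\<bar> \<ge> \<bar>(L + 1) * (\<tau> - \<tau>')\<bar> - \<bar>f (\<sigma> - k * \<tau>) - f (\<sigma> - k * \<tau>')\<bar>" by linarith
          moreover have "\<bar>(L + 1) * (\<tau> - \<tau>')\<bar> = L * \<bar>\<tau> - \<tau>'\<bar> + \<bar>\<tau> - \<tau>'\<bar>"
            using L0 by (subst abs_mult) (simp add: distrib_right)
          ultimately show ?thesis using 1 by linarith
        qed
      qed auto
      then show "emeasure lborel (\<phi> -` B \<inter> I) \<le> ennreal 1 * emeasure lborel B" by simp
    qed
    finally show "(\<integral>\<^sup>+\<tau>. F (P \<sigma> (f' (\<sigma> - k * \<tau>) + (L + 1) * \<tau>)) * indicator {0..\<eta>} \<tau> * indicator {-\<eta><..<\<eta>} (\<sigma> - k * \<tau>) \<partial>lborel)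
      \<le> (\<integral>\<^sup>+y. F (P \<sigma> y) * indicator \<Omega> (P \<sigma> y) \<partial>lborel)" by simp
  qed
  also have "\<dots> = (\<integral>\<^sup>+x. F x * indicator \<Omega> x \<partial>lborel)"
    unfolding P_def chart_pt_def by (rule nn_integral_chart[OF Q, symmetric]) measurable
  finally show ?thesis
    unfolding \<Phi>_def E_def by (simp add: mult_left_mono)
qed

text \<open>From two points of the graph, the ray rising to the right from the left one and the ray
  rising to the left from the right one must meet, since both are steeper than the chord between the
  points.\<close>

lemma lipschitz_cone_patch:
  fixes \<Omega> :: "(real^2) set"
  assumes H: "emeasure hausdorff1 (\<Gamma> :: (real^2) set) \<noteq> 0"
    and ch: "boundary_chart \<Omega> p Q r h f" and L: "L-lipschitz_on {-r<..<r} f" and "open \<Omega>"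
  shows "\<exists>B D \<E> C. p \<in> B \<and> cone_patch \<Omega> B D \<E> C"
proof -
  note Q = boundary_chart_orthogonal[OF ch]
  have L0: "0 \<le> L" using L by (rule lipschitz_on_nonneg)
  have rh: "0 < r" "0 < h" using ch by (auto simp: boundary_chart_def)
  \<comment> \<open>Both size conditions of \<open>lipschitz_cone_sweep\<close> hold with this
    radius, as 2 and \<open>2 * L + 1\<close> are less than \<open>2 * L + 4\<close>.\<close>
  define D where "D = min r h / (2 * L + 4)"
  have D: "0 < D" using rh L0 by (simp add: D_def)
  have Dm: "(2 * L + 4) * D = min r h" using L0 by (simp add: D_def)
  have "2 * D \<le> (2 * L + 3) * D" "(2 * L + 1) * D \<le> (2 * L + 3) * D" using D L0 by (auto intro: mult_right_mono)
  moreover have "(2 * L + 3) * D < (2 * L + 4) * D" using D by simp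
  ultimately have \<eta>: "2 * D < r" "(2 * L + 1) * D < h" using Dm by linarith+
  \<comment> \<open>Half the sweep length, so that two points of \<open>B\<close> are never farther
    apart than the available segments are long.\<close>
  define B where "B = ball p (D / 2)"
  define E where "E k = Q (vector [k, L + 1])" for k
  have cont: "continuous_on {-r<..<r} f" using L by (rule lipschitz_on_continuous_on)
  define P where "P = chart_pt p Q"
  have PE: "P s t + \<tau> *\<^sub>R E k = P (s + k * \<tau>) (t + (L + 1) * \<tau>)" for s t \<tau> k
    by (simp add: P_def E_def chart_scale[OF Q] chart_pt_add[OF Q] mult.commute)
  have "D < h" 
    by (rule le_less_trans[OF _ \<eta>(2)]) (use D L0 in \<open>simp add: distrib_right\<close>)
  have graph: "\<exists>s. \<bar>s\<bar> < r \<and> x = P s (f s)" if "x \<in> frontier \<Omega> \<inter> B" for x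
  proof -
    obtain s t where st: "x = P s t" using chart_pt_surj[OF Q] P_def by blast
    have "dist (P s t) (P 0 0) < D"
      using that st D by (simp add: B_def P_def chart_pt_origin[OF Q] dist_commute)
    then have b: "\<bar>s\<bar> < D" "\<bar>t\<bar> < D"
      using dist_chart_pt_bounds(1)[OF Q, of s 0 p t 0] dist_chart_pt_bounds(2)[OF Q, of t 0 p s 0]
      by (auto simp: P_def)
    have "t = f s"
      by (rule boundary_chart_frontier_is_graph[OF ch \<open>open \<Omega>\<close> cont])
        (use b \<eta> \<open>D < h\<close> that st in \<open>auto simp: P_def\<close>)
    moreover have "\<bar>s\<bar> < r" using b(1) \<eta>(1) D by linarith
    ultimately show ?thesis using st by blast
  qed
  \<comment> \<open>The directions are collected in a set; the sum over it has two terms only if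
    they differ.\<close>
  have E_ne: "E 1 \<noteq> E (-1)"
  proof
    assume "E 1 = E (-1)"
    then have "P 0 0 + 1 *\<^sub>R E 1 = P 0 0 + 1 *\<^sub>R E (-1)" by simp
    then have "dist (P 1 (L + 1)) (P (-1) (L + 1)) = 0" unfolding PE by simp
    then show False unfolding P_def dist_chart_pt[OF Q] by simp
  qed
  have half: "ennreal \<bar>U (P s (f s)) - U (P t (f t))\<bar>
      \<le> seg_int U (E 1) (P s (f s)) l + seg_int U (E (-1)) (P t (f t)) l"
    if U: "smooth U" and st: "\<bar>s\<bar> < r" "\<bar>t\<bar> < r" "s \<le> t" "t - s \<le> l" for U s t l
  proof -
    \<comment> \<open>The rays meet at parameters \<open>a\<close> and \<open>b\<close> with
      \<open>a + b = t - s\<close> from the abscissas and \<open>a - b = d\<close> from the heights.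
      The Lipschitz bound gives \<open>\<bar>d\<bar> \<le> t - s\<close>, hence both parameters are
      nonnegative.\<close>
    define d where "d = (f t - f s) / (L + 1)"
    have "\<bar>f t - f s\<bar> \<le> L * \<bar>t - s\<bar>" using lipschitz_onD[OF L, of t s] st by (auto simp: dist_real_def abs_less_iff)
    also have "\<dots> \<le> (L + 1) * (t - s)" using st by (simp add: mult_right_mono)
    finally have d: "\<bar>d\<bar> \<le> t - s" using L0 by (simp add: d_def abs_divide divide_le_eq mult.commute)
    define a where "a = ((t - s) + d) / 2"
    define b where "b = ((t - s) - d) / 2"
    have ab: "0 \<le> a" "a \<le> l" "0 \<le> b" "b \<le> l" using d st by (auto simp: a_def b_def)
    have "f s + (L + 1) * a = f t + (L + 1) * b"
    proof -
      have "a - b = d" by (simp add: a_def b_def field_simps)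
      moreover have "(L + 1) * d = f t - f s" using L0 by (simp add: d_def)
      ultimately have "(L + 1) * (a - b) = f t - f s" by simp
      then show ?thesis by (simp add: algebra_simps)
    qed
    moreover have "s + a = t - b" by (simp add: a_def b_def field_simps)
    ultimately have meet: "P s (f s) + a *\<^sub>R E 1 = P t (f t) + b *\<^sub>R E (-1)" unfolding PE by simp
    have "\<bar>U (P s (f s)) - U (P t (f t))\<bar>
      \<le> \<bar>U (P s (f s) + a *\<^sub>R E 1) - U (P s (f s))\<bar> + \<bar>U (P t (f t) + b *\<^sub>R E (-1)) - U (P t (f t))\<bar>"
      unfolding meet by linarith
    then have "ennreal \<bar>U (P s (f s)) - U (P t (f t))\<bar>
      \<le> ennreal \<bar>U (P s (f s) + a *\<^sub>R E 1) - U (P s (f s))\<bar> + ennreal \<bar>U (P t (f t) + b *\<^sub>R E (-1)) - U (P t (f t))\<bar>"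
      by (simp add: ennreal_leI flip: ennreal_plus)
    also have "\<dots> \<le> seg_int U (E 1) (P s (f s)) l + seg_int U (E (-1)) (P t (f t)) l"
      by (intro add_mono smooth_segment_bound[OF U] ab)
    finally show ?thesis .
  qed
  have pts: "dist x y \<le> D \<and> ennreal \<bar>U x - U y\<bar> \<le> (\<Sum>E\<in>{E 1, E (-1)}. seg_int U E x (dist x y) + seg_int U E y (dist x y))"
    if U: "smooth U" and x: "x \<in> frontier \<Omega> \<inter> B" and y: "y \<in> frontier \<Omega> \<inter> B" for U x y
  proof
    show "dist x y \<le> D" using x y dist_triangle_half_r[of p x D y] by (auto simp: B_def)
    obtain s where s: "\<bar>s\<bar> < r" "x = P s (f s)" using graph[OF x] by blast
    obtain t where t: "\<bar>t\<bar> < r" "y = P t (f t)" using graph[OF y] by blast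
    have d: "\<bar>s - t\<bar> \<le> dist x y" unfolding s t P_def by (rule dist_chart_pt_bounds(1)[OF Q])
    have sum: "(\<Sum>E\<in>{E 1, E (-1)}. seg_int U E x (dist x y) + seg_int U E y (dist x y))
      = (seg_int U (E 1) x (dist x y) + seg_int U (E (-1)) y (dist x y))
       + (seg_int U (E 1) y (dist x y) + seg_int U (E (-1)) x (dist x y))"
      using E_ne by (simp add: ac_simps)
    have "ennreal \<bar>U x - U y\<bar> \<le> seg_int U (E 1) x (dist x y) + seg_int U (E (-1)) y (dist x y)
      \<or> ennreal \<bar>U x - U y\<bar> \<le> seg_int U (E 1) y (dist x y) + seg_int U (E (-1)) x (dist x y)"
    proof (cases "s \<le> t")
      case True then show ?thesis using half[OF U s(1) t(1), of "dist x y"] d s t by auto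
    next
      case False then show ?thesis
        using half[OF U t(1) s(1), of "dist x y"] d s t by (auto simp: abs_minus_commute)
    qed
    then show "ennreal \<bar>U x - U y\<bar> \<le> (\<Sum>E\<in>{E 1, E (-1)}. seg_int U E x (dist x y) + seg_int U E y (dist x y))"
      unfolding sum by (auto intro: order_trans add_increasing add_increasing2)
  qed
  have sweep: "(\<integral>\<^sup>+x. (\<integral>\<^sup>+\<tau>. F (x + \<tau> *\<^sub>R E k) * indicator {0..D} \<tau> \<partial>lborel) * indicator B x \<partial>boundary_measure \<Omega>)
        \<le> ennreal (1 + L) * (\<integral>\<^sup>+x. F x * indicator \<Omega> x \<partial>lborel)"
    if F: "F \<in> borel_measurable borel" and k: "\<bar>k\<bar> = 1" for F k
  proof -
    have "(\<integral>\<^sup>+x. (\<integral>\<^sup>+\<tau>. F (x + \<tau> *\<^sub>R E k) * indicator {0..D} \<tau> \<partial>lborel) * indicator B x \<partial>boundary_measure \<Omega>)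
      \<le> (\<integral>\<^sup>+x. (\<integral>\<^sup>+\<tau>. F (x + \<tau> *\<^sub>R E k) * indicator {0..D} \<tau> \<partial>lborel) * indicator (ball p D) x \<partial>boundary_measure \<Omega>)"
      using D by (intro nn_integral_mono) (auto simp: B_def indicator_def)
    also have "\<dots> \<le> ennreal (1 + L) * (\<integral>\<^sup>+x. F x * indicator \<Omega> x \<partial>lborel)"
      unfolding E_def by (rule lipschitz_cone_sweep[OF H ch L \<open>open \<Omega>\<close> D \<eta> k F])
    finally show ?thesis .
  qed
  have "cone_patch \<Omega> B D {E 1, E (-1)} (1 + L)"
    unfolding cone_patch_def
  proof (intro conjI ballI)
    show "open B" by (simp add: B_def)
    show "0 < D" by (rule D)
    show "0 \<le> 1 + L" using L0 by simp
    show "\<forall>U x y. smooth U \<longrightarrow> x \<in> frontier \<Omega> \<inter> B \<longrightarrow> y \<in> frontier \<Omega> \<inter> B \<longrightarrow> dist x y \<le> D \<and>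
        ennreal \<bar>U x - U y\<bar> \<le> (\<Sum>E\<in>{E 1, E (-1)}. seg_int U E x (dist x y) + seg_int U E y (dist x y))"
      using pts by blast
    fix e and F :: "real^2 \<Rightarrow> ennreal" assume "e \<in> {E 1, E (-1)}" and F: "F \<in> borel_measurable (borel :: (real^2) measure)"
    then show "(\<integral>\<^sup>+x. (\<integral>\<^sup>+\<tau>. F (x + \<tau> *\<^sub>R e) * indicator {0..D} \<tau> \<partial>lborel) * indicator B x \<partial>boundary_measure \<Omega>)
        \<le> ennreal (1 + L) * (\<integral>\<^sup>+x. F x * indicator \<Omega> x \<partial>lborel)"
      using sweep[OF F, of 1] sweep[OF F, of "-1"] by auto
  qed auto
  moreover have "p \<in> B" using D by (simp add: B_def)
  ultimately show ?thesis by blast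
qed

section \<open>The trace operator\<close>

text \<open>The frontier is compact: take a finite subcover by patches and let \<open>\<eta>\<close>
  be its Lebesgue number.\<close>

lemma cone_cover:
  fixes \<Omega> :: "(real^2) set"
  assumes H: "emeasure hausdorff1 (\<Gamma> :: (real^2) set) \<noteq> 0"
    and \<Omega>: "open \<Omega>" "bounded \<Omega>" "lipschitz_boundary \<Omega>"
  obtains \<P> \<eta> where "finite \<P>" "0 < \<eta>"
    "\<And>B. B \<in> \<P> \<Longrightarrow> \<exists>D \<E> C. cone_patch \<Omega> B D \<E> C"
    "\<And>x y. x \<in> frontier \<Omega> \<Longrightarrow> y \<in> frontier \<Omega> \<Longrightarrow> dist x y < \<eta> \<Longrightarrow> \<exists>B\<in>\<P>. x \<in> B \<and> y \<in> B"
proof -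
  have "compact (frontier \<Omega>)" using \<Omega>(2) by (rule compact_frontier_bounded)
  have "\<exists>B. p \<in> B \<and> (\<exists>D \<E> C. cone_patch \<Omega> B D \<E> C)" if "p \<in> frontier \<Omega>" for p
    using that \<Omega>(3) lipschitz_cone_patch[OF H _ _ \<Omega>(1)] unfolding lipschitz_boundary_def by metis
  then obtain B where B: "\<And>p. p \<in> frontier \<Omega> \<Longrightarrow> p \<in> B p"
    "\<And>p. p \<in> frontier \<Omega> \<Longrightarrow> \<exists>D \<E> C. cone_patch \<Omega> (B p) D \<E> C"
    by metis
  have opn: "open (B p)" if "p \<in> frontier \<Omega>" for p
    using B(2)[OF that] unfolding cone_patch_def by blast
  obtain F where F: "F \<subseteq> frontier \<Omega>" "finite F" "frontier \<Omega> \<subseteq> (\<Union>p\<in>F. B p)"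
    by (rule compactE_image[OF \<open>compact (frontier \<Omega>)\<close>, of "frontier \<Omega>" B]) (use opn B(1) in blast)+
  obtain \<eta> where \<eta>: "0 < \<eta>" "\<forall>x\<in>frontier \<Omega>. \<exists>G\<in>B ` F. ball x \<eta> \<subseteq> G"
    by (rule Heine_Borel_lemma[OF \<open>compact (frontier \<Omega>)\<close> F(3)]) (use opn F(1) in blast)+
  show ?thesis
  proof (rule that[of "B ` F" \<eta>])
    fix x y assume "x \<in> frontier \<Omega>" "y \<in> frontier \<Omega>" "dist x y < \<eta>"
    moreover from this(1) obtain G where "G \<in> B ` F" "ball x \<eta> \<subseteq> G" using \<eta>(2) by blast
    moreover have "x \<in> ball x \<eta>" using \<eta>(1) by simp
    ultimately show "\<exists>B\<in>B ` F. x \<in> B \<and> y \<in> B" by (meson mem_ball subsetD)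
  qed (use F \<eta> B(2) in auto)
qed

section \<open>The trace inequality\<close>

definition dirichlet :: "(real^2) set \<Rightarrow> (real^2 \<Rightarrow> real) \<Rightarrow> ennreal" where
  "dirichlet \<Omega> U = (\<Sum>b\<in>Basis. \<integral>\<^sup>+x. ennreal ((pd b U x)\<^sup>2) \<partial>lebesgue_on \<Omega>)"

lemma pd_borel: "smooth U \<Longrightarrow> pd E U \<in> borel_measurable borel"
proof -
  assume U: "smooth U"
  have lin: "linear (\<lambda>h. pd h U y)" for y
    using has_derivative_linear[OF smooth_has_derivative[OF U]] .
  have rep: "pd E U y = (\<Sum>b\<in>Basis. (E \<bullet> b) * pd b U y)" for y
    using linear_sum[OF lin, of "\<lambda>b. (E \<bullet> b) *\<^sub>R b" Basis] linear_scale[OF lin]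
    by (simp add: euclidean_representation)
  show ?thesis
    unfolding rep[abs_def] using smooth_measurable[OF smooth_pd[OF U]] by (intro borel_measurable_sum borel_measurable_times) auto
qed

text \<open>The factor 2 is the dimension of the plane, from the square of a sum over
  \<open>Basis\<close>.\<close>

lemma directional_dirichlet:
  fixes U :: "real^2 \<Rightarrow> real"
  assumes U: "smooth U" and \<Omega>: "\<Omega> \<in> sets borel"
  shows "(\<integral>\<^sup>+x. ennreal ((pd E U x)\<^sup>2) * indicator \<Omega> x \<partial>lborel) \<le> ennreal (2 * (norm E)\<^sup>2) * dirichlet \<Omega> U"
proof -
  note pd_borel[OF U, measurable] \<Omega>[measurable]
  have "(pd E U x)\<^sup>2 \<le> 2 * (norm E)\<^sup>2 * (\<Sum>b\<in>Basis. (pd b U x)\<^sup>2)" for x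
  proof -
    have "\<bar>pd E U x\<bar>\<^sup>2 \<le> (norm E * (\<Sum>b\<in>Basis. \<bar>pd b U x\<bar>))\<^sup>2"
      by (rule power_mono[OF pd_norm_le[OF U]]) simp
    also have "\<dots> = (norm E)\<^sup>2 * (\<Sum>b\<in>Basis. \<bar>pd b U x\<bar>)\<^sup>2" by (simp add: power_mult_distrib)
    also have "\<dots> \<le> (norm E)\<^sup>2 * (real (card (Basis :: (real^2) set)) * (\<Sum>b\<in>Basis. \<bar>pd b U x\<bar>\<^sup>2))"
      using sum_squared_le_sum_of_squares[of "\<lambda>b. \<bar>pd b U x\<bar>" "Basis :: (real^2) set"]
      by (intro mult_left_mono) (auto simp: mult.commute)
    finally show ?thesis by (simp add: mult.assoc mult.left_commute)
  qed
  then have "(\<integral>\<^sup>+x. ennreal ((pd E U x)\<^sup>2) * indicator \<Omega> x \<partial>lborel)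
     \<le> (\<integral>\<^sup>+x. ennreal (2 * (norm E)\<^sup>2) * (\<Sum>b\<in>Basis. ennreal ((pd b U x)\<^sup>2) * indicator \<Omega> x) \<partial>lborel)"
    by (intro nn_integral_mono) (auto simp: sum_nonneg indicator_def ennreal_leI simp flip: ennreal_mult)
  also have "\<dots> = ennreal (2 * (norm E)\<^sup>2) * (\<Sum>b\<in>Basis. \<integral>\<^sup>+x. ennreal ((pd b U x)\<^sup>2) * indicator \<Omega> x \<partial>lborel)"
    by (subst nn_integral_cmult, measurable) (subst nn_integral_sum, measurable)
  also have "(\<Sum>b\<in>Basis. \<integral>\<^sup>+x. ennreal ((pd b U x)\<^sup>2) * indicator \<Omega> x \<partial>lborel) = dirichlet \<Omega> U"
    unfolding dirichlet_def by (intro sum.cong refl nn_integral_lebesgue_on_borel[symmetric] \<Omega>) measurable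
  finally show ?thesis .
qed

lemma seg_int_square_le:
  assumes U: "smooth U" and D: "0 \<le> D"
  shows "(seg_int U E x D)\<^sup>2 \<le> ennreal D * (\<integral>\<^sup>+\<tau>. ennreal ((pd E U (x + \<tau> *\<^sub>R E))\<^sup>2) * indicator {0..D} \<tau> \<partial>lborel)"
proof -
  note pd_borel[OF U, measurable]
  have "seg_int U E x D = (\<integral>\<^sup>+\<tau>. (ennreal \<bar>pd E U (x + \<tau> *\<^sub>R E)\<bar> * indicator {0..D} \<tau>) * indicator {0..D} \<tau> \<partial>lborel)"
    unfolding seg_int_def by (intro nn_integral_cong) (auto simp: indicator_def)
  then have "(seg_int U E x D)\<^sup>2 \<le> (\<integral>\<^sup>+\<tau>. (ennreal \<bar>pd E U (x + \<tau> *\<^sub>R E)\<bar> * indicator {0..D} \<tau>)\<^sup>2 \<partial>lborel)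
      * (\<integral>\<^sup>+\<tau>. (indicator {0..D} \<tau>)\<^sup>2 \<partial>(lborel::real measure))"
    by (simp only:) (rule Cauchy_Schwarz_nn_integral; measurable)
  also have "(\<integral>\<^sup>+\<tau>. (indicator {0..D} \<tau>)\<^sup>2 \<partial>(lborel::real measure)) = (\<integral>\<^sup>+\<tau>. indicator {0..D} \<tau> \<partial>(lborel::real measure))"
    by (intro nn_integral_cong) (auto simp: indicator_def)
  also have "\<dots> = ennreal D" using D by simp
  also have "(\<integral>\<^sup>+\<tau>. (ennreal \<bar>pd E U (x + \<tau> *\<^sub>R E)\<bar> * indicator {0..D} \<tau>)\<^sup>2 \<partial>lborel)
     = (\<integral>\<^sup>+\<tau>. ennreal ((pd E U (x + \<tau> *\<^sub>R E))\<^sup>2) * indicator {0..D} \<tau> \<partial>lborel)"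
    by (intro nn_integral_cong) (auto simp: indicator_def ennreal_power)
  finally show ?thesis by (simp add: mult.commute)
qed

text \<open>One direction suffices: \<open>U x\<close> is compared with the value at
  \<open>x + \<tau> *\<^sub>R E\<close>, the comparison is averaged over \<open>\<tau>\<close> in
  \<open>{0..D}\<close>, and the sweep turns boundary integrals of segment integrals into integrals
  over \<Omega>.\<close>

lemma patch_trace_inequality:
  assumes H: "emeasure hausdorff1 (\<Gamma> :: (real^2) set) \<noteq> 0" and \<Omega>: "open \<Omega>" and P: "cone_patch \<Omega> B D \<E> C"
  shows "\<exists>K. 0 \<le> K \<and> (\<forall>U. smooth U \<longrightarrow> (\<integral>\<^sup>+x. ennreal ((U x)\<^sup>2) * indicator B x \<partial>boundary_measure \<Omega>)
    \<le> ennreal K * ((\<integral>\<^sup>+x. ennreal ((U x)\<^sup>2) \<partial>lebesgue_on \<Omega>) + dirichlet \<Omega> U))"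
proof -
  have D: "0 < D" and C: "0 \<le> C" and "\<E> \<noteq> {}" and Bo: "open B" using P by (auto simp: cone_patch_def)
  then obtain E where E: "E \<in> \<E>" by blast
  have [measurable]: "\<Omega> \<in> sets borel" "B \<in> sets borel" using \<Omega> Bo by auto
  have sweep: "(\<integral>\<^sup>+x. (\<integral>\<^sup>+\<tau>. F (x + \<tau> *\<^sub>R E) * indicator {0..D} \<tau> \<partial>lborel) * indicator B x \<partial>boundary_measure \<Omega>)
        \<le> ennreal C * (\<integral>\<^sup>+x. F x * indicator \<Omega> x \<partial>lborel)" if "F \<in> borel_measurable borel" for F
    using P E that unfolding cone_patch_def by blast
  \<comment> \<open>Averaging gives \<open>2 / D\<close> in the first constant; in the second,
    \<open>2 * D\<close> comes from Cauchy-Schwarz along the segment. \<open>C\<close> is the cost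
    of the sweep, and \<open>2 * (norm E)\<^sup>2\<close> that of a directional derivative.\<close>
  define K1 where "K1 = 2 / D * C"
  define K2 where "K2 = 2 * D * C * (2 * (norm E)\<^sup>2)"
  have K: "0 \<le> K1" "0 \<le> K2" using D C by (auto simp: K1_def K2_def)
  show ?thesis
  proof (intro exI[of _ "max K1 K2"] conjI allI impI)
    show "0 \<le> max K1 K2" using K by simp
    fix U :: "real^2 \<Rightarrow> real" assume U: "smooth U"
    note [measurable] = pd_borel[OF U] smooth_measurable[OF U]
    define A1 where "A1 x = (\<integral>\<^sup>+\<tau>. ennreal ((U (x + \<tau> *\<^sub>R E))\<^sup>2) * indicator {0..D} \<tau> \<partial>lborel)" for x
    define A2 where "A2 x = (\<integral>\<^sup>+\<tau>. ennreal ((pd E U (x + \<tau> *\<^sub>R E))\<^sup>2) * indicator {0..D} \<tau> \<partial>lborel)" for x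
    have [measurable]: "A1 \<in> borel_measurable borel" "A2 \<in> borel_measurable borel"
      unfolding A1_def A2_def by measurable
    have pw: "ennreal ((U x)\<^sup>2) \<le> ennreal (2 / D) * A1 x + ennreal (2 * D) * A2 x" for x
    proof -
      have S: "ennreal ((U x)\<^sup>2) \<le> 2 * ennreal ((U (x + \<tau> *\<^sub>R E))\<^sup>2) + 2 * (seg_int U E x D)\<^sup>2" if "\<tau> \<in> {0..D}" for \<tau>
      proof -
        let ?a = "U (x + \<tau> *\<^sub>R E)"
        have "(U x)\<^sup>2 \<le> 2 * ?a\<^sup>2 + 2 * \<bar>?a - U x\<bar>\<^sup>2"
          using zero_le_power2[of "2 * ?a - U x"] by (simp add: power2_eq_square algebra_simps)
        then have "ennreal ((U x)\<^sup>2) \<le> ennreal (2 * ?a\<^sup>2 + 2 * \<bar>?a - U x\<bar>\<^sup>2)" by (rule ennreal_leI)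
        also have "\<dots> = 2 * ennreal (?a\<^sup>2) + 2 * (ennreal \<bar>?a - U x\<bar>)\<^sup>2"
          by (simp add: ennreal_mult ennreal_power)
        also have "\<dots> \<le> 2 * ennreal (?a\<^sup>2) + 2 * (seg_int U E x D)\<^sup>2"
          using that by (intro add_left_mono mult_left_mono power_mono smooth_segment_bound[OF U]) auto
        finally show ?thesis .
      qed
      have "ennreal ((U x)\<^sup>2) * ennreal D = (\<integral>\<^sup>+\<tau>. ennreal ((U x)\<^sup>2) * indicator {0..D} \<tau> \<partial>lborel)"
        using D by (simp add: nn_integral_cmult_indicator)
      also have "\<dots> \<le> (\<integral>\<^sup>+\<tau>. 2 * (ennreal ((U (x + \<tau> *\<^sub>R E))\<^sup>2) * indicator {0..D} \<tau>) + 2 * (seg_int U E x D)\<^sup>2 * indicator {0..D} \<tau> \<partial>lborel)"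
        using S by (intro nn_integral_mono) (auto simp: indicator_def)
      also have "\<dots> = 2 * A1 x + 2 * (seg_int U E x D)\<^sup>2 * ennreal D"
        using D by (simp add: nn_integral_add nn_integral_cmult A1_def nn_integral_cmult_indicator)
      also have "\<dots> \<le> 2 * A1 x + 2 * (ennreal D * A2 x) * ennreal D"
        unfolding A2_def using D by (intro add_left_mono mult_right_mono mult_left_mono seg_int_square_le[OF U]) auto
      finally have "ennreal (1 / D) * (ennreal ((U x)\<^sup>2) * ennreal D)
         \<le> ennreal (1 / D) * (2 * A1 x + 2 * (ennreal D * A2 x) * ennreal D)"
        by (rule mult_left_mono) simp
      moreover have "ennreal (1 / D) * (ennreal ((U x)\<^sup>2) * ennreal D) = ennreal ((U x)\<^sup>2)"
        using D by (simp flip: ennreal_mult)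
      moreover have "ennreal (1 / D) * (2 * A1 x + 2 * (ennreal D * A2 x) * ennreal D)
         = (ennreal (1 / D) * ennreal 2) * A1 x + (ennreal (1 / D) * ennreal D * ennreal D * ennreal 2) * A2 x"
        by (simp add: distrib_left ac_simps)
      moreover have "ennreal (1 / D) * ennreal 2 = ennreal (2 / D)"
        "ennreal (1 / D) * ennreal D * ennreal D * ennreal 2 = ennreal (2 * D)"
        using D by (simp_all add: mult.commute flip: ennreal_mult ennreal_numeral)
      ultimately show ?thesis by simp
    qed
    have mb: "f \<in> borel_measurable borel \<Longrightarrow> f \<in> borel_measurable (boundary_measure \<Omega>)" for f :: "real^2 \<Rightarrow> ennreal"
      unfolding boundary_measure_def
      by (rule measurable_restrict_space1) (simp add: measurable_cong_sets[OF sets_hausdorff1[OF H] refl])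
    have "(\<integral>\<^sup>+x. ennreal ((U x)\<^sup>2) * indicator B x \<partial>boundary_measure \<Omega>)
      \<le> (\<integral>\<^sup>+x. ennreal (2 / D) * (A1 x * indicator B x) + ennreal (2 * D) * (A2 x * indicator B x) \<partial>boundary_measure \<Omega>)"
      using pw by (intro nn_integral_mono) (auto simp: indicator_def)
    also have "\<dots> = ennreal (2 / D) * (\<integral>\<^sup>+x. A1 x * indicator B x \<partial>boundary_measure \<Omega>)
        + ennreal (2 * D) * (\<integral>\<^sup>+x. A2 x * indicator B x \<partial>boundary_measure \<Omega>)"
    proof -
      have m1: "(\<lambda>x. A1 x * indicator B x) \<in> borel_measurable (boundary_measure \<Omega>)" by (rule mb; measurable)
      have m2: "(\<lambda>x. A2 x * indicator B x) \<in> borel_measurable (boundary_measure \<Omega>)" by (rule mb; measurable)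
      show ?thesis
        unfolding nn_integral_cmult[OF m1, symmetric] nn_integral_cmult[OF m2, symmetric]
        by (rule nn_integral_add) (intro borel_measurable_times_ennreal m1 m2 borel_measurable_const)+
    qed
    also have "\<dots> \<le> ennreal (2 / D) * (ennreal C * (\<integral>\<^sup>+x. ennreal ((U x)\<^sup>2) * indicator \<Omega> x \<partial>lborel))
        + ennreal (2 * D) * (ennreal C * (\<integral>\<^sup>+x. ennreal ((pd E U x)\<^sup>2) * indicator \<Omega> x \<partial>lborel))"
      unfolding A1_def A2_def by (intro add_mono mult_left_mono sweep) auto
    also have "\<dots> \<le> ennreal (2 / D) * (ennreal C * (\<integral>\<^sup>+x. ennreal ((U x)\<^sup>2) \<partial>lebesgue_on \<Omega>))
        + ennreal (2 * D) * (ennreal C * (ennreal (2 * (norm E)\<^sup>2) * dirichlet \<Omega> U))"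
      by (intro add_mono mult_left_mono directional_dirichlet[OF U])
        (auto simp: nn_integral_lebesgue_on_borel)
    also have "\<dots> = ennreal K1 * (\<integral>\<^sup>+x. ennreal ((U x)\<^sup>2) \<partial>lebesgue_on \<Omega>) + ennreal K2 * dirichlet \<Omega> U"
    proof -
      have k1: "ennreal K1 = ennreal (2 / D) * ennreal C"
        unfolding K1_def by (rule ennreal_mult) (use C D in auto)
      have "ennreal C * ennreal (2 * (norm E)\<^sup>2) = ennreal (C * (2 * (norm E)\<^sup>2))"
        by (rule ennreal_mult[symmetric]) (use C in auto)
      moreover have "ennreal (2 * D) * ennreal (C * (2 * (norm E)\<^sup>2)) = ennreal (2 * D * (C * (2 * (norm E)\<^sup>2)))"
        by (rule ennreal_mult[symmetric]) (use C D in auto)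
      moreover have "2 * D * (C * (2 * (norm E)\<^sup>2)) = K2" by (simp add: K2_def)
      ultimately have k2: "ennreal K2 = ennreal (2 * D) * (ennreal C * ennreal (2 * (norm E)\<^sup>2))" by (simp only:)
      show ?thesis unfolding k1 k2 by (simp only: mult.assoc)
    qed
    also have "\<dots> \<le> ennreal (max K1 K2) * (\<integral>\<^sup>+x. ennreal ((U x)\<^sup>2) \<partial>lebesgue_on \<Omega>) + ennreal (max K1 K2) * dirichlet \<Omega> U"
      by (intro add_mono mult_right_mono ennreal_leI) auto
    finally show "(\<integral>\<^sup>+x. ennreal ((U x)\<^sup>2) * indicator B x \<partial>boundary_measure \<Omega>)
      \<le> ennreal (max K1 K2) * ((\<integral>\<^sup>+x. ennreal ((U x)\<^sup>2) \<partial>lebesgue_on \<Omega>) + dirichlet \<Omega> U)"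
      by (simp add: distrib_left)
  qed
qed

lemma trace_inequality:
  fixes \<Omega> :: "(real^2) set"
  assumes H: "emeasure hausdorff1 (\<Gamma> :: (real^2) set) \<noteq> 0"
    and \<Omega>: "open \<Omega>" "bounded \<Omega>" "lipschitz_boundary \<Omega>"
  shows "\<exists>K. 0 \<le> K \<and> (\<forall>U. smooth U \<longrightarrow> (\<integral>\<^sup>+x. ennreal ((U x)\<^sup>2) \<partial>boundary_measure \<Omega>)
    \<le> ennreal K * ((\<integral>\<^sup>+x. ennreal ((U x)\<^sup>2) \<partial>lebesgue_on \<Omega>) + dirichlet \<Omega> U))"
proof -
  obtain \<P> \<eta> where \<P>: "finite \<P>" "0 < \<eta>" "\<And>B. B \<in> \<P> \<Longrightarrow> \<exists>D \<E> C. cone_patch \<Omega> B D \<E> C"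
    "\<And>x y. x \<in> frontier \<Omega> \<Longrightarrow> y \<in> frontier \<Omega> \<Longrightarrow> dist x y < \<eta> \<Longrightarrow> \<exists>B\<in>\<P>. x \<in> B \<and> y \<in> B"
    using cone_cover[OF H \<Omega>] by metis
  let ?N = "\<lambda>U. (\<integral>\<^sup>+x. ennreal ((U x)\<^sup>2) \<partial>lebesgue_on \<Omega>) + dirichlet \<Omega> U"
  have "\<exists>K. 0 \<le> K \<and> (\<forall>U. smooth U \<longrightarrow> (\<integral>\<^sup>+x. ennreal ((U x)\<^sup>2) * indicator B x \<partial>boundary_measure \<Omega>) \<le> ennreal K * ?N U)"
    if BP: "B \<in> \<P>" for B
  proof -
    obtain D \<E> C where "cone_patch \<Omega> B D \<E> C" using \<P>(3)[OF BP] by blast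
    from patch_trace_inequality[OF H \<Omega>(1) this] show ?thesis .
  qed
  then have ex: "\<forall>B\<in>\<P>. \<exists>K. 0 \<le> K \<and> (\<forall>U. smooth U \<longrightarrow>
      (\<integral>\<^sup>+x. ennreal ((U x)\<^sup>2) * indicator B x \<partial>boundary_measure \<Omega>) \<le> ennreal K * ?N U)" by blast
  from bchoice[OF ex] obtain K where "\<forall>B\<in>\<P>. 0 \<le> K B \<and> (\<forall>U. smooth U \<longrightarrow>
      (\<integral>\<^sup>+x. ennreal ((U x)\<^sup>2) * indicator B x \<partial>boundary_measure \<Omega>) \<le> ennreal (K B) * ?N U)" ..
  then have K: "\<And>B. B \<in> \<P> \<Longrightarrow> 0 \<le> K B" "\<And>B U. B \<in> \<P> \<Longrightarrow> smooth U \<Longrightarrow>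
      (\<integral>\<^sup>+x. ennreal ((U x)\<^sup>2) * indicator B x \<partial>boundary_measure \<Omega>) \<le> ennreal (K B) * ?N U"
    by blast+
  show ?thesis
  proof (intro exI[of _ "sum K \<P>"] conjI allI impI)
    show "0 \<le> sum K \<P>" using K(1) by (rule sum_nonneg)
    fix U :: "real^2 \<Rightarrow> real" assume U: "smooth U"
    have meas: "(\<lambda>x. ennreal ((U x)\<^sup>2) * indicator B x) \<in> borel_measurable (boundary_measure \<Omega>)" if "B \<in> \<P>" for B
    proof -
      have "open B" using \<P>(3)[OF that] by (auto simp: cone_patch_def)
      then show ?thesis
        unfolding boundary_measure_def using smooth_measurable[OF U]
        by (intro measurable_restrict_space1) (simp add: measurable_cong_sets[OF sets_hausdorff1[OF H] refl])
    qed
    have "(\<integral>\<^sup>+x. ennreal ((U x)\<^sup>2) \<partial>boundary_measure \<Omega>) \<le> (\<integral>\<^sup>+x. (\<Sum>B\<in>\<P>. ennreal ((U x)\<^sup>2) * indicator B x) \<partial>boundary_measure \<Omega>)"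
    proof (rule nn_integral_mono)
      fix x assume "x \<in> space (boundary_measure \<Omega>)"
      then have "x \<in> frontier \<Omega>" by (simp add: boundary_measure_space[OF H])
      then obtain B where B: "B \<in> \<P>" "x \<in> B" using \<P>(4)[of x x] \<P>(2) by auto
      have "ennreal ((U x)\<^sup>2) * indicator B x \<le> (\<Sum>B\<in>\<P>. ennreal ((U x)\<^sup>2) * indicator B x)"
        by (rule member_le_sum) (use B \<P>(1) in auto)
      then show "ennreal ((U x)\<^sup>2) \<le> (\<Sum>B\<in>\<P>. ennreal ((U x)\<^sup>2) * indicator B x)" using B by simp
    qed
    also have "\<dots> = (\<Sum>B\<in>\<P>. \<integral>\<^sup>+x. ennreal ((U x)\<^sup>2) * indicator B x \<partial>boundary_measure \<Omega>)"
      by (rule nn_integral_sum[OF meas])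
    also have "\<dots> \<le> (\<Sum>B\<in>\<P>. ennreal (K B) * ?N U)" by (intro sum_mono K(2) U)
    also have "\<dots> = ennreal (sum K \<P>) * ?N U" using K(1) by (simp add: sum_distrib_right[symmetric])
    finally show "(\<integral>\<^sup>+x. ennreal ((U x)\<^sup>2) \<partial>boundary_measure \<Omega>) \<le> ennreal (sum K \<P>) * ?N U" .
  qed
qed

section \<open>Completeness and existence of traces\<close>

lemma L2_complete:
  fixes f :: "nat \<Rightarrow> 'a \<Rightarrow> real"
  assumes [measurable]: "\<And>n. f n \<in> borel_measurable M"
    and cauchy: "\<And>e. 0 < e \<Longrightarrow> \<exists>N. \<forall>m\<ge>N. \<forall>n\<ge>N. (\<integral>\<^sup>+x. ennreal ((f m x - f n x)\<^sup>2) \<partial>M) \<le> ennreal e"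
  shows "\<exists>g. g \<in> borel_measurable M \<and> (\<lambda>n. \<integral>\<^sup>+x. ennreal ((f n x - g x)\<^sup>2) \<partial>M) \<longlonglongrightarrow> 0"
proof -
  have "\<exists>N. \<forall>m\<ge>N. \<forall>n\<ge>N. (\<integral>\<^sup>+x. ennreal ((f m x - f n x)\<^sup>2) \<partial>M) \<le> ennreal ((1 / 8) ^ k)" for k :: nat
    by (rule cauchy) simp
  then obtain N where N: "\<And>k m n. m \<ge> N k \<Longrightarrow> n \<ge> N k \<Longrightarrow>
      (\<integral>\<^sup>+x. ennreal ((f m x - f n x)\<^sup>2) \<partial>M) \<le> ennreal ((1 / 8) ^ k)"
    by metis
  \<comment> \<open>The sum dominates every \<open>N i\<close> with \<open>i \<le> k\<close>, and
    the summand \<open>k\<close> makes the indices tend to infinity.\<close>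
  define r where "r k = k + (\<Sum>i\<le>k. N i)" for k
  have rN: "r k \<ge> N k" "r (Suc k) \<ge> N k" "r k \<ge> k" for k
    using member_le_sum[of k "{..k}" N] by (auto simp: r_def)
  \<comment> \<open>Squared increments are at most \<open>(1 / 8) ^ k\<close>, so with weights
    \<open>4 ^ k\<close> the series still has finite integral. Where it is finite, the increments
    are bounded by a constant times \<open>(1 / 2) ^ k\<close>, hence summable.\<close>
  define S where "S x = (\<Sum>k. ennreal (4 ^ k) * ennreal ((f (r (Suc k)) x - f (r k) x)\<^sup>2))" for x
  have "(\<integral>\<^sup>+x. S x \<partial>M) = (\<Sum>k. ennreal (4 ^ k) * (\<integral>\<^sup>+x. ennreal ((f (r (Suc k)) x - f (r k) x)\<^sup>2) \<partial>M))"
    unfolding S_def by (subst nn_integral_suminf) (auto simp: nn_integral_cmult)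
  also have "\<dots> \<le> (\<Sum>k. ennreal (4 ^ k) * ennreal ((1 / 8) ^ k))"
    by (intro suminf_le mult_left_mono N rN) auto
  also have "\<dots> = (\<Sum>k. ennreal ((1 / 2) ^ k))"
    by (intro suminf_cong) (simp flip: ennreal_mult add: power_mult_distrib[symmetric])
  also have "\<dots> = ennreal (\<Sum>k. (1 / 2) ^ k)"
    by (intro suminf_ennreal2) (auto intro: summable_geometric)
  also have "\<dots> < \<infinity>" by simp
  finally have Sfin: "AE x in M. S x \<noteq> \<infinity>"
    by (intro nn_integral_noteq_infinite) (auto simp: S_def)
  define g where "g x = lim (\<lambda>k. f (r k) x)" for x
  have gm[measurable]: "g \<in> borel_measurable M" unfolding g_def by measurable
  have conv: "AE x in M. (\<lambda>k. f (r k) x) \<longlonglongrightarrow> g x"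
    using Sfin
  proof eventually_elim
    case (elim x)
    define s where "s = enn2real (S x)"
    have s: "S x = ennreal s" "0 \<le> s" using elim by (auto simp: s_def less_top)
    have bd: "\<bar>f (r (Suc k)) x - f (r k) x\<bar> \<le> sqrt s * (1 / 2) ^ k" for k
    proof -
      have "ennreal (4 ^ k) * ennreal ((f (r (Suc k)) x - f (r k) x)\<^sup>2) \<le> S x"
        unfolding S_def using sum_le_suminf[of "\<lambda>k. ennreal (4 ^ k) * ennreal ((f (r (Suc k)) x - f (r k) x)\<^sup>2)" "{k}"] by simp
      then have "4 ^ k * (f (r (Suc k)) x - f (r k) x)\<^sup>2 \<le> s"
        using s by (simp flip: ennreal_mult)
      then have "sqrt (4 ^ k * (f (r (Suc k)) x - f (r k) x)\<^sup>2) \<le> sqrt s" by simp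
      moreover have "sqrt (4 ^ k) = 2 ^ k"
      proof -
        have "(4 :: real) ^ k = (2 ^ k)\<^sup>2" by (simp add: power_mult[symmetric] mult.commute[of k] power_mult)
        then show ?thesis by simp
      qed
      ultimately have "2 ^ k * \<bar>f (r (Suc k)) x - f (r k) x\<bar> \<le> sqrt s" by (simp add: real_sqrt_mult)
      then show ?thesis by (simp add: field_simps power_divide)
    qed
    have "summable (\<lambda>k. f (r (Suc k)) x - f (r k) x)"
    proof (rule summable_comparison_test')
      show "summable (\<lambda>k. sqrt s * (1 / 2) ^ k)" by (intro summable_mult summable_geometric) simp
      show "norm (f (r (Suc n)) x - f (r n) x) \<le> sqrt s * (1 / 2) ^ n" for n using bd by simp
    qed
    then have "convergent (\<lambda>n. \<Sum>k<n. f (r (Suc k)) x - f (r k) x)"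
      by (simp add: summable_iff_convergent)
    then have "convergent (\<lambda>n. f (r n) x - f (r 0) x)" by (simp only: sum_lessThan_telescope[of "\<lambda>n. f (r n) x"])
    then have "convergent (\<lambda>n. f (r n) x)" using convergent_add[OF _ convergent_const[of "f (r 0) x"]] by fastforce
    then show ?case by (simp add: g_def convergent_LIMSEQ_iff)
  qed
  have "(\<lambda>n. \<integral>\<^sup>+x. ennreal ((f n x - g x)\<^sup>2) \<partial>M) \<longlonglongrightarrow> 0"
  proof (rule ennreal_tendsto_0I)
    fix e :: real assume "0 < e"
    then obtain N' where N': "\<forall>m\<ge>N'. \<forall>n\<ge>N'. (\<integral>\<^sup>+x. ennreal ((f m x - f n x)\<^sup>2) \<partial>M) \<le> ennreal e"
      using cauchy by blast
    have "(\<integral>\<^sup>+x. ennreal ((f n x - g x)\<^sup>2) \<partial>M) \<le> ennreal e" if n: "n \<ge> N'" for n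
    proof -
      have "(\<integral>\<^sup>+x. ennreal ((f n x - g x)\<^sup>2) \<partial>M) = (\<integral>\<^sup>+x. liminf (\<lambda>k. ennreal ((f n x - f (r k) x)\<^sup>2)) \<partial>M)"
      proof (rule nn_integral_cong_AE)
        show "AE x in M. ennreal ((f n x - g x)\<^sup>2) = liminf (\<lambda>k. ennreal ((f n x - f (r k) x)\<^sup>2))"
          using conv
        proof eventually_elim
          case (elim x)
          have "(\<lambda>k. ennreal ((f n x - f (r k) x)\<^sup>2)) \<longlonglongrightarrow> ennreal ((f n x - g x)\<^sup>2)"
            by (intro tendsto_ennrealI tendsto_intros elim)
          then show ?case using lim_imp_Liminf[OF sequentially_bot] by metis
        qed
      qed
      also have "\<dots> \<le> liminf (\<lambda>k. \<integral>\<^sup>+x. ennreal ((f n x - f (r k) x)\<^sup>2) \<partial>M)"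
        by (rule nn_integral_liminf) measurable
      also have "\<dots> \<le> ennreal e"
      proof (rule Liminf_le)
        show "eventually (\<lambda>k. (\<integral>\<^sup>+x. ennreal ((f n x - f (r k) x)\<^sup>2) \<partial>M) \<le> ennreal e) sequentially"
          unfolding eventually_sequentially using N' n rN(3) order_trans by blast
      qed simp
      finally show ?thesis .
    qed
    then show "eventually (\<lambda>n. (\<integral>\<^sup>+x. ennreal ((f n x - g x)\<^sup>2) \<partial>M) \<le> ennreal e) sequentially"
      unfolding eventually_sequentially by blast
  qed
  with gm show ?thesis by blast
qed

text \<open>The filter is arbitrary because the statement is applied to sequences and, over a
  product filter, to pairs of indices in a Cauchy argument.\<close>

lemma trace_vanishing:
  fixes \<Omega> :: "(real^2) set"
  assumes H: "emeasure hausdorff1 (\<Gamma> :: (real^2) set) \<noteq> 0"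
    and \<Omega>: "open \<Omega>" "bounded \<Omega>" "lipschitz_boundary \<Omega>"
    and U: "\<And>i. smooth (U i)"
    and L2: "((\<lambda>i. \<integral>\<^sup>+x. ennreal ((U i x)\<^sup>2) \<partial>lebesgue_on \<Omega>) \<longlongrightarrow> 0) F"
    and gr: "\<And>b. b \<in> Basis \<Longrightarrow> ((\<lambda>i. \<integral>\<^sup>+x. ennreal ((pd b (U i) x)\<^sup>2) \<partial>lebesgue_on \<Omega>) \<longlongrightarrow> 0) F"
  shows "((\<lambda>i. \<integral>\<^sup>+x. ennreal ((U i x)\<^sup>2) \<partial>boundary_measure \<Omega>) \<longlongrightarrow> 0) F"
proof -
  obtain K where K: "0 \<le> K" "\<And>U. smooth U \<Longrightarrow> (\<integral>\<^sup>+x. ennreal ((U x)\<^sup>2) \<partial>boundary_measure \<Omega>)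
    \<le> ennreal K * ((\<integral>\<^sup>+x. ennreal ((U x)\<^sup>2) \<partial>lebesgue_on \<Omega>) + dirichlet \<Omega> U)"
    using trace_inequality[OF H \<Omega>] by blast
  have "((\<lambda>i. dirichlet \<Omega> (U i)) \<longlongrightarrow> (\<Sum>b\<in>(Basis :: (real^2) set). 0)) F"
    unfolding dirichlet_def by (intro tendsto_sum gr)
  then have lim: "((\<lambda>i. ennreal K * ((\<integral>\<^sup>+x. ennreal ((U i x)\<^sup>2) \<partial>lebesgue_on \<Omega>) + dirichlet \<Omega> (U i))) \<longlongrightarrow> ennreal K * (0 + 0)) F"
    by (intro ennreal_tendsto_cmult tendsto_add L2) auto
  show ?thesis
  proof (rule tendsto_sandwich[OF _ _ tendsto_const])
    show "eventually (\<lambda>i. (\<integral>\<^sup>+x. ennreal ((U i x)\<^sup>2) \<partial>boundary_measure \<Omega>)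
      \<le> ennreal K * ((\<integral>\<^sup>+x. ennreal ((U i x)\<^sup>2) \<partial>lebesgue_on \<Omega>) + dirichlet \<Omega> (U i))) F"
      by (intro always_eventually allI K(2) U)
  qed (use lim in simp_all)
qed

lemma L2_cauchy:
  fixes U :: "nat \<Rightarrow> 'a \<Rightarrow> real"
  assumes U: "\<And>n. U n \<in> borel_measurable M" and u: "u \<in> borel_measurable M"
    and lim: "(\<lambda>n. \<integral>\<^sup>+x. ennreal ((U n x - u x)\<^sup>2) \<partial>M) \<longlonglongrightarrow> 0"
  shows "((\<lambda>p. \<integral>\<^sup>+x. ennreal ((U (fst p) x - U (snd p) x)\<^sup>2) \<partial>M) \<longlongrightarrow> 0) (sequentially \<times>\<^sub>F sequentially)"
proof (rule tendsto_sandwich[OF _ _ tendsto_const])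
  let ?a = "\<lambda>n. \<integral>\<^sup>+x. ennreal ((U n x - u x)\<^sup>2) \<partial>M"
  have le: "(\<integral>\<^sup>+x. ennreal ((U m x - U n x)\<^sup>2) \<partial>M) \<le> 2 * ?a m + 2 * ?a n" for m n
  proof -
    have "(\<integral>\<^sup>+x. ennreal ((u x - U n x)\<^sup>2) \<partial>M) = ?a n" by (simp add: power2_commute)
    moreover have "(\<integral>\<^sup>+x. ennreal (((U m x - u x) + (u x - U n x))\<^sup>2) \<partial>M)
      \<le> 2 * ?a m + 2 * (\<integral>\<^sup>+x. ennreal ((u x - U n x)\<^sup>2) \<partial>M)"
      by (rule nn_integral_square_add_le) (use U u in auto)
    ultimately show ?thesis by simp
  qed
  then show "eventually (\<lambda>p. (\<integral>\<^sup>+x. ennreal ((U (fst p) x - U (snd p) x)\<^sup>2) \<partial>M)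
    \<le> 2 * ?a (fst p) + 2 * ?a (snd p)) (sequentially \<times>\<^sub>F sequentially)" by simp
  have "((\<lambda>p. 2 * ?a (fst p) + 2 * ?a (snd p)) \<longlongrightarrow> 2 * 0 + 2 * 0) (sequentially \<times>\<^sub>F sequentially)"
    by (intro tendsto_add ennreal_tendsto_cmult filterlim_compose[OF lim filterlim_fst] filterlim_compose[OF lim filterlim_snd]) auto
  then show "((\<lambda>p. 2 * ?a (fst p) + 2 * ?a (snd p)) \<longlongrightarrow> 0) (sequentially \<times>\<^sub>F sequentially)" by simp
qed auto

text \<open>Differences of the \<open>U n\<close> are small in \<open>H\<^sup>1\<close>, so by the
  trace inequality their restrictions form a Cauchy sequence on the boundary. The limit is square
  integrable as the sum of some \<open>U n\<close> and a finite error.\<close>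

lemma trace_limit:
  fixes \<Omega> :: "(real^2) set"
  assumes H: "emeasure hausdorff1 (\<Gamma> :: (real^2) set) \<noteq> 0"
    and \<Omega>: "open \<Omega>" "bounded \<Omega>" "lipschitz_boundary \<Omega>"
    and U: "\<And>n. smooth (U n)" and u: "square_integrable (lebesgue_on \<Omega>) u" and conv: "Hconv \<Omega> 1 U u"
  shows "\<exists>g. square_integrable (boundary_measure \<Omega>) g \<and>
    (\<lambda>n. \<integral>\<^sup>+x. ennreal ((U n x - g x)\<^sup>2) \<partial>boundary_measure \<Omega>) \<longlonglongrightarrow> 0"
proof -
  let ?F = "sequentially \<times>\<^sub>F sequentially :: (nat \<times> nat) filter"
  let ?M = "boundary_measure \<Omega>"
  have Um: "U n \<in> borel_measurable ?M" for n
    by (rule boundary_measure_space(2)[OF H smooth_measurable[OF U]])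
  have "((\<lambda>p. \<integral>\<^sup>+x. ennreal ((U (fst p) x - U (snd p) x)\<^sup>2) \<partial>?M) \<longlongrightarrow> 0) ?F"
  proof (rule trace_vanishing[OF H \<Omega>])
    show "smooth (\<lambda>x. U (fst p) x - U (snd p) x)" for p by (intro smooth_diff U)
    show "((\<lambda>p. \<integral>\<^sup>+x. ennreal ((U (fst p) x - U (snd p) x)\<^sup>2) \<partial>lebesgue_on \<Omega>) \<longlongrightarrow> 0) ?F"
      by (rule L2_cauchy[where u=u])
        (use conv u in \<open>auto intro: borel_lebesgue_on smooth_measurable U square_integrable_D(1)\<close>)
    fix b :: "real^2" assume b: "b \<in> Basis"
    obtain g where g: "has_weak_partial \<Omega> b u g"
      "(\<lambda>n. \<integral>\<^sup>+x. ennreal ((pd b (U n) x - g x)\<^sup>2) \<partial>lebesgue_on \<Omega>) \<longlonglongrightarrow> 0"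
      using conv b by auto
    have "((\<lambda>p. \<integral>\<^sup>+x. ennreal ((pd b (U (fst p)) x - pd b (U (snd p)) x)\<^sup>2) \<partial>lebesgue_on \<Omega>) \<longlongrightarrow> 0) ?F"
      by (rule L2_cauchy[where u=g])
        (use g in \<open>auto intro: borel_lebesgue_on pd_borel U square_integrable_D(1) simp: has_weak_partial_pd\<close>)
    then show "((\<lambda>p. \<integral>\<^sup>+x. ennreal ((pd b (\<lambda>x. U (fst p) x - U (snd p) x) x)\<^sup>2) \<partial>lebesgue_on \<Omega>) \<longlongrightarrow> 0) ?F"
      by (simp add: pd_diff U)
  qed
  then have cauchy: "\<exists>N. \<forall>m\<ge>N. \<forall>n\<ge>N. (\<integral>\<^sup>+x. ennreal ((U m x - U n x)\<^sup>2) \<partial>?M) \<le> ennreal e" if "0 < e" for e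
  proof -
    assume lim: "((\<lambda>p. \<integral>\<^sup>+x. ennreal ((U (fst p) x - U (snd p) x)\<^sup>2) \<partial>?M) \<longlongrightarrow> 0) ?F"
    have "eventually (\<lambda>p. (\<integral>\<^sup>+x. ennreal ((U (fst p) x - U (snd p) x)\<^sup>2) \<partial>?M) < ennreal e) ?F"
      by (rule ennreal_tendsto_0D[OF lim that])
    then obtain N1 N2 where N: "\<And>m n. m \<ge> N1 \<Longrightarrow> n \<ge> N2 \<Longrightarrow> (\<integral>\<^sup>+x. ennreal ((U m x - U n x)\<^sup>2) \<partial>?M) < ennreal e"
      unfolding eventually_prod_sequentially by fastforce
    then show ?thesis by (intro exI[of _ "max N1 N2"]) (auto intro: less_imp_le)
  qed
  from L2_complete[OF Um this] obtain g where g: "g \<in> borel_measurable ?M"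
    "(\<lambda>n. \<integral>\<^sup>+x. ennreal ((U n x - g x)\<^sup>2) \<partial>?M) \<longlonglongrightarrow> 0" by blast
  obtain n where n: "(\<integral>\<^sup>+x. ennreal ((U n x - g x)\<^sup>2) \<partial>?M) < ennreal 1"
    using ennreal_tendsto_0D[OF g(2), of 1] by (auto dest: eventually_happens)
  obtain K where K: "0 \<le> K" "\<And>U. smooth U \<Longrightarrow> (\<integral>\<^sup>+x. ennreal ((U x)\<^sup>2) \<partial>?M)
    \<le> ennreal K * ((\<integral>\<^sup>+x. ennreal ((U x)\<^sup>2) \<partial>lebesgue_on \<Omega>) + dirichlet \<Omega> U)"
    using trace_inequality[OF H \<Omega>] by blast
  have B: "\<Omega> \<in> sets borel" using \<Omega> by auto
  have fin: "(\<integral>\<^sup>+x. ennreal ((w x)\<^sup>2) \<partial>lebesgue_on \<Omega>) < \<infinity>" if "smooth w" for w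
    using smooth_square_integrable[OF that \<Omega>(2) B] unfolding square_integrable_iff by blast
  have "(\<integral>\<^sup>+x. ennreal ((U n x)\<^sup>2) \<partial>?M) < \<infinity>"
    using K(2)[OF U, of n] fin[OF U] fin[OF smooth_pd[OF U]]
    by (auto simp: dirichlet_def ennreal_mult_less_top intro: le_less_trans)
  moreover have "(\<integral>\<^sup>+x. ennreal ((g x - U n x)\<^sup>2) \<partial>?M) < \<infinity>"
    using n by (subst power2_commute) (auto intro: less_trans)
  ultimately have "square_integrable ?M (U n)" "square_integrable ?M (\<lambda>x. g x - U n x)"
    using Um g(1) by (auto simp: square_integrable_iff)
  from square_integrable_add[OF this] have "square_integrable ?M g" by simp
  with g(2) show ?thesis by blast
qed

lemma H1_Hsob: "u \<in> H1 \<Omega> \<Longrightarrow> Hsob \<Omega> UNIV 1 u"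
  by (auto simp: H1_def has_weak_partial_pd)

lemma H2_Hsob:
  assumes "u \<in> H2 \<Omega>" shows "Hsob \<Omega> UNIV 2 u"
proof -
  have u: "u \<in> H1 \<Omega>" "\<And>b. b \<in> Basis \<Longrightarrow> weak_partial \<Omega> b u \<in> H1 \<Omega>" using assms by (auto simp: H2_def)
  have "Hsob \<Omega> UNIV (Suc 1) u"
    unfolding Hsob.simps using u H1_square_integrable[OF u(1)] H1_weak_partial[OF u(1)] H1_Hsob[OF u(2)] by blast
  then show ?thesis by (simp only: numeral_2_eq_2 One_nat_def)
qed

lemma Hconv_H1_norm:
  fixes \<Omega> :: "'a::euclidean_space set"
  assumes \<Omega>: "open \<Omega>" "bounded \<Omega>" and U: "\<And>n. smooth (U n)" and u: "u \<in> H1 \<Omega>" and conv: "Hconv \<Omega> 1 U u"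
  shows "(\<lambda>n. H1_norm \<Omega> (\<lambda>x. U n x - u x)) \<longlonglongrightarrow> 0"
proof -
  have B: "\<Omega> \<in> sets borel" using \<Omega> by auto
  obtain g where g: "\<And>b. b \<in> Basis \<Longrightarrow> has_weak_partial \<Omega> b u (g b)"
    "\<And>b. b \<in> Basis \<Longrightarrow> (\<lambda>n. \<integral>\<^sup>+x. ennreal ((pd b (U n) x - g b x)\<^sup>2) \<partial>lebesgue_on \<Omega>) \<longlonglongrightarrow> 0"
  proof -
    have "\<forall>b\<in>Basis. \<exists>g. has_weak_partial \<Omega> b u g \<and> (\<lambda>n. \<integral>\<^sup>+x. ennreal ((pd b (U n) x - g x)\<^sup>2) \<partial>lebesgue_on \<Omega>) \<longlonglongrightarrow> 0"
      using conv by simp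
    from bchoice[OF this] that show ?thesis by blast
  qed
  show ?thesis
    using H1_norm_tendsto_iff[OF \<Omega> smooth_H1[OF \<Omega> U] u has_weak_partial_smooth[OF B \<Omega>(2) _ U] g(1)]
      g(2) Hconv_imp[OF conv] by simp
qed

text \<open>\<open>trace_on_boundary\<close> is a choice and means something only once a trace is
  known to exist; density of smooth functions provides one.\<close>

lemma trace_exists:
  fixes \<Omega> :: "(real^2) set"
  assumes H: "emeasure hausdorff1 (\<Gamma> :: (real^2) set) \<noteq> 0"
    and \<Omega>: "open \<Omega>" "bounded \<Omega>" "lipschitz_boundary \<Omega>" and u: "u \<in> H1 \<Omega>"
  shows "has_trace \<Omega> u (trace_on_boundary \<Omega> u)"
proof -
  obtain U where U: "\<And>n. smooth (U n)" "Hconv \<Omega> 1 U u"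
    using smooth_dense[OF \<Omega>(2,1) lipschitz_mollifiable[OF \<Omega>(1,3)] H1_Hsob[OF u]] by blast
  obtain g where g: "square_integrable (boundary_measure \<Omega>) g"
    "(\<lambda>n. \<integral>\<^sup>+x. ennreal ((U n x - g x)\<^sup>2) \<partial>boundary_measure \<Omega>) \<longlonglongrightarrow> 0"
    using trace_limit[OF H \<Omega> U(1) H1_square_integrable[OF u] U(2)] by blast
  obtain N where N: "\<And>n. n \<ge> N \<Longrightarrow> (\<integral>\<^sup>+x. ennreal ((U n x - g x)\<^sup>2) \<partial>boundary_measure \<Omega>) < ennreal 1"
    using ennreal_tendsto_0D[OF g(2), of 1] by (auto simp: eventually_sequentially)
  \<comment> \<open>Early terms might be at infinite distance from \<open>g\<close>. There
    \<open>L2_norm\<close> would take the default value of the Bochner integral, so they are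
    dropped.\<close>
  define V where "V n = U (n + N)" for n
  have sq: "square_integrable (boundary_measure \<Omega>) (\<lambda>x. V n x - g x)" for n
    using N[of "n + N"] square_integrable_D(1)[OF g(1)] boundary_measure_space(2)[OF H smooth_measurable[OF U(1)]]
    by (auto simp: square_integrable_iff V_def intro: less_trans)
  have "has_trace \<Omega> u g"
    unfolding has_trace_def
  proof (intro conjI u g(1) exI[of _ V] allI)
    show "Ck k UNIV (V n)" for n k using U(1) by (simp add: V_def smooth_def)
    show "(\<lambda>n. H1_norm \<Omega> (\<lambda>x. V n x - u x)) \<longlonglongrightarrow> 0"
      unfolding V_def using LIMSEQ_ignore_initial_segment[OF Hconv_H1_norm[OF \<Omega>(1,2) U(1) u U(2)], of N] .
    show "(\<lambda>n. L2_norm (boundary_measure \<Omega>) (\<lambda>x. V n x - g x)) \<longlonglongrightarrow> 0"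
      unfolding L2_norm_tendsto_iff[OF sq] unfolding V_def using LIMSEQ_ignore_initial_segment[OF g(2), of N] .
  qed
  then show ?thesis unfolding trace_on_boundary_def by (rule someI[of "has_trace \<Omega> u"])
qed

text \<open>Let \<open>W n\<close> be the approximations of \<open>w\<close> that realise its trace
  \<open>g\<close>, and \<open>\<Phi> n\<close> test functions that approximate
  \<open>w - u\<close>. Then \<open>V n + \<Phi> n - W n\<close> tends to 0 in
  \<open>H\<^sup>1\<close>, therefore also on the boundary, where \<open>\<Phi> n\<close>
  vanishes.\<close>

lemma trace_of_H10_perturbation:
  fixes \<Omega> :: "(real^2) set"
  assumes H: "emeasure hausdorff1 (\<Gamma> :: (real^2) set) \<noteq> 0"
    and \<Omega>: "open \<Omega>" "bounded \<Omega>" "lipschitz_boundary \<Omega>" and u: "u \<in> H1 \<Omega>"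
    and V: "\<And>n. smooth (V n)" "Hconv \<Omega> 1 V u" and w: "has_trace \<Omega> w g" "(\<lambda>x. w x - u x) \<in> H10 \<Omega>"
  shows "(\<lambda>n. \<integral>\<^sup>+x. ennreal ((V n x - g x)\<^sup>2) \<partial>boundary_measure \<Omega>) \<longlonglongrightarrow> 0"
proof -
  let ?M = "boundary_measure \<Omega>"
  have B: "\<Omega> \<in> sets borel" using \<Omega> by auto
  obtain W where W: "\<And>n. smooth (W n)" "(\<lambda>n. H1_norm \<Omega> (\<lambda>x. W n x - w x)) \<longlonglongrightarrow> 0"
    "(\<lambda>n. L2_norm ?M (\<lambda>x. W n x - g x)) \<longlonglongrightarrow> 0"
    using w(1) unfolding has_trace_def smooth_def by blast
  have gs: "square_integrable ?M g" and wH: "w \<in> H1 \<Omega>" using w(1) by (auto simp: has_trace_def)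
  obtain \<Phi> where \<Phi>: "\<And>n. test_function \<Omega> (\<Phi> n)" "(\<lambda>n. H1_norm \<Omega> (\<lambda>x. \<Phi> n x - (w x - u x))) \<longlonglongrightarrow> 0"
    and zH: "(\<lambda>x. w x - u x) \<in> H1 \<Omega>"
    using w(2) unfolding H10_def by blast
  have \<Phi>s: "smooth (\<Phi> n)" for n using \<Phi>(1) by (simp add: test_function_iff)
  have \<Phi>0: "\<Phi> n x = 0" if "x \<in> frontier \<Omega>" for n x
  proof -
    have "x \<notin> \<Omega>" using that \<Omega>(1) by (simp add: frontier_def interior_open)
    then show ?thesis using \<Phi>(1)[of n] unfolding test_function_iff by blast
  qed
  note wp = H1_weak_partial[OF u] H1_weak_partial[OF wH]
  have zw: "has_weak_partial \<Omega> b (\<lambda>x. w x - u x) (\<lambda>x. weak_partial \<Omega> b w x - weak_partial \<Omega> b u x)" if b: "b \<in> Basis" for b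
  proof -
    have "has_weak_partial \<Omega> b (\<lambda>x. (-1) * u x) (\<lambda>x. pd b (\<lambda>x. -1) x * u x + (-1) * weak_partial \<Omega> b u x)"
      by (rule has_weak_partial_mult[OF B \<Omega>(2) b smooth_const H1_square_integrable[OF u] wp(1)[OF b]])
    from has_weak_partial_add[OF B b H1_square_integrable[OF wH] square_integrable_cmult[OF H1_square_integrable[OF u]] wp(2)[OF b] this]
    show ?thesis by (simp add: pd_const)
  qed
  have VH: "(\<lambda>n. \<integral>\<^sup>+x. ennreal ((V n x - u x)\<^sup>2) \<partial>lebesgue_on \<Omega>) \<longlonglongrightarrow> 0 \<and>
    (\<forall>b\<in>Basis. (\<lambda>n. \<integral>\<^sup>+x. ennreal ((pd b (V n) x - weak_partial \<Omega> b u x)\<^sup>2) \<partial>lebesgue_on \<Omega>) \<longlonglongrightarrow> 0)"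
    using H1_norm_tendsto_iff[OF \<Omega>(1,2) smooth_H1[OF \<Omega>(1,2) V(1)] u has_weak_partial_smooth[OF B \<Omega>(2) _ V(1)] wp(1)]
      Hconv_H1_norm[OF \<Omega>(1,2) V(1) u V(2)] by simp
  have WH: "(\<lambda>n. \<integral>\<^sup>+x. ennreal ((W n x - w x)\<^sup>2) \<partial>lebesgue_on \<Omega>) \<longlonglongrightarrow> 0 \<and>
    (\<forall>b\<in>Basis. (\<lambda>n. \<integral>\<^sup>+x. ennreal ((pd b (W n) x - weak_partial \<Omega> b w x)\<^sup>2) \<partial>lebesgue_on \<Omega>) \<longlonglongrightarrow> 0)"
    using H1_norm_tendsto_iff[OF \<Omega>(1,2) smooth_H1[OF \<Omega>(1,2) W(1)] wH has_weak_partial_smooth[OF B \<Omega>(2) _ W(1)] wp(2)]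
      W(2) by simp
  have PH: "(\<lambda>n. \<integral>\<^sup>+x. ennreal ((\<Phi> n x - (w x - u x))\<^sup>2) \<partial>lebesgue_on \<Omega>) \<longlonglongrightarrow> 0 \<and>
    (\<forall>b\<in>Basis. (\<lambda>n. \<integral>\<^sup>+x. ennreal ((pd b (\<Phi> n) x - (weak_partial \<Omega> b w x - weak_partial \<Omega> b u x))\<^sup>2) \<partial>lebesgue_on \<Omega>) \<longlonglongrightarrow> 0)"
    using H1_norm_tendsto_iff[OF \<Omega>(1,2) smooth_H1[OF \<Omega>(1,2) \<Phi>s] zH has_weak_partial_smooth[OF B \<Omega>(2) _ \<Phi>s] zw]
      \<Phi>(2) by simp
  \<comment> \<open>The limits cancel: \<open>a' + (d' - a') - d' = 0\<close>. Used once for the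
    functions and once for each derivative.\<close>
  have combine: "(\<lambda>n. \<integral>\<^sup>+x. ennreal ((a n x + c n x - d n x)\<^sup>2) \<partial>lebesgue_on \<Omega>) \<longlonglongrightarrow> 0"
    if m: "\<And>n. a n \<in> borel_measurable (lebesgue_on \<Omega>)" "\<And>n. c n \<in> borel_measurable (lebesgue_on \<Omega>)"
      "\<And>n. d n \<in> borel_measurable (lebesgue_on \<Omega>)" "a' \<in> borel_measurable (lebesgue_on \<Omega>)" "d' \<in> borel_measurable (lebesgue_on \<Omega>)"
      and l: "(\<lambda>n. \<integral>\<^sup>+x. ennreal ((a n x - a' x)\<^sup>2) \<partial>lebesgue_on \<Omega>) \<longlonglongrightarrow> 0"
      "(\<lambda>n. \<integral>\<^sup>+x. ennreal ((c n x - (d' x - a' x))\<^sup>2) \<partial>lebesgue_on \<Omega>) \<longlonglongrightarrow> 0"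
      "(\<lambda>n. \<integral>\<^sup>+x. ennreal ((d n x - d' x)\<^sup>2) \<partial>lebesgue_on \<Omega>) \<longlonglongrightarrow> 0"
    for a c d :: "nat \<Rightarrow> real^2 \<Rightarrow> real" and a' d'
  proof -
    have "(\<lambda>n. \<integral>\<^sup>+x. ennreal ((d' x - d n x)\<^sup>2) \<partial>lebesgue_on \<Omega>) \<longlonglongrightarrow> 0"
      using l(3) by (simp add: power2_commute)
    from L2_tendsto_add[OF _ _ L2_tendsto_add[OF _ _ l(1,2)] this] m
    have "(\<lambda>n. \<integral>\<^sup>+x. ennreal (((a n x - a' x) + (c n x - (d' x - a' x)) + (d' x - d n x))\<^sup>2) \<partial>lebesgue_on \<Omega>) \<longlonglongrightarrow> 0"
      by auto
    moreover have "(a n x - a' x) + (c n x - (d' x - a' x)) + (d' x - d n x) = a n x + c n x - d n x" for n x by simp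
    ultimately show ?thesis by (simp only:)
  qed
  note bm = borel_lebesgue_on[OF smooth_measurable] borel_lebesgue_on[OF pd_borel]
    square_integrable_D(1)[OF H1_square_integrable[OF u]] square_integrable_D(1)[OF H1_square_integrable[OF wH]]
  have bwp: "weak_partial \<Omega> b u \<in> borel_measurable (lebesgue_on \<Omega>)" "weak_partial \<Omega> b w \<in> borel_measurable (lebesgue_on \<Omega>)"
    if "b \<in> Basis" for b
    using wp(1)[OF that] wp(2)[OF that] by (auto simp: has_weak_partial_pd intro: square_integrable_D(1))
  have "(\<lambda>n. \<integral>\<^sup>+x. ennreal ((V n x + \<Phi> n x - W n x)\<^sup>2) \<partial>?M) \<longlonglongrightarrow> 0"
  proof (rule trace_vanishing[OF H \<Omega>])
    show "smooth (\<lambda>x. V n x + \<Phi> n x - W n x)" for n by (intro smooth_diff smooth_add V \<Phi>s W)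
    show "(\<lambda>n. \<integral>\<^sup>+x. ennreal ((V n x + \<Phi> n x - W n x)\<^sup>2) \<partial>lebesgue_on \<Omega>) \<longlonglongrightarrow> 0"
      by (rule combine[OF bm(1)[OF V(1)] bm(1)[OF \<Phi>s] bm(1)[OF W(1)] bm(3,4)]) (use VH PH WH in auto)
    fix b :: "real^2" assume b: "b \<in> Basis"
    have "(\<lambda>n. \<integral>\<^sup>+x. ennreal ((pd b (V n) x + pd b (\<Phi> n) x - pd b (W n) x)\<^sup>2) \<partial>lebesgue_on \<Omega>) \<longlonglongrightarrow> 0"
      by (rule combine[OF bm(2)[OF V(1)] bm(2)[OF \<Phi>s] bm(2)[OF W(1)] bwp[OF b]]) (use VH PH WH b in auto)
    then show "(\<lambda>n. \<integral>\<^sup>+x. ennreal ((pd b (\<lambda>x. V n x + \<Phi> n x - W n x) x)\<^sup>2) \<partial>lebesgue_on \<Omega>) \<longlonglongrightarrow> 0"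
      by (simp add: pd_diff pd_add smooth_add V(1) \<Phi>s W(1))
  qed
  moreover have "(\<lambda>n. \<integral>\<^sup>+x. ennreal ((W n x - g x)\<^sup>2) \<partial>?M) \<longlonglongrightarrow> 0"
  proof -
    \<comment> \<open>The trace inequality makes \<open>W n\<close> square integrable on the
      boundary, so that its \<open>L2_norm\<close> distance from \<open>g\<close> is a genuine
      integral.\<close>
    obtain K where K: "0 \<le> K" "\<And>U. smooth U \<Longrightarrow> (\<integral>\<^sup>+x. ennreal ((U x)\<^sup>2) \<partial>?M)
      \<le> ennreal K * ((\<integral>\<^sup>+x. ennreal ((U x)\<^sup>2) \<partial>lebesgue_on \<Omega>) + dirichlet \<Omega> U)"
      using trace_inequality[OF H \<Omega>] by blast
    have fin: "(\<integral>\<^sup>+x. ennreal ((f x)\<^sup>2) \<partial>lebesgue_on \<Omega>) < \<infinity>" if "smooth f" for f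
      using smooth_square_integrable[OF that \<Omega>(2) B] unfolding square_integrable_iff by blast
    have "square_integrable ?M (W n)" for n
      using K(2)[OF W(1), of n] fin[OF W(1)] fin[OF smooth_pd[OF W(1)]]
        boundary_measure_space(2)[OF H smooth_measurable[OF W(1)]]
      by (auto simp: dirichlet_def ennreal_mult_less_top square_integrable_iff intro: le_less_trans)
    from L2_norm_tendsto_iff[OF square_integrable_diff[OF this gs]] W(3) show ?thesis by simp
  qed
  ultimately have "(\<lambda>n. \<integral>\<^sup>+x. ennreal ((V n x + \<Phi> n x - W n x + (W n x - g x))\<^sup>2) \<partial>?M) \<longlonglongrightarrow> 0"
    using square_integrable_D(1)[OF gs] boundary_measure_space(2)[OF H smooth_measurable] V(1) \<Phi>s W(1)
    by (intro L2_tendsto_add) auto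
  moreover have "(\<integral>\<^sup>+x. ennreal ((V n x + \<Phi> n x - W n x + (W n x - g x))\<^sup>2) \<partial>?M) = (\<integral>\<^sup>+x. ennreal ((V n x - g x)\<^sup>2) \<partial>?M)" for n
    by (rule nn_integral_cong) (simp add: boundary_measure_space(1)[OF H] \<Phi>0)
  ultimately show ?thesis by simp
qed

section \<open>Hardy's inequality\<close>

text \<open>The integrand is unbounded at 0, but its primitive is continuous up to the end point; a
  derivative in the interior is enough.\<close>

lemma nn_integral_inverse_sqrt:
  assumes "0 < l"
  shows "(\<integral>\<^sup>+\<tau>. ennreal (1 / sqrt \<tau>) * indicator {0..l} \<tau> \<partial>lborel) = ennreal (2 * sqrt l)"
proof -
  have "((\<lambda>\<tau>. 1 / sqrt \<tau>) has_integral (2 * sqrt l - 2 * sqrt 0)) {0..l}"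
  proof (rule fundamental_theorem_of_calculus_interior)
    show "((\<lambda>\<tau>. 2 * sqrt \<tau>) has_vector_derivative 1 / sqrt \<tau>) (at \<tau>)" if "\<tau> \<in> {0<..<l}" for \<tau>
    proof -
      have "0 < \<tau>" using that by simp
      from DERIV_cmult[OF DERIV_real_sqrt[OF this], of 2]
      moreover have "2 * (inverse (sqrt \<tau>) / 2) = 1 / sqrt \<tau>" by (simp add: inverse_eq_divide)
      ultimately have "((\<lambda>\<tau>. 2 * sqrt \<tau>) has_real_derivative 1 / sqrt \<tau>) (at \<tau>)" by (simp only:)
      then show ?thesis unfolding has_real_derivative_iff_has_vector_derivative .
    qed
    show "continuous_on {0..l} (\<lambda>\<tau>. 2 * sqrt \<tau>)" by (intro continuous_intros)
    show "0 \<le> l" using assms by simp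
  qed
  from nn_integral_has_integral_lebesgue[OF _ this]
  have "(\<integral>\<^sup>+\<tau>. ennreal (indicator {0..l} \<tau> * (1 / sqrt \<tau>)) \<partial>lborel) = ennreal (2 * sqrt l)" by simp
  moreover have "(\<integral>\<^sup>+\<tau>. ennreal (indicator {0..l} \<tau> * (1 / sqrt \<tau>)) \<partial>lborel)
     = (\<integral>\<^sup>+\<tau>. ennreal (1 / sqrt \<tau>) * indicator {0..l} \<tau> \<partial>lborel)"
    by (rule nn_integral_cong) (auto simp: indicator_def)
  ultimately show ?thesis by simp
qed

lemma nn_integral_tail:
  assumes "0 < a" "0 < c"
  shows "(\<integral>\<^sup>+u. ennreal (2 * sqrt c / (sqrt u * u)) * indicator {a..} u \<partial>lborel) = ennreal (4 * sqrt c / sqrt a)"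
proof -
  have "(\<integral>\<^sup>+u. ennreal (2 * sqrt c / (sqrt u * u)) * indicator {a..} u \<partial>lborel) = ennreal (0 - (- (4 * sqrt c / sqrt a)))"
  proof (rule nn_integral_FTC_atLeast)
    show "((\<lambda>u. - (4 * sqrt c / sqrt u)) has_real_derivative 2 * sqrt c / (sqrt u * u)) (at u)" if "a \<le> u" for u
    proof -
      define q where "q = sqrt u"
      have u: "0 < u" using that assms by simp
      have q: "0 < q" "u = q * q" using u by (auto simp: q_def)
      have "((\<lambda>u. - (4 * sqrt c) * inverse (sqrt u)) has_real_derivative
          - (4 * sqrt c) * - (inverse q * (inverse q / 2) * inverse q)) (at u)"
        unfolding q_def by (rule DERIV_cmult[OF DERIV_inverse'[OF DERIV_real_sqrt[OF u]]]) (use u in simp)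
      moreover have "- (4 * sqrt c) * - (inverse q * (inverse q / 2) * inverse q) = 2 * sqrt c / (q * (q * q))"
        using q(1) by (simp add: field_simps)
      moreover have "q * (q * q) = sqrt u * u" unfolding q(2)[symmetric] unfolding q_def ..
      moreover have "(\<lambda>u. - (4 * sqrt c) * inverse (sqrt u)) = (\<lambda>u. - (4 * sqrt c / sqrt u))"
        by (simp add: fun_eq_iff inverse_eq_divide)
      ultimately show ?thesis by (simp only:)
    qed
    have "((\<lambda>u. 4 * sqrt c / sqrt u) \<longlongrightarrow> 0) at_top"
      by (rule real_tendsto_divide_at_top[OF tendsto_const sqrt_at_top])
    from tendsto_minus[OF this] show "((\<lambda>u. - (4 * sqrt c / sqrt u)) \<longlongrightarrow> 0) at_top" by simp
  qed (use assms in auto)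
  then show ?thesis by simp
qed

text \<open>For fixed \<open>\<tau>\<close> only \<open>t\<close> with
  \<open>\<bar>s - t\<bar> \<ge> \<tau> / c\<close> contribute. These are two half-lines, and each
  gives the tail integral of a power -3/2.\<close>

lemma hardy_inner:
  assumes c: "0 < c" and \<tau>: "0 < \<tau>"
  shows "(\<integral>\<^sup>+t. ennreal (2 * sqrt (c * \<bar>s - t\<bar>) / (s - t)\<^sup>2) * indicator {..c * \<bar>s - t\<bar>} \<tau> \<partial>lborel)
    \<le> ennreal (8 * c / sqrt \<tau>)"
proof -
  define a where "a = \<tau> / c"
  have a: "0 < a" using c \<tau> by (simp add: a_def)
  define \<phi> where "\<phi> u = ennreal (2 * sqrt c / (sqrt u * u)) * indicator {a..} u" for u :: real
  have [measurable]: "\<phi> \<in> borel_measurable borel" unfolding \<phi>_def by measurable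
  have key: "2 * sqrt (c * u) / u\<^sup>2 = 2 * sqrt c / (sqrt u * u)" if "0 < u" for u
    using that by (simp add: real_sqrt_mult power2_eq_square field_simps)
  have "ennreal (2 * sqrt (c * \<bar>s - t\<bar>) / (s - t)\<^sup>2) * indicator {..c * \<bar>s - t\<bar>} \<tau>
     \<le> \<phi> (s - t) + \<phi> (t - s)" for t
  proof (cases "\<tau> \<le> c * \<bar>s - t\<bar>")
    case True
    then have ge: "a \<le> \<bar>s - t\<bar>" using c by (simp add: a_def field_simps)
    show ?thesis
    proof (cases "t < s")
      case True
      then have "\<phi> (s - t) = ennreal (2 * sqrt (c * \<bar>s - t\<bar>) / (s - t)\<^sup>2)"
        using ge key[of "s - t"] by (simp add: \<phi>_def)
      then show ?thesis by (auto simp: indicator_def intro: add_increasing2)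
    next
      case False
      then have "\<phi> (t - s) = ennreal (2 * sqrt (c * \<bar>s - t\<bar>) / (s - t)\<^sup>2)"
        using ge a key[of "t - s"] by (simp add: \<phi>_def abs_minus_commute power2_commute[of s t])
      then show ?thesis by (auto simp: indicator_def intro: add_increasing)
    qed
  qed auto
  then have "(\<integral>\<^sup>+t. ennreal (2 * sqrt (c * \<bar>s - t\<bar>) / (s - t)\<^sup>2) * indicator {..c * \<bar>s - t\<bar>} \<tau> \<partial>lborel)
    \<le> (\<integral>\<^sup>+t. \<phi> (s - t) + \<phi> (t - s) \<partial>lborel)"
    by (intro nn_integral_mono) auto
  also have "\<dots> = (\<integral>\<^sup>+t. \<phi> (s - t) \<partial>lborel) + (\<integral>\<^sup>+t. \<phi> (t - s) \<partial>lborel)"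
    by (rule nn_integral_add) measurable
  also have "(\<integral>\<^sup>+t. \<phi> (s - t) \<partial>lborel) = (\<integral>\<^sup>+u. \<phi> u \<partial>lborel)"
    using nn_integral_lborel_affine[of \<phi> "-1" s] by simp
  also have "(\<integral>\<^sup>+t. \<phi> (t - s) \<partial>lborel) = (\<integral>\<^sup>+u. \<phi> u \<partial>lborel)"
    by (rule nn_integral_lborel_shift) measurable
  also have "(\<integral>\<^sup>+u. \<phi> u \<partial>lborel) = ennreal (4 * sqrt c / sqrt a)"
    unfolding \<phi>_def by (rule nn_integral_tail[OF a c])
  also have "ennreal (4 * sqrt c / sqrt a) + ennreal (4 * sqrt c / sqrt a) = ennreal (8 * c / sqrt \<tau>)"
  proof -
    have "sqrt c / sqrt a = c / sqrt \<tau>" using c \<tau> by (simp add: a_def real_sqrt_divide)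
    then have "4 * sqrt c / sqrt a + 4 * sqrt c / sqrt a = 8 * c / sqrt \<tau>" by (simp add: field_simps)
    then show ?thesis using c a by (simp flip: ennreal_plus)
  qed
  finally show ?thesis .
qed

text \<open>The weight \<open>\<tau>\<^sup>1\<^sup>/\<^sup>4\<close> in the Cauchy--Schwarz inequality makes the remaining kernel integrable.\<close>

lemma hardy_inequality:
  fixes k :: "real \<Rightarrow> ennreal"
  assumes [measurable]: "k \<in> borel_measurable borel" and c: "0 < c"
  shows "(\<integral>\<^sup>+t. ennreal (1 / (s - t)\<^sup>2) * (\<integral>\<^sup>+\<tau>. k \<tau> * indicator {0..c * \<bar>s - t\<bar>} \<tau> \<partial>lborel)\<^sup>2 \<partial>lborel)
    \<le> ennreal (8 * c) * (\<integral>\<^sup>+\<tau>. (k \<tau>)\<^sup>2 * indicator {0..} \<tau> \<partial>lborel)"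
proof -
  \<comment> \<open>The factor left after Cauchy-Schwarz: \<open>2 * sqrt l\<close> is the integral
    of \<open>1 / sqrt \<tau>\<close> over \<open>{0..l}\<close> with
    \<open>l = c * \<bar>s - t\<bar>\<close>, and the indicator keeps the upper limit when the
    integrals are exchanged.\<close>
  define W where "W t \<tau> = ennreal (2 * sqrt (c * \<bar>s - t\<bar>) / (s - t)\<^sup>2) * indicator {..c * \<bar>s - t\<bar>} \<tau>" for t \<tau>
  have pos: "AE \<tau> in lborel. \<tau> \<noteq> (0::real)" by (rule AE_lborel_singleton)
  have pw: "ennreal (1 / (s - t)\<^sup>2) * (\<integral>\<^sup>+\<tau>. k \<tau> * indicator {0..c * \<bar>s - t\<bar>} \<tau> \<partial>lborel)\<^sup>2
     \<le> (\<integral>\<^sup>+\<tau>. W t \<tau> * (ennreal (sqrt \<tau>) * (k \<tau>)\<^sup>2 * indicator {0..} \<tau>) \<partial>lborel)" for t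
  \<comment> \<open>On the diagonal the left-hand side is 0, since division by 0 gives 0.\<close>
  proof (cases "t = s")
    case False
    define l where "l = c * \<bar>s - t\<bar>"
    have l: "0 < l" using c False by (simp add: l_def)
    let ?f = "\<lambda>\<tau>. ennreal (sqrt (sqrt \<tau>)) * k \<tau> * indicator {0..l} \<tau>"
    let ?g = "\<lambda>\<tau>. ennreal (1 / sqrt (sqrt \<tau>)) * indicator {0..l} \<tau>"
    have "(\<integral>\<^sup>+\<tau>. k \<tau> * indicator {0..l} \<tau> \<partial>lborel) = (\<integral>\<^sup>+\<tau>. ?f \<tau> * ?g \<tau> \<partial>lborel)"
    proof (rule nn_integral_cong_AE)
      show "AE \<tau> in lborel. k \<tau> * indicator {0..l} \<tau> = ?f \<tau> * ?g \<tau>"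
        using pos
      proof eventually_elim
        case (elim \<tau>)
        show ?case
        proof (cases "\<tau> \<in> {0..l}")
          case True
          then have "0 < \<tau>" using elim by auto
          then have "ennreal (sqrt (sqrt \<tau>)) * ennreal (1 / sqrt (sqrt \<tau>)) = 1"
            by (simp flip: ennreal_mult)
          then have "k \<tau> = k \<tau> * (ennreal (sqrt (sqrt \<tau>)) * ennreal (1 / sqrt (sqrt \<tau>)))" by simp
          also have "\<dots> = ennreal (sqrt (sqrt \<tau>)) * k \<tau> * ennreal (1 / sqrt (sqrt \<tau>))" by (simp only: ac_simps)
          finally show ?thesis using True by simp
        qed simp
      qed
    qed
    then have "(\<integral>\<^sup>+\<tau>. k \<tau> * indicator {0..l} \<tau> \<partial>lborel)\<^sup>2 \<le> (\<integral>\<^sup>+\<tau>. (?f \<tau>)\<^sup>2 \<partial>lborel) * (\<integral>\<^sup>+\<tau>. (?g \<tau>)\<^sup>2 \<partial>lborel)"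
      by (simp only:) (rule Cauchy_Schwarz_nn_integral; measurable)
    also have "(\<integral>\<^sup>+\<tau>. (?g \<tau>)\<^sup>2 \<partial>lborel) = (\<integral>\<^sup>+\<tau>. ennreal (1 / sqrt \<tau>) * indicator {0..l} \<tau> \<partial>lborel)"
      by (rule nn_integral_cong) (auto simp: indicator_def ennreal_power power_divide)
    also have "\<dots> = ennreal (2 * sqrt l)" by (rule nn_integral_inverse_sqrt[OF l])
    also have "(\<integral>\<^sup>+\<tau>. (?f \<tau>)\<^sup>2 \<partial>lborel) = (\<integral>\<^sup>+\<tau>. ennreal (sqrt \<tau>) * (k \<tau>)\<^sup>2 * indicator {0..l} \<tau> \<partial>lborel)"
      by (rule nn_integral_cong) (auto simp: indicator_def power_mult_distrib ennreal_power)
    finally have "ennreal (1 / (s - t)\<^sup>2) * (\<integral>\<^sup>+\<tau>. k \<tau> * indicator {0..l} \<tau> \<partial>lborel)\<^sup>2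
      \<le> ennreal (1 / (s - t)\<^sup>2) * ((\<integral>\<^sup>+\<tau>. ennreal (sqrt \<tau>) * (k \<tau>)\<^sup>2 * indicator {0..l} \<tau> \<partial>lborel) * ennreal (2 * sqrt l))"
      by (rule mult_left_mono) simp
    also have "\<dots> = ennreal (2 * sqrt l / (s - t)\<^sup>2) * (\<integral>\<^sup>+\<tau>. ennreal (sqrt \<tau>) * (k \<tau>)\<^sup>2 * indicator {0..l} \<tau> \<partial>lborel)"
    proof -
      have e: "ennreal (2 * sqrt l / (s - t)\<^sup>2) = ennreal (1 / (s - t)\<^sup>2) * ennreal (2 * sqrt l)"
        using l by (subst ennreal_mult[symmetric]) auto
      show ?thesis unfolding e by (simp only: ac_simps)
    qed
    also have "\<dots> = (\<integral>\<^sup>+\<tau>. ennreal (2 * sqrt l / (s - t)\<^sup>2) * (ennreal (sqrt \<tau>) * (k \<tau>)\<^sup>2 * indicator {0..l} \<tau>) \<partial>lborel)"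
      by (rule nn_integral_cmult[symmetric]) measurable
    also have "\<dots> = (\<integral>\<^sup>+\<tau>. W t \<tau> * (ennreal (sqrt \<tau>) * (k \<tau>)\<^sup>2 * indicator {0..} \<tau>) \<partial>lborel)"
      by (rule nn_integral_cong) (auto simp: W_def l_def indicator_def)
    finally show ?thesis by (simp add: l_def)
  qed simp
  have "(\<integral>\<^sup>+t. ennreal (1 / (s - t)\<^sup>2) * (\<integral>\<^sup>+\<tau>. k \<tau> * indicator {0..c * \<bar>s - t\<bar>} \<tau> \<partial>lborel)\<^sup>2 \<partial>lborel)
    \<le> (\<integral>\<^sup>+t. \<integral>\<^sup>+\<tau>. W t \<tau> * (ennreal (sqrt \<tau>) * (k \<tau>)\<^sup>2 * indicator {0..} \<tau>) \<partial>lborel \<partial>lborel)"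
    by (intro nn_integral_mono pw)
  also have "\<dots> = (\<integral>\<^sup>+\<tau>. \<integral>\<^sup>+t. W t \<tau> * (ennreal (sqrt \<tau>) * (k \<tau>)\<^sup>2 * indicator {0..} \<tau>) \<partial>lborel \<partial>lborel)"
    unfolding W_def atMost_def indicator_def mem_Collect_eq by (rule lborel_pair.Fubini') measurable
  also have "\<dots> = (\<integral>\<^sup>+\<tau>. (\<integral>\<^sup>+t. W t \<tau> \<partial>lborel) * (ennreal (sqrt \<tau>) * (k \<tau>)\<^sup>2 * indicator {0..} \<tau>) \<partial>lborel)"
    unfolding W_def by (intro nn_integral_cong nn_integral_multc) (simp add: atMost_def indicator_def)
  also have "\<dots> \<le> (\<integral>\<^sup>+\<tau>. ennreal (8 * c) * ((k \<tau>)\<^sup>2 * indicator {0..} \<tau>) \<partial>lborel)"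
  proof (rule nn_integral_mono_AE)
    show "AE \<tau> in lborel. (\<integral>\<^sup>+t. W t \<tau> \<partial>lborel) * (ennreal (sqrt \<tau>) * (k \<tau>)\<^sup>2 * indicator {0..} \<tau>)
      \<le> ennreal (8 * c) * ((k \<tau>)\<^sup>2 * indicator {0..} \<tau>)"
      using pos
    proof eventually_elim
      case (elim \<tau>)
      show ?case
      proof (cases "0 \<le> \<tau>")
        case True
        then have \<tau>: "0 < \<tau>" using elim by simp
        have "(\<integral>\<^sup>+t. W t \<tau> \<partial>lborel) * (ennreal (sqrt \<tau>) * (k \<tau>)\<^sup>2 * indicator {0..} \<tau>)
          \<le> ennreal (8 * c / sqrt \<tau>) * (ennreal (sqrt \<tau>) * (k \<tau>)\<^sup>2 * indicator {0..} \<tau>)"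
          unfolding W_def by (intro mult_right_mono hardy_inner c \<tau>) simp
        also have "\<dots> = (ennreal (8 * c / sqrt \<tau>) * ennreal (sqrt \<tau>)) * ((k \<tau>)\<^sup>2 * indicator {0..} \<tau>)"
          by (simp only: ac_simps)
        also have "ennreal (8 * c / sqrt \<tau>) * ennreal (sqrt \<tau>) = ennreal (8 * c)"
          using \<tau> c by (subst ennreal_mult[symmetric]) auto
        finally show ?thesis .
      qed simp
    qed
  qed
  also have "\<dots> = ennreal (8 * c) * (\<integral>\<^sup>+\<tau>. (k \<tau>)\<^sup>2 * indicator {0..} \<tau> \<partial>lborel)"
    by (rule nn_integral_cmult) measurable
  finally show ?thesis .
qed

section \<open>The Gagliardo seminorm of a trace\<close>

lemma ennreal_sum_square_le:
  fixes a :: "'i \<Rightarrow> ennreal"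
  assumes "finite I"
  shows "(\<Sum>i\<in>I. a i)\<^sup>2 \<le> of_nat (card I) * (\<Sum>i\<in>I. (a i)\<^sup>2)"
proof (cases "\<exists>i\<in>I. a i = top")
  case True
  then obtain i where i: "i \<in> I" "a i = top" by blast
  then have "(\<Sum>i\<in>I. (a i)\<^sup>2) = top" using assms by (auto simp: ennreal_top_eq_mult_iff power2_eq_square intro!: bexI[of _ i])
  moreover have "card I \<noteq> 0" using i assms by auto
  ultimately show ?thesis by (simp add: ennreal_mult_top)
next
  case False
  then have e: "a i = ennreal (enn2real (a i))" if "i \<in> I" for i using that by (simp add: less_top)
  have "(\<Sum>i\<in>I. a i) = ennreal (\<Sum>i\<in>I. enn2real (a i))"
    by (subst sum_ennreal[symmetric]) (use e in \<open>auto intro!: sum.cong\<close>)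
  moreover have "(\<Sum>i\<in>I. (a i)\<^sup>2) = ennreal (\<Sum>i\<in>I. (enn2real (a i))\<^sup>2)"
    by (subst sum_ennreal[symmetric]) (use e in \<open>auto intro!: sum.cong simp: ennreal_power[symmetric]\<close>)
  moreover have "(\<Sum>i\<in>I. enn2real (a i))\<^sup>2 \<le> real (card I) * (\<Sum>i\<in>I. (enn2real (a i))\<^sup>2)"
    using sum_squared_le_sum_of_squares[of "\<lambda>i. enn2real (a i)" I] by (simp add: mult.commute)
  ultimately show ?thesis
    by (simp add: ennreal_power ennreal_of_nat_eq_real_of_nat sum_nonneg ennreal_leI flip: ennreal_mult)
qed

text \<open>Modelled on a graph over its abscissa. The lower constant 1 lets boundary integrals
  dominate parameter integrals without loss; the upper constant \<open>c\<close> bounds chords by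
  parameter distances and fixes the range in Hardy's inequality.\<close>

locale boundary_curve =
  fixes \<Omega> \<Gamma> :: "(real^2) set" and J :: "real set" and \<gamma> :: "real \<Rightarrow> real^2" and c :: real
  assumes H: "emeasure hausdorff1 \<Gamma> \<noteq> 0"
    and \<Omega>: "open \<Omega>" "bounded \<Omega>" "lipschitz_boundary \<Omega>"
    and J[measurable]: "J \<in> sets borel" and J_finite: "emeasure lborel J < \<infinity>"
    and \<gamma>[measurable]: "\<gamma> \<in> borel_measurable borel" and \<gamma>_frontier: "\<And>s. s \<in> J \<Longrightarrow> \<gamma> s \<in> frontier \<Omega>"
    and c: "0 < c"
    and bilip: "\<And>s t. s \<in> J \<Longrightarrow> t \<in> J \<Longrightarrow> \<bar>s - t\<bar> \<le> dist (\<gamma> s) (\<gamma> t)"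
      "\<And>s t. s \<in> J \<Longrightarrow> t \<in> J \<Longrightarrow> dist (\<gamma> s) (\<gamma> t) \<le> c * \<bar>s - t\<bar>"
begin

lemma \<gamma>_measurable: "\<gamma> \<in> measurable (restrict_space lborel J) (boundary_measure \<Omega>)"
proof -
  have "\<gamma> \<in> measurable (restrict_space lborel J) (restrict_space borel (frontier \<Omega>))"
    by (rule measurable_restrict_space2) (auto simp: space_restrict_space \<gamma>_frontier intro!: measurable_restrict_space1)
  then show ?thesis by (simp add: measurable_cong_sets[OF refl boundary_measure_space(3)[OF H]])
qed

text \<open>Only an inequality, since \<open>\<gamma>\<close> may stretch lengths and cover just a
  part of the boundary. It rests on the fact that Lebesgue measure of a preimage is at most
  Hausdorff measure.\<close>

lemma pullback:
  assumes "F \<in> borel_measurable (boundary_measure \<Omega>)"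
  shows "(\<integral>\<^sup>+s. F (\<gamma> s) * indicator J s \<partial>lborel) \<le> (\<integral>\<^sup>+x. F x \<partial>boundary_measure \<Omega>)"
proof -
  have "(\<integral>\<^sup>+s. F (\<gamma> s) * indicator J s \<partial>lborel) \<le> 1 * (\<integral>\<^sup>+x. F x \<partial>boundary_measure \<Omega>)"
  proof (rule nn_integral_change_le[OF _ \<gamma>_measurable _ assms])
    fix B assume "B \<in> sets (boundary_measure \<Omega>)"
    then have "B \<in> sets (restrict_space borel (frontier \<Omega>))" by (simp add: boundary_measure_space(3)[OF H])
    then have B: "B \<in> sets borel" "B \<subseteq> frontier \<Omega>" by (auto simp: sets_restrict_space_iff)
    have "emeasure lborel (\<gamma> -` B \<inter> J) \<le> hausdorff1_outer B"
    proof (rule emeasure_le_hausdorff1_outer)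
      show "\<gamma> -` B \<inter> J \<in> sets borel" using measurable_sets[OF \<gamma> B(1)] J by simp
    qed (use bilip in auto)
    then show "emeasure lborel (\<gamma> -` B \<inter> J) \<le> 1 * emeasure (boundary_measure \<Omega>) B"
      by (simp add: boundary_measure_emeasure(1)[OF H B])
  qed simp
  then show ?thesis by simp
qed

lemma pullback_AE:
  assumes "AE x in boundary_measure \<Omega>. P x" shows "AE s in lborel. s \<in> J \<longrightarrow> P (\<gamma> s)"
proof -
  obtain N where N: "{x \<in> space (boundary_measure \<Omega>). \<not> P x} \<subseteq> N" "emeasure (boundary_measure \<Omega>) N = 0"
    "N \<in> sets (boundary_measure \<Omega>)"
    using assms by (rule AE_E)
  have "(\<integral>\<^sup>+s. indicator N (\<gamma> s) * indicator J s \<partial>lborel) \<le> (\<integral>\<^sup>+x. indicator N x \<partial>boundary_measure \<Omega>)"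
    by (rule pullback) (use N in simp)
  then have z: "(\<integral>\<^sup>+s. indicator N (\<gamma> s) * indicator J s \<partial>lborel) = 0" using N by simp
  have "N \<in> sets (restrict_space borel (frontier \<Omega>))" using N(3) by (simp add: boundary_measure_space(3)[OF H])
  then have [measurable]: "N \<in> sets borel" by (auto simp: sets_restrict_space_iff)
  have "AE s in lborel. indicator N (\<gamma> s) * indicator J s = (0 :: ennreal)"
    using z by (subst (asm) nn_integral_0_iff_AE) auto
  then show ?thesis
  proof eventually_elim
    case (elim s)
    then show ?case using N(1) \<gamma>_frontier[of s] by (auto simp: indicator_def boundary_measure_space(1)[OF H] split: if_split_asm)
  qed
qed

lemma borel_pullback:
  fixes G :: "real^2 \<Rightarrow> real"
  assumes "G \<in> borel_measurable (boundary_measure \<Omega>)"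
  shows "(\<lambda>s. if s \<in> J then G (\<gamma> s) else 0) \<in> borel_measurable borel"
proof -
  have "(\<lambda>s. G (\<gamma> s)) \<in> borel_measurable (restrict_space lborel J)"
    by (rule measurable_compose[OF \<gamma>_measurable assms])
  then show ?thesis by (subst (asm) measurable_restrict_space_iff[where c=0]) auto
qed

text \<open>A segment integral cut off twice: at \<open>D\<close>, as far as the sweep reaches, and
  at \<open>c * \<bar>s - t\<bar>\<close>, which bounds the chord. It depends on \<open>t\<close>
  only through its upper limit, as Hardy's inequality requires.\<close>

definition seg_part :: "(real^2 \<Rightarrow> real) \<Rightarrow> real^2 \<Rightarrow> real \<Rightarrow> real \<Rightarrow> real \<Rightarrow> ennreal" where
  "seg_part U E D s t = (\<integral>\<^sup>+\<tau>. ennreal \<bar>pd E U (\<gamma> s + \<tau> *\<^sub>R E)\<bar> * indicator {0..D} \<tau> * indicator {0..c * \<bar>s - t\<bar>} \<tau> \<partial>lborel)"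

lemma seg_part_measurable:
  assumes "smooth U" shows "(\<lambda>(s, t). seg_part U E D s t) \<in> borel_measurable (lborel \<Otimes>\<^sub>M lborel)"
proof -
  note pd_borel[OF assms, measurable]
  show ?thesis unfolding seg_part_def atLeastAtMost_iff indicator_def by measurable
qed

text \<open>Hardy's inequality in \<open>t\<close> for fixed \<open>s\<close> leaves the squared
  directional derivative along the segment at \<open>\<gamma> s\<close>. Integration in
  \<open>s\<close> is then moved to the boundary by \<open>pullback\<close> and into \<Omega> by the
  sweep.\<close>

lemma patch_seg_part:
  assumes U: "smooth U" and P: "cone_patch \<Omega> B D \<E> C" and E: "E \<in> \<E>"
  shows "(\<integral>\<^sup>+s. \<integral>\<^sup>+t. ennreal (1 / (s - t)\<^sup>2) * (seg_part U E D s t)\<^sup>2 * indicator {s\<in>J. \<gamma> s \<in> B} s \<partial>lborel \<partial>lborel)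
    \<le> ennreal (8 * c) * (ennreal C * (ennreal (2 * (norm E)\<^sup>2) * dirichlet \<Omega> U))"
proof -
  note pd_borel[OF U, measurable]
  have [measurable]: "B \<in> sets borel" using P by (auto simp: cone_patch_def)
  let ?\<Phi> = "\<lambda>x. \<integral>\<^sup>+\<tau>. ennreal ((pd E U (x + \<tau> *\<^sub>R E))\<^sup>2) * indicator {0..D} \<tau> \<partial>lborel"
  have "(\<integral>\<^sup>+t. ennreal (1 / (s - t)\<^sup>2) * (seg_part U E D s t)\<^sup>2 * indicator {s\<in>J. \<gamma> s \<in> B} s \<partial>lborel)
     \<le> ennreal (8 * c) * (?\<Phi> (\<gamma> s) * indicator B (\<gamma> s) * indicator J s)" for s
  proof (cases "s \<in> J \<and> \<gamma> s \<in> B")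
    case True
    let ?k = "\<lambda>\<tau>. ennreal \<bar>pd E U (\<gamma> s + \<tau> *\<^sub>R E)\<bar> * indicator {0..D} \<tau>"
    have "(\<integral>\<^sup>+t. ennreal (1 / (s - t)\<^sup>2) * (seg_part U E D s t)\<^sup>2 \<partial>lborel)
      \<le> ennreal (8 * c) * (\<integral>\<^sup>+\<tau>. (?k \<tau>)\<^sup>2 * indicator {0..} \<tau> \<partial>lborel)"
      unfolding seg_part_def by (rule hardy_inequality[OF _ c]) measurable
    also have "(\<integral>\<^sup>+\<tau>. (?k \<tau>)\<^sup>2 * indicator {0..} \<tau> \<partial>lborel) = ?\<Phi> (\<gamma> s)"
      by (rule nn_integral_cong) (auto simp: indicator_def ennreal_power)
    finally show ?thesis using True by simp
  qed auto
  then have "(\<integral>\<^sup>+s. \<integral>\<^sup>+t. ennreal (1 / (s - t)\<^sup>2) * (seg_part U E D s t)\<^sup>2 * indicator {s\<in>J. \<gamma> s \<in> B} s \<partial>lborel \<partial>lborel)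
    \<le> (\<integral>\<^sup>+s. ennreal (8 * c) * (?\<Phi> (\<gamma> s) * indicator B (\<gamma> s) * indicator J s) \<partial>lborel)"
    by (intro nn_integral_mono)
  also have "\<dots> = ennreal (8 * c) * (\<integral>\<^sup>+s. ?\<Phi> (\<gamma> s) * indicator B (\<gamma> s) * indicator J s \<partial>lborel)"
    by (rule nn_integral_cmult) measurable
  also have "(\<integral>\<^sup>+s. ?\<Phi> (\<gamma> s) * indicator B (\<gamma> s) * indicator J s \<partial>lborel)
      \<le> (\<integral>\<^sup>+x. ?\<Phi> x * indicator B x \<partial>boundary_measure \<Omega>)"
  proof (rule pullback)
    have "(\<lambda>x. ?\<Phi> x * indicator B x) \<in> borel_measurable borel" by measurable
    then show "(\<lambda>x. ?\<Phi> x * indicator B x) \<in> borel_measurable (boundary_measure \<Omega>)"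
      unfolding boundary_measure_def
      by (intro measurable_restrict_space1) (simp add: measurable_cong_sets[OF sets_hausdorff1[OF H] refl])
  qed
  also have "\<dots> \<le> ennreal C * (\<integral>\<^sup>+x. ennreal ((pd E U x)\<^sup>2) * indicator \<Omega> x \<partial>lborel)"
  proof -
    have "(\<lambda>x. ennreal ((pd E U x)\<^sup>2)) \<in> borel_measurable borel" by measurable
    moreover have "\<forall>F\<in>borel_measurable borel.
        (\<integral>\<^sup>+x. (\<integral>\<^sup>+\<tau>. F (x + \<tau> *\<^sub>R E) * indicator {0..D} \<tau> \<partial>lborel) * indicator B x \<partial>boundary_measure \<Omega>)
        \<le> ennreal C * (\<integral>\<^sup>+x. F x * indicator \<Omega> x \<partial>lborel)"
      using P E unfolding cone_patch_def by blast
    ultimately show ?thesis by (rule bspec[rotated])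
  qed
  also have "\<dots> \<le> ennreal C * (ennreal (2 * (norm E)\<^sup>2) * dirichlet \<Omega> U)"
    using \<Omega> by (intro mult_left_mono directional_dirichlet[OF U]) auto
  finally show ?thesis by (simp add: mult_left_mono)
qed

text \<open>The difference quotient is bounded by segment integrals based at \<open>s\<close> and at
  \<open>t\<close>. The latter become the former when the variables are exchanged, so
  \<open>patch_seg_part\<close> covers both.\<close>

lemma patch_gagliardo:
  assumes P: "cone_patch \<Omega> B D \<E> C"
  shows "\<exists>K\<ge>0. \<forall>U. smooth U \<longrightarrow>
    (\<integral>\<^sup>+s. \<integral>\<^sup>+t. ennreal ((U (\<gamma> s) - U (\<gamma> t))\<^sup>2 / (s - t)\<^sup>2) * indicator {s\<in>J. \<gamma> s \<in> B} s * indicator {s\<in>J. \<gamma> s \<in> B} t \<partial>lborel \<partial>lborel)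
    \<le> ennreal K * dirichlet \<Omega> U"
proof -
  have fin: "finite \<E>" and C: "0 \<le> C" using P by (auto simp: cone_patch_def)
  have Bm[measurable]: "B \<in> sets borel" using P by (auto simp: cone_patch_def)
  define S where "S = {s\<in>J. \<gamma> s \<in> B}"
  have Sm[measurable]: "S \<in> sets borel" unfolding S_def by measurable
  define n where "n = real (card \<E>)"
  \<comment> \<open>For each direction: \<open>2 * n\<close> for each of the two base points from
    squaring the sum, with \<open>n\<close> the number of directions; \<open>8 * c\<close> from
    Hardy's inequality; \<open>C\<close> from the sweep; \<open>2 * (norm E)\<^sup>2\<close> from
    the directional derivative.\<close>
  define K where "K = (\<Sum>E\<in>\<E>. 4 * n * (8 * c * (C * (2 * (norm E)\<^sup>2))))"
  have K0: "0 \<le> K" unfolding K_def using c C by (intro sum_nonneg) (simp add: n_def)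
  show ?thesis
  proof (intro exI[of _ K] conjI K0 allI impI)
    fix U :: "real^2 \<Rightarrow> real" assume U: "smooth U"
    note [measurable] = seg_part_measurable[OF U] smooth_measurable[OF U]
    let ?A = "\<lambda>E s t. ennreal (1 / (s - t)\<^sup>2) * (seg_part U E D s t)\<^sup>2"
    have meas1: "(\<lambda>(s, t). ?A E s t * indicator S s) \<in> borel_measurable (lborel \<Otimes>\<^sub>M lborel)" for E
      by measurable
    have swap: "(\<lambda>(s, t). seg_part U E D t s) \<in> borel_measurable (lborel \<Otimes>\<^sub>M lborel)" for E
      using measurable_compose[OF measurable_pair_swap'[of lborel lborel] seg_part_measurable[OF U]] by (simp add: case_prod_beta')
    note swap[measurable]
    have pw: "ennreal ((U (\<gamma> s) - U (\<gamma> t))\<^sup>2 / (s - t)\<^sup>2) * indicator S s * indicator S t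
      \<le> (\<Sum>E\<in>\<E>. ennreal (2 * n) * (?A E s t * indicator S s) + ennreal (2 * n) * (?A E t s * indicator S t))" for s t
    proof (cases "s \<in> S \<and> t \<in> S")
      case True
      then have s: "s \<in> J" "\<gamma> s \<in> frontier \<Omega> \<inter> B" and t: "t \<in> J" "\<gamma> t \<in> frontier \<Omega> \<inter> B"
        using \<gamma>_frontier by (auto simp: S_def)
      have PD: "dist (\<gamma> s) (\<gamma> t) \<le> D" and
        Pb: "ennreal \<bar>U (\<gamma> s) - U (\<gamma> t)\<bar> \<le> (\<Sum>E\<in>\<E>. seg_int U E (\<gamma> s) (dist (\<gamma> s) (\<gamma> t)) + seg_int U E (\<gamma> t) (dist (\<gamma> s) (\<gamma> t)))"
        using P U s(2) t(2) unfolding cone_patch_def by blast+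
      have seg: "seg_int U E (\<gamma> a) (dist (\<gamma> s) (\<gamma> t)) \<le> seg_part U E D a b" if "{a, b} = {s, t}" for a b E
      proof -
        have "\<bar>a - b\<bar> = \<bar>s - t\<bar>" using that by (auto simp: doubleton_eq_iff)
        then have "dist (\<gamma> s) (\<gamma> t) \<le> c * \<bar>a - b\<bar>" using bilip(2)[OF s(1) t(1)] by simp
        then show ?thesis
          unfolding seg_int_def seg_part_def using PD by (intro nn_integral_mono) (auto simp: indicator_def)
      qed
      have "ennreal \<bar>U (\<gamma> s) - U (\<gamma> t)\<bar> \<le> (\<Sum>E\<in>\<E>. seg_part U E D s t + seg_part U E D t s)"
        by (rule order_trans[OF Pb]) (intro sum_mono add_mono seg; auto)
      then have "(ennreal \<bar>U (\<gamma> s) - U (\<gamma> t)\<bar>)\<^sup>2 \<le> (\<Sum>E\<in>\<E>. seg_part U E D s t + seg_part U E D t s)\<^sup>2"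
        by (rule power_mono) simp
      also have "\<dots> \<le> of_nat (card \<E>) * (\<Sum>E\<in>\<E>. (seg_part U E D s t + seg_part U E D t s)\<^sup>2)"
        by (rule ennreal_sum_square_le[OF fin])
      also have "\<dots> \<le> of_nat (card \<E>) * (\<Sum>E\<in>\<E>. 2 * ((seg_part U E D s t)\<^sup>2 + (seg_part U E D t s)\<^sup>2))"
      proof (intro mult_left_mono sum_mono)
        fix E
        show "(seg_part U E D s t + seg_part U E D t s)\<^sup>2 \<le> 2 * ((seg_part U E D s t)\<^sup>2 + (seg_part U E D t s)\<^sup>2)"
          using ennreal_sum_square_le[of "{False, True}" "\<lambda>i. if i then seg_part U E D s t else seg_part U E D t s"]
          by (simp add: add.commute)
      qed simp
      finally have sq: "(ennreal \<bar>U (\<gamma> s) - U (\<gamma> t)\<bar>)\<^sup>2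
        \<le> of_nat (card \<E>) * (\<Sum>E\<in>\<E>. 2 * ((seg_part U E D s t)\<^sup>2 + (seg_part U E D t s)\<^sup>2))" .
      have "ennreal ((U (\<gamma> s) - U (\<gamma> t))\<^sup>2 / (s - t)\<^sup>2) = ennreal (1 / (s - t)\<^sup>2) * (ennreal \<bar>U (\<gamma> s) - U (\<gamma> t)\<bar>)\<^sup>2"
        by (simp add: ennreal_power flip: ennreal_mult)
      also have "\<dots> \<le> ennreal (1 / (s - t)\<^sup>2) * (of_nat (card \<E>) * (\<Sum>E\<in>\<E>. 2 * ((seg_part U E D s t)\<^sup>2 + (seg_part U E D t s)\<^sup>2)))"
        by (rule mult_left_mono[OF sq]) simp
      also have "\<dots> = (\<Sum>E\<in>\<E>. ennreal (2 * n) * ?A E s t + ennreal (2 * n) * ?A E t s)"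
      proof -
        have n: "ennreal (2 * n) = 2 * of_nat (card \<E>)"
          by (simp add: n_def ennreal_mult ennreal_of_nat_eq_real_of_nat)
        have "(t - s)\<^sup>2 = (s - t)\<^sup>2" by (rule power2_commute)
        then show ?thesis unfolding n sum_distrib_left by (simp add: distrib_left ac_simps)
      qed
      finally show ?thesis using True by simp
    qed auto
    have "(\<integral>\<^sup>+s. \<integral>\<^sup>+t. ennreal ((U (\<gamma> s) - U (\<gamma> t))\<^sup>2 / (s - t)\<^sup>2) * indicator S s * indicator S t \<partial>lborel \<partial>lborel)
      \<le> (\<integral>\<^sup>+s. \<integral>\<^sup>+t. (\<Sum>E\<in>\<E>. ennreal (2 * n) * (?A E s t * indicator S s) + ennreal (2 * n) * (?A E t s * indicator S t)) \<partial>lborel \<partial>lborel)"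
      by (intro nn_integral_mono pw)
    also have "\<dots> = (\<Sum>E\<in>\<E>. ennreal (2 * n) * (\<integral>\<^sup>+s. \<integral>\<^sup>+t. ?A E s t * indicator S s \<partial>lborel \<partial>lborel)
       + ennreal (2 * n) * (\<integral>\<^sup>+s. \<integral>\<^sup>+t. ?A E t s * indicator S t \<partial>lborel \<partial>lborel))"
    proof -
      have "(\<integral>\<^sup>+t. (\<Sum>E\<in>\<E>. ennreal (2 * n) * (?A E s t * indicator S s) + ennreal (2 * n) * (?A E t s * indicator S t)) \<partial>lborel)
        = (\<Sum>E\<in>\<E>. ennreal (2 * n) * (\<integral>\<^sup>+t. ?A E s t * indicator S s \<partial>lborel) + ennreal (2 * n) * (\<integral>\<^sup>+t. ?A E t s * indicator S t \<partial>lborel))" for s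
        by (subst nn_integral_sum, measurable, intro sum.cong refl, subst nn_integral_add, measurable, subst (1 2) nn_integral_cmult, measurable)
      then show ?thesis
        by (simp only:) (subst nn_integral_sum, measurable, intro sum.cong refl, subst nn_integral_add, measurable, subst (1 2) nn_integral_cmult, measurable)
    qed
    also have "\<dots> = (\<Sum>E\<in>\<E>. ennreal (2 * n) * (\<integral>\<^sup>+s. \<integral>\<^sup>+t. ?A E s t * indicator S s \<partial>lborel \<partial>lborel)
       + ennreal (2 * n) * (\<integral>\<^sup>+s. \<integral>\<^sup>+t. ?A E s t * indicator S s \<partial>lborel \<partial>lborel))"
    proof -
      have "(\<integral>\<^sup>+s. \<integral>\<^sup>+t. ?A E t s * indicator S t \<partial>lborel \<partial>lborel) = (\<integral>\<^sup>+s. \<integral>\<^sup>+t. ?A E s t * indicator S s \<partial>lborel \<partial>lborel)" for E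
        by (rule lborel_pair.Fubini'[OF meas1])
      then show ?thesis by simp
    qed
    also have "\<dots> \<le> (\<Sum>E\<in>\<E>. ennreal (2 * n) * (ennreal (8 * c) * (ennreal C * (ennreal (2 * (norm E)\<^sup>2) * dirichlet \<Omega> U)))
       + ennreal (2 * n) * (ennreal (8 * c) * (ennreal C * (ennreal (2 * (norm E)\<^sup>2) * dirichlet \<Omega> U))))"
      by (intro sum_mono add_mono mult_left_mono patch_seg_part[OF U P, folded S_def]) auto
    also have "\<dots> = (\<Sum>E\<in>\<E>. ennreal (4 * n * (8 * c * (C * (2 * (norm E)\<^sup>2)))) * dirichlet \<Omega> U)"
    proof (rule sum.cong[OF refl])
      fix E
      let ?q = "8 * c * (C * (2 * (norm E)\<^sup>2))"
      have q: "ennreal (8 * c) * (ennreal C * ennreal (2 * (norm E)\<^sup>2)) = ennreal ?q"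
        using c C by (simp only: ennreal_mult[symmetric] mult_nonneg_nonneg zero_le_numeral zero_le_power2 less_imp_le)
      have "ennreal (2 * n) * ennreal ?q + ennreal (2 * n) * ennreal ?q = ennreal (2 * n * ?q + 2 * n * ?q)"
        using c C by (simp add: n_def flip: ennreal_mult ennreal_plus)
      also have "2 * n * ?q + 2 * n * ?q = 4 * n * ?q" by simp
      finally have qq: "ennreal (2 * n) * ennreal ?q + ennreal (2 * n) * ennreal ?q = ennreal (4 * n * ?q)" .
      show "ennreal (2 * n) * (ennreal (8 * c) * (ennreal C * (ennreal (2 * (norm E)\<^sup>2) * dirichlet \<Omega> U)))
       + ennreal (2 * n) * (ennreal (8 * c) * (ennreal C * (ennreal (2 * (norm E)\<^sup>2) * dirichlet \<Omega> U)))
       = ennreal (4 * n * ?q) * dirichlet \<Omega> U"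
        unfolding qq[symmetric] q[symmetric] by (simp only: distrib_right mult.assoc)
    qed
    also have "\<dots> = ennreal K * dirichlet \<Omega> U"
      unfolding K_def sum_distrib_right[symmetric] using c C
      by (subst sum_ennreal) (auto simp: n_def)
    finally show "(\<integral>\<^sup>+s. \<integral>\<^sup>+t. ennreal ((U (\<gamma> s) - U (\<gamma> t))\<^sup>2 / (s - t)\<^sup>2) * indicator {s\<in>J. \<gamma> s \<in> B} s * indicator {s\<in>J. \<gamma> s \<in> B} t \<partial>lborel \<partial>lborel)
      \<le> ennreal K * dirichlet \<Omega> U"
      unfolding S_def .
  qed
qed

end

section \<open>Rules for the Gagliardo seminorm\<close>

definition gagliardo :: "real set \<Rightarrow> (real \<Rightarrow> real) \<Rightarrow> ennreal" where
  "gagliardo J q = (\<integral>\<^sup>+s. \<integral>\<^sup>+t. ennreal ((q s - q t)\<^sup>2 / (s - t)\<^sup>2) * indicator J s * indicator J t \<partial>lborel \<partial>lborel)"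

lemma gagliardo_add:
  assumes [measurable]: "J \<in> sets borel" "p \<in> borel_measurable borel" "q \<in> borel_measurable borel"
    and "gagliardo J p < \<infinity>" "gagliardo J q < \<infinity>"
  shows "gagliardo J (\<lambda>s. p s + q s) < \<infinity>"
proof -
  let ?g = "\<lambda>q s t. ennreal ((q s - q t)\<^sup>2 / (s - t)\<^sup>2) * indicator J s * indicator J t"
  have pw: "?g (\<lambda>s. p s + q s) s t \<le> 2 * ?g p s t + 2 * ?g q s t" for s t
  proof -
    have "(p s + q s - (p t + q t))\<^sup>2 \<le> 2 * (p s - p t)\<^sup>2 + 2 * (q s - q t)\<^sup>2"
      using zero_le_power2[of "(p s - p t) - (q s - q t)"] by (simp add: power2_eq_square algebra_simps)
    then have "(p s + q s - (p t + q t))\<^sup>2 / (s - t)\<^sup>2 \<le> (2 * (p s - p t)\<^sup>2 + 2 * (q s - q t)\<^sup>2) / (s - t)\<^sup>2"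
      by (rule divide_right_mono) simp
    also have "\<dots> = 2 * ((p s - p t)\<^sup>2 / (s - t)\<^sup>2) + 2 * ((q s - q t)\<^sup>2 / (s - t)\<^sup>2)" by (simp add: add_divide_distrib)
    finally have "ennreal ((p s + q s - (p t + q t))\<^sup>2 / (s - t)\<^sup>2)
      \<le> ennreal (2 * ((p s - p t)\<^sup>2 / (s - t)\<^sup>2) + 2 * ((q s - q t)\<^sup>2 / (s - t)\<^sup>2))" by (rule ennreal_leI)
    also have "\<dots> = 2 * ennreal ((p s - p t)\<^sup>2 / (s - t)\<^sup>2) + 2 * ennreal ((q s - q t)\<^sup>2 / (s - t)\<^sup>2)"
    proof -
      have e: "ennreal (2 * a + 2 * b) = 2 * ennreal a + 2 * ennreal b" if "0 \<le> a" "0 \<le> b" for a b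
        using that by (simp add: ennreal_mult)
      show ?thesis by (rule e) simp_all
    qed
    finally show ?thesis by (auto simp: indicator_def)
  qed
  have "gagliardo J (\<lambda>s. p s + q s) \<le> (\<integral>\<^sup>+s. \<integral>\<^sup>+t. 2 * ?g p s t + 2 * ?g q s t \<partial>lborel \<partial>lborel)"
    unfolding gagliardo_def by (intro nn_integral_mono pw)
  also have "\<dots> = 2 * gagliardo J p + 2 * gagliardo J q"
  proof -
    have "(\<integral>\<^sup>+t. 2 * ?g p s t + 2 * ?g q s t \<partial>lborel) = 2 * (\<integral>\<^sup>+t. ?g p s t \<partial>lborel) + 2 * (\<integral>\<^sup>+t. ?g q s t \<partial>lborel)" for s
      by (subst nn_integral_add, measurable, subst (1 2) nn_integral_cmult, measurable)
    then show ?thesis unfolding gagliardo_def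
      by (simp only:) (subst nn_integral_add, measurable, subst (1 2) nn_integral_cmult, measurable)
  qed
  also have "\<dots> < \<infinity>" using assms(4,5) by (simp add: ennreal_mult_less_top)
  finally show ?thesis .
qed

lemma gagliardo_sum:
  assumes "finite B" "J \<in> sets borel" "\<And>b. b \<in> B \<Longrightarrow> q b \<in> borel_measurable borel" "\<And>b. b \<in> B \<Longrightarrow> gagliardo J (q b) < \<infinity>"
  shows "gagliardo J (\<lambda>s. \<Sum>b\<in>B. q b s) < \<infinity>"
  using assms
proof (induction B)
  case empty then show ?case by (simp add: gagliardo_def)
next
  case (insert b B)
  have "gagliardo J (\<lambda>s. q b s + (\<Sum>b\<in>B. q b s)) < \<infinity>"
    by (rule gagliardo_add) (use insert in \<open>auto intro!: borel_measurable_sum\<close>)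
  then show ?case using insert.hyps by simp
qed

text \<open>The increment of the product is \<open>p s * (q s - q t) + (p s - p t) * q t\<close>. In
  the second term the Lipschitz bound cancels the singular denominator, and an
  \<open>L\<^sup>2\<close> norm over the set \<open>J\<close> of finite length remains.\<close>

lemma gagliardo_mult_lipschitz:
  assumes [measurable]: "J \<in> sets borel" "p \<in> borel_measurable borel" "q \<in> borel_measurable borel"
    and J: "emeasure lborel J < \<infinity>"
    and p: "\<And>s. s \<in> J \<Longrightarrow> \<bar>p s\<bar> \<le> P" "\<And>s t. s \<in> J \<Longrightarrow> t \<in> J \<Longrightarrow> \<bar>p s - p t\<bar> \<le> L * \<bar>s - t\<bar>"
    and q: "(\<integral>\<^sup>+s. ennreal ((q s)\<^sup>2) * indicator J s \<partial>lborel) < \<infinity>" "gagliardo J q < \<infinity>"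
  shows "gagliardo J (\<lambda>s. p s * q s) < \<infinity>"
proof -
  let ?g = "\<lambda>s t. ennreal ((q s - q t)\<^sup>2 / (s - t)\<^sup>2) * indicator J s * indicator J t"
  let ?h = "\<lambda>s t. ennreal ((q t)\<^sup>2) * indicator J t * indicator J s"
  have pw: "ennreal ((p s * q s - p t * q t)\<^sup>2 / (s - t)\<^sup>2) * indicator J s * indicator J t
     \<le> ennreal (2 * P\<^sup>2) * ?g s t + ennreal (2 * L\<^sup>2) * ?h s t" for s t
  proof (cases "s \<in> J \<and> t \<in> J \<and> s \<noteq> t")
    case True
    then have st: "s \<in> J" "t \<in> J" "0 < (s - t)\<^sup>2" by auto
    have "(p s * q s - p t * q t)\<^sup>2 = (p s * (q s - q t) + (p s - p t) * q t)\<^sup>2" by (simp add: algebra_simps)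
    also have "\<dots> \<le> 2 * (p s * (q s - q t))\<^sup>2 + 2 * ((p s - p t) * q t)\<^sup>2"
      using zero_le_power2[of "p s * (q s - q t) - (p s - p t) * q t"] unfolding power2_sum power2_diff by linarith
    also have "(p s * (q s - q t))\<^sup>2 \<le> P\<^sup>2 * (q s - q t)\<^sup>2"
      unfolding power_mult_distrib using p(1)[OF st(1)] by (intro mult_right_mono) (auto simp: abs_le_square_iff[symmetric])
    also have "((p s - p t) * q t)\<^sup>2 \<le> (L\<^sup>2 * (s - t)\<^sup>2) * (q t)\<^sup>2"
    proof -
      have "\<bar>p s - p t\<bar>\<^sup>2 \<le> (L * \<bar>s - t\<bar>)\<^sup>2" by (rule power_mono[OF p(2)[OF st(1,2)]]) simp
      then have "(p s - p t)\<^sup>2 \<le> L\<^sup>2 * (s - t)\<^sup>2" by (simp add: power_mult_distrib)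
      then show ?thesis unfolding power_mult_distrib by (intro mult_right_mono) auto
    qed
    finally have "(p s * q s - p t * q t)\<^sup>2 \<le> 2 * (P\<^sup>2 * (q s - q t)\<^sup>2) + 2 * (L\<^sup>2 * (s - t)\<^sup>2 * (q t)\<^sup>2)" by simp
    then have "(p s * q s - p t * q t)\<^sup>2 / (s - t)\<^sup>2
       \<le> (2 * (P\<^sup>2 * (q s - q t)\<^sup>2) + 2 * (L\<^sup>2 * (s - t)\<^sup>2 * (q t)\<^sup>2)) / (s - t)\<^sup>2"
      by (rule divide_right_mono) simp
    also have "\<dots> = 2 * P\<^sup>2 * ((q s - q t)\<^sup>2 / (s - t)\<^sup>2) + 2 * L\<^sup>2 * (q t)\<^sup>2"
      using st(3) by (simp add: add_divide_distrib)
    finally have "ennreal ((p s * q s - p t * q t)\<^sup>2 / (s - t)\<^sup>2)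
      \<le> ennreal (2 * P\<^sup>2 * ((q s - q t)\<^sup>2 / (s - t)\<^sup>2) + 2 * L\<^sup>2 * (q t)\<^sup>2)" by (rule ennreal_leI)
    also have "\<dots> = ennreal (2 * P\<^sup>2) * ennreal ((q s - q t)\<^sup>2 / (s - t)\<^sup>2) + ennreal (2 * L\<^sup>2) * ennreal ((q t)\<^sup>2)"
      by (subst ennreal_plus) (auto simp flip: ennreal_mult)
    finally show ?thesis using st by simp
  qed (auto simp: indicator_def)
  have "gagliardo J (\<lambda>s. p s * q s) \<le> (\<integral>\<^sup>+s. \<integral>\<^sup>+t. ennreal (2 * P\<^sup>2) * ?g s t + ennreal (2 * L\<^sup>2) * ?h s t \<partial>lborel \<partial>lborel)"
    unfolding gagliardo_def by (intro nn_integral_mono pw)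
  also have "\<dots> = ennreal (2 * P\<^sup>2) * gagliardo J q + ennreal (2 * L\<^sup>2) * (\<integral>\<^sup>+s. \<integral>\<^sup>+t. ?h s t \<partial>lborel \<partial>lborel)"
  proof -
    have "(\<integral>\<^sup>+t. ennreal (2 * P\<^sup>2) * ?g s t + ennreal (2 * L\<^sup>2) * ?h s t \<partial>lborel)
      = ennreal (2 * P\<^sup>2) * (\<integral>\<^sup>+t. ?g s t \<partial>lborel) + ennreal (2 * L\<^sup>2) * (\<integral>\<^sup>+t. ?h s t \<partial>lborel)" for s
      by (subst nn_integral_add, measurable, subst (1 2) nn_integral_cmult, measurable)
    then show ?thesis unfolding gagliardo_def
      by (simp only:) (subst nn_integral_add, measurable, subst (1 2) nn_integral_cmult, measurable)
  qed
  also have "(\<integral>\<^sup>+s. \<integral>\<^sup>+t. ?h s t \<partial>lborel \<partial>lborel) = (\<integral>\<^sup>+t. ennreal ((q t)\<^sup>2) * indicator J t \<partial>lborel) * emeasure lborel J"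
    by (simp add: nn_integral_multc nn_integral_cmult)
  also have "ennreal (2 * P\<^sup>2) * gagliardo J q + ennreal (2 * L\<^sup>2) * \<dots> < \<infinity>"
    using q J by (simp add: ennreal_mult_less_top)
  finally show ?thesis .
qed

text \<open>A uniform bound is all that is needed for the passage to the limit, and only for large
  indices: beyond \<open>N\<close> each derivative is within 1 of its limit in squared
  \<open>L\<^sup>2\<close> distance.\<close>

lemma dirichlet_bounded:
  fixes \<Omega> :: "(real^2) set"
  assumes U: "\<And>n. smooth (U n)" and conv: "Hconv \<Omega> 1 U u"
  obtains M N where "\<And>n. n \<ge> N \<Longrightarrow> dirichlet \<Omega> (U n) \<le> ennreal M"
proof -
  have "\<exists>M N. \<forall>n\<ge>N. (\<integral>\<^sup>+x. ennreal ((pd b (U n) x)\<^sup>2) \<partial>lebesgue_on \<Omega>) \<le> ennreal M" if b: "b \<in> Basis" for b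
  proof -
    obtain g where g: "has_weak_partial \<Omega> b u g"
      "(\<lambda>n. \<integral>\<^sup>+x. ennreal ((pd b (U n) x - g x)\<^sup>2) \<partial>lebesgue_on \<Omega>) \<longlonglongrightarrow> 0"
      using conv b by auto
    have gs: "g \<in> borel_measurable (lebesgue_on \<Omega>)" "(\<integral>\<^sup>+x. ennreal ((g x)\<^sup>2) \<partial>lebesgue_on \<Omega>) < \<infinity>"
      using g(1) by (auto simp: has_weak_partial_pd square_integrable_iff)
    then obtain A where A: "(\<integral>\<^sup>+x. ennreal ((g x)\<^sup>2) \<partial>lebesgue_on \<Omega>) = ennreal A" "0 \<le> A"
      by (cases "\<integral>\<^sup>+x. ennreal ((g x)\<^sup>2) \<partial>lebesgue_on \<Omega>") auto
    obtain N where N: "\<And>n. n \<ge> N \<Longrightarrow> (\<integral>\<^sup>+x. ennreal ((pd b (U n) x - g x)\<^sup>2) \<partial>lebesgue_on \<Omega>) < ennreal 1"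
      using ennreal_tendsto_0D[OF g(2), of 1] by (auto simp: eventually_sequentially)
    have "(\<integral>\<^sup>+x. ennreal ((pd b (U n) x)\<^sup>2) \<partial>lebesgue_on \<Omega>) \<le> ennreal (2 * 1 + 2 * A)" if "n \<ge> N" for n
    proof -
      have "(\<integral>\<^sup>+x. ennreal (((pd b (U n) x - g x) + g x)\<^sup>2) \<partial>lebesgue_on \<Omega>)
        \<le> 2 * (\<integral>\<^sup>+x. ennreal ((pd b (U n) x - g x)\<^sup>2) \<partial>lebesgue_on \<Omega>) + 2 * (\<integral>\<^sup>+x. ennreal ((g x)\<^sup>2) \<partial>lebesgue_on \<Omega>)"
        by (rule nn_integral_square_add_le) (intro borel_measurable_diff borel_lebesgue_on pd_borel U gs)+
      also have "\<dots> \<le> 2 * ennreal 1 + 2 * ennreal A"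
        using N[OF that] A by (intro add_mono mult_left_mono) auto
      also have "\<dots> = ennreal (2 * 1 + 2 * A)" using A(2) by (simp add: ennreal_mult)
      finally show ?thesis by simp
    qed
    then show ?thesis by blast
  qed
  then have ex: "\<forall>b\<in>Basis. \<exists>p. \<forall>n\<ge>snd p. (\<integral>\<^sup>+x. ennreal ((pd b (U n) x)\<^sup>2) \<partial>lebesgue_on \<Omega>) \<le> ennreal (fst p)"
    by fastforce
  from bchoice[OF ex] obtain p where p: "\<forall>b\<in>(Basis :: (real^2) set). \<forall>n\<ge>snd (p b). (\<integral>\<^sup>+x. ennreal ((pd b (U n) x)\<^sup>2) \<partial>lebesgue_on \<Omega>) \<le> ennreal (fst (p b))" ..
  show ?thesis
  proof (rule that[of "\<Sum>b\<in>Basis. snd (p b)" "\<Sum>b\<in>Basis. \<bar>fst (p b)\<bar>"])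
    fix n assume n: "n \<ge> (\<Sum>b\<in>Basis. snd (p b))"
    have "snd (p b) \<le> n" if "b \<in> Basis" for b
      using n member_le_sum[OF that, of "\<lambda>b. snd (p b)"] by simp
    then have "dirichlet \<Omega> (U n) \<le> (\<Sum>b\<in>(Basis :: (real^2) set). ennreal (fst (p b)))"
      unfolding dirichlet_def using p by (intro sum_mono) auto
    also have "\<dots> \<le> (\<Sum>b\<in>(Basis :: (real^2) set). ennreal \<bar>fst (p b)\<bar>)" by (intro sum_mono ennreal_leI) auto
    also have "\<dots> = ennreal (\<Sum>b\<in>(Basis :: (real^2) set). \<bar>fst (p b)\<bar>)" by (rule sum_ennreal) auto
    finally show "dirichlet \<Omega> (U n) \<le> ennreal (\<Sum>b\<in>(Basis :: (real^2) set). \<bar>fst (p b)\<bar>)" .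
  qed
qed

context boundary_curve
begin

text \<open>Parameters closer than the Lebesgue number divided by \<open>c\<close> have images in a
  common patch, so the integrand is dominated by the sum over the finitely many patches.\<close>

lemma near_gagliardo:
  "\<exists>\<eta>>0. \<exists>K\<ge>0. \<forall>U. smooth U \<longrightarrow>
    (\<integral>\<^sup>+s. \<integral>\<^sup>+t. ennreal ((U (\<gamma> s) - U (\<gamma> t))\<^sup>2 / (s - t)\<^sup>2) * indicator J s * indicator J t * indicator {..<\<eta>} \<bar>s - t\<bar> \<partial>lborel \<partial>lborel)
    \<le> ennreal K * dirichlet \<Omega> U"
proof -
  obtain \<P> \<eta> where \<P>: "finite \<P>" "0 < \<eta>" "\<And>B. B \<in> \<P> \<Longrightarrow> \<exists>D \<E> C. cone_patch \<Omega> B D \<E> C"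
    "\<And>x y. x \<in> frontier \<Omega> \<Longrightarrow> y \<in> frontier \<Omega> \<Longrightarrow> dist x y < \<eta> \<Longrightarrow> \<exists>B\<in>\<P>. x \<in> B \<and> y \<in> B"
    using cone_cover[OF H \<Omega>] by metis
  let ?T = "\<lambda>U B s t. ennreal ((U (\<gamma> s) - U (\<gamma> t))\<^sup>2 / (s - t)\<^sup>2) * indicator {s\<in>J. \<gamma> s \<in> B} s * indicator {s\<in>J. \<gamma> s \<in> B} t"
  have ex: "\<forall>B\<in>\<P>. \<exists>K. 0 \<le> K \<and> (\<forall>U. smooth U \<longrightarrow> (\<integral>\<^sup>+s. \<integral>\<^sup>+t. ?T U B s t \<partial>lborel \<partial>lborel) \<le> ennreal K * dirichlet \<Omega> U)"
  proof
    fix B assume "B \<in> \<P>"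
    then obtain D \<E> C where "cone_patch \<Omega> B D \<E> C" using \<P>(3) by blast
    from patch_gagliardo[OF this] show "\<exists>K. 0 \<le> K \<and> (\<forall>U. smooth U \<longrightarrow> (\<integral>\<^sup>+s. \<integral>\<^sup>+t. ?T U B s t \<partial>lborel \<partial>lborel) \<le> ennreal K * dirichlet \<Omega> U)" .
  qed
  from bchoice[OF ex] obtain K where K: "\<forall>B\<in>\<P>. 0 \<le> K B \<and> (\<forall>U. smooth U \<longrightarrow> (\<integral>\<^sup>+s. \<integral>\<^sup>+t. ?T U B s t \<partial>lborel \<partial>lborel) \<le> ennreal (K B) * dirichlet \<Omega> U)" ..
  have 1: "0 < \<eta> / c" using \<P>(2) c by simp
  have 2: "0 \<le> sum K \<P>" using K by (intro sum_nonneg) auto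
  have 3: "(\<integral>\<^sup>+s. \<integral>\<^sup>+t. ennreal ((U (\<gamma> s) - U (\<gamma> t))\<^sup>2 / (s - t)\<^sup>2) * indicator J s * indicator J t * indicator {..<\<eta> / c} \<bar>s - t\<bar> \<partial>lborel \<partial>lborel)
      \<le> ennreal (sum K \<P>) * dirichlet \<Omega> U" if U: "smooth U" for U
  proof -
    note [measurable] = smooth_measurable[OF U]
    have pw: "ennreal ((U (\<gamma> s) - U (\<gamma> t))\<^sup>2 / (s - t)\<^sup>2) * indicator J s * indicator J t * indicator {..<\<eta> / c} \<bar>s - t\<bar>
      \<le> (\<Sum>B\<in>\<P>. ?T U B s t)" for s t
    proof (cases "s \<in> J \<and> t \<in> J \<and> \<bar>s - t\<bar> < \<eta> / c")
      case True
      then have "dist (\<gamma> s) (\<gamma> t) < \<eta>"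
        using bilip(2)[of s t] c by (simp add: pos_less_divide_eq mult.commute)
      then obtain B where B: "B \<in> \<P>" "\<gamma> s \<in> B" "\<gamma> t \<in> B" using \<P>(4) \<gamma>_frontier True by blast
      have "?T U B s t \<le> (\<Sum>B\<in>\<P>. ?T U B s t)" by (rule member_le_sum) (use B \<P>(1) in auto)
      then show ?thesis using True B by simp
    qed auto
    have Bm: "B \<in> sets borel" if "B \<in> \<P>" for B using \<P>(3)[OF that] by (auto simp: cone_patch_def)
    have Tm: "(\<lambda>(s, t). ?T U B s t) \<in> borel_measurable (lborel \<Otimes>\<^sub>M lborel)" if "B \<in> \<P>" for B
    proof -
      note Bm[OF that, measurable]
      show ?thesis by measurable
    qed
    have Tm2: "(\<lambda>t. ?T U B s t) \<in> borel_measurable lborel" if "B \<in> \<P>" for B s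
    proof -
      note Bm[OF that, measurable]
      show ?thesis by measurable
    qed
    have "(\<integral>\<^sup>+s. \<integral>\<^sup>+t. ennreal ((U (\<gamma> s) - U (\<gamma> t))\<^sup>2 / (s - t)\<^sup>2) * indicator J s * indicator J t * indicator {..<\<eta> / c} \<bar>s - t\<bar> \<partial>lborel \<partial>lborel)
      \<le> (\<integral>\<^sup>+s. \<integral>\<^sup>+t. (\<Sum>B\<in>\<P>. ?T U B s t) \<partial>lborel \<partial>lborel)"
      by (intro nn_integral_mono pw)
    also have "\<dots> = (\<integral>\<^sup>+s. (\<Sum>B\<in>\<P>. \<integral>\<^sup>+t. ?T U B s t \<partial>lborel) \<partial>lborel)"
      by (intro nn_integral_cong nn_integral_sum Tm2)
    also have "\<dots> = (\<Sum>B\<in>\<P>. \<integral>\<^sup>+s. \<integral>\<^sup>+t. ?T U B s t \<partial>lborel \<partial>lborel)"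
      by (rule nn_integral_sum) (rule lborel.borel_measurable_nn_integral[OF Tm])
    also have "\<dots> \<le> (\<Sum>B\<in>\<P>. ennreal (K B) * dirichlet \<Omega> U)" using K U by (intro sum_mono) auto
    also have "\<dots> = ennreal (sum K \<P>) * dirichlet \<Omega> U"
      unfolding sum_distrib_right[symmetric] using K by (subst sum_ennreal) auto
    finally show ?thesis .
  qed
  show ?thesis using 1 2 3 by blast
qed

text \<open>Near the diagonal the bound for \<open>U n\<close> passes to the trace by Fatou's lemma,
  used once in each variable, along a subsequence that converges almost everywhere on the
  curve.\<close>

lemma trace_gagliardo_finite:
  assumes U: "\<And>n. smooth (U n)" and conv: "Hconv \<Omega> 1 U u"
    and G: "square_integrable (boundary_measure \<Omega>) G"
    and lim: "(\<lambda>n. \<integral>\<^sup>+x. ennreal ((U n x - G x)\<^sup>2) \<partial>boundary_measure \<Omega>) \<longlonglongrightarrow> 0"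
  defines "q \<equiv> \<lambda>s. if s \<in> J then G (\<gamma> s) else 0"
  shows "q \<in> borel_measurable borel" "(\<integral>\<^sup>+s. ennreal ((q s)\<^sup>2) * indicator J s \<partial>lborel) < \<infinity>" "gagliardo J q < \<infinity>"
proof -
  let ?M = "boundary_measure \<Omega>"
  have Gm: "G \<in> borel_measurable ?M" using G by (rule square_integrable_D)
  show qm[measurable]: "q \<in> borel_measurable borel" unfolding q_def by (rule borel_pullback[OF Gm])
  have "(\<integral>\<^sup>+s. ennreal ((q s)\<^sup>2) * indicator J s \<partial>lborel) = (\<integral>\<^sup>+s. ennreal ((G (\<gamma> s))\<^sup>2) * indicator J s \<partial>lborel)"
    by (rule nn_integral_cong) (auto simp: q_def indicator_def)
  also have "\<dots> \<le> (\<integral>\<^sup>+x. ennreal ((G x)\<^sup>2) \<partial>?M)" by (rule pullback) (use Gm in measurable)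
  also have "\<dots> < \<infinity>" using G by (simp add: square_integrable_iff)
  finally show q2: "(\<integral>\<^sup>+s. ennreal ((q s)\<^sup>2) * indicator J s \<partial>lborel) < \<infinity>" .
  obtain \<eta> K where \<eta>: "0 < \<eta>" and K: "0 \<le> K" "\<And>U. smooth U \<Longrightarrow>
    (\<integral>\<^sup>+s. \<integral>\<^sup>+t. ennreal ((U (\<gamma> s) - U (\<gamma> t))\<^sup>2 / (s - t)\<^sup>2) * indicator J s * indicator J t * indicator {..<\<eta>} \<bar>s - t\<bar> \<partial>lborel \<partial>lborel)
    \<le> ennreal K * dirichlet \<Omega> U"
    using near_gagliardo by blast
  obtain M N where M: "\<And>n. n \<ge> N \<Longrightarrow> dirichlet \<Omega> (U n) \<le> ennreal M"
    using dirichlet_bounded[OF U conv] by metis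
  have dm: "(\<lambda>x. U n x - G x) \<in> borel_measurable ?M" for n
    using boundary_measure_space(2)[OF H smooth_measurable[OF U]] Gm by auto
  from L2_AE_subseq[OF dm lim] obtain r :: "nat \<Rightarrow> nat"
    where r: "strict_mono r" "AE x in ?M. (\<lambda>n. U (r n) x - G x) \<longlonglongrightarrow> 0" by blast
  have ae: "AE s in lborel. s \<in> J \<longrightarrow> (\<lambda>n. U (r n) (\<gamma> s)) \<longlonglongrightarrow> q s"
    using pullback_AE[OF r(2)] by eventually_elim (auto simp: q_def LIM_zero_iff)
  note [measurable] = smooth_measurable[OF U]
  let ?I = "\<lambda>s t. indicator J s * indicator J t * indicator {..<\<eta>} \<bar>s - t\<bar> :: ennreal"
  let ?T = "\<lambda>n s t. ennreal ((U (r n) (\<gamma> s) - U (r n) (\<gamma> t))\<^sup>2 / (s - t)\<^sup>2) * ?I s t"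
  let ?Tq = "\<lambda>s t. ennreal ((q s - q t)\<^sup>2 / (s - t)\<^sup>2) * ?I s t"
  have "(\<integral>\<^sup>+s. \<integral>\<^sup>+t. ?Tq s t \<partial>lborel \<partial>lborel) \<le> (\<integral>\<^sup>+s. liminf (\<lambda>n. \<integral>\<^sup>+t. ?T n s t \<partial>lborel) \<partial>lborel)"
  proof (rule nn_integral_mono_AE)
    show "AE s in lborel. (\<integral>\<^sup>+t. ?Tq s t \<partial>lborel) \<le> liminf (\<lambda>n. \<integral>\<^sup>+t. ?T n s t \<partial>lborel)"
      using ae
    proof eventually_elim
      case (elim s)
      have "(\<integral>\<^sup>+t. ?Tq s t \<partial>lborel) = (\<integral>\<^sup>+t. liminf (\<lambda>n. ?T n s t) \<partial>lborel)"
      proof (rule nn_integral_cong_AE)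
        show "AE t in lborel. ?Tq s t = liminf (\<lambda>n. ?T n s t)"
          using ae
        proof eventually_elim
          case (elim t)
          have "(\<lambda>n. ?T n s t) \<longlonglongrightarrow> ?Tq s t"
          proof (cases "s \<in> J \<and> t \<in> J \<and> \<bar>s - t\<bar> < \<eta>")
            case True
            have "(\<lambda>n. (U (r n) (\<gamma> s) - U (r n) (\<gamma> t))\<^sup>2 * inverse ((s - t)\<^sup>2)) \<longlonglongrightarrow> (q s - q t)\<^sup>2 * inverse ((s - t)\<^sup>2)"
              using True elim \<open>s \<in> J \<longrightarrow> (\<lambda>n. U (r n) (\<gamma> s)) \<longlonglongrightarrow> q s\<close> by (intro tendsto_intros) auto
            then have "(\<lambda>n. ennreal ((U (r n) (\<gamma> s) - U (r n) (\<gamma> t))\<^sup>2 / (s - t)\<^sup>2)) \<longlonglongrightarrow> ennreal ((q s - q t)\<^sup>2 / (s - t)\<^sup>2)"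
              by (intro tendsto_ennrealI) (simp add: divide_inverse)
            then show ?thesis using True by simp
          qed (auto simp: indicator_def)
          then show ?case by (rule lim_imp_Liminf[OF sequentially_bot, symmetric])
        qed
      qed
      also have "\<dots> \<le> liminf (\<lambda>n. \<integral>\<^sup>+t. ?T n s t \<partial>lborel)"
        by (rule nn_integral_liminf) measurable
      finally show ?case .
    qed
  qed
  also have "\<dots> \<le> liminf (\<lambda>n. \<integral>\<^sup>+s. \<integral>\<^sup>+t. ?T n s t \<partial>lborel \<partial>lborel)"
    by (rule nn_integral_liminf) measurable
  also have "\<dots> \<le> ennreal K * ennreal M"
  proof (rule Liminf_le)
    have "(\<integral>\<^sup>+s. \<integral>\<^sup>+t. ?T n s t \<partial>lborel \<partial>lborel) \<le> ennreal K * ennreal M" if n: "n \<ge> N" for n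
    proof -
      have "r n \<ge> N" using n seq_suble[OF r(1), of n] by simp
      then have "ennreal K * dirichlet \<Omega> (U (r n)) \<le> ennreal K * ennreal M" by (intro mult_left_mono M) auto
      moreover have "(\<integral>\<^sup>+s. \<integral>\<^sup>+t. ?T n s t \<partial>lborel \<partial>lborel) \<le> ennreal K * dirichlet \<Omega> (U (r n))"
        using K(2)[OF U, of "r n"] by (simp add: mult.assoc)
      ultimately show ?thesis by (rule order_trans[rotated])
    qed
    then show "eventually (\<lambda>n. (\<integral>\<^sup>+s. \<integral>\<^sup>+t. ?T n s t \<partial>lborel \<partial>lborel) \<le> ennreal K * ennreal M) sequentially"
      unfolding eventually_sequentially by blast
  qed simp
  finally have near: "(\<integral>\<^sup>+s. \<integral>\<^sup>+t. ?Tq s t \<partial>lborel \<partial>lborel) < \<infinity>"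
    by (rule le_less_trans) (simp add: ennreal_mult_less_top)
  let ?Q = "\<lambda>s. ennreal ((q s)\<^sup>2) * indicator J s"
  \<comment> \<open>Away from the diagonal the denominator is at least
    \<open>\<eta>\<^sup>2\<close>, and the integrand is controlled by the squares of
    \<open>q\<close> alone.\<close>
  have pw: "ennreal ((q s - q t)\<^sup>2 / (s - t)\<^sup>2) * indicator J s * indicator J t
    \<le> ?Tq s t + ennreal (2 / \<eta>\<^sup>2) * (?Q s * indicator J t + ?Q t * indicator J s)" for s t
  proof (cases "s \<in> J \<and> t \<in> J \<and> \<not> \<bar>s - t\<bar> < \<eta>")
    case True
    have "\<eta>\<^sup>2 \<le> (s - t)\<^sup>2" using True \<eta> by (simp add: abs_le_square_iff[symmetric])
    then have "(q s - q t)\<^sup>2 / (s - t)\<^sup>2 \<le> (q s - q t)\<^sup>2 / \<eta>\<^sup>2"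
      using \<eta> True by (intro divide_left_mono mult_pos_pos) auto
    also have "(q s - q t)\<^sup>2 \<le> 2 * (q s)\<^sup>2 + 2 * (q t)\<^sup>2"
      using zero_le_power2[of "q s + q t"] unfolding power2_sum power2_diff by linarith
    also have "(2 * (q s)\<^sup>2 + 2 * (q t)\<^sup>2) / \<eta>\<^sup>2 = 2 / \<eta>\<^sup>2 * ((q s)\<^sup>2 + (q t)\<^sup>2)" by (simp add: field_simps)
    finally have "(q s - q t)\<^sup>2 / (s - t)\<^sup>2 \<le> 2 / \<eta>\<^sup>2 * ((q s)\<^sup>2 + (q t)\<^sup>2)"
      using \<eta> by (simp add: divide_right_mono)
    then have "ennreal ((q s - q t)\<^sup>2 / (s - t)\<^sup>2) \<le> ennreal (2 / \<eta>\<^sup>2 * ((q s)\<^sup>2 + (q t)\<^sup>2))" by (rule ennreal_leI)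
    also have "\<dots> = ennreal (2 / \<eta>\<^sup>2) * (ennreal ((q s)\<^sup>2) + ennreal ((q t)\<^sup>2))"
      by (subst ennreal_mult) auto
    finally show ?thesis using True by simp
  qed (auto simp: indicator_def)
  have "gagliardo J q \<le> (\<integral>\<^sup>+s. \<integral>\<^sup>+t. ?Tq s t + ennreal (2 / \<eta>\<^sup>2) * (?Q s * indicator J t + ?Q t * indicator J s) \<partial>lborel \<partial>lborel)"
    unfolding gagliardo_def by (intro nn_integral_mono pw)
  also have "\<dots> = (\<integral>\<^sup>+s. \<integral>\<^sup>+t. ?Tq s t \<partial>lborel \<partial>lborel)
     + ennreal (2 / \<eta>\<^sup>2) * (\<integral>\<^sup>+s. ?Q s * emeasure lborel J + (\<integral>\<^sup>+t. ?Q t \<partial>lborel) * indicator J s \<partial>lborel)"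
  proof -
    have "(\<integral>\<^sup>+t. ?Tq s t + ennreal (2 / \<eta>\<^sup>2) * (?Q s * indicator J t + ?Q t * indicator J s) \<partial>lborel)
      = (\<integral>\<^sup>+t. ?Tq s t \<partial>lborel) + ennreal (2 / \<eta>\<^sup>2) * (?Q s * emeasure lborel J + (\<integral>\<^sup>+t. ?Q t \<partial>lborel) * indicator J s)" for s
    proof -
      have "(\<integral>\<^sup>+t. ?Q s * indicator J t + ?Q t * indicator J s \<partial>lborel) = ?Q s * emeasure lborel J + (\<integral>\<^sup>+t. ?Q t \<partial>lborel) * indicator J s"
        by (subst nn_integral_add) (auto simp: nn_integral_multc nn_integral_cmult_indicator)
      then show ?thesis by (subst nn_integral_add, measurable, subst nn_integral_cmult, measurable)
    qed
    then show ?thesis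
      by (simp only:) (subst nn_integral_add, measurable, subst nn_integral_cmult, measurable)
  qed
  also have "(\<integral>\<^sup>+s. ?Q s * emeasure lborel J + (\<integral>\<^sup>+t. ?Q t \<partial>lborel) * indicator J s \<partial>lborel)
      = (\<integral>\<^sup>+s. ?Q s \<partial>lborel) * emeasure lborel J + (\<integral>\<^sup>+t. ?Q t \<partial>lborel) * emeasure lborel J"
    by (subst nn_integral_add, measurable, subst nn_integral_multc, measurable, subst nn_integral_cmult_indicator, measurable)
  also have "(\<integral>\<^sup>+s. \<integral>\<^sup>+t. ?Tq s t \<partial>lborel \<partial>lborel) + ennreal (2 / \<eta>\<^sup>2) * \<dots> < \<infinity>"
    using near q2 J_finite by (simp add: ennreal_mult_less_top)
  finally show "gagliardo J q < \<infinity>" .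
qed

end

text \<open>\<open>H32\<close> is defined with the chosen \<open>weak_partial\<close>; on an open
  set any Borel weak derivative agrees with it almost everywhere, and the double integral does not
  see the difference.\<close>

lemma H32I:
  assumes I: "open I" and u: "square_integrable (lebesgue_on I) u" and w: "has_weak_partial I 1 u w"
    and wm: "w \<in> borel_measurable borel" and fin: "gagliardo I w < \<infinity>"
  shows "u \<in> H32 I"
proof -
  have Ib[measurable]: "I \<in> sets borel" using I by auto
  note wm[measurable]
  have ae: "AE s in lebesgue_on I. weak_partial I 1 u s = w s"
    by (rule has_weak_partial_unique[OF I has_weak_partial_weak_partial[OF w] w])
  have "(\<integral>\<^sup>+s. (\<integral>\<^sup>+t. ennreal ((weak_partial I 1 u s - weak_partial I 1 u t)\<^sup>2 / (s - t)\<^sup>2) \<partial>lebesgue_on I) \<partial>lebesgue_on I)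
     = (\<integral>\<^sup>+s. (\<integral>\<^sup>+t. ennreal ((w s - w t)\<^sup>2 / (s - t)\<^sup>2) \<partial>lebesgue_on I) \<partial>lebesgue_on I)"
  proof (rule nn_integral_cong_AE)
    show "AE s in lebesgue_on I. (\<integral>\<^sup>+t. ennreal ((weak_partial I 1 u s - weak_partial I 1 u t)\<^sup>2 / (s - t)\<^sup>2) \<partial>lebesgue_on I)
      = (\<integral>\<^sup>+t. ennreal ((w s - w t)\<^sup>2 / (s - t)\<^sup>2) \<partial>lebesgue_on I)"
      using ae
    proof eventually_elim
      case (elim s)
      show ?case
        by (rule nn_integral_cong_AE) (use ae in eventually_elim, simp add: elim)
    qed
  qed
  also have "\<dots> = (\<integral>\<^sup>+s. (\<integral>\<^sup>+t. ennreal ((w s - w t)\<^sup>2 / (s - t)\<^sup>2) * indicator I t \<partial>lborel) \<partial>lebesgue_on I)"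
    by (intro nn_integral_cong nn_integral_lebesgue_on_borel Ib) measurable
  also have "\<dots> = (\<integral>\<^sup>+s. (\<integral>\<^sup>+t. ennreal ((w s - w t)\<^sup>2 / (s - t)\<^sup>2) * indicator I t \<partial>lborel) * indicator I s \<partial>lborel)"
    by (rule nn_integral_lebesgue_on_borel[OF Ib]) measurable
  also have "\<dots> = gagliardo I w"
    unfolding gagliardo_def
  proof (rule nn_integral_cong)
    fix s
    show "(\<integral>\<^sup>+t. ennreal ((w s - w t)\<^sup>2 / (s - t)\<^sup>2) * indicator I t \<partial>lborel) * indicator I s
      = (\<integral>\<^sup>+t. ennreal ((w s - w t)\<^sup>2 / (s - t)\<^sup>2) * indicator I s * indicator I t \<partial>lborel)"
      by (cases "s \<in> I") simp_all
  qed
  finally have "(\<integral>\<^sup>+s. (\<integral>\<^sup>+t. ennreal ((weak_partial I 1 u s - weak_partial I 1 u t)\<^sup>2 / (s - t)\<^sup>2) \<partial>lebesgue_on I) \<partial>lebesgue_on I) < \<infinity>"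
    using fin by simp
  moreover have "u \<in> H1 I" by (rule H1_I[OF u, of "\<lambda>b. w"]) (use w in simp)
  ultimately show ?thesis by (simp add: H32_def)
qed

lemma L2_weak_limit:
  fixes a :: "nat \<Rightarrow> 'a \<Rightarrow> real"
  assumes a: "\<And>n. square_integrable M (a n)" "square_integrable M a'" and \<psi>: "square_integrable M \<psi>"
    and lim: "(\<lambda>n. \<integral>\<^sup>+x. ennreal ((a n x - a' x)\<^sup>2) \<partial>M) \<longlonglongrightarrow> 0"
  shows "(\<lambda>n. LINT x|M. a n x * \<psi> x) \<longlonglongrightarrow> (LINT x|M. a' x * \<psi> x)"
proof -
  note [measurable] = square_integrable_D(1)[OF a(1)] square_integrable_D(1)[OF a(2)] square_integrable_D(1)[OF \<psi>]
  let ?d = "\<lambda>n. (LINT x|M. a n x * \<psi> x) - (LINT x|M. a' x * \<psi> x)"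
  have le: "ennreal ((?d n)\<^sup>2) \<le> (\<integral>\<^sup>+x. ennreal ((\<psi> x)\<^sup>2) \<partial>M) * (\<integral>\<^sup>+x. ennreal ((a n x - a' x)\<^sup>2) \<partial>M)" for n
  proof -
    have i: "integrable M (\<lambda>x. (a n x - a' x) * \<psi> x)"
      by (rule integrable_mult_square_integrable[OF square_integrable_diff[OF a(1) a(2)] \<psi>])
    have "?d n = (LINT x|M. (a n x - a' x) * \<psi> x)"
      using integrable_mult_square_integrable[OF a(1) \<psi>] integrable_mult_square_integrable[OF a(2) \<psi>]
      by (simp add: left_diff_distrib)
    then have "ennreal \<bar>?d n\<bar> \<le> (\<integral>\<^sup>+x. ennreal \<bar>a n x - a' x\<bar> * ennreal \<bar>\<psi> x\<bar> \<partial>M)"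
      using integral_norm_bound_ennreal[OF i] by (simp add: abs_mult ennreal_mult)
    then have "(ennreal \<bar>?d n\<bar>)\<^sup>2 \<le> (\<integral>\<^sup>+x. ennreal \<bar>a n x - a' x\<bar> * ennreal \<bar>\<psi> x\<bar> \<partial>M)\<^sup>2"
      by (rule power_mono) simp
    also have "\<dots> \<le> (\<integral>\<^sup>+x. (ennreal \<bar>a n x - a' x\<bar>)\<^sup>2 \<partial>M) * (\<integral>\<^sup>+x. (ennreal \<bar>\<psi> x\<bar>)\<^sup>2 \<partial>M)"
      by (rule Cauchy_Schwarz_nn_integral) measurable
    finally show ?thesis by (simp add: ennreal_power mult.commute)
  qed
  have "(\<integral>\<^sup>+x. ennreal ((\<psi> x)\<^sup>2) \<partial>M) < top" using \<psi> by (simp add: square_integrable_iff)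
  from ennreal_tendsto_cmult[OF this lim]
  have lim': "(\<lambda>n. (\<integral>\<^sup>+x. ennreal ((\<psi> x)\<^sup>2) \<partial>M) * (\<integral>\<^sup>+x. ennreal ((a n x - a' x)\<^sup>2) \<partial>M)) \<longlonglongrightarrow> 0" by simp
  have "(\<lambda>n. ennreal ((?d n)\<^sup>2)) \<longlonglongrightarrow> 0"
    by (rule tendsto_sandwich[OF _ _ tendsto_const lim']) (auto intro!: always_eventually le)
  then have "(\<lambda>n. (?d n)\<^sup>2) \<longlonglongrightarrow> 0" by (simp add: ennreal_tendsto_0_iff)
  from tendsto_real_sqrt[OF this] have "?d \<longlonglongrightarrow> 0" by (simp add: tendsto_rabs_zero_iff)
  then show ?thesis by (simp add: LIM_zero_iff)
qed

section \<open>Pullback of traces to the parameter interval\<close>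

context boundary_curve
begin

text \<open>Nothing is known about \<open>G (\<gamma> s)\<close> off \<open>J\<close>; the value 0
  there makes the pullback Borel on the whole line.\<close>

definition curve_pullback :: "(real^2 \<Rightarrow> real) \<Rightarrow> real \<Rightarrow> real" where
  "curve_pullback G s = (if s \<in> J then G (\<gamma> s) else 0)"

lemma curve_pullback_measurable: "G \<in> borel_measurable (boundary_measure \<Omega>) \<Longrightarrow> curve_pullback G \<in> borel_measurable borel"
  unfolding curve_pullback_def[abs_def] by (rule borel_pullback)

lemma curve_pullback_smooth_measurable: "smooth V \<Longrightarrow> V \<in> borel_measurable (boundary_measure \<Omega>)"
  by (rule boundary_measure_space(2)[OF H smooth_measurable])

lemma curve_pullback_L2_le:
  assumes I: "I \<in> sets borel" "I \<subseteq> J"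
    and F: "F \<in> borel_measurable (boundary_measure \<Omega>)" "G \<in> borel_measurable (boundary_measure \<Omega>)"
  shows "(\<integral>\<^sup>+s. ennreal ((curve_pullback F s - curve_pullback G s)\<^sup>2) \<partial>lebesgue_on I) \<le> (\<integral>\<^sup>+x. ennreal ((F x - G x)\<^sup>2) \<partial>boundary_measure \<Omega>)"
proof -
  note [measurable] = curve_pullback_measurable[OF F(1)] curve_pullback_measurable[OF F(2)] F
  have "(\<integral>\<^sup>+s. ennreal ((curve_pullback F s - curve_pullback G s)\<^sup>2) \<partial>lebesgue_on I) = (\<integral>\<^sup>+s. ennreal ((curve_pullback F s - curve_pullback G s)\<^sup>2) * indicator I s \<partial>lborel)"
    by (rule nn_integral_lebesgue_on_borel[OF I(1)]) measurable
  also have "\<dots> \<le> (\<integral>\<^sup>+s. ennreal ((F (\<gamma> s) - G (\<gamma> s))\<^sup>2) * indicator J s \<partial>lborel)"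
    by (rule nn_integral_mono) (use I in \<open>auto simp: curve_pullback_def indicator_def\<close>)
  also have "\<dots> \<le> (\<integral>\<^sup>+x. ennreal ((F x - G x)\<^sup>2) \<partial>boundary_measure \<Omega>)" by (rule pullback) measurable
  finally show ?thesis .
qed

lemma curve_pullback_square_integrable:
  assumes I: "I \<in> sets borel" "I \<subseteq> J" and G: "square_integrable (boundary_measure \<Omega>) G"
  shows "square_integrable (lebesgue_on I) (curve_pullback G)"
proof -
  have Gm: "G \<in> borel_measurable (boundary_measure \<Omega>)" using G by (rule square_integrable_D)
  have "(\<integral>\<^sup>+s. ennreal ((curve_pullback G s - curve_pullback (\<lambda>x. 0) s)\<^sup>2) \<partial>lebesgue_on I) \<le> (\<integral>\<^sup>+x. ennreal ((G x - 0)\<^sup>2) \<partial>boundary_measure \<Omega>)"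
    by (rule curve_pullback_L2_le[OF I Gm]) simp
  also have "\<dots> < \<infinity>" using G by (simp add: square_integrable_iff)
  finally have "(\<integral>\<^sup>+s. ennreal ((curve_pullback G s)\<^sup>2) \<partial>lebesgue_on I) < \<infinity>" by (simp add: curve_pullback_def)
  then show ?thesis using borel_lebesgue_on[OF curve_pullback_measurable[OF Gm]] by (simp add: square_integrable_iff)
qed

lemma curve_pullback_smooth_square_integrable:
  assumes I: "I \<in> sets borel" "I \<subseteq> J" and V: "smooth V"
  shows "square_integrable (lebesgue_on I) (curve_pullback V)"
proof -
  have "compact (frontier \<Omega>)" using \<Omega>(2) by (simp add: compact_frontier_bounded)
  then have "bounded (V ` frontier \<Omega>)"
    by (intro compact_imp_bounded compact_continuous_image smooth_continuous[OF V])
  then obtain B where B: "\<And>x. x \<in> frontier \<Omega> \<Longrightarrow> \<bar>V x\<bar> \<le> B" by (auto simp: bounded_iff)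
  have "(\<integral>\<^sup>+s. ennreal 1 \<partial>lebesgue_on I) = (\<integral>\<^sup>+s. ennreal 1 * indicator I s \<partial>lborel)"
    by (rule nn_integral_lebesgue_on_borel[OF I(1)]) simp
  also have "\<dots> \<le> emeasure lborel J" using emeasure_mono[OF I(2) , of lborel] J I by simp
  finally have one: "square_integrable (lebesgue_on I) (\<lambda>s. 1 :: real)"
    using J_finite by (auto simp: square_integrable_iff intro: le_less_trans)
  have "square_integrable (lebesgue_on I) (\<lambda>s. curve_pullback V s * 1)"
  proof (rule square_integrable_mult_bounded[OF one, where B=B])
    show "curve_pullback V \<in> borel_measurable (lebesgue_on I)"
      by (rule borel_lebesgue_on[OF curve_pullback_measurable[OF curve_pullback_smooth_measurable[OF V]]])
    show "\<bar>curve_pullback V s\<bar> \<le> B" if "s \<in> space (lebesgue_on I)" for s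
      using that I B[OF \<gamma>_frontier] by (auto simp: curve_pullback_def)
  qed
  then show ?thesis by simp
qed

lemma curve_pullback_weak_limit:
  assumes I: "I \<in> sets borel" "I \<subseteq> J" and V: "\<And>n. smooth (V n)"
    and G: "square_integrable (boundary_measure \<Omega>) G"
    and lim: "(\<lambda>n. \<integral>\<^sup>+x. ennreal ((V n x - G x)\<^sup>2) \<partial>boundary_measure \<Omega>) \<longlonglongrightarrow> 0"
    and \<psi>: "square_integrable (lebesgue_on I) \<psi>"
  shows "(\<lambda>n. LINT s|lebesgue_on I. curve_pullback (V n) s * \<psi> s) \<longlonglongrightarrow> (LINT s|lebesgue_on I. curve_pullback G s * \<psi> s)"
proof (rule L2_weak_limit[OF curve_pullback_smooth_square_integrable[OF I V] curve_pullback_square_integrable[OF I G] \<psi>])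
  show "(\<lambda>n. \<integral>\<^sup>+s. ennreal ((curve_pullback (V n) s - curve_pullback G s)\<^sup>2) \<partial>lebesgue_on I) \<longlonglongrightarrow> 0"
  proof (rule tendsto_sandwich[OF _ _ tendsto_const lim])
    show "\<forall>\<^sub>F n in sequentially. (\<integral>\<^sup>+s. ennreal ((curve_pullback (V n) s - curve_pullback G s)\<^sup>2) \<partial>lebesgue_on I)
      \<le> (\<integral>\<^sup>+x. ennreal ((V n x - G x)\<^sup>2) \<partial>boundary_measure \<Omega>)"
      by (intro always_eventually allI curve_pullback_L2_le[OF I curve_pullback_smooth_measurable[OF V] square_integrable_D(1)[OF G]])
  qed simp
qed

end

section \<open>Regularity along a boundary chart\<close>

text \<open>The margin between \<open>r\<close> and \<open>R\<close> puts the closed interval inside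
  the open set where the derivative is continuous, so the derivative is bounded up to the end
  points. Applied to \<open>f\<close> and again to its derivative.\<close>

lemma Ck_Suc_lipschitz:
  fixes f :: "real \<Rightarrow> real"
  assumes f: "Ck (Suc k) {-R<..<R} f" and r: "r < R"
  shows "\<exists>L\<ge>0. (\<forall>s\<in>{-r..r}. (f has_real_derivative pd 1 f s) (at s) \<and> \<bar>pd 1 f s\<bar> \<le> L)
     \<and> (\<forall>s\<in>{-r..r}. \<forall>t\<in>{-r..r}. \<bar>f s - f t\<bar> \<le> L * \<bar>s - t\<bar>)"
proof -
  have d: "(f has_real_derivative pd 1 f s) (at s)" if "s \<in> {-r..r}" for s
  proof -
    have "f differentiable_on {-R<..<R}" using f by simp
    then have "f differentiable (at s)" using that r by (auto simp: differentiable_on_eq_differentiable_at)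
    then obtain D where D: "(f has_real_derivative D) (at s)" by (auto simp: real_differentiable_def)
    have "pd 1 f s = D" using pd_eqI[OF D[unfolded has_field_derivative_def], of 1] by simp
    then show ?thesis using D by simp
  qed
  have "continuous_on {-R<..<R} (pd 1 f)" using f by (intro Ck_continuous_on[of k]) (simp add: pd_def[abs_def])
  then have "continuous_on {-r..r} (pd 1 f)" by (rule continuous_on_subset) (use r in auto)
  then have "bounded (pd 1 f ` {-r..r})" by (intro compact_imp_bounded compact_continuous_image) auto
  then obtain L where L: "\<And>s. s \<in> {-r..r} \<Longrightarrow> \<bar>pd 1 f s\<bar> \<le> L" by (fastforce simp: bounded_iff)
  have "\<bar>f s - f t\<bar> \<le> max L 0 * \<bar>s - t\<bar>" if "s \<in> {-r..r}" "t \<in> {-r..r}" for s t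
    using field_differentiable_bound[of "{-r..r}" f "pd 1 f" "max L 0" s t] d L that
    by (auto simp: le_max_iff_disj intro: has_field_derivative_at_within)
  then show ?thesis using d L by (intro exI[of _ "max L 0"]) (auto simp: le_max_iff_disj)
qed

locale C2_graph =
  fixes \<Omega> \<Gamma> :: "(real^2) set" and x0 :: "real^2" and Q :: "real^2 \<Rightarrow> real^2" and r h R :: real and f :: "real \<Rightarrow> real"
  assumes H: "emeasure hausdorff1 \<Gamma> \<noteq> 0"
    and \<Omega>: "open \<Omega>" "bounded \<Omega>" "lipschitz_boundary \<Omega>"
    and chart: "boundary_chart \<Omega> x0 Q r h f" and R: "r < R" and f: "Ck 2 {-R<..<R} f"
begin

text \<open>The graph point over \<open>s\<close>, with a default outside the chart so that the
  curve is Borel on the line.\<close>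

definition graph_pt :: "real \<Rightarrow> real^2" where "graph_pt s = chart_pt x0 Q s (if s \<in> {-r<..<r} then f s else 0)"

definition tangent :: "real \<Rightarrow> real^2" where "tangent s = Q (vector [1, pd 1 f s])"

lemma orthogonal: "orthogonal_transformation Q" using chart by (rule boundary_chart_orthogonal)

lemma f_C1: "Ck (Suc 1) {-R<..<R} f" using f by (simp only: numeral_2_eq_2 One_nat_def)

lemma df_C1: "Ck (Suc 0) {-R<..<R} (pd 1 f)" using f_C1 unfolding Ck_Suc_pd[of 1] by simp

lemma f_derivative: "s \<in> {-r..r} \<Longrightarrow> (f has_real_derivative pd 1 f s) (at s)"
  using Ck_Suc_lipschitz[OF f_C1 R] by blast

lemma df_isCont: "s \<in> {-r..r} \<Longrightarrow> isCont (pd 1 f) s"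
  using Ck_Suc_lipschitz[OF df_C1 R] DERIV_isCont by blast

lemma curve: "\<exists>c. boundary_curve \<Omega> \<Gamma> {-r<..<r} graph_pt c"
proof -
  obtain L where L: "0 \<le> L" "\<And>s t. s \<in> {-r..r} \<Longrightarrow> t \<in> {-r..r} \<Longrightarrow> \<bar>f s - f t\<bar> \<le> L * \<bar>s - t\<bar>"
    using Ck_Suc_lipschitz[OF f_C1 R] by blast
  have cont: "continuous_on {-r<..<r} f"
    by (intro continuous_at_imp_continuous_on ballI DERIV_isCont[OF f_derivative]) auto
  have "boundary_curve \<Omega> \<Gamma> {-r<..<r} graph_pt (1 + L)"
  proof (unfold_locales, rule H, rule \<Omega>, rule \<Omega>, rule \<Omega>)
    show "graph_pt \<in> borel_measurable borel"
      unfolding graph_pt_def[abs_def]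
      by (intro chart_pt_measurable2[OF orthogonal] borel_measurable_continuous_on_if cont) auto
    show "graph_pt s \<in> frontier \<Omega>" if "s \<in> {-r<..<r}" for s
      using that boundary_chart_graph_in_frontier[OF chart \<Omega>(1), of s] by (simp add: graph_pt_def abs_less_iff)
    fix s t assume st: "s \<in> {-r<..<r}" "t \<in> {-r<..<r}"
    show "\<bar>s - t\<bar> \<le> dist (graph_pt s) (graph_pt t)" unfolding graph_pt_def by (rule dist_chart_pt_bounds(1)[OF orthogonal])
    have "dist (graph_pt s) (graph_pt t) \<le> \<bar>s - t\<bar> + \<bar>f s - f t\<bar>"
      using dist_chart_pt_bounds(3)[OF orthogonal, of x0 s "f s" t "f t"] st by (simp add: graph_pt_def)
    also have "\<dots> \<le> (1 + L) * \<bar>s - t\<bar>" using L(2)[of s t] st by (simp add: algebra_simps)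
    finally show "dist (graph_pt s) (graph_pt t) \<le> (1 + L) * \<bar>s - t\<bar>" .
  qed (use L chart in \<open>auto simp: boundary_chart_def\<close>)
  then show ?thesis by blast
qed

lemma derivative_along_graph:
  assumes V: "smooth V" and s: "s \<in> {-r..r}"
  shows "((\<lambda>s. V (chart_pt x0 Q s (f s))) has_real_derivative
    (\<Sum>b\<in>Basis. (tangent s \<bullet> b) * pd b V (chart_pt x0 Q s (f s)))) (at s)"
proof -
  define e1 e2 where "e1 = Q (vector [1, 0])" and "e2 = Q (vector [0, 1])"
  have eq: "Q (vector [a, b]) = a *\<^sub>R e1 + b *\<^sub>R e2" for a b
    unfolding e1_def e2_def chart_scale[OF orthogonal] linear_add[OF chart_linear[OF orthogonal], symmetric] vector2_add
    by simp
  have "((\<lambda>s. x0 + (s *\<^sub>R e1 + f s *\<^sub>R e2)) has_derivative (\<lambda>h. 0 + (h *\<^sub>R e1 + (pd 1 f s * h) *\<^sub>R e2))) (at s)"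
    using f_derivative[OF s] unfolding has_field_derivative_def
    by (intro has_derivative_add has_derivative_const has_derivative_scaleR_left has_derivative_ident) 
  then have "((\<lambda>s. chart_pt x0 Q s (f s)) has_derivative (\<lambda>h. h *\<^sub>R tangent s)) (at s)"
    by (simp add: chart_pt_def eq tangent_def scaleR_add_right mult.commute)
  from has_derivative_compose[OF this smooth_has_derivative[OF V]]
  have "((\<lambda>s. V (chart_pt x0 Q s (f s))) has_derivative (\<lambda>h. pd (h *\<^sub>R tangent s) V (chart_pt x0 Q s (f s)))) (at s)" .
  moreover have "pd (h *\<^sub>R tangent s) V x = (\<Sum>b\<in>Basis. (tangent s \<bullet> b) * pd b V x) * h" for h x
  proof -
    interpret D: linear "\<lambda>h. pd h V x"
      using has_derivative_linear[OF smooth_has_derivative[OF V]] .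
    have "pd (tangent s) V x = pd (\<Sum>b\<in>Basis. (tangent s \<bullet> b) *\<^sub>R b) V x" by (simp add: euclidean_representation)
    also have "\<dots> = (\<Sum>b\<in>Basis. (tangent s \<bullet> b) * pd b V x)" by (simp only: D.sum D.scale real_scaleR_def)
    finally show ?thesis by (simp add: D.scale)
  qed
  ultimately show ?thesis by (simp add: has_field_derivative_def)
qed

lemma tangent_inner:
  assumes "b \<in> Basis" shows "tangent s \<bullet> b = Q (vector [1, 0]) \<bullet> b + pd 1 f s * (Q (vector [0, 1]) \<bullet> b)"
proof -
  have "tangent s = Q (vector [1, 0]) + pd 1 f s *\<^sub>R Q (vector [0, 1])"
    unfolding tangent_def chart_scale[OF orthogonal] linear_add[OF chart_linear[OF orthogonal], symmetric] vector2_add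
    by simp
  then show ?thesis by (simp add: inner_add_left)
qed

lemma tangent_inner_bounds:
  "\<exists>P L. \<forall>b\<in>Basis. \<forall>s\<in>{-r<..<r}. \<bar>tangent s \<bullet> b\<bar> \<le> P \<and> (\<forall>t\<in>{-r<..<r}. \<bar>tangent s \<bullet> b - tangent t \<bullet> b\<bar> \<le> L * \<bar>s - t\<bar>)"
proof -
  obtain P where P: "0 \<le> P" "\<And>s. s \<in> {-r..r} \<Longrightarrow> \<bar>pd 1 f s\<bar> \<le> P"
    using Ck_Suc_lipschitz[OF f_C1 R] by blast
  obtain L where L: "0 \<le> L" "\<And>s t. s \<in> {-r..r} \<Longrightarrow> t \<in> {-r..r} \<Longrightarrow> \<bar>pd 1 f s - pd 1 f t\<bar> \<le> L * \<bar>s - t\<bar>"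
    using Ck_Suc_lipschitz[OF df_C1 R] by blast
  have n: "\<bar>Q (vector [1, 0]) \<bullet> b\<bar> \<le> 1" "\<bar>Q (vector [0, 1]) \<bullet> b\<bar> \<le> 1" if "b \<in> Basis" for b
    using Basis_le_norm[OF that, of "Q (vector [1, 0])"] Basis_le_norm[OF that, of "Q (vector [0, 1])"]
    by (simp_all add: norm_chart_vector[OF orthogonal])
  show ?thesis
  proof (intro exI ballI conjI)
    fix b :: "real^2" and s assume b: "b \<in> Basis" and s: "s \<in> {-r<..<r}"
    have "\<bar>pd 1 f s * (Q (vector [0, 1]) \<bullet> b)\<bar> \<le> P * 1"
      unfolding abs_mult using P s n[OF b] by (intro mult_mono) auto
    then show "\<bar>tangent s \<bullet> b\<bar> \<le> 1 + P"
      unfolding tangent_inner[OF b] using n(1)[OF b] abs_triangle_ineq[of "Q (vector [1, 0]) \<bullet> b" "pd 1 f s * (Q (vector [0, 1]) \<bullet> b)"]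
      by linarith
    fix t assume t: "t \<in> {-r<..<r}"
    have "\<bar>tangent s \<bullet> b - tangent t \<bullet> b\<bar> = \<bar>pd 1 f s - pd 1 f t\<bar> * \<bar>Q (vector [0, 1]) \<bullet> b\<bar>"
      unfolding tangent_inner[OF b] by (simp add: abs_mult[symmetric] algebra_simps)
    also have "\<dots> \<le> (L * \<bar>s - t\<bar>) * 1" using L s t n[OF b] by (intro mult_mono) auto
    finally show "\<bar>tangent s \<bullet> b - tangent t \<bullet> b\<bar> \<le> L * \<bar>s - t\<bar>" by simp
  qed
qed

text \<open>\<open>A + B\<close> is the derivative of \<open>\<phi>\<close> times \<open>V\<close>
  along the graph. \<open>\<phi>\<close> vanishes at both ends, as its support lies in the open
  interval, and the graph function is differentiable there, so the fundamental theorem applies on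
  the closed interval.\<close>

lemma graph_integration_by_parts:
  assumes V: "smooth V" and I: "open I" "I \<subseteq> {-r<..<r}" and \<phi>: "test_function I \<phi>"
  shows "(LINT s|lebesgue_on I. V (graph_pt s) * pd 1 \<phi> s)
    = - (LINT s|lebesgue_on I. (\<Sum>b\<in>Basis. (tangent s \<bullet> b) * pd b V (graph_pt s)) * \<phi> s)"
proof -
  obtain K where K: "smooth \<phi>" "compact K" "K \<subseteq> I" "\<And>x. x \<notin> K \<Longrightarrow> \<phi> x = 0"
    using \<phi> test_function_iff by metis
  have r: "0 < r" using chart by (simp add: boundary_chart_def)
  define A B where "A s = V (chart_pt x0 Q s (f s)) * pd 1 \<phi> s"
    and "B s = (\<Sum>b\<in>Basis. (tangent s \<bullet> b) * pd b V (chart_pt x0 Q s (f s))) * \<phi> s" for s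
  have \<phi>d: "(\<phi> has_real_derivative pd 1 \<phi> s) (at s)" for s
  proof -
    interpret D: linear "\<lambda>h. pd h \<phi> s"
      using has_derivative_linear[OF smooth_has_derivative[OF K(1)]] .
    have "(\<lambda>h. pd h \<phi> s) = (\<lambda>h. pd 1 \<phi> s * h)"
    proof
      show "pd h \<phi> s = pd 1 \<phi> s * h" for h using D.scale[of h 1] by (simp add: mult.commute)
    qed
    then show ?thesis using smooth_has_derivative[OF K(1), of s] by (simp add: has_field_derivative_def)
  qed
  have sm: "isCont W x" if "smooth W" for W :: "'c::euclidean_space \<Rightarrow> real" and x
    using smooth_continuous[OF that, of UNIV] by (simp add: continuous_on_eq_continuous_at)
  have gc: "isCont (\<lambda>s. W (chart_pt x0 Q s (f s))) s" if "smooth W" "s \<in> {-r..r}" for W s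
    using derivative_along_graph[OF that] by (rule DERIV_isCont)
  have A: "isCont A s" if "s \<in> {-r..r}" for s
    unfolding A_def using gc[OF V that] sm[OF smooth_pd[OF K(1)]] by (intro continuous_intros) auto
  have B: "isCont B s" if s: "s \<in> {-r..r}" for s
    unfolding B_def
  proof (intro continuous_mult sm[OF K(1)] continuous_sum)
    fix b :: "real^2" assume b: "b \<in> Basis"
    show "isCont (\<lambda>s. tangent s \<bullet> b) s" unfolding tangent_inner[OF b] using df_isCont[OF s] by (intro continuous_intros)
    show "isCont (\<lambda>s. pd b V (chart_pt x0 Q s (f s))) s" by (rule gc[OF smooth_pd[OF V b] s])
  qed
  have iA: "integrable lborel (\<lambda>s. A s * indicator {-r..r} s)"
    and iB: "integrable lborel (\<lambda>s. B s * indicator {-r..r} s)"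
    using A B by (auto intro!: borel_integrable_atLeastAtMost)
  have "has_bochner_integral lborel (\<lambda>s. (A s + B s) * indicator {-r..r} s)
    (V (chart_pt x0 Q r (f r)) * \<phi> r - V (chart_pt x0 Q (-r) (f (-r))) * \<phi> (-r))"
  proof (rule has_bochner_integral_FTC_Icc_real)
    fix s assume "-r \<le> s" "s \<le> r"
    then have s: "s \<in> {-r..r}" by simp
    show "((\<lambda>s. V (chart_pt x0 Q s (f s)) * \<phi> s) has_real_derivative (A s + B s)) (at s)"
      using DERIV_mult[OF derivative_along_graph[OF V s] \<phi>d] by (simp add: A_def B_def add.commute mult.commute)
    show "isCont (\<lambda>s. A s + B s) s" using A[OF s] B[OF s] by (intro continuous_intros)
  qed (use r in simp)
  moreover have "\<phi> r = 0" "\<phi> (-r) = 0" using K(3,4) I(2) by (metis greaterThanLessThan_iff in_mono less_irrefl)+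
  ultimately have 0: "(LINT s|lborel. (A s + B s) * indicator {-r..r} s) = 0"
    by (simp add: has_bochner_integral_integral_eq)
  have "(LINT s|lborel. A s * indicator {-r..r} s) + (LINT s|lborel. B s * indicator {-r..r} s)
    = (LINT s|lborel. A s * indicator {-r..r} s + B s * indicator {-r..r} s)"
    by (rule Bochner_Integration.integral_add[OF iA iB, symmetric])
  also have "\<dots> = 0" using 0 by (simp add: distrib_right)
  finally have sum: "(LINT s|lborel. A s * indicator {-r..r} s) + (LINT s|lborel. B s * indicator {-r..r} s) = 0" .
  have Ib: "I \<in> sets borel" using I by auto
  have zero: "A s = 0" "B s = 0" if "s \<notin> I" for s
  proof -
    have "s \<notin> K" using that K(3) by auto
    then show "A s = 0" "B s = 0" using K(4) pd_zero_off_compact[OF K(2,4)] by (simp_all add: A_def B_def)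
  qed
  have on: "indicator {-r..r} s = (1::real)" "graph_pt s = chart_pt x0 Q s (f s)" if "s \<in> I" for s
    using that I(2) by (auto simp: graph_pt_def)
  have "(LINT s|lebesgue_on I. V (graph_pt s) * pd 1 \<phi> s) = (LINT s|lebesgue_on I. A s * indicator {-r..r} s)"
    by (rule Bochner_Integration.integral_cong) (auto simp: on A_def)
  also have "\<dots> = (LINT s|lborel. A s * indicator {-r..r} s)"
    by (rule lebesgue_on_borel(1)[OF Ib]) (use borel_measurable_integrable[OF iA] zero in auto)
  also have "\<dots> = - (LINT s|lborel. B s * indicator {-r..r} s)" using sum by simp
  also have "(LINT s|lborel. B s * indicator {-r..r} s) = (LINT s|lebesgue_on I. B s * indicator {-r..r} s)"
    by (rule lebesgue_on_borel(1)[OF Ib, symmetric]) (use borel_measurable_integrable[OF iB] zero in auto)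
  also have "\<dots> = (LINT s|lebesgue_on I. (\<Sum>b\<in>Basis. (tangent s \<bullet> b) * pd b V (graph_pt s)) * \<phi> s)"
    by (rule Bochner_Integration.integral_cong) (auto simp: on B_def)
  finally show ?thesis .
qed

text \<open>Convergence of order 2 is what makes each \<open>pd b (V n)\<close> converge to order 1;
  hence it has a limit \<open>G b\<close> on the boundary with finite seminorm, and the integration
  by parts formula can be passed to the limit.\<close>

lemma graph_H32:
  assumes I: "open I" "I \<subseteq> {-r<..<r}" and V: "\<And>n. smooth (V n)" "Hconv \<Omega> 2 V u"
    and g: "square_integrable (boundary_measure \<Omega>) g"
    and lim: "(\<lambda>n. \<integral>\<^sup>+x. ennreal ((V n x - g x)\<^sup>2) \<partial>boundary_measure \<Omega>) \<longlonglongrightarrow> 0"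
  shows "(\<lambda>s. g (graph_pt s)) \<in> H32 I"
proof -
  let ?J = "{-r<..<r}"
  obtain c where "boundary_curve \<Omega> \<Gamma> ?J graph_pt c" using curve by blast
  then interpret C: boundary_curve \<Omega> \<Gamma> ?J graph_pt c .
  have Ib: "I \<in> sets borel" using I by auto
  have "\<forall>b\<in>Basis. \<exists>G. square_integrable (boundary_measure \<Omega>) G \<and>
    (\<lambda>n. \<integral>\<^sup>+x. ennreal ((pd b (V n) x - G x)\<^sup>2) \<partial>boundary_measure \<Omega>) \<longlonglongrightarrow> 0 \<and> (\<exists>w. Hconv \<Omega> 1 (\<lambda>n. pd b (V n)) w)"
  proof
    fix b :: "real^2" assume b: "b \<in> Basis"
    have "Hconv \<Omega> (Suc 1) V u" using V(2) by (simp only: numeral_2_eq_2 One_nat_def)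
    then obtain w where w: "has_weak_partial \<Omega> b u w" "Hconv \<Omega> 1 (\<lambda>n. pd b (V n)) w"
      unfolding Hconv.simps(2)[of _ 1] using b by blast
    have "square_integrable (lebesgue_on \<Omega>) w" using w(1) by (simp add: has_weak_partial_def)
    from trace_limit[OF H \<Omega> smooth_pd[OF V(1) b] this w(2)] w(2)
    show "\<exists>G. square_integrable (boundary_measure \<Omega>) G \<and>
      (\<lambda>n. \<integral>\<^sup>+x. ennreal ((pd b (V n) x - G x)\<^sup>2) \<partial>boundary_measure \<Omega>) \<longlonglongrightarrow> 0 \<and> (\<exists>w. Hconv \<Omega> 1 (\<lambda>n. pd b (V n)) w)"
      by blast
  qed
  then obtain G where "\<forall>b\<in>Basis. square_integrable (boundary_measure \<Omega>) (G b) \<and>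
    (\<lambda>n. \<integral>\<^sup>+x. ennreal ((pd b (V n) x - G b x)\<^sup>2) \<partial>boundary_measure \<Omega>) \<longlonglongrightarrow> 0 \<and> (\<exists>w. Hconv \<Omega> 1 (\<lambda>n. pd b (V n)) w)"
    unfolding bchoice_iff by blast
  then have G: "square_integrable (boundary_measure \<Omega>) (G b)"
      "(\<lambda>n. \<integral>\<^sup>+x. ennreal ((pd b (V n) x - G b x)\<^sup>2) \<partial>boundary_measure \<Omega>) \<longlonglongrightarrow> 0"
      "\<exists>w. Hconv \<Omega> 1 (\<lambda>n. pd b (V n)) w" if "b \<in> Basis" for b
    using that by blast+
  \<comment> \<open>The tangent component, extended by 0 so that it is bounded and Borel on the
    line; its Lipschitz bound is used only inside the interval.\<close>
  define p where "p b s = (if s \<in> ?J then tangent s \<bullet> b else 0)" for b s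
  obtain P L where PL: "\<forall>b\<in>Basis. \<forall>s\<in>?J. \<bar>tangent s \<bullet> b\<bar> \<le> P \<and> (\<forall>t\<in>?J. \<bar>tangent s \<bullet> b - tangent t \<bullet> b\<bar> \<le> L * \<bar>s - t\<bar>)"
    using tangent_inner_bounds by blast
  have pm: "p b \<in> borel_measurable borel" if "b \<in> Basis" for b
  proof -
    have "continuous_on ?J (\<lambda>s. tangent s \<bullet> b)"
      unfolding tangent_inner[OF that]
      by (intro continuous_intros continuous_at_imp_continuous_on ballI df_isCont) auto
    then show ?thesis unfolding p_def[abs_def] by (intro borel_measurable_continuous_on_if) auto
  qed
  have p_bound: "\<bar>p b s\<bar> \<le> \<bar>P\<bar>" if "b \<in> Basis" for b s
    using bspec[OF bspec[OF PL that], of s] by (auto simp: p_def)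
  define w where "w s = (\<Sum>b\<in>Basis. p b s * C.curve_pullback (G b) s)" for s
  have qm: "C.curve_pullback (G b) \<in> borel_measurable borel" if "b \<in> Basis" for b
    by (rule C.curve_pullback_measurable[OF square_integrable_D(1)[OF G(1)[OF that]]])
  have wm: "w \<in> borel_measurable borel"
    unfolding w_def[abs_def] using pm qm by (intro borel_measurable_sum borel_measurable_times) auto
  have pq: "square_integrable (lebesgue_on I) (\<lambda>s. p b s * C.curve_pullback (G b) s)" if "b \<in> Basis" for b
    by (rule square_integrable_mult_bounded[OF C.curve_pullback_square_integrable[OF Ib I(2) G(1)[OF that]] borel_lebesgue_on[OF pm[OF that]] p_bound[OF that]])
  have sum: "square_integrable M (\<lambda>s. \<Sum>b\<in>B. a b s)" if "finite B" "\<And>b. b \<in> B \<Longrightarrow> square_integrable M (a b)"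
    for M :: "real measure" and B :: "(real^2) set" and a :: "real^2 \<Rightarrow> real \<Rightarrow> real"
    using that
  proof (induction B)
    case empty then show ?case by (simp add: square_integrable_iff)
  next
    case (insert b B)
    then show ?case using square_integrable_add[of M "a b" "\<lambda>s. \<Sum>b\<in>B. a b s"] by simp
  qed
  have w_sq: "square_integrable (lebesgue_on I) w" unfolding w_def[abs_def] by (rule sum[OF finite_Basis pq])
  have fin: "gagliardo I w < \<infinity>"
  proof -
    have "gagliardo ?J (\<lambda>s. p b s * C.curve_pullback (G b) s) < \<infinity>" if b: "b \<in> Basis" for b
    proof -
      obtain w where "Hconv \<Omega> 1 (\<lambda>n. pd b (V n)) w" using G(3)[OF b] by blast
      note tr = C.trace_gagliardo_finite[OF smooth_pd[OF V(1) b] this G(1,2)[OF b]]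
      have q: "(\<integral>\<^sup>+s. ennreal ((C.curve_pullback (G b) s)\<^sup>2) * indicator ?J s \<partial>lborel) < \<infinity>" "gagliardo ?J (C.curve_pullback (G b)) < \<infinity>"
        unfolding C.curve_pullback_def[abs_def] using tr(2,3) by auto
      show ?thesis
      proof (rule gagliardo_mult_lipschitz[OF C.J pm[OF b] qm[OF b] C.J_finite p_bound[OF b] _ q])
        show "\<bar>p b s - p b t\<bar> \<le> L * \<bar>s - t\<bar>" if "s \<in> ?J" "t \<in> ?J" for s t
          using bspec[OF bspec[OF PL b] that(1)] that by (auto simp: p_def)
      qed
    qed
    then have "gagliardo ?J w < \<infinity>"
      unfolding w_def[abs_def] using pm qm by (intro gagliardo_sum) auto
    moreover have "gagliardo I w \<le> gagliardo ?J w"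
      unfolding gagliardo_def using I(2) by (intro nn_integral_mono) (auto simp: indicator_def)
    ultimately show ?thesis by simp
  qed
  have on: "C.curve_pullback F s = F (graph_pt s)" "p b s = tangent s \<bullet> b" if "s \<in> I" for F b s
    using that I(2) by (auto simp: C.curve_pullback_def p_def)
  have wp: "has_weak_partial I 1 (C.curve_pullback g) w"
    unfolding has_weak_partial_pd
  proof (intro conjI w_sq allI impI)
    fix \<phi> :: "real \<Rightarrow> real" assume \<phi>: "test_function I \<phi>"
    note \<phi>sq = test_function_square_integrable[OF \<phi> Ib]
    have p\<phi>: "square_integrable (lebesgue_on I) (\<lambda>s. p b s * \<phi> s)" if "b \<in> Basis" for b
      by (rule square_integrable_mult_bounded[OF \<phi>sq(1) borel_lebesgue_on[OF pm[OF that]] p_bound[OF that]])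
    have split: "(LINT s|lebesgue_on I. (\<Sum>b\<in>Basis. p b s * a b s) * \<phi> s)
        = (\<Sum>b\<in>Basis. LINT s|lebesgue_on I. a b s * (p b s * \<phi> s))"
      if a: "\<And>b. b \<in> Basis \<Longrightarrow> square_integrable (lebesgue_on I) (a b)" for a
    proof -
      have "(\<Sum>b\<in>Basis. LINT s|lebesgue_on I. a b s * (p b s * \<phi> s))
        = (LINT s|lebesgue_on I. (\<Sum>b\<in>Basis. a b s * (p b s * \<phi> s)))"
        by (rule Bochner_Integration.integral_sum[symmetric]) (rule integrable_mult_square_integrable[OF a p\<phi>])
      also have "\<dots> = (LINT s|lebesgue_on I. (\<Sum>b\<in>Basis. p b s * a b s) * \<phi> s)"
        by (rule Bochner_Integration.integral_cong) (auto simp: sum_distrib_left sum_distrib_right mult_ac)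
      finally show ?thesis ..
    qed
    \<comment> \<open>The factor \<open>p b\<close> is moved to the test function. Each summand then
      pairs a convergent boundary function with a fixed square integrable one.\<close>
    have ibp: "(LINT s|lebesgue_on I. C.curve_pullback (V n) s * pd 1 \<phi> s)
      = - (\<Sum>b\<in>Basis. LINT s|lebesgue_on I. C.curve_pullback (pd b (V n)) s * (p b s * \<phi> s))" for n
    proof -
      have "(LINT s|lebesgue_on I. C.curve_pullback (V n) s * pd 1 \<phi> s) = (LINT s|lebesgue_on I. V n (graph_pt s) * pd 1 \<phi> s)"
        by (rule Bochner_Integration.integral_cong) (auto simp: on)
      also have "\<dots> = - (LINT s|lebesgue_on I. (\<Sum>b\<in>Basis. (tangent s \<bullet> b) * pd b (V n) (graph_pt s)) * \<phi> s)"
        by (rule graph_integration_by_parts[OF V(1) I \<phi>])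
      also have "(LINT s|lebesgue_on I. (\<Sum>b\<in>Basis. (tangent s \<bullet> b) * pd b (V n) (graph_pt s)) * \<phi> s)
        = (LINT s|lebesgue_on I. (\<Sum>b\<in>Basis. p b s * C.curve_pullback (pd b (V n)) s) * \<phi> s)"
        by (rule Bochner_Integration.integral_cong) (auto simp: on)
      also have "\<dots> = (\<Sum>b\<in>Basis. LINT s|lebesgue_on I. C.curve_pullback (pd b (V n)) s * (p b s * \<phi> s))"
        by (rule split[OF C.curve_pullback_smooth_square_integrable[OF Ib I(2) smooth_pd[OF V(1)]]])
      finally show ?thesis .
    qed
    have l1: "(\<lambda>n. LINT s|lebesgue_on I. C.curve_pullback (V n) s * pd 1 \<phi> s) \<longlonglongrightarrow> (LINT s|lebesgue_on I. C.curve_pullback g s * pd 1 \<phi> s)"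
      by (rule C.curve_pullback_weak_limit[OF Ib I(2) V(1) g lim \<phi>sq(2)]) simp
    have "(\<lambda>n. - (\<Sum>b\<in>Basis. LINT s|lebesgue_on I. C.curve_pullback (pd b (V n)) s * (p b s * \<phi> s)))
      \<longlonglongrightarrow> - (\<Sum>b\<in>Basis. LINT s|lebesgue_on I. C.curve_pullback (G b) s * (p b s * \<phi> s))"
      by (intro tendsto_minus tendsto_sum C.curve_pullback_weak_limit[OF Ib I(2) smooth_pd[OF V(1)] G(1,2) p\<phi>])
    also have "(\<Sum>b\<in>Basis. LINT s|lebesgue_on I. C.curve_pullback (G b) s * (p b s * \<phi> s)) = (LINT s|lebesgue_on I. w s * \<phi> s)"
      unfolding w_def by (rule split[symmetric]) (rule C.curve_pullback_square_integrable[OF Ib I(2) G(1)])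
    finally have l2: "(\<lambda>n. - (\<Sum>b\<in>Basis. LINT s|lebesgue_on I. C.curve_pullback (pd b (V n)) s * (p b s * \<phi> s)))
      \<longlonglongrightarrow> - (LINT s|lebesgue_on I. w s * \<phi> s)" .
    show "(LINT s|lebesgue_on I. C.curve_pullback g s * pd 1 \<phi> s) = - (LINT s|lebesgue_on I. w s * \<phi> s)"
      by (rule LIMSEQ_unique[OF l1[unfolded ibp] l2])
  qed
  have eq: "C.curve_pullback g s = g (graph_pt s)" if "s \<in> I" for s using that by (rule on)
  have "square_integrable (lebesgue_on I) (\<lambda>s. g (graph_pt s))"
    using C.curve_pullback_square_integrable[OF Ib I(2) g] square_integrable_cong[of "lebesgue_on I" "C.curve_pullback g" "\<lambda>s. g (graph_pt s)"] eq by simp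
  moreover have "has_weak_partial I 1 (\<lambda>s. g (graph_pt s)) w" by (rule has_weak_partial_cong[OF wp]) (use eq in auto)
  ultimately show ?thesis by (rule H32I[OF I(1) _ _ wm fin])
qed

text \<open>A chosen trace is 0 only up to a null set of the boundary. The curve pulls this set back
  to a null set of parameters, so 0 is a weak derivative.\<close>

lemma graph_H32_zero:
  assumes I: "open I" "I \<subseteq> {-r<..<r}"
    and g: "square_integrable (boundary_measure \<Omega>) g" "AE x in boundary_measure \<Omega>. g x = 0"
  shows "(\<lambda>s. g (graph_pt s)) \<in> H32 I"
proof -
  obtain c where "boundary_curve \<Omega> \<Gamma> {-r<..<r} graph_pt c" using curve by blast
  then interpret C: boundary_curve \<Omega> \<Gamma> "{-r<..<r}" graph_pt c .
  have Ib: "I \<in> sets borel" using I by auto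
  have eq: "C.curve_pullback g s = g (graph_pt s)" if "s \<in> I" for s using that I(2) by (auto simp: C.curve_pullback_def)
  have sq: "square_integrable (lebesgue_on I) (\<lambda>s. g (graph_pt s))"
    using C.curve_pullback_square_integrable[OF Ib I(2) g(1)] square_integrable_cong[of "lebesgue_on I" "C.curve_pullback g" "\<lambda>s. g (graph_pt s)"] eq by simp
  have ae: "AE s in lebesgue_on I. g (graph_pt s) = 0"
  proof -
    have "AE s in lebesgue. s \<in> {-r<..<r} \<longrightarrow> g (graph_pt s) = 0" by (rule AE_completion[OF C.pullback_AE[OF g(2)]])
    then have "AE s in lebesgue. s \<in> I \<longrightarrow> g (graph_pt s) = 0" by eventually_elim (use I in auto)
    then show ?thesis using Ib by (subst AE_restrict_space_iff) (auto simp: sets_completionI_sets)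
  qed
  show ?thesis
  proof (rule H32I[OF I(1) sq, where w="\<lambda>s. 0"])
    show "has_weak_partial I 1 (\<lambda>s. g (graph_pt s)) (\<lambda>s. 0)"
      unfolding has_weak_partial_pd
    proof (intro conjI allI impI)
      fix \<phi> :: "real \<Rightarrow> real"
      have "(LINT s|lebesgue_on I. g (graph_pt s) * pd 1 \<phi> s) = 0"
        by (rule integral_eq_zero_AE) (use ae in eventually_elim, simp)
      then show "(LINT s|lebesgue_on I. g (graph_pt s) * pd 1 \<phi> s) = - (LINT s|lebesgue_on I. 0 * \<phi> s)" by simp
    qed (simp add: square_integrable_iff)
  qed (simp_all add: gagliardo_def)
qed

text \<open>Supplies the open parameter set on which \<open>H32\<close> is tested. Continuity of the
  graph is obtained coordinatewise, each coordinate being a smooth function followed along the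
  graph.\<close>

lemma open_pullback:
  assumes "openin (top_of_set (frontier \<Omega>)) \<Gamma>e"
  shows "open {s. \<bar>s\<bar> < r \<and> x0 + Q (vector [s, f s]) \<in> \<Gamma>e}"
proof -
  obtain W where W: "open W" "\<Gamma>e = frontier \<Omega> \<inter> W" using assms by (auto simp: openin_open)
  have "isCont (\<lambda>s. chart_pt x0 Q s (f s)) s" if "s \<in> {-r<..<r}" for s
  proof -
    have "isCont (\<lambda>s. chart_pt x0 Q s (f s) \<bullet> b) s" if "b \<in> Basis" for b
    proof -
      have "smooth (\<lambda>x. x \<bullet> b)"
        by (auto simp: smooth_def intro!: Ck_bounded_linear bounded_linear_intros)
      from DERIV_isCont[OF derivative_along_graph[OF this]] show ?thesis using \<open>s \<in> {-r<..<r}\<close> by simp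
    qed
    then show ?thesis unfolding isCont_def by (subst tendsto_componentwise_iff) auto
  qed
  then have "continuous_on {-r<..<r} (\<lambda>s. chart_pt x0 Q s (f s))" by (intro continuous_at_imp_continuous_on) auto
  from continuous_open_preimage[OF this open_greaterThanLessThan W(1)]
  have "open ({-r<..<r} \<inter> (\<lambda>s. chart_pt x0 Q s (f s)) -` W)" .
  also have "{-r<..<r} \<inter> (\<lambda>s. chart_pt x0 Q s (f s)) -` W = {s. \<bar>s\<bar> < r \<and> x0 + Q (vector [s, f s]) \<in> \<Gamma>e}"
    using boundary_chart_graph_in_frontier[OF chart \<Omega>(1)] by (auto simp: W(2) chart_pt_def abs_less_iff)
  finally show ?thesis .
qed

end

section \<open>From graphs to the boundary\<close>

lemma H32_cong:
  assumes u: "u \<in> H32 I" and eq: "\<And>s. s \<in> I \<Longrightarrow> u s = u' s"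
  shows "u' \<in> H32 I"
proof -
  \<comment> \<open>The predicates are equal, not merely equivalent up to null sets, so
    \<open>weak_partial\<close> chooses the same function for \<open>u\<close> and
    \<open>u'\<close>.\<close>
  have wp: "has_weak_partial I b u = has_weak_partial I b u'" for b
    using has_weak_partial_cong[of I b u _ u'] has_weak_partial_cong[of I b u' _ u] eq by (intro ext iffI) auto
  have "square_integrable (lebesgue_on I) u = square_integrable (lebesgue_on I) u'"
    by (rule square_integrable_cong) (simp add: eq)
  then have "u \<in> H1 I \<longleftrightarrow> u' \<in> H1 I" by (simp add: H1_def wp)
  then show ?thesis using u by (simp add: H32_def weak_partial_def wp)
qed

text \<open>Membership is tested on all \<open>C\<^sup>2\<close> charts, each of which is an
  instance of \<open>C2_graph\<close>; the condition \<open>graph\<close> therefore ranges over all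
  instances and all open parameter sets.\<close>

lemma H32_boundaryI:
  fixes \<Omega> \<Gamma>e :: "(real^2) set"
  assumes H: "emeasure hausdorff1 (\<Gamma> :: (real^2) set) \<noteq> 0"
    and \<Omega>: "open \<Omega>" "bounded \<Omega>" "lipschitz_boundary \<Omega>"
    and \<Gamma>e: "openin (top_of_set (frontier \<Omega>)) \<Gamma>e" and g: "square_integrable (boundary_measure \<Omega>) g"
    and graph: "\<And>x0 Q r h R f I. C2_graph \<Omega> \<Gamma> x0 Q r h R f \<Longrightarrow> open I \<Longrightarrow> I \<subseteq> {-r<..<r} \<Longrightarrow>
      (\<lambda>s. g (C2_graph.graph_pt x0 Q r f s)) \<in> H32 I"
  shows "g \<in> H32_boundary \<Omega> \<Gamma>e"
  unfolding H32_boundary_def mem_Collect_eq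
proof (intro conjI allI impI)
  have "(\<integral>\<^sup>+x. ennreal ((g x)\<^sup>2) \<partial>restrict_space (boundary_measure \<Omega>) \<Gamma>e) \<le> (\<integral>\<^sup>+x. ennreal ((g x)\<^sup>2) \<partial>boundary_measure \<Omega>)"
  proof -
    obtain W where W: "open W" "\<Gamma>e = frontier \<Omega> \<inter> W" using \<Gamma>e by (auto simp: openin_open)
    have "\<Gamma>e \<in> sets (boundary_measure \<Omega>)"
      by (rule boundary_measure_emeasure(2)[OF H]) (use W in auto)
    then have "\<Gamma>e \<inter> space (boundary_measure \<Omega>) \<in> sets (boundary_measure \<Omega>)" by blast
    then have "(\<integral>\<^sup>+x. ennreal ((g x)\<^sup>2) \<partial>restrict_space (boundary_measure \<Omega>) \<Gamma>e)
      = (\<integral>\<^sup>+x. ennreal ((g x)\<^sup>2) * indicator \<Gamma>e x \<partial>boundary_measure \<Omega>)"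
      by (rule nn_integral_restrict_space)
    also have "\<dots> \<le> (\<integral>\<^sup>+x. ennreal ((g x)\<^sup>2) \<partial>boundary_measure \<Omega>)"
      by (rule nn_integral_mono) (auto simp: indicator_def)
    finally show ?thesis .
  qed
  then show "square_integrable (restrict_space (boundary_measure \<Omega>) \<Gamma>e) g"
    using g by (auto simp: square_integrable_iff intro: measurable_restrict_space1 le_less_trans)
  fix x0 Q r h f assume "C2_chart \<Omega> x0 Q r h f"
  then obtain R where "boundary_chart \<Omega> x0 Q r h f" "r < R" "Ck 2 {-R<..<R} f" by (auto simp: C2_chart_def)
  then interpret C2_graph \<Omega> \<Gamma> x0 Q r h R f using H \<Omega> by unfold_locales
  let ?I = "{s. \<bar>s\<bar> < r \<and> x0 + Q (vector [s, f s]) \<in> \<Gamma>e}"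
  have "(\<lambda>s. g (graph_pt s)) \<in> H32 ?I"
    by (rule graph[OF C2_graph_axioms open_pullback[OF \<Gamma>e]]) auto
  then show "(\<lambda>s. g (x0 + Q (vector [s, f s]))) \<in> H32 ?I"
    by (rule H32_cong) (auto simp: graph_pt_def chart_pt_def abs_less_iff)
qed


text \<open>\<open>w\<close> has only first order regularity inside \<Omega>, but it shares its
  boundary values with \<open>u\<close>; the approximations of \<open>u\<close> of order 2 thus
  converge to the trace of \<open>w\<close>. Used for the temperature, with the boundary datum as
  \<open>u\<close>.\<close>

lemma H32_boundary_trace:
  fixes \<Omega> \<Gamma>e :: "(real^2) set"
  assumes H: "emeasure hausdorff1 (\<Gamma> :: (real^2) set) \<noteq> 0"
    and \<Omega>: "open \<Omega>" "bounded \<Omega>" "lipschitz_boundary \<Omega>"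
    and u: "u \<in> H2 \<Omega>" and w: "w \<in> H1 \<Omega>" "(\<lambda>x. w x - u x) \<in> H10 \<Omega>"
    and \<Gamma>e: "openin (top_of_set (frontier \<Omega>)) \<Gamma>e"
  shows "trace_on_boundary \<Omega> w \<in> H32_boundary \<Omega> \<Gamma>e"
proof -
  let ?g = "trace_on_boundary \<Omega> w"
  have tr: "has_trace \<Omega> w ?g" by (rule trace_exists[OF H \<Omega> w(1)])
  then have g: "square_integrable (boundary_measure \<Omega>) ?g" by (simp add: has_trace_def)
  obtain V where V: "\<And>n. smooth (V n)" "Hconv \<Omega> 2 V u"
    using smooth_dense[OF \<Omega>(2,1) lipschitz_mollifiable[OF \<Omega>(1,3)] H2_Hsob[OF u]] by blast
  have V1: "Hconv \<Omega> 1 V u"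
  proof -
    have "Hconv \<Omega> (Suc 1) V u" using V(2) by (simp only: numeral_2_eq_2 One_nat_def)
    then show ?thesis unfolding Hconv.simps(2)[of _ 1] One_nat_def Hconv.simps using Hconv_imp by blast
  qed
  have "u \<in> H1 \<Omega>" using u by (simp add: H2_def)
  note lim = trace_of_H10_perturbation[OF H \<Omega> this V(1) V1 tr w(2)]
  show ?thesis
    by (rule H32_boundaryI[OF H \<Omega> \<Gamma>e g]) (rule C2_graph.graph_H32[OF _ _ _ V g lim])
qed

text \<open>Used for the components of the velocity. The trace is fixed only up to null sets, so
  \<open>graph_H32_zero\<close> is applied to the chosen representative.\<close>

lemma H32_boundary_zero_trace:
  fixes \<Omega> \<Gamma>e :: "(real^2) set"
  assumes H: "emeasure hausdorff1 (\<Gamma> :: (real^2) set) \<noteq> 0"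
    and \<Omega>: "open \<Omega>" "bounded \<Omega>" "lipschitz_boundary \<Omega>"
    and w: "w \<in> H1 \<Omega>" "zero_trace_on \<Omega> (frontier \<Omega>) w"
    and \<Gamma>e: "openin (top_of_set (frontier \<Omega>)) \<Gamma>e"
  shows "trace_on_boundary \<Omega> w \<in> H32_boundary \<Omega> \<Gamma>e"
proof -
  let ?g = "trace_on_boundary \<Omega> w"
  have "has_trace \<Omega> w ?g" by (rule trace_exists[OF H \<Omega> w(1)])
  then have g: "square_integrable (boundary_measure \<Omega>) ?g" by (simp add: has_trace_def)
  have "AE x in boundary_measure \<Omega>. ?g x = 0"
    using w(2) AE_space unfolding zero_trace_on_def
    by eventually_elim (simp add: boundary_measure_space(1)[OF H])
  note z = this
  show ?thesis
    by (rule H32_boundaryI[OF H \<Omega> \<Gamma>e g]) (rule C2_graph.graph_H32_zero[OF _ _ _ g z])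
qed

theorem theorem2p2:
  fixes \<Omega> \<Gamma> :: "(real^2) set"
    and g1 v :: "real^2 \<Rightarrow> real^2"
    and g2 Td T :: "real^2 \<Rightarrow> real"
    and \<epsilon>1 \<epsilon>2 \<epsilon>3 \<delta> Rey Pr Gr :: real
  assumes "open \<Omega>" and "bounded \<Omega>" and "lipschitz_boundary \<Omega>"
    and "openin (top_of_set (frontier \<Omega>)) \<Gamma>" and "connected \<Gamma>"
    and "emeasure hausdorff1 \<Gamma> \<noteq> 0"
    and "C2_portion \<Omega> \<Gamma>"
    and "square_integrable (lebesgue_on \<Omega>) g1"
    and "square_integrable (lebesgue_on \<Omega>) g2"
    and "Td \<in> H2 \<Omega>" and "zero_trace_on \<Omega> (frontier \<Omega> - \<Gamma>) Td"
    and "well_posedness_constants \<Omega> \<Gamma> \<epsilon>1 \<epsilon>2 \<epsilon>3 \<delta>"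
    and "Rey \<in> {0<..<\<epsilon>1}" and "Pr \<in> {0<..<\<epsilon>2 / Rey}" and "Gr \<in> {0<..<\<epsilon>3 * Rey}"
    and "dual_norm (solenoidal_space \<Omega>) (vec_grad_norm \<Omega>) (L2_functional \<Omega> g1) \<le> \<delta>"
    and "dual_norm (H10 \<Omega>) (grad_norm \<Omega>) (L2_functional \<Omega> g2) \<le> \<delta>"
    and "H1_norm \<Omega> Td \<le> \<delta>"
    and "weak_solution \<Omega> Rey Pr Gr (L2_functional \<Omega> g1) (L2_functional \<Omega> g2) Td v T"
  shows "\<forall>\<Gamma>e. openin (top_of_set (frontier \<Omega>)) \<Gamma>e \<and> closure \<Gamma>e \<subseteq> \<Gamma> \<longrightarrow>
           (\<forall>j. trace_on_boundary \<Omega> (\<lambda>x. v x $ j) \<in> H32_boundary \<Omega> \<Gamma>e) \<and>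
           trace_on_boundary \<Omega> T \<in> H32_boundary \<Omega> \<Gamma>e"
proof (intro allI impI)
  fix \<Gamma>e assume "openin (top_of_set (frontier \<Omega>)) \<Gamma>e \<and> closure \<Gamma>e \<subseteq> \<Gamma>"
  then have \<Gamma>e: "openin (top_of_set (frontier \<Omega>)) \<Gamma>e" by simp
  have v: "(\<lambda>x. v x $ j) \<in> H1 \<Omega>" "zero_trace_on \<Omega> (frontier \<Omega>) (\<lambda>x. v x $ j)" for j
    using assms(19) by (auto simp: weak_solution_def solenoidal_space_def)
  have T: "T \<in> H1 \<Omega>" "(\<lambda>x. T x - Td x) \<in> H10 \<Omega>" using assms(19) by (auto simp: weak_solution_def)
  show "(\<forall>j. trace_on_boundary \<Omega> (\<lambda>x. v x $ j) \<in> H32_boundary \<Omega> \<Gamma>e) \<and>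
      trace_on_boundary \<Omega> T \<in> H32_boundary \<Omega> \<Gamma>e"
    using H32_boundary_zero_trace[OF assms(6,1-3) v \<Gamma>e] H32_boundary_trace[OF assms(6,1-3,10) T \<Gamma>e] by simp
qed

end
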